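(* Let $(A,B,C,\pi_C)$ be a CQG Doi-Koppinen datum of coideal type, and let $\mathcal{D}(B,\mathcal{I})$ be the associated $*$-algebra, where $\mathcal{I}$ is the restricted dual of $C$. If $(\mathcal{H}_0,\pi_0,\delta_0)$ is a unitary Doi-Koppinen module for $(A,B,C)$, then the completion $\mathcal{H}$ of $\mathcal{H}_0$ carries a non-degenerate $*$-representation $\pi_{\mathcal{D}}$ of $\mathcal{D}(B,\mathcal{I})$ by $$\pi_{\mathcal{D}}(bx):=\pi(b)\hat{\pi}(x),\qquad b\in B,\ x\in\mathcal{I}.\qquad(\ast)$$ Conversely, if $(\mathcal{H},\pi_{\mathcal{D}})$ is a non-degenerate $*$-representation of $\mathcal{D}(B,\mathcal{I})$ on a Hilbert space, then $\mathcal{H}_0:=\pi_{\mathcal{D}}(\mathcal{I})\mathcal{H}$ carries a unique structure of unitary Doi-Koppinen module such that $(\ast)$ holds. The assignment sending a unitary Doi-Koppinen module $(\mathcal{H}_0,\pi_0,\delta_0)$ to the completion $\mathcal{H}$ of $\mathcal{H}_0$ with the $*$-representation $\pi_{\mathcal{D}}(bx)=\pi(b)\hat{\pi}(x)$, together with the assignment sending a non-degenerate $*$-representation $(\mathcal{H},\pi_{\mathcal{D}})$ to $\mathcal{H}_0=\pi_{\mathcal{D}}(\mathcal{I})\mathcal{H}$ with its unique unitary Doi-Koppinen module structure such that $\pi_{\mathcal{D}}(bx)=\pi(b)\hat{\pi}(x)$ for all $b\in B$, $x\in\mathcal{I}$, sets up a one-to-one correspondence between locally complete unitary Doi-Koppinen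 modules and non-degenerate $*$-representations of $\mathcal{D}(B,\mathcal{I})$ (on Hilbert spaces).
   Context: Everything is over $\mathbb{C}$; coalgebras and comodules are counital, modules over unital algebras unital. Inner products are linear in the second variable. Sweedler notation: $\Delta_C(c)=c_{(1)}\otimes c_{(2)}$, $\delta(v)=v_{(0)}\otimes v_{(1)}$ for right comodules. A Hopf $*$-algebra is a Hopf algebra $A$ with a $*$-algebra structure (involutive, anti-linear, anti-multiplicative) with $\Delta_A(a^* )=a_{(1)}^*\otimes a_{(2)}^*$. It is a CQG Hopf $*$-algebra if there is a linear functional $\Phi_A:A\to\mathbb{C}$ with $(\mathrm{id}\otimes\Phi_A)\Delta_A(a)=\Phi_A(a)1=(\Phi_A\otimes\mathrm{id})\Delta_A(a)$, $\Phi_A(1)=1$ and $\Phi_A(a^*a)\ge 0$ for all $a\in A$. With antipode $S_A$, put $a^\dag:=S_A(a)^*$. A $\dag$-structure on a coalgebra $C$ is an involutive, anti-linear map $\dag$ with $\Delta_C(c^\dag)=c_{(2)}^\dag\otimes c_{(1)}^\dag$. A left $A$-module $\dag$-coalgebra is a left $A$-module coalgebra $C$ with a $\dag$-structure such that $(ac)^\dag=a^\dag c^\dag$. A CQG Doi-Koppinen datum of coideal type $(A,B,C,\pi_C)$ consists of a CQG Hopf $*$-algebra $A$, a left $A$-module $\dag$-coalgebra $C$, a surjective $\dag$-preserving left $A$-linear coalgebra map $\pi_C:A\to C$, and the unital $*$-subalgebra $B={}^CA=\{a\in A\mid \pi_C(a_{(1)})\otimes a_{(2)}=\pi_C(1_A)\otimes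 a\}$ of $A$. One has $\Delta_A(B)\subseteq B\otimes A$, and we write $\delta_B(b)=\Delta_A(b)=b_{(0)}\otimes b_{(1)}\in B\otimes A$. The full linear dual $\mathscr{I}=\mathrm{Lin}_{\mathbb{C}}(C,\mathbb{C})$ is a unital $*$-algebra with $\omega\chi=(\omega\otimes\chi)\Delta_C$ and $\omega^*(c)=\overline{\omega(c^\dag)}$; it is a right $A$-module by $(x\lhd a)(c)=x(ac)$. The restricted dual is the two-sided $*$-ideal $\mathcal{I}=\{x\in\mathscr{I}\mid\mathscr{I}x\mathscr{I}\text{ is finite-dimensional}\}$. $\mathscr{D}(B,\mathscr{I})$ is the unital $*$-algebra generated by $B$ and $\mathscr{I}$ with interchange relation $xb=b_{(0)}(x\lhd b_{(1)})$, and $\mathcal{D}(B,\mathcal{I})=B\mathcal{I}$ is the linear span of products $bx$ ($b\in B,x\in\mathcal{I}$) in it; it is a $*$-subalgebra and multiplication gives bijections $B\otimes\mathcal{I}\to\mathcal{D}(B,\mathcal{I})$ and $\mathcal{I}\otimes B\to\mathcal{D}(B,\mathcal{I})$. A $*$-representation of a $*$-algebra on a pre-Hilbert space is a module structure $\pi_0$ with $\langle v,\pi_0(a)w\rangle=\langle\pi_0(a^* )v,w\rangle$. A $*$-representation $\pi$ of $\mathcal{A}$ on a Hilbert space $\mathcal{H}$ is non-degenerate if $\pi(\mathcal{A})\mathcal{H}$ is dense. A unitary right $C$-comodule is a pre-Hilbert space $\mathcal{H}_0$ with a right $C$-comodule structure with $\langle v,w_{(0)}\rangle w_{(1)}=\langle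 v_{(0)},w\rangle v_{(1)}^\dag$ for all $v,w$. It is locally complete if for each finite-dimensional subcoalgebra $D\subseteq C$ the space $\mathcal{H}_D=\{v\in\mathcal{H}_0\mid\delta(v)\in\mathcal{H}_0\otimes D\}$ is complete. A unitary Doi-Koppinen module $(\mathcal{H}_0,\pi_0,\delta_0)$ is a pre-Hilbert space $\mathcal{H}_0$ with a unitary right $C$-comodule structure $\delta_0$ and a $*$-representation $\pi_0$ of $B$ such that $\delta_0(\pi_0(b)v)=\pi_0(b_{(0)})v_{(0)}\otimes b_{(1)}v_{(1)}$ for all $b\in B$, $v\in\mathcal{H}_0$. It is locally complete if its underlying unitary comodule is. For a unitary Doi-Koppinen module, $\hat{\pi}_0(x)v=(\mathrm{id}\otimes x)\delta_0(v)$ defines a $*$-representation of $\mathcal{I}$ on $\mathcal{H}_0$. The operators $\pi_0(b)$ ($b\in B$) and $\hat{\pi}_0(x)$ ($x\in\mathcal{I}$) are bounded, and $\pi(b),\hat{\pi}(x)$ denote their extensions to the completion $\mathcal{H}$. *)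

theory Defs
  imports
    "HOL-Analysis.Analysis"
    "HOL-Library.Poly_Mapping"
    "HOL-Library.Function_Algebras"
begin

section \<open>Complex vector spaces, algebras and pre-Hilbert spaces\<close>

class complex_vector = ab_group_add +
  fixes scaleC :: "complex \<Rightarrow> 'a \<Rightarrow> 'a"  (infixr \<open>*\<^sub>C\<close> 75)
  assumes scaleC_add_right: "a *\<^sub>C (x + y) = a *\<^sub>C x + a *\<^sub>C y"
    and scaleC_add_left: "(a + b) *\<^sub>C x = a *\<^sub>C x + b *\<^sub>C x"
    and scaleC_scaleC: "a *\<^sub>C b *\<^sub>C x = (a * b) *\<^sub>C x"
    and scaleC_one: "1 *\<^sub>C x = x"

global_interpretation complex_vector: vector_space "scaleC :: complex \<Rightarrow> 'a \<Rightarrow> 'a::complex_vector"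
  by unfold_locales (simp_all add: scaleC_add_right scaleC_add_left scaleC_scaleC scaleC_one)

abbreviation cspan :: "'a::complex_vector set \<Rightarrow> 'a set"
  where "cspan \<equiv> module.span scaleC"

abbreviation csubspace :: "'a::complex_vector set \<Rightarrow> bool"
  where "csubspace \<equiv> module.subspace scaleC"

abbreviation clinear :: "('a::complex_vector \<Rightarrow> 'b::complex_vector) \<Rightarrow> bool"
  where "clinear \<equiv> Vector_Spaces.linear scaleC scaleC"

definition clinear_on :: "'a::complex_vector set \<Rightarrow> ('a \<Rightarrow> 'b::complex_vector) \<Rightarrow> bool"
  where "clinear_on V f \<longleftrightarrow>
    (\<forall>v\<in>V. \<forall>w\<in>V. f (v + w) = f v + f w) \<and> (\<forall>c. \<forall>v\<in>V. f (c *\<^sub>C v) = c *\<^sub>C f v)"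

definition antilinear :: "('a::complex_vector \<Rightarrow> 'b::complex_vector) \<Rightarrow> bool"
  where "antilinear f \<longleftrightarrow> (\<forall>v w. f (v + w) = f v + f w) \<and> (\<forall>c v. f (c *\<^sub>C v) = cnj c *\<^sub>C f v)"

definition fin_dim :: "'a::complex_vector set \<Rightarrow> bool"
  where "fin_dim V \<longleftrightarrow> (\<exists>F. finite F \<and> V \<subseteq> cspan F)"

class complex_algebra_1 = complex_vector + ring_1 +
  assumes mult_scaleC_left: "(a *\<^sub>C x) * y = a *\<^sub>C (x * y)"
    and mult_scaleC_right: "x * (a *\<^sub>C y) = a *\<^sub>C (x * y)"

text \<open>Pre-Hilbert spaces; the inner product is linear in the second variable. The norm and
  the topology are those of the underlying real inner product space.\<close>

class complex_inner = complex_vector + real_inner +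
  fixes cinner :: "'a \<Rightarrow> 'a \<Rightarrow> complex"
  assumes scaleR_scaleC: "scaleR r x = complex_of_real r *\<^sub>C x"
    and cinner_commute: "cinner x y = cnj (cinner y x)"
    and cinner_add_right: "cinner x (y + z) = cinner x y + cinner x z"
    and cinner_scaleC_right: "cinner x (c *\<^sub>C y) = c * cinner x y"
    and inner_eq_Re_cinner: "inner x y = Re (cinner x y)"

instantiation complex :: complex_algebra_1
begin
definition scaleC_complex_def [simp]: "scaleC c (x::complex) = c * x"
instance by standard (simp_all add: algebra_simps)
end

instantiation "fun" :: (type, complex_vector) complex_vector
begin
definition scaleC_fun_def: "scaleC c f = (\<lambda>x. c *\<^sub>C f x)"
instance
  by standard (simp_all add: scaleC_fun_def fun_eq_iff scaleC_add_right scaleC_add_left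
      scaleC_scaleC scaleC_one)
end

instantiation poly_mapping :: (type, complex_vector) complex_vector
begin
lift_definition scaleC_poly_mapping :: "complex \<Rightarrow> ('a \<Rightarrow>\<^sub>0 'b) \<Rightarrow> ('a \<Rightarrow>\<^sub>0 'b)"
  is "\<lambda>c f x. c *\<^sub>C f x"
  by (erule finite_subset[rotated]) auto
instance
  by standard (transfer; simp add: fun_eq_iff scaleC_add_right scaleC_add_left
      scaleC_scaleC scaleC_one)+
end

section \<open>Algebraic tensor products\<close>

text \<open>The quotient of the free vector space on pairs by the bilinearity relations.\<close>

definition tensor_null :: "('a::complex_vector \<times> 'b::complex_vector \<Rightarrow>\<^sub>0 complex) set"
  where "tensor_null = cspan (
    {Poly_Mapping.single (a + a', b) 1 - Poly_Mapping.single (a, b) 1 - Poly_Mapping.single (a', b) 1 | a a' b. True} \<union>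
    {Poly_Mapping.single (a, b + b') 1 - Poly_Mapping.single (a, b) 1 - Poly_Mapping.single (a, b') 1 | a b b'. True} \<union>
    {Poly_Mapping.single (c *\<^sub>C a, b) 1 - c *\<^sub>C Poly_Mapping.single (a, b) 1 | c a b. True} \<union>
    {Poly_Mapping.single (a, c *\<^sub>C b) 1 - c *\<^sub>C Poly_Mapping.single (a, b) 1 | c a b. True})"

quotient_type (overloaded) ('a, 'b) tensor =
  "('a::complex_vector \<times> 'b::complex_vector) \<Rightarrow>\<^sub>0 complex" / "\<lambda>f g. f - g \<in> tensor_null"
proof (intro equivpI reflpI sympI transpI)
  fix f g h :: "('a \<times> 'b) \<Rightarrow>\<^sub>0 complex"
  show "f - f \<in> tensor_null"
    by (simp add: tensor_null_def complex_vector.span_zero)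
  show "g - f \<in> tensor_null" if "f - g \<in> tensor_null"
    using complex_vector.span_neg[OF that[unfolded tensor_null_def]] by (simp add: tensor_null_def)
  show "f - h \<in> tensor_null" if "f - g \<in> tensor_null" "g - h \<in> tensor_null"
    using complex_vector.span_add[OF that[unfolded tensor_null_def]] by (simp add: tensor_null_def)
qed

instantiation tensor :: (complex_vector, complex_vector) complex_vector
begin

lift_definition zero_tensor :: "('a, 'b) tensor" is 0 .

lift_definition plus_tensor :: "('a, 'b) tensor \<Rightarrow> ('a, 'b) tensor \<Rightarrow> ('a, 'b) tensor" is "(+)"
  by (simp only: add_diff_add) (simp only: tensor_null_def complex_vector.span_add)

lift_definition uminus_tensor :: "('a, 'b) tensor \<Rightarrow> ('a, 'b) tensor" is uminus
  by (simp only: minus_diff_minus) (simp only: tensor_null_def complex_vector.span_neg)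

definition minus_tensor :: "('a, 'b) tensor \<Rightarrow> ('a, 'b) tensor \<Rightarrow> ('a, 'b) tensor"
  where "minus_tensor s t = s + (- t)"

lift_definition scaleC_tensor :: "complex \<Rightarrow> ('a, 'b) tensor \<Rightarrow> ('a, 'b) tensor" is "scaleC"
  by (simp only: complex_vector.scale_right_diff_distrib[symmetric])
    (simp only: tensor_null_def complex_vector.span_scale)

instance
proof
  have null: "f - g \<in> tensor_null" if "f = g" for f g :: "'a \<times> 'b \<Rightarrow>\<^sub>0 complex"
    using that by (simp add: tensor_null_def complex_vector.span_zero)
  fix s t u :: "('a, 'b) tensor" and c d :: complex
  show "s + t + u = s + (t + u)" by transfer (rule null, rule add.assoc)
  show "s + t = t + s" by transfer (rule null, rule add.commute)
  show "0 + s = s" by transfer (rule null, rule add_0_left)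
  show "- s + s = 0" by transfer (rule null, rule left_minus)
  show "s - t = s + - t" by (rule minus_tensor_def)
  show "c *\<^sub>C (s + t) = c *\<^sub>C s + c *\<^sub>C t" by transfer (rule null, rule scaleC_add_right)
  show "(c + d) *\<^sub>C s = c *\<^sub>C s + d *\<^sub>C s" by transfer (rule null, rule scaleC_add_left)
  show "c *\<^sub>C d *\<^sub>C s = (c * d) *\<^sub>C s" by transfer (rule null, rule scaleC_scaleC)
  show "1 *\<^sub>C s = s" by transfer (rule null, rule scaleC_one)
qed

end

lift_definition pure_tensor :: "'a::complex_vector \<Rightarrow> 'b::complex_vector \<Rightarrow> ('a, 'b) tensor"
  (infixr \<open>\<otimes>\<close> 76) is "\<lambda>a b. Poly_Mapping.single (a, b) 1" .

text \<open>The subspace \<open>V \<otimes> W\<close> of the ambient tensor product.\<close>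

definition tensor_span :: "'a::complex_vector set \<Rightarrow> 'b::complex_vector set \<Rightarrow> ('a, 'b) tensor set"
  where "tensor_span V W = cspan {v \<otimes> w | v w. v \<in> V \<and> w \<in> W}"

text \<open>\<open>sweedler V W h t\<close> is the value written \<open>h(t\<^sub>(\<^sub>1\<^sub>), t\<^sub>(\<^sub>2\<^sub>))\<close> in Sweedler
  notation: \<open>\<Sum>\<^sub>i h(v\<^sub>i, w\<^sub>i)\<close> for any expression \<open>t = \<Sum>\<^sub>i v\<^sub>i \<otimes> w\<^sub>i\<close> with \<open>v\<^sub>i \<in> V\<close>, \<open>w\<^sub>i \<in> W\<close>.
  It is only meaningful if \<open>t\<close> lies in \<open>V \<otimes> W\<close> and \<open>h\<close> is biadditive and balanced on \<open>V \<times> W\<close>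
  (which includes bilinear as well as conjugate-bilinear maps); see \<open>sweedler_sum\<close> below.\<close>

definition sweedler :: "'a::complex_vector set \<Rightarrow> 'b::complex_vector set \<Rightarrow>
    ('a \<Rightarrow> 'b \<Rightarrow> 'd::ab_group_add) \<Rightarrow> ('a, 'b) tensor \<Rightarrow> 'd"
  where "sweedler V W h t = (THE y. \<exists>vws. set vws \<subseteq> V \<times> W \<and>
    t = (\<Sum>(v, w)\<leftarrow>vws. v \<otimes> w) \<and> y = (\<Sum>(v, w)\<leftarrow>vws. h v w))"

abbreviation tmap :: "('a::complex_vector \<Rightarrow> 'b::complex_vector \<Rightarrow> 'd::ab_group_add) \<Rightarrow> ('a, 'b) tensor \<Rightarrow> 'd"
  where "tmap h t \<equiv> sweedler UNIV UNIV h t"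

definition balanced_on :: "'a::complex_vector set \<Rightarrow> 'b::complex_vector set \<Rightarrow>
    ('a \<Rightarrow> 'b \<Rightarrow> 'd::ab_group_add) \<Rightarrow> bool"
  where "balanced_on V W h \<longleftrightarrow>
    (\<forall>v\<in>V. \<forall>v'\<in>V. \<forall>w\<in>W. h (v + v') w = h v w + h v' w) \<and>
    (\<forall>v\<in>V. \<forall>w\<in>W. \<forall>w'\<in>W. h v (w + w') = h v w + h v w') \<and>
    (\<forall>c. \<forall>v\<in>V. \<forall>w\<in>W. h (c *\<^sub>C v) w = h v (c *\<^sub>C w))"

lemma pure_tensor_add_left: "(a + a') \<otimes> b = a \<otimes> b + a' \<otimes> b"
proof transfer
  fix a a' :: 'a and b :: 'b
  have "Poly_Mapping.single (a + a', b) 1 - Poly_Mapping.single (a, b) 1 - Poly_Mapping.single (a', b) 1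
    \<in> (tensor_null :: ('a \<times> 'b \<Rightarrow>\<^sub>0 complex) set)"
    unfolding tensor_null_def by (rule complex_vector.span_base) blast
  then show "Poly_Mapping.single (a + a', b) 1 - (Poly_Mapping.single (a, b) 1 + Poly_Mapping.single (a', b) 1)
    \<in> (tensor_null :: ('a \<times> 'b \<Rightarrow>\<^sub>0 complex) set)"
    by (simp only: diff_diff_eq)
qed

lemma pure_tensor_add_right: "a \<otimes> (b + b') = a \<otimes> b + a \<otimes> b'"
proof transfer
  fix a :: 'a and b b' :: 'b
  have "Poly_Mapping.single (a, b + b') 1 - Poly_Mapping.single (a, b) 1 - Poly_Mapping.single (a, b') 1
    \<in> (tensor_null :: ('a \<times> 'b \<Rightarrow>\<^sub>0 complex) set)"
    unfolding tensor_null_def by (rule complex_vector.span_base) blast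
  then show "Poly_Mapping.single (a, b + b') 1 - (Poly_Mapping.single (a, b) 1 + Poly_Mapping.single (a, b') 1)
    \<in> (tensor_null :: ('a \<times> 'b \<Rightarrow>\<^sub>0 complex) set)"
    by (simp only: diff_diff_eq)
qed

lemma pure_tensor_scaleC_left: "(c *\<^sub>C a) \<otimes> b = c *\<^sub>C (a \<otimes> b)"
  by transfer (unfold tensor_null_def, rule complex_vector.span_base, blast)

lemma pure_tensor_scaleC_right: "a \<otimes> (c *\<^sub>C b) = c *\<^sub>C (a \<otimes> b)"
  by transfer (unfold tensor_null_def, rule complex_vector.span_base, blast)

context
  fixes h :: "'a::complex_vector \<Rightarrow> 'b::complex_vector \<Rightarrow> 'd::ab_group_add"
  assumes h: "balanced_on UNIV UNIV h"
begin

private definition free_ext :: "('a \<times> 'b \<Rightarrow>\<^sub>0 complex) \<Rightarrow> 'd"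
  where "free_ext f =
    (\<Sum>k\<in>Poly_Mapping.keys f. h (Poly_Mapping.lookup f k *\<^sub>C fst k) (snd k))"

private lemma h_add: "h (v + v') w = h v w + h v' w" "h v (w + w') = h v w + h v w'"
  and h_scale: "h (c *\<^sub>C v) w = h v (c *\<^sub>C w)"
  using h by (auto simp: balanced_on_def)

private lemma h_zero: "h 0 w = 0"
  using h_add(1)[of 0 0 w] by simp

private lemma free_ext_superset:
  assumes "finite K" "Poly_Mapping.keys f \<subseteq> K"
  shows "free_ext f = (\<Sum>k\<in>K. h (Poly_Mapping.lookup f k *\<^sub>C fst k) (snd k))"
  unfolding free_ext_def using assms
  by (intro sum.mono_neutral_left) (auto simp: in_keys_iff h_zero)

private lemma free_ext_add: "free_ext (f + g) = free_ext f + free_ext g"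
proof -
  let ?K = "Poly_Mapping.keys f \<union> Poly_Mapping.keys g"
  have "Poly_Mapping.keys (f + g) \<subseteq> ?K" by (rule Poly_Mapping.keys_add)
  then show ?thesis
    by (simp add: free_ext_superset[of ?K] lookup_add complex_vector.scale_left_distrib h_add
        sum.distrib)
qed

private lemma free_ext_diff: "free_ext (f - g) = free_ext f - free_ext g"
  using free_ext_add[of "f - g" g] by (simp add: algebra_simps)

private lemma free_ext_scale_single:
  "free_ext (c *\<^sub>C Poly_Mapping.single (v, w) 1) = h (c *\<^sub>C v) w"
proof -
  have *: "Poly_Mapping.lookup (c *\<^sub>C Poly_Mapping.single (v, w) 1) l = (if l = (v, w) then c else 0)" for l
    by transfer (simp add: when_def)
  have "Poly_Mapping.keys (c *\<^sub>C Poly_Mapping.single (v, w) (1 :: complex)) \<subseteq> {(v, w)}"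
    by (rule subsetI) (simp add: in_keys_iff * split: if_splits)
  then show ?thesis
    by (simp add: free_ext_superset[of "{(v, w)}"] *)
qed

private lemma free_ext_null:
  assumes "f \<in> tensor_null"
  shows "free_ext f = 0"
proof -
  have "\<forall>c. free_ext (c *\<^sub>C f) = 0"
    using assms unfolding tensor_null_def
  proof (induction rule: complex_vector.span_induct_alt)
    case base
    show ?case by (simp add: free_ext_def)
  next
    case (step c x y)
    have x: "free_ext (d *\<^sub>C x) = 0" for d
      using step(1)
    proof (elim UnE CollectE exE conjE)
      fix a a' b
      assume "x = Poly_Mapping.single (a + a', b) 1 - Poly_Mapping.single (a, b) 1 - Poly_Mapping.single (a', b) 1"
      then show ?thesis
        by (simp add: complex_vector.scale_right_diff_distrib free_ext_diff free_ext_scale_single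
            complex_vector.scale_right_distrib h_add)
    next
      fix a b b'
      assume "x = Poly_Mapping.single (a, b + b') 1 - Poly_Mapping.single (a, b) 1 - Poly_Mapping.single (a, b') 1"
      then show ?thesis
        by (simp add: complex_vector.scale_right_diff_distrib free_ext_diff free_ext_scale_single h_add)
    next
      fix e a b
      assume "x = Poly_Mapping.single (e *\<^sub>C a, b) 1 - e *\<^sub>C Poly_Mapping.single (a, b) 1"
      then show ?thesis
        by (simp add: complex_vector.scale_right_diff_distrib free_ext_diff free_ext_scale_single)
    next
      fix e a b
      assume x: "x = Poly_Mapping.single (a, e *\<^sub>C b) 1 - e *\<^sub>C Poly_Mapping.single (a, b) 1"
      have "h (d *\<^sub>C a) (e *\<^sub>C b) = h ((d * e) *\<^sub>C a) b"
        using h_scale[of e "d *\<^sub>C a" b] by (simp add: mult.commute)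
      then show ?thesis
        by (simp add: x complex_vector.scale_right_diff_distrib free_ext_diff free_ext_scale_single)
    qed
    show ?case
    proof
      fix d
      show "free_ext (d *\<^sub>C (c *\<^sub>C x + y)) = 0"
        using step(2) by (simp add: complex_vector.scale_right_distrib free_ext_add x)
    qed
  qed
  from this[rule_format, of 1] show ?thesis by simp
qed

private lemma free_ext_rep_add: "free_ext (rep_tensor (s + t)) = free_ext (rep_tensor s) + free_ext (rep_tensor t)"
proof -
  have "abs_tensor (rep_tensor (s + t)) = abs_tensor (rep_tensor s + rep_tensor t)"
    by (simp add: Quotient3_abs_rep[OF Quotient3_tensor] plus_tensor.abs_eq[symmetric])
  then have "rep_tensor (s + t) - (rep_tensor s + rep_tensor t) \<in> tensor_null"
    by (simp add: tensor.abs_eq_iff)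
  from free_ext_null[OF this] show ?thesis by (simp add: free_ext_diff free_ext_add)
qed

private lemma free_ext_rep_pure: "free_ext (rep_tensor (v \<otimes> w)) = h v w"
proof -
  have "abs_tensor (rep_tensor (v \<otimes> w)) = abs_tensor (Poly_Mapping.single (v, w) 1)"
    by (simp add: Quotient3_abs_rep[OF Quotient3_tensor] pure_tensor.abs_eq)
  then have "rep_tensor (v \<otimes> w) - Poly_Mapping.single (v, w) 1 \<in> tensor_null"
    by (simp add: tensor.abs_eq_iff)
  from free_ext_null[OF this] have "free_ext (rep_tensor (v \<otimes> w)) = free_ext (1 *\<^sub>C Poly_Mapping.single (v, w) 1)"
    by (simp add: free_ext_diff)
  also have "\<dots> = h v w" using free_ext_scale_single[of 1 v w] by (simp only: scaleC_one)
  finally show ?thesis .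
qed

lemma tensor_universal: "\<exists>L. (\<forall>s t. L (s + t) = L s + L t) \<and> (\<forall>v w. L (v \<otimes> w) = h v w)"
  using free_ext_rep_add free_ext_rep_pure
  by (intro exI[of _ "\<lambda>t. free_ext (rep_tensor t)"]) auto

end

lemma sweedler_sum:
  assumes V: "csubspace V" and W: "csubspace W" and h: "balanced_on V W h"
    and vws: "set vws \<subseteq> V \<times> W"
  shows "sweedler V W h (\<Sum>(v, w)\<leftarrow>vws. v \<otimes> w) = (\<Sum>(v, w)\<leftarrow>vws. h v w)"
proof -
  interpret A: vector_space_pair "scaleC :: complex \<Rightarrow> 'a \<Rightarrow> 'a" "scaleC :: complex \<Rightarrow> 'a \<Rightarrow> 'a"
    by unfold_locales
  interpret B: vector_space_pair "scaleC :: complex \<Rightarrow> 'b \<Rightarrow> 'b" "scaleC :: complex \<Rightarrow> 'b \<Rightarrow> 'b"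
    by unfold_locales
  obtain p where p: "range p \<subseteq> V" "clinear p" "\<forall>v\<in>V. p v = v"
    using A.linear_exists_left_inverse_on[OF complex_vector.linear_ident V] by auto
  obtain q where q: "range q \<subseteq> W" "clinear q" "\<forall>w\<in>W. q w = w"
    using B.linear_exists_left_inverse_on[OF complex_vector.linear_ident W] by auto
  have "balanced_on UNIV UNIV (\<lambda>v w. h (p v) (q w))"
  proof -
    have "p v \<in> V" "q w \<in> W" for v w using p(1) q(1) by auto
    then show ?thesis
      using h unfolding balanced_on_def
      by (simp add: A.linear_add[OF p(2)] B.linear_add[OF q(2)] A.linear_scale[OF p(2)]
          B.linear_scale[OF q(2)])
  qed
  from tensor_universal[OF this]
  obtain L where "(\<forall>s t. L (s + t) = L s + L t) \<and> (\<forall>v w. L (v \<otimes> w) = h (p v) (q w))" ..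
  then have L: "L (s + t) = L s + L t" "L (v \<otimes> w) = h (p v) (q w)" for s t v w
    by blast+
  have L0: "L 0 = 0" using L(1)[of 0 0] by simp
  have *: "L (\<Sum>(v, w)\<leftarrow>xs. v \<otimes> w) = (\<Sum>(v, w)\<leftarrow>xs. h v w)" if "set xs \<subseteq> V \<times> W" for xs
    using that
  proof (induction xs)
    case Nil
    show ?case by (simp add: L0)
  next
    case (Cons x xs)
    then show ?case by (cases x) (simp add: L p(3) q(3))
  qed
  show ?thesis
    unfolding sweedler_def
  proof (rule the_equality)
    show "\<exists>vws'. set vws' \<subseteq> V \<times> W \<and>
        (\<Sum>(v, w)\<leftarrow>vws. v \<otimes> w) = (\<Sum>(v, w)\<leftarrow>vws'. v \<otimes> w) \<and>
        (\<Sum>(v, w)\<leftarrow>vws. h v w) = (\<Sum>(v, w)\<leftarrow>vws'. h v w)"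
      using vws by blast
  next
    fix y
    assume "\<exists>vws'. set vws' \<subseteq> V \<times> W \<and>
        (\<Sum>(v, w)\<leftarrow>vws. v \<otimes> w) = (\<Sum>(v, w)\<leftarrow>vws'. v \<otimes> w) \<and> y = (\<Sum>(v, w)\<leftarrow>vws'. h v w)"
    then obtain vws' where "set vws' \<subseteq> V \<times> W"
      "(\<Sum>(v, w)\<leftarrow>vws. v \<otimes> w) = (\<Sum>(v, w)\<leftarrow>vws'. v \<otimes> w)" "y = (\<Sum>(v, w)\<leftarrow>vws'. h v w)"
      by blast
    then show "y = (\<Sum>(v, w)\<leftarrow>vws. h v w)"
      using *[OF vws] *[of vws'] by simp
  qed
qed

definition tensor_mult ::
    "('a::complex_algebra_1, 'b::complex_algebra_1) tensor \<Rightarrow> ('a, 'b) tensor \<Rightarrow> ('a, 'b) tensor"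
  where "tensor_mult s t = tmap (\<lambda>a b. tmap (\<lambda>a' b'. (a * a') \<otimes> (b * b')) t) s"

definition tensor_assoc ::
    "(('a::complex_vector, 'b::complex_vector) tensor, 'c::complex_vector) tensor \<Rightarrow> ('a, ('b, 'c) tensor) tensor"
  where "tensor_assoc = tmap (\<lambda>t c. tmap (\<lambda>a b. a \<otimes> (b \<otimes> c)) t)"

section \<open>Coalgebras and CQG Hopf *-algebras\<close>

locale coalgebra =
  fixes comult :: "'c::complex_vector \<Rightarrow> ('c, 'c) tensor"
    and counit :: "'c \<Rightarrow> complex"
  assumes clinear_comult: "clinear comult"
    and clinear_counit: "clinear counit"
    and coassoc: "tensor_assoc (tmap (\<lambda>c d. comult c \<otimes> d) (comult e)) = tmap (\<lambda>c d. c \<otimes> comult d) (comult e)"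
    and counit_left: "tmap (\<lambda>c d. counit c *\<^sub>C d) (comult e) = e"
    and counit_right: "tmap (\<lambda>c d. counit d *\<^sub>C c) (comult e) = e"

locale hopf_algebra = coalgebra comult counit
  for comult :: "'a::complex_algebra_1 \<Rightarrow> ('a, 'a) tensor"
    and counit :: "'a \<Rightarrow> complex" +
  fixes antipode :: "'a \<Rightarrow> 'a"
  assumes comult_mult: "comult (a * b) = tensor_mult (comult a) (comult b)"
    and comult_one: "comult 1 = 1 \<otimes> 1"
    and counit_mult: "counit (a * b) = counit a * counit b"
    and counit_one: "counit 1 = 1"
    and clinear_antipode: "clinear antipode"
    and antipode_left: "tmap (\<lambda>a b. antipode a * b) (comult e) = counit e *\<^sub>C 1"
    and antipode_right: "tmap (\<lambda>a b. a * antipode b) (comult e) = counit e *\<^sub>C 1"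

locale hopf_star_algebra = hopf_algebra comult counit antipode
  for star :: "'a::complex_algebra_1 \<Rightarrow> 'a"
    and comult :: "'a \<Rightarrow> ('a, 'a) tensor"
    and counit :: "'a \<Rightarrow> complex"
    and antipode :: "'a \<Rightarrow> 'a" +
  assumes star_star: "star (star a) = a"
    and antilinear_star: "antilinear star"
    and star_mult: "star (a * b) = star b * star a"
    and comult_star: "comult (star a) = tmap (\<lambda>b c. star b \<otimes> star c) (comult a)"

locale cqg_hopf_star_algebra = hopf_star_algebra star comult counit antipode
  for star :: "'a::complex_algebra_1 \<Rightarrow> 'a"
    and comult :: "'a \<Rightarrow> ('a, 'a) tensor"
    and counit :: "'a \<Rightarrow> complex"
    and antipode :: "'a \<Rightarrow> 'a" +
  assumes haar: "\<exists>\<Phi> :: 'a \<Rightarrow> complex. clinear \<Phi> \<and>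
    (\<forall>a. tmap (\<lambda>b c. \<Phi> c *\<^sub>C b) (comult a) = \<Phi> a *\<^sub>C 1) \<and>
    (\<forall>a. tmap (\<lambda>b c. \<Phi> b *\<^sub>C c) (comult a) = \<Phi> a *\<^sub>C 1) \<and>
    \<Phi> 1 = 1 \<and> (\<forall>a. \<Phi> (star a * a) \<in> \<real>\<^sub>\<ge>\<^sub>0)"

locale dagger_coalgebra = coalgebra comult counit
  for comult :: "'c::complex_vector \<Rightarrow> ('c, 'c) tensor"
    and counit :: "'c \<Rightarrow> complex" +
  fixes dag :: "'c \<Rightarrow> 'c"
  assumes dag_dag: "dag (dag c) = c"
    and antilinear_dag: "antilinear dag"
    and comult_dag: "comult (dag c) = tmap (\<lambda>d e. dag e \<otimes> dag d) (comult c)"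

section \<open>CQG Doi-Koppinen data of coideal type\<close>

text \<open>The data of \<open>A\<close> come first, then those of the coalgebra \<open>C\<close>; the algebra \<open>B\<close> is
  determined by the rest (\<open>coinv\<close> below).\<close>

record (overloaded) ('a, 'c) dk_datum =
  star :: "'a \<Rightarrow> 'a"
  comult :: "'a \<Rightarrow> ('a, 'a) tensor"
  counit :: "'a \<Rightarrow> complex"
  antipode :: "'a \<Rightarrow> 'a"
  ccomult :: "'c \<Rightarrow> ('c, 'c) tensor"
  ccounit :: "'c \<Rightarrow> complex"
  cdag :: "'c \<Rightarrow> 'c"
  act :: "'a \<Rightarrow> 'c \<Rightarrow> 'c"
  proj :: "'a \<Rightarrow> 'c"

definition adag :: "('a::complex_algebra_1, 'c::complex_vector) dk_datum \<Rightarrow> 'a \<Rightarrow> 'a"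
  where "adag X a = star X (antipode X a)"

definition module_dagger_coalgebra :: "('a::complex_algebra_1, 'c::complex_vector) dk_datum \<Rightarrow> bool"
  where "module_dagger_coalgebra X \<longleftrightarrow>
    dagger_coalgebra (ccomult X) (ccounit X) (cdag X) \<and>
    (\<forall>a. clinear (act X a)) \<and> (\<forall>c. clinear (\<lambda>a. act X a c)) \<and>
    (\<forall>c. act X 1 c = c) \<and> (\<forall>a b c. act X (a * b) c = act X a (act X b c)) \<and>
    (\<forall>a c. ccomult X (act X a c) =
       tmap (\<lambda>a1 a2. tmap (\<lambda>c1 c2. act X a1 c1 \<otimes> act X a2 c2) (ccomult X c)) (comult X a)) \<and>
    (\<forall>a c. ccounit X (act X a c) = counit X a * ccounit X c) \<and>
    (\<forall>a c. cdag X (act X a c) = act X (adag X a) (cdag X c))"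

definition cqg_doi_koppinen_datum :: "('a::complex_algebra_1, 'c::complex_vector) dk_datum \<Rightarrow> bool"
  where "cqg_doi_koppinen_datum X \<longleftrightarrow>
    cqg_hopf_star_algebra (star X) (comult X) (counit X) (antipode X) \<and>
    module_dagger_coalgebra X \<and>
    clinear (proj X) \<and> surj (proj X) \<and>
    (\<forall>a. proj X (adag X a) = cdag X (proj X a)) \<and>
    (\<forall>a b. proj X (a * b) = act X a (proj X b)) \<and>
    (\<forall>a. ccomult X (proj X a) = tmap (\<lambda>a1 a2. proj X a1 \<otimes> proj X a2) (comult X a)) \<and>
    (\<forall>a. ccounit X (proj X a) = counit X a)"

definition coinv :: "('a::complex_algebra_1, 'c::complex_vector) dk_datum \<Rightarrow> 'a set"
  where "coinv X = {a. tmap (\<lambda>a1 a2. proj X a1 \<otimes> a2) (comult X a) = proj X 1 \<otimes> a}"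

section \<open>*-algebras and *-representations\<close>

record 'd star_alg =
  sa_carrier :: "'d set"
  sa_add :: "'d \<Rightarrow> 'd \<Rightarrow> 'd"
  sa_scale :: "complex \<Rightarrow> 'd \<Rightarrow> 'd"
  sa_mult :: "'d \<Rightarrow> 'd \<Rightarrow> 'd"
  sa_star :: "'d \<Rightarrow> 'd"

text \<open>Representations are extensional functions on the carriers (\<open>\<rightarrow>\<^sub>E\<close>), so that equality of
  structures is literal equality.\<close>

definition star_rep :: "'d star_alg \<Rightarrow> 'v::complex_inner set \<Rightarrow> ('d \<Rightarrow> 'v \<Rightarrow> 'v) \<Rightarrow> bool"
  where "star_rep D V \<pi> \<longleftrightarrow>
    \<pi> \<in> sa_carrier D \<rightarrow>\<^sub>E (V \<rightarrow>\<^sub>E V) \<and>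
    (\<forall>a\<in>sa_carrier D. clinear_on V (\<pi> a)) \<and>
    (\<forall>a\<in>sa_carrier D. \<forall>b\<in>sa_carrier D. \<forall>v\<in>V. \<pi> (sa_add D a b) v = \<pi> a v + \<pi> b v) \<and>
    (\<forall>c. \<forall>a\<in>sa_carrier D. \<forall>v\<in>V. \<pi> (sa_scale D c a) v = c *\<^sub>C \<pi> a v) \<and>
    (\<forall>a\<in>sa_carrier D. \<forall>b\<in>sa_carrier D. \<forall>v\<in>V. \<pi> (sa_mult D a b) v = \<pi> a (\<pi> b v)) \<and>
    (\<forall>a\<in>sa_carrier D. \<forall>v\<in>V. \<forall>w\<in>V. cinner v (\<pi> a w) = cinner (\<pi> (sa_star D a) v) w)"

text \<open>On the Hilbert space given by a complete type, *-representations are by bounded operators.\<close>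

definition nondeg_star_rep ::
    "'d star_alg \<Rightarrow> ('d \<Rightarrow> 'h \<Rightarrow> 'h::{complex_inner, complete_space}) \<Rightarrow> bool"
  where "nondeg_star_rep D \<pi> \<longleftrightarrow>
    star_rep D UNIV \<pi> \<and> (\<forall>a\<in>sa_carrier D. bounded_linear (\<pi> a)) \<and>
    closure (cspan {\<pi> a v | a v. a \<in> sa_carrier D}) = UNIV"

subsection \<open>Unital *-algebras by generators and relations\<close>

datatype 'g star_term =
    TGen 'g
  | TZero
  | TOne
  | TAdd "'g star_term" "'g star_term"
  | TScale complex "'g star_term"
  | TMult "'g star_term" "'g star_term"
  | TStar "'g star_term"

text \<open>The least congruence containing \<open>R\<close> whose quotient is a unital *-algebra.\<close>

inductive star_cong :: "('g star_term \<times> 'g star_term) set \<Rightarrow> 'g star_term \<Rightarrow> 'g star_term \<Rightarrow> bool"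
  for R :: "('g star_term \<times> 'g star_term) set" where
  rel: "(s, t) \<in> R \<Longrightarrow> star_cong R s t"
| refl: "star_cong R s s"
| sym: "star_cong R s t \<Longrightarrow> star_cong R t s"
| trans: "star_cong R s t \<Longrightarrow> star_cong R t u \<Longrightarrow> star_cong R s u"
| cong_add: "star_cong R s s' \<Longrightarrow> star_cong R t t' \<Longrightarrow> star_cong R (TAdd s t) (TAdd s' t')"
| cong_scale: "star_cong R s s' \<Longrightarrow> star_cong R (TScale c s) (TScale c s')"
| cong_mult: "star_cong R s s' \<Longrightarrow> star_cong R t t' \<Longrightarrow> star_cong R (TMult s t) (TMult s' t')"
| cong_star: "star_cong R s s' \<Longrightarrow> star_cong R (TStar s) (TStar s')"
| add_assoc: "star_cong R (TAdd (TAdd s t) u) (TAdd s (TAdd t u))"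
| add_commute: "star_cong R (TAdd s t) (TAdd t s)"
| add_zero: "star_cong R (TAdd TZero s) s"
| scale_add: "star_cong R (TScale c (TAdd s t)) (TAdd (TScale c s) (TScale c t))"
| add_scale: "star_cong R (TScale (c + d) s) (TAdd (TScale c s) (TScale d s))"
| scale_scale: "star_cong R (TScale c (TScale d s)) (TScale (c * d) s)"
| scale_one: "star_cong R (TScale 1 s) s"
| scale_zero: "star_cong R (TScale 0 s) TZero"
| mult_assoc: "star_cong R (TMult (TMult s t) u) (TMult s (TMult t u))"
| one_mult: "star_cong R (TMult TOne s) s"
| mult_one: "star_cong R (TMult s TOne) s"
| mult_add: "star_cong R (TMult s (TAdd t u)) (TAdd (TMult s t) (TMult s u))"
| add_mult: "star_cong R (TMult (TAdd s t) u) (TAdd (TMult s u) (TMult t u))"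
| scale_mult: "star_cong R (TMult (TScale c s) t) (TScale c (TMult s t))"
| mult_scale: "star_cong R (TMult s (TScale c t)) (TScale c (TMult s t))"
| star_add: "star_cong R (TStar (TAdd s t)) (TAdd (TStar s) (TStar t))"
| star_scale: "star_cong R (TStar (TScale c s)) (TScale (cnj c) (TStar s))"
| star_mult: "star_cong R (TStar (TMult s t)) (TMult (TStar t) (TStar s))"
| star_star: "star_cong R (TStar (TStar s)) s"

definition tclass :: "('g star_term \<times> 'g star_term) set \<Rightarrow> 'g star_term \<Rightarrow> 'g star_term set"
  where "tclass R s = {t. star_cong R s t}"

definition presented_star_alg ::
    "'g set \<Rightarrow> ('g star_term \<times> 'g star_term) set \<Rightarrow> 'g star_term set star_alg"
  where "presented_star_alg G R = \<lparr>
    sa_carrier = {tclass R s | s. set_star_term s \<subseteq> G},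
    sa_add = (\<lambda>x y. \<Union>s\<in>x. \<Union>t\<in>y. tclass R (TAdd s t)),
    sa_scale = (\<lambda>c x. \<Union>s\<in>x. tclass R (TScale c s)),
    sa_mult = (\<lambda>x y. \<Union>s\<in>x. \<Union>t\<in>y. tclass R (TMult s t)),
    sa_star = (\<lambda>x. \<Union>s\<in>x. tclass R (TStar s))\<rparr>"

definition tsum :: "'g star_term list \<Rightarrow> 'g star_term"
  where "tsum ss = foldr TAdd ss TZero"

section \<open>The *-algebras attached to the datum\<close>

definition coinv_alg :: "('a::complex_algebra_1, 'c::complex_vector) dk_datum \<Rightarrow> 'a star_alg"
  where "coinv_alg X =
    \<lparr>sa_carrier = coinv X, sa_add = (+), sa_scale = scaleC, sa_mult = (*), sa_star = star X\<rparr>"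

definition full_dual :: "('a::complex_algebra_1, 'c::complex_vector) dk_datum \<Rightarrow> ('c \<Rightarrow> complex) set"
  where "full_dual X = {x. clinear x}"

definition dual_mult :: "('a::complex_algebra_1, 'c::complex_vector) dk_datum \<Rightarrow>
    ('c \<Rightarrow> complex) \<Rightarrow> ('c \<Rightarrow> complex) \<Rightarrow> ('c \<Rightarrow> complex)"
  where "dual_mult X x y = (\<lambda>c. tmap (\<lambda>c1 c2. x c1 * y c2) (ccomult X c))"

definition dual_star :: "('a::complex_algebra_1, 'c::complex_vector) dk_datum \<Rightarrow>
    ('c \<Rightarrow> complex) \<Rightarrow> ('c \<Rightarrow> complex)"
  where "dual_star X x = (\<lambda>c. cnj (x (cdag X c)))"

definition dual_act :: "('a::complex_algebra_1, 'c::complex_vector) dk_datum \<Rightarrow>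
    ('c \<Rightarrow> complex) \<Rightarrow> 'a \<Rightarrow> ('c \<Rightarrow> complex)"
  where "dual_act X x a = (\<lambda>c. x (act X a c))"

definition restricted_dual :: "('a::complex_algebra_1, 'c::complex_vector) dk_datum \<Rightarrow> ('c \<Rightarrow> complex) set"
  where "restricted_dual X = {x \<in> full_dual X.
    fin_dim (cspan {dual_mult X y (dual_mult X x z) | y z. y \<in> full_dual X \<and> z \<in> full_dual X})}"

abbreviation genB :: "'a \<Rightarrow> ('a + ('c \<Rightarrow> complex)) star_term"
  where "genB b \<equiv> TGen (Inl b)"

abbreviation genI :: "('c \<Rightarrow> complex) \<Rightarrow> ('a + ('c \<Rightarrow> complex)) star_term"
  where "genI x \<equiv> TGen (Inr x)"

text \<open>The relations say that \<open>B\<close> and the full dual map in as unital *-algebras, together with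
  the interchange relation \<open>x b = b\<^sub>(\<^sub>0\<^sub>) (x \<lhd> b\<^sub>(\<^sub>1\<^sub>))\<close>, where \<open>b\<^sub>(\<^sub>0\<^sub>) \<otimes> b\<^sub>(\<^sub>1\<^sub>) \<in> B \<otimes> A\<close>.\<close>

inductive_set double_rels ::
    "('a::complex_algebra_1, 'c::complex_vector) dk_datum \<Rightarrow>
     (('a + ('c \<Rightarrow> complex)) star_term \<times> ('a + ('c \<Rightarrow> complex)) star_term) set"
  for X :: "('a, 'c) dk_datum" where
  "a \<in> coinv X \<Longrightarrow> b \<in> coinv X \<Longrightarrow> (genB (a + b), TAdd (genB a) (genB b)) \<in> double_rels X"
| "b \<in> coinv X \<Longrightarrow> (genB (c *\<^sub>C b), TScale c (genB b)) \<in> double_rels X"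
| "a \<in> coinv X \<Longrightarrow> b \<in> coinv X \<Longrightarrow> (genB (a * b), TMult (genB a) (genB b)) \<in> double_rels X"
| "b \<in> coinv X \<Longrightarrow> (genB (star X b), TStar (genB b)) \<in> double_rels X"
| "(genB 1, TOne) \<in> double_rels X"
| "x \<in> full_dual X \<Longrightarrow> y \<in> full_dual X \<Longrightarrow> (genI (x + y), TAdd (genI x) (genI y)) \<in> double_rels X"
| "x \<in> full_dual X \<Longrightarrow> (genI (c *\<^sub>C x), TScale c (genI x)) \<in> double_rels X"
| "x \<in> full_dual X \<Longrightarrow> y \<in> full_dual X \<Longrightarrow> (genI (dual_mult X x y), TMult (genI x) (genI y)) \<in> double_rels X"
| "x \<in> full_dual X \<Longrightarrow> (genI (dual_star X x), TStar (genI x)) \<in> double_rels X"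
| "(genI (ccounit X), TOne) \<in> double_rels X"
| interchange: "b \<in> coinv X \<Longrightarrow> x \<in> full_dual X \<Longrightarrow> set bs \<subseteq> coinv X \<times> UNIV \<Longrightarrow>
    comult X b = (\<Sum>(b0, b1)\<leftarrow>bs. b0 \<otimes> b1) \<Longrightarrow>
    (TMult (genI x) (genB b), tsum (map (\<lambda>(b0, b1). TMult (genB b0) (genI (dual_act X x b1))) bs))
      \<in> double_rels X"

definition full_double :: "('a::complex_algebra_1, 'c::complex_vector) dk_datum \<Rightarrow>
    ('a + ('c \<Rightarrow> complex)) star_term set star_alg"
  where "full_double X = presented_star_alg (coinv X <+> full_dual X) (double_rels X)"

definition dprod :: "('a::complex_algebra_1, 'c::complex_vector) dk_datum \<Rightarrow>
    'a \<Rightarrow> ('c \<Rightarrow> complex) \<Rightarrow> ('a + ('c \<Rightarrow> complex)) star_term set"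
  where "dprod X b x = tclass (double_rels X) (TMult (genB b) (genI x))"

text \<open>The linear span of the products \<open>b x\<close> with \<open>b \<in> B\<close> and \<open>x\<close> in the restricted dual;
  the scalars are absorbed into \<open>b\<close>.\<close>

definition double :: "('a::complex_algebra_1, 'c::complex_vector) dk_datum \<Rightarrow>
    ('a + ('c \<Rightarrow> complex)) star_term set star_alg"
  where "double X = (full_double X)\<lparr>sa_carrier :=
    {tclass (double_rels X) (tsum (map (\<lambda>(b, x). TMult (genB b) (genI x)) bxs)) | bxs.
       set bxs \<subseteq> coinv X \<times> restricted_dual X}\<rparr>"

section \<open>Unitary Doi-Koppinen modules\<close>

text \<open>A module is a triple \<open>(\<H>\<^sub>0, \<pi>\<^sub>0, \<delta>\<^sub>0)\<close> whose pre-Hilbert space \<open>\<H>\<^sub>0\<close> is a linear subspace of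
  an ambient pre-Hilbert space.\<close>

type_synonym ('a, 'c, 'v) dk_module =
  "'v set \<times> ('a \<Rightarrow> 'v \<Rightarrow> 'v) \<times> ('v \<Rightarrow> ('v, 'c) tensor)"

definition unitary_comodule :: "('a::complex_algebra_1, 'c::complex_vector) dk_datum \<Rightarrow>
    'v::complex_inner set \<Rightarrow> ('v \<Rightarrow> ('v, 'c) tensor) \<Rightarrow> bool"
  where "unitary_comodule X H0 \<delta>0 \<longleftrightarrow>
    csubspace H0 \<and> \<delta>0 \<in> H0 \<rightarrow>\<^sub>E tensor_span H0 UNIV \<and> clinear_on H0 \<delta>0 \<and>
    (\<forall>v\<in>H0. tensor_assoc (sweedler H0 UNIV (\<lambda>w c. \<delta>0 w \<otimes> c) (\<delta>0 v)) =
             sweedler H0 UNIV (\<lambda>w c. w \<otimes> ccomult X c) (\<delta>0 v)) \<and>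
    (\<forall>v\<in>H0. sweedler H0 UNIV (\<lambda>w c. ccounit X c *\<^sub>C w) (\<delta>0 v) = v) \<and>
    (\<forall>v\<in>H0. \<forall>w\<in>H0.
       sweedler H0 UNIV (\<lambda>w0 w1. cinner v w0 *\<^sub>C w1) (\<delta>0 w) =
       sweedler H0 UNIV (\<lambda>v0 v1. cinner v0 w *\<^sub>C cdag X v1) (\<delta>0 v))"

definition unitary_dk_module :: "('a::complex_algebra_1, 'c::complex_vector) dk_datum \<Rightarrow>
    ('a, 'c, 'v::complex_inner) dk_module \<Rightarrow> bool"
  where "unitary_dk_module X = (\<lambda>(H0, \<pi>0, \<delta>0).
    unitary_comodule X H0 \<delta>0 \<and>
    star_rep (coinv_alg X) H0 \<pi>0 \<and> (\<forall>v\<in>H0. \<pi>0 1 v = v) \<and>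
    (\<forall>b\<in>coinv X. \<forall>v\<in>H0. \<delta>0 (\<pi>0 b v) =
       sweedler (coinv X) UNIV (\<lambda>b0 b1.
         sweedler H0 UNIV (\<lambda>v0 v1. \<pi>0 b0 v0 \<otimes> act X b1 v1) (\<delta>0 v)) (comult X b)))"

definition subcoalgebra :: "('a::complex_algebra_1, 'c::complex_vector) dk_datum \<Rightarrow> 'c set \<Rightarrow> bool"
  where "subcoalgebra X D \<longleftrightarrow> csubspace D \<and> ccomult X ` D \<subseteq> tensor_span D D"

definition locally_complete :: "('a::complex_algebra_1, 'c::complex_vector) dk_datum \<Rightarrow>
    ('a, 'c, 'v::complex_inner) dk_module \<Rightarrow> bool"
  where "locally_complete X = (\<lambda>(H0, \<pi>0, \<delta>0).
    \<forall>D. subcoalgebra X D \<and> fin_dim D \<longrightarrow> complete {v \<in> H0. \<delta>0 v \<in> tensor_span H0 D})"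

definition dual_op :: "'v::complex_inner set \<Rightarrow> ('v \<Rightarrow> ('v, 'c::complex_vector) tensor) \<Rightarrow>
    ('c \<Rightarrow> complex) \<Rightarrow> 'v \<Rightarrow> 'v"
  where "dual_op H0 \<delta>0 x v = sweedler H0 UNIV (\<lambda>w c. x c *\<^sub>C w) (\<delta>0 v)"

text \<open>Completions: \<open>\<iota>\<close> exhibits the Hilbert space \<open>'h\<close> as a completion of \<open>\<H>\<^sub>0\<close>.\<close>

definition completion_map :: "'v::complex_inner set \<Rightarrow>
    ('v \<Rightarrow> 'h::{complex_inner, complete_space}) \<Rightarrow> bool"
  where "completion_map H0 \<iota> \<longleftrightarrow>
    clinear_on H0 \<iota> \<and> (\<forall>v\<in>H0. \<forall>w\<in>H0. cinner (\<iota> v) (\<iota> w) = cinner v w) \<and> closure (\<iota> ` H0) = UNIV"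

definition bounded_extension :: "'v::complex_inner set \<Rightarrow>
    ('v \<Rightarrow> 'h::{complex_inner, complete_space}) \<Rightarrow> ('v \<Rightarrow> 'v) \<Rightarrow> ('h \<Rightarrow> 'h) \<Rightarrow> bool"
  where "bounded_extension H0 \<iota> T T' \<longleftrightarrow>
    clinear T' \<and> bounded_linear T' \<and> (\<forall>v\<in>H0. T' (\<iota> v) = \<iota> (T v))"

text \<open>The formula defining \<open>\<pi>\<^sub>\<D>\<close> on products \<open>b x\<close>. If \<open>\<iota>\<close> is a completion map, the bounded extensions
  are uniquely determined.\<close>

definition rep_formula :: "('a::complex_algebra_1, 'c::complex_vector) dk_datum \<Rightarrow>
    ('a, 'c, 'v::complex_inner) dk_module \<Rightarrow> ('v \<Rightarrow> 'h::{complex_inner, complete_space}) \<Rightarrow>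
    (('a + ('c \<Rightarrow> complex)) star_term set \<Rightarrow> 'h \<Rightarrow> 'h) \<Rightarrow> bool"
  where "rep_formula X = (\<lambda>(H0, \<pi>0, \<delta>0) \<iota> \<pi>D.
    \<forall>b\<in>coinv X. \<forall>x\<in>restricted_dual X. \<exists>P Q.
      bounded_extension H0 \<iota> (\<pi>0 b) P \<and> bounded_extension H0 \<iota> (dual_op H0 \<delta>0 x) Q \<and>
      \<pi>D (dprod X b x) = P \<circ> Q)"

text \<open>\<open>\<pi>\<^sub>\<D>(\<I>) \<H>\<close>, where \<open>\<I>\<close> sits in the double as \<open>1 \<I>\<close>.\<close>

definition rep_core :: "('a::complex_algebra_1, 'c::complex_vector) dk_datum \<Rightarrow>
    (('a + ('c \<Rightarrow> complex)) star_term set \<Rightarrow> 'h \<Rightarrow> 'h::{complex_inner, complete_space}) \<Rightarrow> 'h set"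
  where "rep_core X \<pi>D = cspan {\<pi>D (tclass (double_rels X) (genI x)) v | x v. x \<in> restricted_dual X}"

subsection \<open>The two assignments and isomorphisms\<close>

definition dk_to_rep :: "('a::complex_algebra_1, 'c::complex_vector) dk_datum \<Rightarrow>
    ('v \<Rightarrow> 'h::{complex_inner, complete_space}) \<Rightarrow> ('a, 'c, 'v::complex_inner) dk_module \<Rightarrow>
    (('a + ('c \<Rightarrow> complex)) star_term set \<Rightarrow> 'h \<Rightarrow> 'h)"
  where "dk_to_rep X \<iota> M = (THE \<pi>D. nondeg_star_rep (double X) \<pi>D \<and> rep_formula X M \<iota> \<pi>D)"

definition rep_to_dk :: "('a::complex_algebra_1, 'c::complex_vector) dk_datum \<Rightarrow>
    (('a + ('c \<Rightarrow> complex)) star_term set \<Rightarrow> 'h \<Rightarrow> 'h::{complex_inner, complete_space}) \<Rightarrow>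
    ('a, 'c, 'h) dk_module"
  where "rep_to_dk X \<pi>D = (THE M. fst M = rep_core X \<pi>D \<and> unitary_dk_module X M \<and>
    rep_formula X M id \<pi>D)"

definition dk_iso :: "('a::complex_algebra_1, 'c::complex_vector) dk_datum \<Rightarrow>
    ('v::complex_inner \<Rightarrow> 'w::complex_inner) \<Rightarrow>
    ('a, 'c, 'v) dk_module \<Rightarrow> ('a, 'c, 'w) dk_module \<Rightarrow> bool"
  where "dk_iso X U = (\<lambda>(H0, \<pi>0, \<delta>0) (K0, \<rho>0, \<epsilon>0).
    bij_betw U H0 K0 \<and> clinear_on H0 U \<and>
    (\<forall>v\<in>H0. \<forall>w\<in>H0. cinner (U v) (U w) = cinner v w) \<and>
    (\<forall>b\<in>coinv X. \<forall>v\<in>H0. U (\<pi>0 b v) = \<rho>0 b (U v)) \<and>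
    (\<forall>v\<in>H0. \<epsilon>0 (U v) = sweedler H0 UNIV (\<lambda>w c. U w \<otimes> c) (\<delta>0 v)))"

definition rep_iso :: "'d star_alg \<Rightarrow>
    ('h \<Rightarrow> 'k) \<Rightarrow> ('d \<Rightarrow> 'h \<Rightarrow> 'h::{complex_inner, complete_space}) \<Rightarrow>
    ('d \<Rightarrow> 'k \<Rightarrow> 'k::{complex_inner, complete_space}) \<Rightarrow> bool"
  where "rep_iso D U \<pi> \<rho> \<longleftrightarrow>
    bij U \<and> clinear U \<and> (\<forall>v w. cinner (U v) (U w) = cinner v w) \<and>
    (\<forall>a\<in>sa_carrier D. \<forall>v. U (\<pi> a v) = \<rho> a (U v))"

end

theory Submission
  imports Defs
begin

text \<open>Write \<open>C*\<close> for the full linear dual of the coalgebra, \<open>I\<close> for the restricted dual and \<open>\<D> = B I\<close> for the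
double. The whole dual acts on the coalgebra by \<open>x \<cdot> c = c\<^sub>(\<^sub>1\<^sub>) x(c\<^sub>(\<^sub>2\<^sub>))\<close>, and on any comodule by slicing the
coaction, and a comodule is determined by this action. So a unitary Doi-Koppinen module is the same
thing as a pair of \<open>*\<close>-actions of \<open>B\<close> and of \<open>C*\<close> satisfying the interchange relation, in which
every vector is killed by the annihilator of some finite-dimensional subcoalgebra. What has to be
explained is how completing and restricting to \<open>\<pi>(I) \<H>\<close> are inverse to each other, and for this three
facts about the datum are decisive.

The first is the existence of local units (lemma \<open>local_unit\<close>): for each
finite-dimensional subspace \<open>V\<close> of the coalgebra there is \<open>e \<in> I\<close> that agrees with the counit on \<open>V\<close>. It
expresses cosemisimplicity, and comes from the Haar functional \<open>\<Phi>\<close>: the form \<open>\<Phi>(a\<^sup>* b)\<close> on \<open>A\<close> is positive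
definite (\<open>null_zero\<close>), and by strong invariance the dual of the coalgebra acts on \<open>A\<close> by a \<open>*\<close>-representation for it
(\<open>aact_adjoint\<close>). Orthogonal complements in locally finite modules then split each finite-dimensional \<open>\<dagger>\<close>-closed
subcoalgebra off \<open>C\<close> (\<open>ann_splitting\<close>, \<open>ann_range_disjoint\<close>), and \<open>e\<close> is the counit on that summand and \<open>0\<close> on the
complement. Local units give \<open>e b x = b x\<close> in the double for suitable \<open>e \<in> I\<close> (\<open>left_unit\<close>), which
makes \<open>\<D>\<close> closed under the involution and shows \<open>\<pi>(\<D>) \<H> = \<pi>(I) \<H>\<close>.

The second is automatic boundedness on a pre-Hilbert space. For \<open>b \<in> B\<close>, writing \<open>\<Delta>(b) = \<Sum> b\<^sub>e \<otimes> e\<close> with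
\<open>e\<close> orthonormal for the Haar form, invariance gives \<open>\<Sum> b\<^sub>e\<^sup>* b\<^sub>e = \<Phi>(b\<^sup>* b) 1\<close>, which bounds every \<open>b\<^sub>e\<close>, hence \<open>b\<close>
(\<open>coinv_sum_of_squares\<close>, \<open>pi_bounded\<close>). For \<open>x \<in> I\<close> the ideal generated by \<open>x\<close> is finite-dimensional, and
\<open>\<parallel>f v\<parallel>\<^sup>2 \<le> \<parallel>v\<parallel> \<parallel>f\<^sup>* f v\<parallel>\<close> for \<open>f\<close> in a basis of it is a self-improving inequality (\<open>op_bounded\<close>).

The third is that \<open>x \<cdot> C\<close> lies in a finite-dimensional subcoalgebra when \<open>x \<in> I\<close> (\<open>rdual_range\<close>). Hence vectors of
\<open>\<pi>(I) \<H>\<close> have finite-dimensional support, so that the action of the dual comes from a coaction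
(\<open>delta_exists\<close>), and \<open>x\<close> maps all of \<open>\<H>\<^sub>0\<close> into one of the subspaces \<open>\<H>\<^sub>D\<close>; if these are complete, then
\<open>\<pi>(x) \<H>\<close> already lies in \<open>\<H>\<^sub>0\<close> (\<open>iota_image\<close>). This is exactly where local completeness enters.

The double is given by generators and relations. A module acts on terms by evaluation in adjointable
operators, and this respects the congruence because an adjoint is unique (\<open>ev_cong\<close>); in the
other direction, a generator acts on \<open>v = \<pi>(e) v\<close> as \<open>\<pi>(s e) v\<close>, for any such \<open>e \<in> I\<close> (\<open>sop_eq\<close>).\<close>

section \<open>Linear algebra\<close>

lemma clinear_iff: "clinear f \<longleftrightarrow>
  (\<forall>x y. f (x + y) = f x + f y) \<and> (\<forall>c x. f (c *\<^sub>C x) = c *\<^sub>C f x)"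
  by (simp add: Vector_Spaces.linear_iff complex_vector.vector_space_axioms)

lemma clinear_add: "clinear f \<Longrightarrow> f (x + y) = f x + f y"
  and clinear_scale: "clinear f \<Longrightarrow> f (c *\<^sub>C x) = c *\<^sub>C f x"
  by (simp_all add: clinear_iff)

lemma clinear_zero: "clinear f \<Longrightarrow> f 0 = 0"
  using clinear_add[of f 0 0] by simp

lemma clinear_diff: "clinear f \<Longrightarrow> f (x - y) = f x - f y"
  using clinear_add[of f "x - y" y] by simp

lemma clinear_sum:
  assumes "clinear f"
  shows "f (sum g S) = (\<Sum>x\<in>S. f (g x))"
  by (induction S rule: infinite_finite_induct)
    (simp_all add: clinear_zero[OF assms] clinear_add[OF assms])

lemma scaleC_minus1: "(-1) *\<^sub>C x = - (x::'a::complex_vector)"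
  by (simp add: complex_vector.scale_minus_left)

lemmas scale_simps = scaleC_add_right scaleC_add_left scaleC_scaleC scaleC_one
  complex_vector.scale_right_diff_distrib complex_vector.scale_left_diff_distrib
  complex_vector.scale_minus_left complex_vector.scale_minus_right

lemma clinear_plus: "clinear f \<Longrightarrow> clinear g \<Longrightarrow> clinear (f + g)"
  by (simp add: clinear_iff scale_simps add_ac)

lemma clinear_scaled: "clinear f \<Longrightarrow> clinear (c *\<^sub>C f)"
  by (simp add: clinear_iff scaleC_fun_def scale_simps mult.commute)

lemma csubspace_iff: "csubspace V \<longleftrightarrow>
  0 \<in> V \<and> (\<forall>x\<in>V. \<forall>y\<in>V. x + y \<in> V) \<and> (\<forall>c. \<forall>x\<in>V. c *\<^sub>C x \<in> V)"
  by (simp add: complex_vector.subspace_def)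

lemma csubspaceD:
  assumes "csubspace V"
  shows "0 \<in> V" "x \<in> V \<Longrightarrow> y \<in> V \<Longrightarrow> x + y \<in> V" "x \<in> V \<Longrightarrow> c *\<^sub>C x \<in> V"
    "x \<in> V \<Longrightarrow> y \<in> V \<Longrightarrow> x - y \<in> V" "x \<in> V \<Longrightarrow> - x \<in> V"
  using complex_vector.subspace_diff[OF assms] complex_vector.subspace_neg[OF assms] assms
  by (simp_all add: csubspace_iff)

lemma cspan_subset: "S \<subseteq> V \<Longrightarrow> csubspace V \<Longrightarrow> cspan S \<subseteq> V"
  by (rule complex_vector.span_minimal)

lemma clinear_cspan_image:
  assumes "clinear f" "v \<in> cspan S"
  shows "f v \<in> cspan (f ` S)"
  using assms(2)
proof (induction rule: complex_vector.span_induct_alt)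
  case base show ?case using clinear_zero[OF assms(1)] by (simp add: complex_vector.span_zero)
next
  case (step c x y)
  then have "f x \<in> cspan (f ` S)" by (intro complex_vector.span_base) simp
  then show ?case using step(2)
    by (simp add: clinear_add[OF assms(1)] clinear_scale[OF assms(1)] complex_vector.span_add
        complex_vector.span_scale)
qed

lemma cspan_finite_sum:
  assumes "finite K" "x \<in> cspan K"
  obtains r where "x = (\<Sum>k\<in>K. r k *\<^sub>C k)"
  using assms complex_vector.span_finite by auto

lemma fin_dim_basis:
  assumes "fin_dim V"
  obtains K where "finite K" "K \<subseteq> V" "\<not> module.dependent scaleC K" "V \<subseteq> cspan K"
proof -
  obtain F where F: "finite F" "V \<subseteq> cspan F" using assms by (auto simp: fin_dim_def)
  obtain B where B: "B \<subseteq> V" "complex_vector.independent B" "V \<subseteq> cspan B"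
    using complex_vector.maximal_independent_subset by blast
  have "finite B" using complex_vector.independent_span_bound[OF F(1) B(2)] B F by auto
  then show ?thesis using that B by blast
qed

lemma fin_dim_subset: "fin_dim V \<Longrightarrow> U \<subseteq> V \<Longrightarrow> fin_dim U"
  by (auto simp: fin_dim_def)

lemma fin_dim_cspan: "fin_dim S \<Longrightarrow> fin_dim (cspan S)"
  unfolding fin_dim_def by (meson complex_vector.span_minimal complex_vector.subspace_span)

lemma fin_dim_finite_cspan: "finite S \<Longrightarrow> fin_dim (cspan S)"
  unfolding fin_dim_def by blast

lemma fin_dim_union:
  assumes "fin_dim S" "fin_dim T"
  shows "fin_dim (S \<union> T)"
proof -
  obtain F G where "finite F" "S \<subseteq> cspan F" "finite G" "T \<subseteq> cspan G"
    using assms by (auto simp: fin_dim_def)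
  then have "finite (F \<union> G)" "S \<union> T \<subseteq> cspan (F \<union> G)"
    using complex_vector.span_mono[of F "F \<union> G"] complex_vector.span_mono[of G "F \<union> G"] by auto
  then show ?thesis unfolding fin_dim_def by blast
qed

lemma fin_dim_UN: "finite A \<Longrightarrow> (\<And>a. a \<in> A \<Longrightarrow> fin_dim (f a)) \<Longrightarrow> fin_dim (\<Union>a\<in>A. f a)"
proof (induction A rule: finite_induct)
  case empty
  show ?case unfolding fin_dim_def by (intro exI[of _ "{}"]) simp
next
  case (insert x F) then show ?case by (simp add: fin_dim_union)
qed

lemma fin_dim_image:
  assumes "clinear f" "fin_dim V"
  shows "fin_dim (f ` V)"
proof -
  obtain F where F: "finite F" "V \<subseteq> cspan F" using assms by (auto simp: fin_dim_def)
  then have "f ` V \<subseteq> cspan (f ` F)" using clinear_cspan_image[OF assms(1)] by blast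
  then show ?thesis using F unfolding fin_dim_def by blast
qed


text \<open>The coordinate functionals of an independent set, extended to the whole space.\<close>
lemma basis_functionals:
  assumes "\<not> module.dependent scaleC (K::'a::complex_vector set)"
  shows "\<exists>\<phi> :: 'a \<Rightarrow> 'a \<Rightarrow> complex. (\<forall>k. clinear (\<phi> k)) \<and> (\<forall>k l. l \<in> K \<longrightarrow> \<phi> k l = (if l = k then 1 else 0))"
proof -
  interpret A: vector_space_pair "scaleC :: complex \<Rightarrow> 'a \<Rightarrow> 'a" "scaleC :: complex \<Rightarrow> complex \<Rightarrow> complex"
    by unfold_locales
  have "\<exists>g. clinear g \<and> (\<forall>l\<in>K. g l = (if l = k then 1 else 0::complex))" for k
    using A.linear_independent_extend[OF assms, of "\<lambda>l. if l = k then 1 else 0"] by simp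
  then have "\<forall>k. \<exists>g. clinear g \<and> (\<forall>l\<in>K. g l = (if l = k then 1 else 0::complex))" ..
  then have "\<exists>\<phi>. \<forall>k. clinear (\<phi> k) \<and> (\<forall>l\<in>K. \<phi> k l = (if l = k then 1 else 0::complex))"
    by (rule choice)
  then show ?thesis by blast
qed

lemma functional_separates:
  assumes "csubspace (V::'a::complex_vector set)" "x \<notin> V"
  obtains f where "clinear (f::'a\<Rightarrow>complex)" "\<And>v. v \<in> V \<Longrightarrow> f v = 0" "f x = 1"
proof -
  obtain B where B: "B \<subseteq> V" "complex_vector.independent B" "V \<subseteq> cspan B"
    using complex_vector.maximal_independent_subset by blast
  have sp: "cspan B = V" using B assms by (metis complex_vector.span_subspace)
  then have "x \<notin> cspan B" using assms by auto
  then have "complex_vector.independent (insert x B)" using B by (simp add: complex_vector.independent_insertI)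
  from basis_functionals[OF this] obtain \<phi> :: "'a \<Rightarrow> 'a \<Rightarrow> complex" where
    p: "\<And>k. clinear (\<phi> k)" "\<And>k l. l \<in> insert x B \<Longrightarrow> \<phi> k l = (if l = k then 1 else 0)"
    by blast
  have l: "clinear (\<phi> x)" using p by simp
  have xB: "x \<notin> B" using \<open>x \<notin> cspan B\<close> complex_vector.span_base by blast
  have p0: "\<phi> x k = 0" if "k \<in> B" for k using p(2)[of k x] that xB by auto
  have "\<phi> x v = 0" if "v \<in> V" for v
  proof -
    have "v \<in> cspan B" using that sp by simp
    then show ?thesis
      by (induction rule: complex_vector.span_induct_alt)
        (use p0 in \<open>simp_all add: clinear_zero[OF l] clinear_add[OF l] clinear_scale[OF l]\<close>)
  qed
  moreover have "\<phi> x x = 1" using p(2)[of x x] by simp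
  ultimately show ?thesis using that[OF l] by simp
qed

section \<open>Sums over tensors\<close>

text \<open>Sums of a binary function over a list of pairs: the values of a Sweedler expression on a chosen decomposition of a tensor.\<close>
definition psum :: "('a \<Rightarrow> 'b \<Rightarrow> 'd::comm_monoid_add) \<Rightarrow> ('a \<times> 'b) list \<Rightarrow> 'd"
  where "psum h xs = (\<Sum>(v, w)\<leftarrow>xs. h v w)"

lemma psum_Nil [simp]: "psum h [] = 0"
  and psum_Cons [simp]: "psum h ((v, w) # xs) = h v w + psum h xs"
  and psum_append [simp]: "psum h (xs @ ys) = psum h xs + psum h ys"
  by (simp_all add: psum_def)

lemma psum_Cons': "psum h (x # xs) = h (fst x) (snd x) + psum h xs"
  by (cases x) simp

lemma psum_add: "psum (\<lambda>v w. h v w + g v w) xs = psum h xs + psum g xs"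
  by (induction xs) (auto simp: psum_Cons' algebra_simps)

lemma psum_hom:
  assumes "L 0 = 0" "\<And>x y. L (x + y) = L x + L y"
  shows "L (psum h xs) = psum (\<lambda>v w. L (h v w)) xs"
  by (induction xs) (auto simp: psum_Cons' assms)

lemma psum_hom_on:
  assumes "csubspace V" "\<And>v w. (v, w) \<in> set xs \<Longrightarrow> h v w \<in> V"
    "L 0 = 0" "\<And>x y. x \<in> V \<Longrightarrow> y \<in> V \<Longrightarrow> L (x + y) = L x + L y"
  shows "L (psum h xs) = psum (\<lambda>v w. L (h v w)) xs \<and> psum h xs \<in> V"
  using assms(2) by (induction xs) (auto simp: psum_Cons' assms(3,4) csubspaceD[OF assms(1)])

lemma psum_in:
  assumes "csubspace V" "\<And>v w. (v, w) \<in> set xs \<Longrightarrow> h v w \<in> V"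
  shows "psum h xs \<in> V"
  using assms(2) by (induction xs) (auto simp: psum_Cons' csubspaceD[OF assms(1)])

lemma psum_cong: "(\<And>v w. (v, w) \<in> set xs \<Longrightarrow> h v w = g v w) \<Longrightarrow> psum h xs = psum g xs"
  by (induction xs) (auto simp: psum_Cons')

lemma psum_zero [simp]: "psum (\<lambda>v w. 0) xs = 0"
  by (induction xs) (auto simp: psum_Cons')

lemma psum_swap: "psum (\<lambda>v w. psum (\<lambda>x y. h v w x y) ys) xs = psum (\<lambda>x y. psum (\<lambda>v w. h v w x y) xs) ys"
  by (induction xs) (auto simp: psum_Cons' psum_add)

lemma psum_map: "psum h (map (\<lambda>(v, w). (f v w, g v w)) xs) = psum (\<lambda>v w. h (f v w) (g v w)) xs"
  by (induction xs) (auto simp: psum_Cons')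

lemma psum_scaleC: "c *\<^sub>C psum h xs = psum (\<lambda>v w. c *\<^sub>C h v w) xs"
  by (rule psum_hom) (simp_all add: scale_simps)

abbreviation bal :: "('a::complex_vector \<Rightarrow> 'b::complex_vector \<Rightarrow> 'd::ab_group_add) \<Rightarrow> bool"
  where "bal h \<equiv> balanced_on UNIV UNIV h"

lemma balI:
  assumes "\<And>v v' w. h (v + v') w = h v w + h v' w" "\<And>v w w'. h v (w + w') = h v w + h v w'"
    "\<And>c v w. h (c *\<^sub>C v) w = h v (c *\<^sub>C w)"
  shows "bal h"
  using assms by (simp add: balanced_on_def)

lemma balD:
  assumes "bal h"
  shows "h (v + v') w = h v w + h v' w" "h v (w + w') = h v w + h v w'"
    "h (c *\<^sub>C v) w = h v (c *\<^sub>C w)"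
  using assms by (simp_all add: balanced_on_def)

lemma bal_pure: "bal (\<otimes>)"
  by (rule balI) (simp_all add: pure_tensor_add_left pure_tensor_add_right pure_tensor_scaleC_left
      pure_tensor_scaleC_right)

lemma tensor_zero_left: "0 \<otimes> w = 0"
  using pure_tensor_add_left[of 0 0 w] by simp

lemma tensor_zero_right: "v \<otimes> 0 = 0"
  using pure_tensor_add_right[of v 0 0] by simp

lemma tensor_decomp: "\<exists>xs. t = psum (\<otimes>) xs"
proof -
  obtain f where t: "t = abs_tensor f" by (rule that[OF Quotient3_abs_rep[OF Quotient3_tensor, of t, THEN HOL.sym]])
  have "\<exists>xs. abs_tensor f = psum (\<otimes>) xs" if "finite K" "Poly_Mapping.keys f \<subseteq> K" for K f
    using that
  proof (induction K arbitrary: f rule: finite_induct)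
    case empty
    then have "abs_tensor f = 0" by (simp add: zero_tensor_def)
    then show ?case by (intro exI[of _ "[]"]) simp
  next
    case (insert k K)
    let ?v = "Poly_Mapping.lookup f k"
    define g where "g = f - ?v *\<^sub>C Poly_Mapping.single k 1"
    have lk: "Poly_Mapping.lookup (c *\<^sub>C Poly_Mapping.single k 1) l = (if l = k then c else 0)" for l c
      by transfer (simp add: when_def)
    have "Poly_Mapping.keys g \<subseteq> K"
    proof
      fix l assume "l \<in> Poly_Mapping.keys g"
      then have "l \<noteq> k \<and> l \<in> Poly_Mapping.keys f"
        by (auto simp: in_keys_iff g_def lookup_minus lk split: if_splits)
      then show "l \<in> K" using insert.prems by auto
    qed
    then obtain xs where xs: "abs_tensor g = psum (\<otimes>) xs" using insert.IH by blast
    have f: "f = g + ?v *\<^sub>C Poly_Mapping.single k 1" by (simp add: g_def)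
    have "abs_tensor (g + ?v *\<^sub>C Poly_Mapping.single k 1) = abs_tensor g + ?v *\<^sub>C (fst k \<otimes> snd k)"
      by (simp add: plus_tensor.abs_eq[symmetric] scaleC_tensor.abs_eq[symmetric]
          pure_tensor.abs_eq)
    also have "\<dots> = psum (\<otimes>) (xs @ [(?v *\<^sub>C fst k, snd k)])"
      by (simp add: pure_tensor_scaleC_left xs)
    finally show ?case unfolding f[symmetric] by blast
  qed
  from this[of "Poly_Mapping.keys f" f] have "\<exists>xs. abs_tensor f = psum (\<otimes>) xs" by simp
  then show ?thesis using t by simp
qed

definition dec :: "('a::complex_vector, 'b::complex_vector) tensor \<Rightarrow> ('a \<times> 'b) list"
  where "dec t = (SOME xs. t = psum (\<otimes>) xs)"

lemma psum_dec: "psum (\<otimes>) (dec t) = t"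
proof -
  obtain xs where "t = psum (\<otimes>) xs" using tensor_decomp[of t] ..
  then have "t = psum (\<otimes>) (dec t)"
    unfolding dec_def by (rule someI[of "\<lambda>xs. t = psum (\<otimes>) xs"])
  then show ?thesis by (rule HOL.sym)
qed

text \<open>The Sweedler expression of \<open>h\<close> at \<open>t\<close>, computed on one fixed decomposition of \<open>t\<close>. For balanced \<open>h\<close> this is
  the canonical map out of the tensor product (\<open>ts_tmap\<close>); the point of the definition is that additivity in \<open>h\<close>,
  commutation with additive maps and interchange of two such sums hold for every \<open>h\<close>, so that balancedness
  only has to be checked where a decomposition is changed.\<close>
definition ts :: "('a::complex_vector \<Rightarrow> 'b::complex_vector \<Rightarrow> 'd::comm_monoid_add) \<Rightarrow> ('a, 'b) tensor \<Rightarrow> 'd"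
  where "ts h t = psum h (dec t)"

lemma sweedler_psum:
  assumes "csubspace V" "csubspace W" "balanced_on V W h" "set xs \<subseteq> V \<times> W" "t = psum (\<otimes>) xs"
  shows "sweedler V W h t = psum h xs"
  using sweedler_sum[OF assms(1-4)] assms(5) by (simp add: psum_def)

lemma csubspace_UNIV: "csubspace UNIV" by simp

lemma tmap_psum: "bal h \<Longrightarrow> tmap h (psum (\<otimes>) xs) = psum h xs"
  by (rule sweedler_psum) auto

lemma ts_tmap: "bal h \<Longrightarrow> tmap h t = ts h t"
  using tmap_psum[of h "dec t"] by (simp add: psum_dec ts_def)

lemma ts_psum: "bal h \<Longrightarrow> ts h (psum (\<otimes>) xs) = psum h xs"
  using tmap_psum[of h xs] ts_tmap[of h] by simp

lemma ts_pure: "bal h \<Longrightarrow> ts h (v \<otimes> w) = h v w"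
  using ts_psum[of h "[(v,w)]"] by simp

lemma ts_plus: "bal h \<Longrightarrow> ts h (s + t) = ts h s + ts h t"
  using ts_psum[of h "dec s @ dec t"] by (simp add: psum_dec ts_def)

lemma ts_0: "bal h \<Longrightarrow> ts h 0 = 0"
  using ts_psum[of h "[]"] by simp

lemma ts_scale: "bal h \<Longrightarrow> ts h (c *\<^sub>C t) = ts (\<lambda>v w. h (c *\<^sub>C v) w) t"
proof -
  assume h: "bal h"
  have e: "c *\<^sub>C t = psum (\<otimes>) (map (\<lambda>(v,w). (c *\<^sub>C v, w)) (dec t))"
    by (subst psum_dec[of t, symmetric]) (simp add: psum_scaleC psum_map pure_tensor_scaleC_left)
  show ?thesis unfolding e ts_psum[OF h] by (simp add: psum_map ts_def)
qed

lemma ts_add_fun: "ts (\<lambda>v w. h v w + g v w) t = ts h t + ts g t"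
  by (simp add: ts_def psum_add)

lemma ts_scale_fun: "ts (\<lambda>v w. c *\<^sub>C h v w) t = c *\<^sub>C ts h t"
  by (simp add: ts_def psum_scaleC)

lemma ts_zero_fun [simp]: "ts (\<lambda>v w. 0) t = 0"
  by (simp add: ts_def)

lemma ts_hom:
  assumes "L 0 = 0" "\<And>x y. L (x + y) = L x + L y"
  shows "L (ts h t) = ts (\<lambda>v w. L (h v w)) t"
  unfolding ts_def by (rule psum_hom[of L]) (fact assms)+

lemma ts_clinear: "clinear L \<Longrightarrow> L (ts h t) = ts (\<lambda>v w. L (h v w)) t"
  by (rule ts_hom) (fact clinear_zero clinear_add)+

lemma ts_swap: "ts (\<lambda>v w. ts (\<lambda>x y. h v w x y) s) t = ts (\<lambda>x y. ts (\<lambda>v w. h v w x y) t) s"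
  unfolding ts_def by (rule psum_swap)

lemma ts_mult_right: "ts h t * c = ts (\<lambda>v w. h v w * (c::'a::ring)) t"
  by (rule ts_hom[of "\<lambda>x. x * c"]) (simp_all add: algebra_simps)

lemma ts_mult_left: "c * ts h t = ts (\<lambda>v w. (c::'a::ring) * h v w) t"
  by (rule ts_hom[of "\<lambda>x. c * x"]) (simp_all add: algebra_simps)

lemma bal_clinear:
  assumes "bal h" "\<And>c v w. h (c *\<^sub>C v) w = c *\<^sub>C h v w"
  shows "clinear (ts h)"
  unfolding clinear_iff using assms by (simp add: ts_plus ts_scale ts_scale_fun)


text \<open>Collecting the terms of a tensor along a finite spanning family \<open>F\<close> of the second legs. With \<open>F\<close> independent the
  coefficients are the slices of the tensor, with \<open>F\<close> orthonormal they satisfy the orthogonality relations used for \<open>B\<close>.\<close>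
lemma tensor_indep_right:
  assumes "finite F" "set xs \<subseteq> UNIV \<times> cspan F" "csubspace V" "fst ` set xs \<subseteq> V"
  shows "\<exists>g. psum (\<otimes>) xs = (\<Sum>k\<in>F. g k \<otimes> k) \<and> g ` F \<subseteq> V"
  using assms(2,4)
proof (induction xs)
  case Nil
  show ?case by (intro exI[of _ "\<lambda>_. 0"]) (auto simp: tensor_zero_left csubspaceD(1)[OF assms(3)])
next
  case (Cons x xs)
  then obtain g where g: "psum (\<otimes>) xs = (\<Sum>k\<in>F. g k \<otimes> k)" "g ` F \<subseteq> V" by auto
  have "snd x \<in> cspan F" using Cons by auto
  then obtain r where r: "snd x = (\<Sum>k\<in>F. r k *\<^sub>C k)" using cspan_finite_sum[OF assms(1)] by metis
  have "fst x \<otimes> snd x = (\<Sum>k\<in>F. (r k *\<^sub>C fst x) \<otimes> k)"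
  proof -
    have "fst x \<otimes> (\<Sum>k\<in>S. r k *\<^sub>C k) = (\<Sum>k\<in>S. (r k *\<^sub>C fst x) \<otimes> k)" for S
      by (induction S rule: infinite_finite_induct) (simp_all add: tensor_zero_right pure_tensor_add_right
        pure_tensor_scaleC_left pure_tensor_scaleC_right)
    then show ?thesis by (simp add: r)
  qed
  then have "psum (\<otimes>) (x # xs) = (\<Sum>k\<in>F. (r k *\<^sub>C fst x + g k) \<otimes> k)"
    by (simp add: psum_Cons' g sum.distrib pure_tensor_add_left)
  moreover have "(\<lambda>k. r k *\<^sub>C fst x + g k) ` F \<subseteq> V" 
    using Cons g by (auto simp: csubspaceD[OF assms(3)])
  ultimately show ?case by (intro exI[of _ "\<lambda>k. r k *\<^sub>C fst x + g k"]) simp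
qed

lemma tensor_indep_left:
  assumes "finite F" "set xs \<subseteq> cspan F \<times> UNIV"
  shows "\<exists>g. psum (\<otimes>) xs = (\<Sum>k\<in>F. k \<otimes> g k)"
  using assms(2)
proof (induction xs)
  case Nil
  show ?case by (intro exI[of _ "\<lambda>_. 0"]) (auto simp: tensor_zero_right)
next
  case (Cons x xs)
  then obtain g where g: "psum (\<otimes>) xs = (\<Sum>k\<in>F. k \<otimes> g k)" by auto
  have "fst x \<in> cspan F" using Cons by auto
  then obtain r where r: "fst x = (\<Sum>k\<in>F. r k *\<^sub>C k)" using cspan_finite_sum[OF assms(1)] by metis
  have "fst x \<otimes> snd x = (\<Sum>k\<in>F. k \<otimes> (r k *\<^sub>C snd x))"
  proof -
    have "(\<Sum>k\<in>S. r k *\<^sub>C k) \<otimes> snd x = (\<Sum>k\<in>S. k \<otimes> (r k *\<^sub>C snd x))" for S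
      by (induction S rule: infinite_finite_induct) (simp_all add: tensor_zero_left pure_tensor_add_left
        pure_tensor_scaleC_left pure_tensor_scaleC_right)
    then show ?thesis by (simp add: r)
  qed
  then have "psum (\<otimes>) (x # xs) = (\<Sum>k\<in>F. k \<otimes> (r k *\<^sub>C snd x + g k))"
    by (simp add: psum_Cons' g sum.distrib pure_tensor_add_right)
  then show ?case by (intro exI[of _ "\<lambda>k. r k *\<^sub>C snd x + g k"]) simp
qed

lemma finite_basis_of:
  assumes "finite S"
  shows "\<exists>K. finite K \<and> K \<subseteq> cspan S \<and> \<not> module.dependent scaleC K \<and> S \<subseteq> cspan K"
proof -
  obtain K where "finite K" "K \<subseteq> cspan S" "\<not> module.dependent scaleC K" "cspan S \<subseteq> cspan K"
    by (rule fin_dim_basis[OF fin_dim_finite_cspan[OF assms]])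
  then show ?thesis using complex_vector.span_superset[of S] by blast
qed

lemma tensor_basis_right:
  obtains K g where "finite K" "\<not> module.dependent scaleC K" "t = (\<Sum>k\<in>K. g k \<otimes> k)"
proof -
  obtain K where K: "finite K" "\<not> module.dependent scaleC K" "snd ` set (dec t) \<subseteq> cspan K"
    using finite_basis_of[OF finite_imageI[OF finite_set], of snd "dec t"] by blast
  have "set (dec t) \<subseteq> UNIV \<times> cspan K" using K(3) by auto
  from tensor_indep_right[OF K(1) this csubspace_UNIV] obtain g where "t = (\<Sum>k\<in>K. g k \<otimes> k)"
    unfolding psum_dec by blast
  then show ?thesis by (rule that[OF K(1,2)])
qed

lemma tensor_basis_left:
  obtains K g where "finite K" "\<not> module.dependent scaleC K" "t = (\<Sum>k\<in>K. k \<otimes> g k)"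
proof -
  obtain K where K: "finite K" "\<not> module.dependent scaleC K" "fst ` set (dec t) \<subseteq> cspan K"
    using finite_basis_of[OF finite_imageI[OF finite_set], of fst "dec t"] by blast
  have "set (dec t) \<subseteq> cspan K \<times> UNIV" using K(3) by auto
  from tensor_indep_left[OF K(1) this] obtain g where "t = (\<Sum>k\<in>K. k \<otimes> g k)"
    unfolding psum_dec by blast
  then show ?thesis by (rule that[OF K(1,2)])
qed

lemma ts_sum: "bal h \<Longrightarrow> ts h (\<Sum>k\<in>K. f k) = (\<Sum>k\<in>K. ts h (f k))"
  by (induction K rule: infinite_finite_induct) (simp_all add: ts_0 ts_plus)

text \<open>The map \<open>id \<otimes> y\<close>.\<close>
definition slice :: "('c \<Rightarrow> complex) \<Rightarrow> ('v::complex_vector, 'c::complex_vector) tensor \<Rightarrow> 'v"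
  where "slice y = ts (\<lambda>v c. y c *\<^sub>C v)"

lemma bal_slice: "clinear y \<Longrightarrow> bal (\<lambda>v c. y c *\<^sub>C v)"
  unfolding clinear_iff by (rule balI) (simp_all add: scale_simps mult.commute)

lemma clinear_slice: "clinear y \<Longrightarrow> clinear (slice y)"
  unfolding slice_def by (rule bal_clinear) (simp_all add: bal_slice scale_simps mult.commute)

lemma slice_pure: "clinear y \<Longrightarrow> slice y (v \<otimes> c) = y c *\<^sub>C v"
  by (simp add: slice_def ts_pure bal_slice)

lemma slice_psum: "clinear y \<Longrightarrow> slice y (psum (\<otimes>) xs) = psum (\<lambda>v c. y c *\<^sub>C v) xs"
  by (simp add: slice_def ts_psum bal_slice)

text \<open>Expand the difference of the two tensors in independent second legs; the coordinate functionals then read off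
  its coefficients, which therefore vanish.\<close>
lemma tensor_eq_slices:
  assumes "\<And>y. clinear y \<Longrightarrow> slice y s = slice y t"
  shows "s = t"
proof -
  obtain K g where K: "finite K" "\<not> module.dependent scaleC K" "s - t = (\<Sum>k\<in>K. g k \<otimes> k)"
    using tensor_basis_right by blast
  obtain \<phi> where \<phi>: "\<And>k. clinear (\<phi> k)"
    "\<And>k l. l \<in> K \<Longrightarrow> \<phi> k l = (if l = k then 1 else (0::complex))"
    using basis_functionals[OF K(2)] by blast
  have "g k = 0" if "k \<in> K" for k
  proof -
    have "slice (\<phi> k) (s - t) = (\<Sum>l\<in>K. \<phi> k l *\<^sub>C g l)"
      by (simp add: K(3) clinear_sum[OF clinear_slice[OF \<phi>(1)]] slice_pure[OF \<phi>(1)])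
    also have "\<dots> = (\<Sum>l\<in>K. if l = k then g l else 0)"
      by (rule sum.cong) (auto simp: \<phi>(2) scale_simps)
    also have "\<dots> = g k" using K(1) that by simp
    finally show ?thesis using assms[OF \<phi>(1)] by (simp add: clinear_diff[OF clinear_slice[OF \<phi>(1)]])
  qed
  then have "s - t = 0" using K(3) by (simp add: tensor_zero_left)
  then show ?thesis by simp
qed

lemma tensor_span_psum:
  assumes "csubspace V"
  shows "t \<in> tensor_span V W \<longleftrightarrow> (\<exists>xs. set xs \<subseteq> V \<times> W \<and> t = psum (\<otimes>) xs)"
proof
  assume "t \<in> tensor_span V W"
  then show "\<exists>xs. set xs \<subseteq> V \<times> W \<and> t = psum (\<otimes>) xs"
    unfolding tensor_span_def
  proof (induction rule: complex_vector.span_induct_alt)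
    case base show ?case by (intro exI[of _ "[]"]) simp
  next
    case (step c x y)
    then obtain v w xs where "x = v \<otimes> w" "v \<in> V" "w \<in> W" "set xs \<subseteq> V \<times> W" "y = psum (\<otimes>) xs" by auto
    then show ?case
      by (intro exI[of _ "(c *\<^sub>C v, w) # xs"]) (simp add: csubspaceD[OF assms] pure_tensor_scaleC_left)
  qed
next
  assume "\<exists>xs. set xs \<subseteq> V \<times> W \<and> t = psum (\<otimes>) xs"
  then obtain xs where "set xs \<subseteq> V \<times> W" "t = psum (\<otimes>) xs" by blast
  moreover have "psum (\<otimes>) xs \<in> tensor_span V W" if "set xs \<subseteq> V \<times> W"
    unfolding tensor_span_def using that
    by (intro psum_in complex_vector.span_base) auto
  ultimately show "t \<in> tensor_span V W" by simp
qed

lemma slice_in: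
  assumes "clinear y" "csubspace V" "t \<in> tensor_span V W"
  shows "slice y t \<in> V"
proof -
  obtain xs where "set xs \<subseteq> V \<times> W" "t = psum (\<otimes>) xs" using assms tensor_span_psum by blast
  then show ?thesis using assms by (auto simp: slice_psum intro!: psum_in csubspaceD(3))
qed

lemma slice_ann:
  assumes "clinear y" "csubspace V" "t \<in> tensor_span V W" "\<And>w. w \<in> W \<Longrightarrow> y w = 0"
  shows "slice y t = 0"
proof -
  obtain xs where "set xs \<subseteq> V \<times> W" "t = psum (\<otimes>) xs" using assms tensor_span_psum by blast
  then show ?thesis using assms(1,4)
    by (simp add: slice_psum psum_cong[of xs _ "\<lambda>_ _. 0"] subset_iff)
qed

text \<open>Write \<open>t = \<Sum> k \<otimes> g(k)\<close> with independent \<open>k\<close>. If some \<open>g(k)\<close> were outside \<open>W\<close>, a functional that vanishes on \<open>W\<close> but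
  not at \<open>g(k)\<close> would have a nonzero slice; so the second legs lie in \<open>W\<close>. Expanding those in a basis, the
  coefficients are slices, hence lie in \<open>V\<close>.\<close>
lemma tensor_span_slices:
  assumes V: "csubspace V" and W: "csubspace W"
    and "\<And>y. clinear y \<Longrightarrow> slice y t \<in> V"
    and "\<And>y. clinear y \<Longrightarrow> (\<And>w. w \<in> W \<Longrightarrow> y w = 0) \<Longrightarrow> slice y t = 0"
  shows "t \<in> tensor_span V W"
proof -
  obtain K g where K: "finite K" "\<not> module.dependent scaleC K" "t = (\<Sum>k\<in>K. k \<otimes> g k)"
    using tensor_basis_left by blast
  have *: "slice y t = (\<Sum>k\<in>K. y (g k) *\<^sub>C k)" if "clinear y" for y
    by (simp add: K(3) clinear_sum[OF clinear_slice[OF that]] slice_pure[OF that])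
  have gW: "g k \<in> W" if k: "k \<in> K" for k
  proof (rule ccontr)
    assume "g k \<notin> W"
    then obtain f where f: "clinear f" "\<And>v. v \<in> W \<Longrightarrow> f v = 0" "f (g k) = (1::complex)"
      using functional_separates[OF W] by metis
    from assms(4)[OF f(1,2)] have "(\<Sum>k\<in>K. f (g k) *\<^sub>C k) = 0" using *[OF f(1)] by simp
    then have "f (g k) = 0"
      using complex_vector.independentD[OF K(2,1), of "\<lambda>k. f (g k)" k] k by auto
    then show False using f by simp
  qed
  have sl: "\<exists>xs. (\<Sum>k\<in>K. k \<otimes> g k) = psum (\<otimes>) xs \<and> set xs = (\<lambda>k. (k, g k)) ` K"
    using K(1)
  proof (induction K rule: finite_induct)
    case empty show ?case by (intro exI[of _ "[]"]) simp
  next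
    case (insert k K)
    then obtain xs where "(\<Sum>k\<in>K. k \<otimes> g k) = psum (\<otimes>) xs" "set xs = (\<lambda>k. (k, g k)) ` K" by blast
    then show ?case using insert(1,2) by (intro exI[of _ "(k, g k) # xs"]) simp
  qed
  then obtain xs where xs: "t = psum (\<otimes>) xs" "set xs = (\<lambda>k. (k, g k)) ` K" using K(3) by auto
  obtain L where L: "finite L" "L \<subseteq> cspan (g ` K)" "\<not> module.dependent scaleC L" "g ` K \<subseteq> cspan L"
    using finite_basis_of[OF finite_imageI[OF K(1)], of g] by blast
  have "set xs \<subseteq> UNIV \<times> cspan L" using xs(2) L(4) by auto
  from tensor_indep_right[OF L(1) this csubspace_UNIV]
  obtain h where h: "t = (\<Sum>l\<in>L. h l \<otimes> l)" unfolding xs(1) by blast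
  obtain \<phi> where \<phi>: "\<And>k. clinear (\<phi> k)"
    "\<And>k l. l \<in> L \<Longrightarrow> \<phi> k l = (if l = k then 1 else (0::complex))"
    using basis_functionals[OF L(3)] by blast
  have "h l \<in> V" if "l \<in> L" for l
  proof -
    have "slice (\<phi> l) t = (\<Sum>m\<in>L. \<phi> l m *\<^sub>C h m)"
      by (simp add: h clinear_sum[OF clinear_slice[OF \<phi>(1)]] slice_pure[OF \<phi>(1)])
    also have "\<dots> = (\<Sum>m\<in>L. if m = l then h m else 0)"
      by (rule sum.cong) (auto simp: \<phi>(2) scale_simps)
    also have "\<dots> = h l" using L(1) that by simp
    finally show ?thesis using assms(3)[OF \<phi>(1)[of l]] by simp
  qed
  moreover have "L \<subseteq> W" using L(2) gW cspan_subset[of "g ` K" W] W by auto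
  ultimately have "(\<Sum>l\<in>L. h l \<otimes> l) \<in> tensor_span V W"
    unfolding tensor_span_def by (intro complex_vector.span_sum complex_vector.span_base) auto
  then show ?thesis using h by simp
qed

section \<open>Coalgebras\<close>

text \<open>The condition under which a ternary function is defined on a triple tensor product. As for \<open>balanced_on\<close>, scalars only
  have to move between the arguments, so that maps that are antilinear in every argument are covered too.\<close>
definition tribalanced :: "('a::complex_vector \<Rightarrow> 'b::complex_vector \<Rightarrow> 'c::complex_vector \<Rightarrow> 'd::ab_group_add) \<Rightarrow> bool"
  where "tribalanced f \<longleftrightarrow> (\<forall>a a' b c. f (a + a') b c = f a b c + f a' b c) \<and>
    (\<forall>a b b' c. f a (b + b') c = f a b c + f a b' c) \<and>
    (\<forall>a b c c'. f a b (c + c') = f a b c + f a b c') \<and>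
    (\<forall>r a b c. f (r *\<^sub>C a) b c = f a (r *\<^sub>C b) c) \<and>
    (\<forall>r a b c. f a (r *\<^sub>C b) c = f a b (r *\<^sub>C c))"

lemma triI:
  assumes "\<And>a a' b c. f (a + a') b c = f a b c + f a' b c"
    "\<And>a b b' c. f a (b + b') c = f a b c + f a b' c"
    "\<And>a b c c'. f a b (c + c') = f a b c + f a b c'"
    "\<And>r a b c. f (r *\<^sub>C a) b c = f a (r *\<^sub>C b) c"
    "\<And>r a b c. f a (r *\<^sub>C b) c = f a b (r *\<^sub>C c)"
  shows "tribalanced f"
  unfolding tribalanced_def using assms by blast

lemma triD:
  assumes "tribalanced f"
  shows "f (a + a') b c = f a b c + f a' b c" "f a (b + b') c = f a b c + f a b' c"
    "f a b (c + c') = f a b c + f a b c'" "f (r *\<^sub>C a) b c = f a (r *\<^sub>C b) c"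
    "f a (r *\<^sub>C b) c = f a b (r *\<^sub>C c)"
  using assms unfolding tribalanced_def by blast+

lemma tri_bal_right: "tribalanced f \<Longrightarrow> bal (f a)"
  by (rule balI) (simp_all add: triD)

lemma tri_bal_left: "tribalanced f \<Longrightarrow> bal (\<lambda>a b. f a b c)"
  by (rule balI) (simp_all add: triD)

lemma bal_ts_right:
  assumes "tribalanced f"
  shows "bal (\<lambda>a u. ts (f a) u)"
proof (rule balI)
  note tri_bal_right[OF assms]
  show "ts (f (v + v')) w = ts (f v) w + ts (f v') w" for v v' w
  proof -
    have "f (v + v') = (\<lambda>b c. f v b c + f v' b c)" by (intro ext) (rule triD[OF assms])
    then show ?thesis by (simp add: ts_add_fun)
  qed
  show "ts (f v) (w + w') = ts (f v) w + ts (f v) w'" for v w w'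
    by (rule ts_plus) fact
  show "ts (f (c *\<^sub>C v)) w = ts (f v) (c *\<^sub>C w)" for c v w
  proof -
    have "f (c *\<^sub>C v) = (\<lambda>a b. f v (c *\<^sub>C a) b)" by (intro ext) (rule triD[OF assms])
    then show ?thesis by (simp add: ts_scale[OF tri_bal_right[OF assms]])
  qed
qed

lemma bal_ts_left:
  assumes "tribalanced f"
  shows "bal (\<lambda>u c. ts (\<lambda>a b. f a b c) u)"
proof (rule balI)
  note b = tri_bal_left[OF assms]
  show "ts (\<lambda>a b. f a b w) (v + v') = ts (\<lambda>a b. f a b w) v + ts (\<lambda>a b. f a b w) v'" for v v' w
    by (rule ts_plus) (rule b)
  show "ts (\<lambda>a b. f a b (w + w')) v = ts (\<lambda>a b. f a b w) v + ts (\<lambda>a b. f a b w') v" for v w w'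
    unfolding ts_add_fun[symmetric] by (simp add: triD[OF assms])
  show "ts (\<lambda>a b. f a b w) (c *\<^sub>C v) = ts (\<lambda>a b. f a b (c *\<^sub>C w)) v" for c v w
    by (subst ts_scale[OF b]) (simp add: triD[OF assms])
qed

lemma tri_assoc: "tribalanced (\<lambda>a b c. a \<otimes> (b \<otimes> c))"
  by (rule triI) (simp_all add: pure_tensor_add_left pure_tensor_add_right pure_tensor_scaleC_left
      pure_tensor_scaleC_right)

lemma tensor_assoc_ts: "tensor_assoc t = ts (\<lambda>u c. ts (\<lambda>a b. a \<otimes> (b \<otimes> c)) u) t"
proof -
  have "tensor_assoc t = tmap (\<lambda>u c. ts (\<lambda>a b. a \<otimes> (b \<otimes> c)) u) t"
    unfolding tensor_assoc_def by (simp add: ts_tmap[OF tri_bal_left[OF tri_assoc]])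
  then show ?thesis by (simp add: ts_tmap[OF bal_ts_left[OF tri_assoc]])
qed

lemma tensor_assoc_hom: "tensor_assoc 0 = 0" "tensor_assoc (s + t) = tensor_assoc s + tensor_assoc t"
  unfolding tensor_assoc_ts
  by (rule ts_0[OF bal_ts_left[OF tri_assoc]], rule ts_plus[OF bal_ts_left[OF tri_assoc]])

lemma tensor_assoc_pure: "tensor_assoc (u \<otimes> c) = ts (\<lambda>a b. a \<otimes> (b \<otimes> c)) u"
  unfolding tensor_assoc_ts by (rule ts_pure[OF bal_ts_left[OF tri_assoc]])

text \<open>Coassociativity is an equation between tensors in \<open>C \<otimes> (C \<otimes> C)\<close>; this evaluation turns it into an
  interchange rule for Sweedler sums of ternary functions.\<close>
lemma ts_tensor_assoc_pure:
  assumes "tribalanced f"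
  shows "ts (\<lambda>a u. ts (f a) u) (tensor_assoc (u \<otimes> c)) = ts (\<lambda>a b. f a b c) u"
proof -
  note b = bal_ts_right[OF assms]
  have "ts (\<lambda>a u. ts (f a) u) (ts (\<lambda>a b. a \<otimes> (b \<otimes> c)) u) = ts (\<lambda>a b. ts (\<lambda>a u. ts (f a) u) (a \<otimes> (b \<otimes> c))) u"
    by (rule ts_hom) (simp_all add: ts_0[OF b] ts_plus[OF b])
  then show ?thesis unfolding tensor_assoc_pure
    by (simp add: ts_pure[OF b] ts_pure[OF tri_bal_right[OF assms]])
qed

lemma ts_scale_left: "ts h t *\<^sub>C w = ts (\<lambda>a b. h a b *\<^sub>C w) t"
  by (rule ts_hom[of "\<lambda>r. r *\<^sub>C w"]) (simp_all add: scale_simps)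

lemma ts_scale_left_fun: "(*\<^sub>C) (ts h t) = (\<lambda>w. ts (\<lambda>a b. h a b *\<^sub>C w) t)"
  by (rule ext) (rule ts_scale_left)

lemma bal_comp_left: "clinear D \<Longrightarrow> bal h \<Longrightarrow> bal (\<lambda>c d. h (D c) d)"
  unfolding clinear_iff by (rule balI) (simp_all add: balD)

lemma bal_comp_right: "clinear D \<Longrightarrow> bal h \<Longrightarrow> bal (\<lambda>c d. h c (D d))"
  unfolding clinear_iff by (rule balI) (simp_all add: balD)

lemma bal_mult: "clinear x \<Longrightarrow> clinear y \<Longrightarrow> bal (\<lambda>c d. x c * (y d :: complex))"
  unfolding clinear_iff by (rule balI) (simp_all add: algebra_simps)

context coalgebra
begin

text \<open>Coassociativity in Sweedler notation: the three legs may be produced by splitting the first or the second one.\<close>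
lemma sw_coassoc:
  assumes "tribalanced f"
  shows "ts (\<lambda>x d. ts (\<lambda>a b. f a b d) (comult x)) (comult e) = ts (\<lambda>a y. ts (\<lambda>b d. f a b d) (comult y)) (comult e)"
proof -
  let ?G = "\<lambda>t. ts (\<lambda>a u. ts (f a) u) t"
  note b = bal_ts_right[OF assms]
  have G: "?G 0 = 0" "\<And>s t. ?G (s + t) = ?G s + ?G t" by (rule ts_0[OF b], rule ts_plus[OF b])
  have "?G (tensor_assoc (tmap (\<lambda>c d. comult c \<otimes> d) (comult e))) = ?G (tmap (\<lambda>c d. c \<otimes> comult d) (comult e))"
    by (simp only: coassoc)
  also have "tmap (\<lambda>c d. comult c \<otimes> d) (comult e) = ts (\<lambda>c d. comult c \<otimes> d) (comult e)"
    by (rule ts_tmap[OF bal_comp_left[OF clinear_comult bal_pure]])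
  also have "tmap (\<lambda>c d. c \<otimes> comult d) (comult e) = ts (\<lambda>c d. c \<otimes> comult d) (comult e)"
    by (rule ts_tmap[OF bal_comp_right[OF clinear_comult bal_pure]])
  also have "tensor_assoc (ts (\<lambda>c d. comult c \<otimes> d) (comult e)) = ts (\<lambda>c d. tensor_assoc (comult c \<otimes> d)) (comult e)"
    by (rule ts_hom) (fact tensor_assoc_hom)+
  also have "?G \<dots> = ts (\<lambda>c d. ?G (tensor_assoc (comult c \<otimes> d))) (comult e)"
    by (rule ts_hom[of ?G]) (fact G)+
  also have "?G (ts (\<lambda>c d. c \<otimes> comult d) (comult e)) = ts (\<lambda>c d. ?G (c \<otimes> comult d)) (comult e)"
    by (rule ts_hom[of ?G]) (fact G)+
  finally show ?thesis
    by (simp add: ts_tensor_assoc_pure[OF assms] ts_pure[OF b])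
qed

lemma sw_add: "bal f \<Longrightarrow> ts f (comult (a + b)) = ts f (comult a) + ts f (comult b)"
  by (simp add: clinear_add[OF clinear_comult] ts_plus)

lemma sw_scale: "bal f \<Longrightarrow> ts f (comult (c *\<^sub>C a)) = ts (\<lambda>v w. f (c *\<^sub>C v) w) (comult a)"
  by (simp add: clinear_scale[OF clinear_comult] ts_scale)

lemma sw_counit_left: "clinear L \<Longrightarrow> ts (\<lambda>c d. counit c *\<^sub>C L d) (comult e) = L e"
proof -
  assume L: "clinear L"
  have b: "bal (\<lambda>c d. counit c *\<^sub>C d)"
    using clinear_counit unfolding clinear_iff by (intro balI) (simp_all add: scale_simps mult.commute)
  have "L (ts (\<lambda>c d. counit c *\<^sub>C d) (comult e)) = L e"
    using counit_left[of e] by (simp only: ts_tmap[OF b])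
  then show ?thesis by (simp add: ts_clinear[OF L] clinear_scale[OF L])
qed

lemma sw_counit_right: "clinear L \<Longrightarrow> ts (\<lambda>c d. counit d *\<^sub>C L c) (comult e) = L e"
proof -
  assume L: "clinear L"
  have "L (ts (\<lambda>c d. counit d *\<^sub>C c) (comult e)) = L e"
    using counit_right[of e] by (simp only: ts_tmap[OF bal_slice[OF clinear_counit]])
  then show ?thesis by (simp add: ts_clinear[OF L] clinear_scale[OF L])
qed


text \<open>The dual of a coalgebra is an algebra under \<open>conv\<close>, and the coalgebra is a bimodule over it under \<open>lact\<close> and \<open>ract\<close>.
  This turns comultiplicative bookkeeping into algebra: subcoalgebras are the subbimodules, and a product is evaluated
  by moving one factor to the argument (\<open>conv_lact\<close>, \<open>conv_ract\<close>).\<close>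
definition conv :: "('c \<Rightarrow> complex) \<Rightarrow> ('c \<Rightarrow> complex) \<Rightarrow> 'c \<Rightarrow> complex"
  where "conv x y c = ts (\<lambda>c1 c2. x c1 * y c2) (comult c)"

definition lact :: "('c \<Rightarrow> complex) \<Rightarrow> 'c \<Rightarrow> 'c"
  where "lact y c = ts (\<lambda>c1 c2. y c2 *\<^sub>C c1) (comult c)"

definition ract :: "('c \<Rightarrow> complex) \<Rightarrow> 'c \<Rightarrow> 'c"
  where "ract y c = ts (\<lambda>c1 c2. y c1 *\<^sub>C c2) (comult c)"

lemma lact_slice: "lact y c = slice y (comult c)"
  by (simp add: lact_def slice_def)

lemma bal_ract: "clinear y \<Longrightarrow> bal (\<lambda>c1 c2. y c1 *\<^sub>C c2)"
  unfolding clinear_iff by (rule balI) (simp_all add: scale_simps mult.commute)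

lemma clinear_conv: "clinear x \<Longrightarrow> clinear y \<Longrightarrow> clinear (conv x y)"
  unfolding clinear_iff[of "conv x y"] conv_def
  by (simp add: sw_add[OF bal_mult] sw_scale[OF bal_mult] clinear_scale[of x] ts_mult_left mult.assoc)

lemma clinear_lact: "clinear y \<Longrightarrow> clinear (lact y)"
  unfolding clinear_iff[of "lact y"] lact_def
  by (simp add: sw_add[OF bal_slice] sw_scale[OF bal_slice] ts_scale_fun[symmetric] scale_simps mult.commute)

lemma clinear_ract: "clinear y \<Longrightarrow> clinear (ract y)"
  unfolding clinear_iff[of "ract y"] ract_def
  by (simp add: sw_add[OF bal_ract] sw_scale[OF bal_ract] ts_scale_fun[symmetric] scale_simps clinear_scale[of y])

lemma conv_lact: "clinear y \<Longrightarrow> conv y x c = y (lact x c)"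
  by (simp add: conv_def lact_def ts_clinear clinear_scale[of y] mult.commute)

lemma conv_ract: "clinear y \<Longrightarrow> conv x y c = y (ract x c)"
  by (simp add: conv_def ract_def ts_clinear clinear_scale[of y])

lemma lact_conv:
  assumes "clinear x" "clinear y"
  shows "lact (conv x y) c = lact x (lact y c)"
proof -
  have "lact x (lact y c) = ts (\<lambda>d e. y e *\<^sub>C lact x d) (comult c)"
    unfolding lact_def[of y c] by (simp add: ts_clinear[OF clinear_lact[OF assms(1)]] clinear_scale[OF clinear_lact[OF assms(1)]])
  also have "\<dots> = ts (\<lambda>d e. ts (\<lambda>a b. (x b * y e) *\<^sub>C a) (comult d)) (comult c)"
    by (simp add: lact_def ts_scale_fun[symmetric] scale_simps mult.commute)
  also have "\<dots> = ts (\<lambda>a d. ts (\<lambda>b e. (x b * y e) *\<^sub>C a) (comult d)) (comult c)"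
    by (rule sw_coassoc, rule triI)
      (simp_all add: scale_simps clinear_add[OF assms(1)] clinear_add[OF assms(2)]
        clinear_scale[OF assms(1)] clinear_scale[OF assms(2)] distrib_left distrib_right mult_ac)
  also have "\<dots> = lact (conv x y) c"
    unfolding lact_def conv_def
    by (simp only: ts_scale_left)
  finally show ?thesis ..
qed

lemma ract_conv:
  assumes "clinear x" "clinear y"
  shows "ract (conv x y) c = ract y (ract x c)"
proof -
  have "ract y (ract x c) = ts (\<lambda>d e. x d *\<^sub>C ract y e) (comult c)"
    unfolding ract_def[of x c] by (simp add: ts_clinear[OF clinear_ract[OF assms(2)]] clinear_scale[OF clinear_ract[OF assms(2)]])
  also have "\<dots> = ts (\<lambda>d e. ts (\<lambda>a b. (x d * y a) *\<^sub>C b) (comult e)) (comult c)"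
    by (simp add: ract_def ts_scale_fun[symmetric] scale_simps mult.commute)
  also have "\<dots> = ts (\<lambda>d b. ts (\<lambda>a e. (x a * y e) *\<^sub>C b) (comult d)) (comult c)"
    by (rule sw_coassoc[symmetric], rule triI)
      (simp_all add: scale_simps clinear_add[OF assms(1)] clinear_add[OF assms(2)]
        clinear_scale[OF assms(1)] clinear_scale[OF assms(2)] distrib_left distrib_right mult_ac)
  also have "\<dots> = ract (conv x y) c"
    unfolding ract_def conv_def
    by (simp only: ts_scale_left_fun)
  finally show ?thesis ..
qed

lemma lact_ract:
  assumes "clinear x" "clinear y"
  shows "lact y (ract x c) = ract x (lact y c)"
proof -
  have "lact y (ract x c) = ts (\<lambda>d e. x d *\<^sub>C lact y e) (comult c)"
    unfolding ract_def[of x c] by (simp add: ts_clinear[OF clinear_lact[OF assms(2)]] clinear_scale[OF clinear_lact[OF assms(2)]])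
  also have "\<dots> = ts (\<lambda>d e. ts (\<lambda>a b. (x d * y b) *\<^sub>C a) (comult e)) (comult c)"
    by (simp add: lact_def ts_scale_fun[symmetric] scale_simps mult.commute)
  also have "\<dots> = ts (\<lambda>d b. ts (\<lambda>a e. (x a * y b) *\<^sub>C e) (comult d)) (comult c)"
    by (rule sw_coassoc[symmetric], rule triI)
      (simp_all add: scale_simps clinear_add[OF assms(1)] clinear_add[OF assms(2)]
        clinear_scale[OF assms(1)] clinear_scale[OF assms(2)] distrib_left distrib_right mult_ac)
  also have "\<dots> = ts (\<lambda>d b. y b *\<^sub>C ract x d) (comult c)"
    by (simp add: ract_def ts_scale_fun[symmetric] scale_simps mult.commute)
  also have "\<dots> = ract x (lact y c)"
    unfolding lact_def[of y c] by (simp add: ts_clinear[OF clinear_ract[OF assms(1)]] clinear_scale[OF clinear_ract[OF assms(1)]])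
  finally show ?thesis .
qed

lemma conv_assoc:
  assumes "clinear x" "clinear y" "clinear z"
  shows "conv (conv x y) z = conv x (conv y z)"
  by (rule ext) (simp add: conv_ract[of z] conv_ract[of "conv y z"] clinear_conv assms ract_conv)

lemma lact_counit: "lact counit c = c"
  using sw_counit_right[of "\<lambda>c. c" c] by (simp add: lact_def clinear_iff)

lemma ract_counit: "ract counit c = c"
  using sw_counit_left[of "\<lambda>c. c" c] by (simp add: ract_def clinear_iff)

lemma conv_counit_right: "clinear x \<Longrightarrow> conv x counit = x"
  by (rule ext) (simp add: conv_lact lact_counit)

lemma conv_counit_left: "clinear x \<Longrightarrow> conv counit x = x"
  by (rule ext) (simp add: conv_ract ract_counit)

lemma lact_add: "lact (x + y) c = lact x c + lact y c"
  by (simp add: lact_def ts_add_fun[symmetric] scale_simps)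

lemma lact_in_span: "lact y c \<in> cspan (fst ` set (dec (comult c)))"
  unfolding lact_def ts_def
  by (rule psum_in[OF complex_vector.subspace_span])
    (rule complex_vector.span_scale, rule complex_vector.span_base, erule rev_image_eqI, simp)

lemma ract_in_span: "ract y c \<in> cspan (snd ` set (dec (comult c)))"
  unfolding ract_def ts_def
  by (rule psum_in[OF complex_vector.subspace_span])
    (rule complex_vector.span_scale, rule complex_vector.span_base, erule rev_image_eqI, simp)

definition stable :: "'c set \<Rightarrow> bool"
  where "stable D \<longleftrightarrow> csubspace D \<and> (\<forall>y. clinear y \<longrightarrow> (\<forall>d\<in>D. lact y d \<in> D \<and> ract y d \<in> D))"

text \<open>A subbimodule is a subcoalgebra because the slices of \<open>\<Delta>(d)\<close> are the vectors \<open>y \<cdot> d\<close>, and because a functional \<open>y\<close> that vanishes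
  on the right orbit of \<open>d\<close> satisfies \<open>f(y \<cdot> d) = y(d \<cdot> f) = 0\<close> for all \<open>f\<close>.\<close>
lemma stable_subcoalgebra: "stable D \<longleftrightarrow> csubspace D \<and> comult ` D \<subseteq> tensor_span D D"
proof
  assume D: "stable D"
  then have sub: "csubspace D" by (simp add: stable_def)
  have "comult d \<in> tensor_span D D" if d: "d \<in> D" for d
  proof (rule tensor_span_slices[OF sub sub])
    fix y :: "'c \<Rightarrow> complex" assume y: "clinear y"
    show "slice y (comult d) \<in> D" using D d y by (simp add: stable_def lact_slice[symmetric])
    assume 0: "\<And>w. w \<in> D \<Longrightarrow> y w = 0"
    show "slice y (comult d) = 0"
    proof (rule ccontr)
      assume "slice y (comult d) \<noteq> 0"
      then have "lact y d \<notin> {0}" by (simp add: lact_slice)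
      then obtain f where f: "clinear f" "f (lact y d) = (1::complex)"
        using functional_separates[of "{0}" "lact y d"] by auto
      have "f (lact y d) = y (ract f d)"
        using conv_lact[OF f(1), of y d] conv_ract[OF y, of f d] by simp
      also have "\<dots> = 0" using D d f by (simp add: stable_def 0)
      finally show False using f by simp
    qed
  qed
  then show "csubspace D \<and> comult ` D \<subseteq> tensor_span D D" using sub by blast
next
  assume D: "csubspace D \<and> comult ` D \<subseteq> tensor_span D D"
  then have sub: "csubspace D" by simp
  have "lact y d \<in> D \<and> ract y d \<in> D" if y: "clinear y" and d: "d \<in> D" for y d
  proof -
    obtain xs where xs: "set xs \<subseteq> D \<times> D" "comult d = psum (\<otimes>) xs"
      using D d tensor_span_psum[OF sub, of "comult d" D] by blast
    have "lact y d = psum (\<lambda>c1 c2. y c2 *\<^sub>C c1) xs"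
      unfolding lact_def xs(2) by (rule ts_psum[OF bal_slice[OF y]])
    moreover have "\<dots> \<in> D" using xs(1) by (intro psum_in[OF sub]) (auto intro: csubspaceD(3)[OF sub])
    moreover have "ract y d = psum (\<lambda>c1 c2. y c1 *\<^sub>C c2) xs"
      unfolding ract_def xs(2) by (rule ts_psum[OF bal_ract[OF y]])
    moreover have "\<dots> \<in> D" using xs(1) by (intro psum_in[OF sub]) (auto intro: csubspaceD(3)[OF sub])
    ultimately show ?thesis by simp
  qed
  then show "stable D" using sub by (simp add: stable_def)
qed

lemma fin_dim_lact: "fin_dim {lact y c | y. clinear y}"
  unfolding fin_dim_def using lact_in_span
  by (intro exI[of _ "fst ` set (dec (comult c))"]) auto

lemma fin_dim_ract: "fin_dim {ract y c | y. clinear y}"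
  unfolding fin_dim_def using ract_in_span
  by (intro exI[of _ "snd ` set (dec (comult c))"]) auto


lemma fin_dim_lact_orbit:
  assumes "fin_dim V"
  shows "fin_dim {lact y v | y v. clinear y \<and> v \<in> V}"
proof -
  obtain F where F: "finite F" "V \<subseteq> cspan F" using assms by (auto simp: fin_dim_def)
  have fin: "fin_dim (\<Union>f\<in>F. {lact y f | y. clinear y})" (is "fin_dim ?U")
    by (rule fin_dim_UN[OF F(1) fin_dim_lact])
  have "lact y v \<in> cspan ?U" if y: "clinear y" and v: "v \<in> cspan F" for y v
  proof -
    have "lact y v \<in> cspan (lact y ` F)" by (rule clinear_cspan_image[OF clinear_lact[OF y] v])
    moreover have "lact y ` F \<subseteq> ?U" using y by blast
    ultimately show ?thesis using complex_vector.span_mono by blast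
  qed
  then have "{lact y v | y v. clinear y \<and> v \<in> V} \<subseteq> cspan ?U" using F(2) by blast
  then show ?thesis using fin_dim_subset fin_dim_cspan[OF fin] by blast
qed

lemma fin_dim_ract_orbit:
  assumes "fin_dim V"
  shows "fin_dim {ract y v | y v. clinear y \<and> v \<in> V}"
proof -
  obtain F where F: "finite F" "V \<subseteq> cspan F" using assms by (auto simp: fin_dim_def)
  have fin: "fin_dim (\<Union>f\<in>F. {ract y f | y. clinear y})" (is "fin_dim ?U")
    by (rule fin_dim_UN[OF F(1) fin_dim_ract])
  have "ract y v \<in> cspan ?U" if y: "clinear y" and v: "v \<in> cspan F" for y v
  proof -
    have "ract y v \<in> cspan (ract y ` F)" by (rule clinear_cspan_image[OF clinear_ract[OF y] v])
    moreover have "ract y ` F \<subseteq> ?U" using y by blast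
    ultimately show ?thesis using complex_vector.span_mono by blast
  qed
  then have "{ract y v | y v. clinear y \<and> v \<in> V} \<subseteq> cspan ?U" using F(2) by blast
  then show ?thesis using fin_dim_subset fin_dim_cspan[OF fin] by blast
qed

lemma cspan_stableI:
  assumes "\<And>y s. clinear y \<Longrightarrow> s \<in> S \<Longrightarrow> lact y s \<in> cspan S \<and> ract y s \<in> cspan S"
  shows "stable (cspan S)"
  unfolding stable_def
proof (intro conjI allI impI ballI)
  fix y :: "'c \<Rightarrow> complex" and d assume y: "clinear y" and d: "d \<in> cspan S"
  have "lact y d \<in> cspan (lact y ` S)" by (rule clinear_cspan_image[OF clinear_lact[OF y] d])
  moreover have "cspan (lact y ` S) \<subseteq> cspan S"
    using assms[OF y] by (intro cspan_subset) auto
  ultimately show "lact y d \<in> cspan S" by blast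
  have "ract y d \<in> cspan (ract y ` S)" by (rule clinear_cspan_image[OF clinear_ract[OF y] d])
  moreover have "cspan (ract y ` S) \<subseteq> cspan S"
    using assms[OF y] by (intro cspan_subset) auto
  ultimately show "ract y d \<in> cspan S" by blast
qed simp

text \<open>The fundamental theorem of coalgebras. Each one-sided orbit is spanned by the legs of one coproduct, so the span of the
  two-sided orbits of a finite-dimensional space is finite-dimensional.\<close>
lemma fin_dim_stable:
  assumes "fin_dim V"
  shows "\<exists>D. stable D \<and> fin_dim D \<and> V \<subseteq> D"
proof -
  let ?S = "{lact y w | y w. clinear y \<and> w \<in> {ract z v | z v. clinear z \<and> v \<in> V}}"
  have fin: "fin_dim (cspan ?S)"
    by (intro fin_dim_cspan fin_dim_lact_orbit fin_dim_ract_orbit assms)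
  have SI: "lact y (ract z v) \<in> ?S" if "clinear y" "clinear z" "v \<in> V" for y z v
    by (rule CollectI, intro exI[of _ y] exI[of _ "ract z v"]) (use that in auto)
  have "stable (cspan ?S)"
  proof (rule cspan_stableI)
    fix u :: "'c \<Rightarrow> complex" and s assume u: "clinear u" and "s \<in> ?S"
    then obtain y z v where s: "s = lact y (ract z v)" and c: "clinear y" "clinear z" "v \<in> V" by blast
    have "lact u s = lact (conv u y) (ract z v)" using u c by (simp add: s lact_conv)
    then have 1: "lact u s \<in> ?S" using SI[OF clinear_conv[OF u c(1)] c(2,3)] by (simp only:)
    have "ract u s = lact y (ract (conv z u) v)" using u c
      by (simp add: s lact_ract[symmetric] ract_conv)
    then have "ract u s \<in> ?S" using SI[OF c(1) clinear_conv[OF c(2) u] c(3)] by (simp only:)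
    with 1 show "lact u s \<in> cspan ?S \<and> ract u s \<in> cspan ?S"
      by (intro conjI complex_vector.span_base)
  qed
  moreover have "V \<subseteq> cspan ?S"
  proof
    fix v assume "v \<in> V"
    from SI[OF clinear_counit clinear_counit this] have "v \<in> ?S" by (simp only: lact_counit ract_counit)
    then show "v \<in> cspan ?S" by (rule complex_vector.span_base)
  qed
  ultimately show ?thesis using fin by blast
qed

definition ann :: "'c set \<Rightarrow> ('c \<Rightarrow> complex) set"
  where "ann D = {y. clinear y \<and> (\<forall>d\<in>D. y d = 0)}"

lemma ann_conv:
  assumes "stable D" "y \<in> ann D" "clinear z"
  shows "conv y z \<in> ann D" "conv z y \<in> ann D"
  using assms by (auto simp: ann_def clinear_conv conv_lact[of y] conv_ract[of y] stable_def)

lemma lact_ann: 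
  assumes "stable D" "y \<in> ann D" "d \<in> D"
  shows "lact y d = 0"
proof -
  have "clinear y" "\<And>w. w \<in> D \<Longrightarrow> y w = 0" using assms by (auto simp: ann_def)
  then show ?thesis unfolding lact_slice
    using assms slice_ann[of y D "comult d" D] by (auto simp: stable_subcoalgebra)
qed

text \<open>Recovers the subcoalgebra from its annihilator: a functional vanishing on \<open>D\<close> but not at \<open>c\<close> is seen by \<open>\<epsilon>(f \<cdot> c) = f(c)\<close>.\<close>
lemma lact_ann_mem:
  assumes "csubspace D" "\<And>y. y \<in> ann D \<Longrightarrow> lact y c = 0"
  shows "c \<in> D"
proof (rule ccontr)
  assume "c \<notin> D"
  then obtain f where f: "clinear f" "\<And>v. v \<in> D \<Longrightarrow> f v = 0" "f c = (1::complex)"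
    using functional_separates[OF assms(1)] by blast
  then have "lact f c = 0" using assms(2)[of f] by (simp add: ann_def)
  moreover have "counit (lact f c) = f c"
    using conv_lact[OF clinear_counit, of f c] by (simp add: conv_counit_left[OF f(1)])
  ultimately show False using f by (simp add: clinear_zero[OF clinear_counit])
qed

subsection \<open>The restricted dual\<close>

text \<open>The restricted dual, expressed by \<open>conv\<close> and without reference to a datum.\<close>
definition rdual :: "('c \<Rightarrow> complex) set"
  where "rdual = {x. clinear x \<and> fin_dim (cspan {conv y (conv x z) | y z. clinear y \<and> clinear z})}"

lemma rdualI:
  assumes "clinear x" "fin_dim V" "\<And>y z. clinear y \<Longrightarrow> clinear z \<Longrightarrow> conv y (conv x z) \<in> V"
  shows "x \<in> rdual"
proof -
  have "{conv y (conv x z) | y z. clinear y \<and> clinear z} \<subseteq> V" using assms(3) by blast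
  then show ?thesis unfolding rdual_def
    using assms(1) fin_dim_cspan[OF fin_dim_subset[OF assms(2)]] by blast
qed

lemma rdual_clinear: "x \<in> rdual \<Longrightarrow> clinear x"
  by (simp add: rdual_def)

lemma rdualE:
  assumes "x \<in> rdual"
  obtains V where "fin_dim V" "csubspace V" "\<And>y z. clinear y \<Longrightarrow> clinear z \<Longrightarrow> conv y (conv x z) \<in> V"
proof (rule that[of "cspan {conv y (conv x z) | y z. clinear y \<and> clinear z}"])
  show "fin_dim (cspan {conv y (conv x z) | y z. clinear y \<and> clinear z})"
    using assms by (simp add: rdual_def)
  fix y z :: "'c \<Rightarrow> complex" assume "clinear y" "clinear z"
  then show "conv y (conv x z) \<in> cspan {conv y (conv x z) | y z. clinear y \<and> clinear z}"
    by (intro complex_vector.span_base) blast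
qed simp

lemma rdual_mult_left:
  assumes "x \<in> rdual" "clinear u"
  shows "conv u x \<in> rdual"
proof -
  obtain V where V: "fin_dim V" "csubspace V" "\<And>y z. clinear y \<Longrightarrow> clinear z \<Longrightarrow> conv y (conv x z) \<in> V"
    by (rule rdualE[OF assms(1)]) iprover
  note x = rdual_clinear[OF assms(1)]
  show ?thesis
  proof (rule rdualI[OF clinear_conv[OF assms(2) x] V(1)])
    fix y z :: "'c \<Rightarrow> complex" assume "clinear y" "clinear z"
    then show "conv y (conv (conv u x) z) \<in> V"
      using V(3)[OF clinear_conv[OF _ assms(2)], of y z] x assms(2) by (simp add: conv_assoc clinear_conv)
  qed
qed


text \<open>The common kernel of finitely many functionals has finite codimension.\<close>
lemma functionals_common_complement:
  assumes "finite F" "\<And>f. f \<in> F \<Longrightarrow> clinear (f :: 'c \<Rightarrow> complex)"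
  shows "\<exists>K. finite K \<and> (\<forall>c. \<exists>k\<in>cspan K. \<forall>f\<in>F. f (c - k) = 0)"
  using assms
proof (induction F rule: finite_induct)
  case empty
  show ?case by (intro exI[of _ "{}"]) simp
next
  case (insert g F)
  then obtain K where K: "finite K" "\<forall>c. \<exists>k\<in>cspan K. \<forall>f\<in>F. f (c - k) = 0" by auto
  show ?case
  proof (cases "\<exists>c. (\<forall>f\<in>F. f c = 0) \<and> g c \<noteq> 0")
    case True
    then obtain e where e: "\<forall>f\<in>F. f e = 0" "g e \<noteq> 0" by blast
    have g: "clinear g" using insert.prems by blast
    have "\<exists>k\<in>cspan (insert e K). \<forall>f\<in>insert g F. f (c - k) = 0" for c
    proof -
      obtain k where k: "k \<in> cspan K" "\<forall>f\<in>F. f (c - k) = 0" using K by blast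
      let ?r = "g (c - k) / g e"
      have "k + ?r *\<^sub>C e \<in> cspan (insert e K)"
        using k(1) complex_vector.span_mono[OF subset_insertI[of K e]]
        by (intro complex_vector.span_add complex_vector.span_scale) (auto intro: complex_vector.span_base)
      moreover have f: "f (c - (k + ?r *\<^sub>C e)) = f (c - k) - ?r * f e" if "clinear f" for f
        by (simp only: diff_diff_eq[symmetric] clinear_diff[OF that, of "c - k"] clinear_scale[OF that] scaleC_complex_def)
      have "\<forall>f\<in>insert g F. f (c - (k + ?r *\<^sub>C e)) = 0"
      proof
        fix h assume h: "h \<in> insert g F"
        show "h (c - (k + ?r *\<^sub>C e)) = 0"
          unfolding f[OF insert.prems[OF h]] using h k(2) e by auto
      qed
      ultimately show ?thesis by blast
    qed
    then show ?thesis using K(1) by (intro exI[of _ "insert e K"]) auto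
  next
    case False
    have "\<forall>f\<in>insert g F. f (c - k) = 0" if "\<forall>f\<in>F. f (c - k) = 0" for c k
      using that False by blast
    then show ?thesis using K by meson
  qed
qed

text \<open>The finite-dimensional ideal \<open>J\<close> generated by \<open>x\<close> has a common kernel of finite codimension, and \<open>x \<cdot> c = 0\<close> for \<open>c\<close> in it, because
  \<open>f(x \<cdot> c) = (f x)(c)\<close>. So \<open>x \<cdot> C\<close> is finite-dimensional, and \<open>fin_dim_stable\<close> applies.\<close>
lemma rdual_range:
  assumes "x \<in> rdual"
  shows "\<exists>D. stable D \<and> fin_dim D \<and> (\<forall>c. lact x c \<in> D)"
proof -
  note x = rdual_clinear[OF assms]
  let ?J = "{conv y (conv x z) | y z. clinear y \<and> clinear z}"
  have "fin_dim (cspan ?J)" using assms unfolding rdual_def by blast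
  then have "fin_dim ?J" using fin_dim_subset complex_vector.span_superset by blast
  then obtain F where F: "finite F" "F \<subseteq> ?J" "?J \<subseteq> cspan F" by (rule fin_dim_basis)
  have "clinear f" if "f \<in> F" for f using F(2) that x by (auto simp: clinear_conv)
  from functionals_common_complement[OF F(1) this]
  obtain K where K: "finite K" "\<And>c. \<exists>k\<in>cspan K. \<forall>f\<in>F. f (c - k) = 0" by blast
  have lx: "lact x c \<in> cspan (lact x ` K)" for c
  proof -
    obtain k where k: "k \<in> cspan K" "\<And>f. f \<in> F \<Longrightarrow> f (c - k) = 0" using K(2) by blast
    have J: "f (c - k) = 0" if "f \<in> cspan F" for f
      using that by (induction rule: complex_vector.span_induct_alt) (simp_all add: k(2) scaleC_fun_def)
    have "lact x (c - k) = 0"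
    proof (rule ccontr)
      assume "lact x (c - k) \<noteq> 0"
      then have "lact x (c - k) \<notin> {0}" by simp
      then obtain f where f: "clinear f" "f (lact x (c - k)) = (1::complex)"
        using functional_separates[of "{0}" "lact x (c - k)"] by auto
      have "f (lact x (c - k)) = conv f (conv x counit) (c - k)"
        by (simp add: conv_counit_right[OF x] conv_lact[OF f(1)])
      also have "\<dots> = 0" using F(3) f clinear_counit by (intro J) blast
      finally show False using f by simp
    qed
    then have "lact x c = lact x k" by (simp add: clinear_diff[OF clinear_lact[OF x]])
    then show ?thesis using clinear_cspan_image[OF clinear_lact[OF x] k(1)] by simp
  qed
  have "fin_dim (cspan (lact x ` K))" using K(1) by (intro fin_dim_finite_cspan) simp
  from fin_dim_stable[OF this] show ?thesis using lx by blast
qed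

text \<open>The form in which finite-dimensionality of the ideal of \<open>x\<close> is used to bound the operators of the restricted dual.\<close>
lemma rdual_left_ideal:
  assumes "x \<in> rdual"
  shows "\<exists>F. finite F \<and> (\<forall>f\<in>F. clinear f) \<and> x \<in> cspan F \<and> (\<forall>f\<in>F. \<forall>y. clinear y \<longrightarrow> conv y f \<in> cspan F)"
proof -
  note x = rdual_clinear[OF assms]
  let ?J = "{conv y (conv x z) | y z. clinear y \<and> clinear z}"
  have "fin_dim (cspan ?J)" using assms unfolding rdual_def by blast
  then have "fin_dim ?J" using fin_dim_subset complex_vector.span_superset by blast
  then obtain F where F: "finite F" "F \<subseteq> ?J" "?J \<subseteq> cspan F" by (rule fin_dim_basis)
  have "\<forall>f\<in>F. clinear f" using F(2) x by (auto simp: clinear_conv)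
  moreover have "x = conv counit (conv x counit)" by (simp add: x conv_counit_left conv_counit_right)
  then have "x \<in> ?J" using clinear_counit by blast
  then have "x \<in> cspan F" using F(3) by blast
  moreover have "conv y f \<in> cspan F" if "f \<in> F" "clinear y" for y f
  proof -
    have "f \<in> ?J" using F(2) that(1) by (rule subsetD)
    then obtain u z where f: "f = conv u (conv x z)" "clinear u" "clinear z" by blast
    have "conv y f = conv (conv y u) (conv x z)" using f x that by (simp add: conv_assoc clinear_conv)
    then have "conv y f \<in> ?J" using clinear_conv[OF that(2) f(2)] f(3) by blast
    then show ?thesis using F(3) by blast
  qed
  ultimately show ?thesis using F(1) by blast
qed

end

section \<open>Positive definite sesquilinear forms\<close>

locale pos_form =
  fixes ip :: "'a::complex_vector \<Rightarrow> 'a \<Rightarrow> complex"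
  assumes ip_add_right: "ip a (b + c) = ip a b + ip a c"
    and ip_scale_right: "ip a (r *\<^sub>C b) = r * ip a b"
    and ip_commute: "ip a b = cnj (ip b a)"
    and ip_pos: "a \<noteq> 0 \<Longrightarrow> Re (ip a a) > 0"
begin

lemma ip_add_left: "ip (a + b) c = ip a c + ip b c"
  by (subst (1 2 3) ip_commute) (simp add: ip_add_right)

lemma ip_scale_left: "ip (r *\<^sub>C a) b = cnj r * ip a b"
  by (subst (1 2) ip_commute) (simp add: ip_scale_right)

lemma ip_zero_right [simp]: "ip a 0 = 0"
  using ip_scale_right[of a 0 0] by simp

lemma ip_zero_left [simp]: "ip 0 a = 0"
  using ip_scale_left[of 0 0 a] by simp

lemma ip_diff_right: "ip a (b - c) = ip a b - ip a c"
  using ip_add_right[of a "b - c" c] by simp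

lemma ip_sum_right: "ip a (\<Sum>k\<in>K. f k) = (\<Sum>k\<in>K. ip a (f k))"
  by (induction K rule: infinite_finite_induct) (simp_all add: ip_add_right)

lemma ip_eq_zero: "ip a a = 0 \<Longrightarrow> a = 0"
  using ip_pos[of a] by force

lemma ip_self_real: "ip a a = complex_of_real (Re (ip a a))"
  using ip_commute[of a a] by (simp add: complex_eq_iff)

definition orthonormal :: "'a set \<Rightarrow> bool"
  where "orthonormal E \<longleftrightarrow> (\<forall>e\<in>E. \<forall>f\<in>E. ip e f = (if e = f then 1 else 0))"

lemma orthonormal_expand:
  assumes "finite E" "orthonormal E" "e \<in> E"
  shows "ip e (\<Sum>f\<in>E. r f *\<^sub>C f) = r e"
proof -
  have "ip e (\<Sum>f\<in>E. r f *\<^sub>C f) = (\<Sum>f\<in>E. r f * (if e = f then 1 else 0))"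
    using assms(2,3) by (simp add: ip_sum_right ip_scale_right orthonormal_def)
  also have "\<dots> = (\<Sum>f\<in>E. if e = f then r f else 0)"
    by (rule sum.cong) auto
  also have "\<dots> = r e" using assms(1,3) by simp
  finally show ?thesis .
qed

lemma gram_schmidt:
  assumes "finite F"
  shows "\<exists>E. finite E \<and> orthonormal E \<and> F \<subseteq> cspan E \<and> E \<subseteq> cspan F"
  using assms
proof (induction F rule: finite_induct)
  case empty
  show ?case by (intro exI[of _ "{}"]) (simp add: orthonormal_def)
next
  case (insert w F)
  then obtain E where E: "finite E" "orthonormal E" "F \<subseteq> cspan E" "E \<subseteq> cspan F" by blast
  define p where "p = (\<Sum>e\<in>E. ip e w *\<^sub>C e)"
  have p: "p \<in> cspan E" unfolding p_def
    by (intro complex_vector.span_sum complex_vector.span_scale complex_vector.span_base)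
  have orth: "ip e (w - p) = 0" if "e \<in> E" for e
    using orthonormal_expand[OF E(1,2) that, of "\<lambda>f. ip f w"] by (simp add: ip_diff_right p_def)
  have mono: "cspan F \<subseteq> cspan (insert w F)" by (rule complex_vector.span_mono) auto
  show ?case
  proof (cases "w = p")
    case True
    then show ?thesis using E p mono by (intro exI[of _ E]) auto
  next
    case False
    let ?n = "Re (ip (w - p) (w - p))"
    define v where "v = complex_of_real (1 / sqrt ?n) *\<^sub>C (w - p)"
    have pos: "?n > 0" using ip_pos[of "w - p"] False by simp
    have "ip v v = complex_of_real (1 / sqrt ?n * (1 / sqrt ?n)) * ip (w - p) (w - p)"
      by (simp only: v_def ip_scale_left ip_scale_right complex_cnj_complex_of_real of_real_mult mult.assoc)
    also have "\<dots> = complex_of_real (1 / sqrt ?n * (1 / sqrt ?n) * ?n)"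
      unfolding of_real_mult by (rule arg_cong[OF ip_self_real])
    also have "1 / sqrt ?n * (1 / sqrt ?n) * ?n = 1" using pos by (simp add: field_simps)
    finally have vv: "ip v v = 1" by simp
    have ev: "ip e v = 0" if "e \<in> E" for e using orth[OF that] by (simp add: v_def ip_scale_right)
    then have ve: "ip v e = 0" if "e \<in> E" for e using that ip_commute[of v e] by simp
    have "orthonormal (insert v E)"
      using E(2) vv ev ve by (auto simp: orthonormal_def)
    moreover have sE: "cspan E \<subseteq> cspan (insert v E)" by (rule complex_vector.span_mono) auto
    have "w = p + complex_of_real (sqrt ?n) *\<^sub>C v"
    proof -
      have "complex_of_real (sqrt ?n) * complex_of_real (1 / sqrt ?n) = 1"
        unfolding of_real_mult[symmetric] using pos by simp
      then have "complex_of_real (sqrt ?n) *\<^sub>C v = 1 *\<^sub>C (w - p)"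
        unfolding v_def scaleC_scaleC by (simp only:)
      then show ?thesis by (simp add: scaleC_one)
    qed
    then have "w \<in> cspan (insert v E)"
      using p sE by (metis complex_vector.span_add complex_vector.span_scale complex_vector.span_base insertI1 subsetD)
    then have "insert w F \<subseteq> cspan (insert v E)" using E(3) sE by auto
    moreover have "cspan E \<subseteq> cspan F" using E(4) by (intro cspan_subset) auto
    then have "p \<in> cspan (insert w F)" using p mono by auto
    then have "v \<in> cspan (insert w F)" unfolding v_def
      by (intro complex_vector.span_scale complex_vector.span_diff) (auto intro: complex_vector.span_base)
    then have "insert v E \<subseteq> cspan (insert w F)" using E(4) mono by auto
    ultimately show ?thesis using E(1) by (intro exI[of _ "insert v E"]) auto
  qed
qed

text \<open>The best approximation of \<open>a\<close> from \<open>K\<close>, read off from an orthonormal basis of \<open>K\<close>.\<close>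
lemma orthogonal_projection:
  assumes "fin_dim K" "csubspace K"
  shows "\<exists>k\<in>K. \<forall>h\<in>K. ip h (a - k) = 0"
proof -
  obtain B where B: "finite B" "B \<subseteq> K" "\<not> module.dependent scaleC B" "K \<subseteq> cspan B"
    by (rule fin_dim_basis[OF assms(1)])
  obtain E where E: "finite E" "orthonormal E" "B \<subseteq> cspan E" "E \<subseteq> cspan B"
    using gram_schmidt[OF B(1)] by blast
  have EK: "E \<subseteq> K" using E(4) cspan_subset[OF B(2) assms(2)] by blast
  define k where "k = (\<Sum>e\<in>E. ip e a *\<^sub>C e)"
  have "k \<in> K" unfolding k_def using EK
    by (intro complex_vector.subspace_sum[OF assms(2)] complex_vector.subspace_scale[OF assms(2)]) auto
  have e: "ip e (a - k) = 0" if "e \<in> E" for e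
    using orthonormal_expand[OF E(1,2) that, of "\<lambda>f. ip f a"] by (simp add: ip_diff_right k_def)
  have "ip h (a - k) = 0" if "h \<in> K" for h
  proof -
    have "cspan B \<subseteq> cspan E" using E(3) by (intro cspan_subset) auto
    then have "h \<in> cspan E" using that B(4) by auto
    then show ?thesis
      by (induction rule: complex_vector.span_induct_alt) (simp_all add: e ip_add_left ip_scale_left)
  qed
  then show ?thesis using \<open>k \<in> K\<close> by blast
qed

end

section \<open>The Haar form of a CQG Hopf *-algebra\<close>

context hopf_star_algebra
begin

text \<open>This is \<open>a\<^sup>\<dagger>\<close>.\<close>
definition dg :: "'a \<Rightarrow> 'a" where "dg a = star (antipode a)"

lemma star_add: "star (a + b) = star a + star b"
  and star_scale: "star (c *\<^sub>C a) = cnj c *\<^sub>C star a"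
  using antilinear_star by (auto simp: antilinear_def)

lemma star_zero [simp]: "star 0 = 0"
  using star_add[of 0 0] by simp

lemma dg_add: "dg (a + b) = dg a + dg b"
  and dg_scale: "dg (c *\<^sub>C a) = cnj c *\<^sub>C dg a"
  using clinear_antipode by (auto simp: dg_def clinear_iff star_add star_scale)

lemma star_one [simp]: "star 1 = 1"
  by (metis star_star star_mult mult_1_right mult_1_left)

lemma antipode_one [simp]: "antipode 1 = 1"
proof -
  have b: "bal (\<lambda>a b. antipode a * b)"
    using clinear_antipode unfolding clinear_iff
    by (intro balI) (simp_all add: distrib_left distrib_right mult_scaleC_left mult_scaleC_right)
  have "tmap (\<lambda>a b. antipode a * b) (comult 1) = antipode 1 * 1"
    by (simp only: comult_one ts_tmap[OF b] ts_pure[OF b])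
  then show ?thesis using antipode_left[of 1] by (simp add: counit_one scaleC_one)
qed

lemma dg_one [simp]: "dg 1 = 1"
  by (simp add: dg_def)

lemmas mult_simps = distrib_left distrib_right mult_scaleC_left mult_scaleC_right

lemmas lin_simps = star_add star_scale dg_add dg_scale mult_simps
  scaleC_add_right scaleC_add_left scaleC_scaleC

lemma sw_star:
  assumes "bal f"
  shows "ts f (comult (star a)) = ts (\<lambda>b c. f (star b) (star c)) (comult a)"
proof -
  have b: "bal (\<lambda>b c. star b \<otimes> star c)"
    by (rule balI) (simp_all add: star_add star_scale pure_tensor_add_left pure_tensor_add_right
        pure_tensor_scaleC_left pure_tensor_scaleC_right)
  have "ts f (comult (star a)) = ts f (ts (\<lambda>b c. star b \<otimes> star c) (comult a))"
    by (simp only: comult_star ts_tmap[OF b])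
  also have "\<dots> = ts (\<lambda>b c. ts f (star b \<otimes> star c)) (comult a)"
    by (rule ts_hom) (simp_all add: ts_0[OF assms] ts_plus[OF assms])
  finally show ?thesis by (simp only: ts_pure[OF assms])
qed

lemma sw_mult:
  assumes "bal f"
  shows "ts f (comult (a * b)) = ts (\<lambda>a1 a2. ts (\<lambda>b1 b2. f (a1 * b1) (a2 * b2)) (comult b)) (comult a)"
proof -
  note pt = pure_tensor_add_left pure_tensor_add_right pure_tensor_scaleC_left pure_tensor_scaleC_right
  have b1: "bal (\<lambda>b b'. (a * b) \<otimes> (a' * b'))" for a a' :: 'a
    by (rule balI) (simp_all add: mult_simps pt)
  have b2: "bal (\<lambda>(a :: 'a) (a' :: 'a). ts (\<lambda>b b'. (a * b) \<otimes> (a' * b')) t)" for t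
    by (rule balI) (simp_all add: mult_simps pt ts_add_fun)
  have "comult (a * b) = ts (\<lambda>a1 a2. ts (\<lambda>b1 b2. (a1 * b1) \<otimes> (a2 * b2)) (comult b)) (comult a)"
    by (simp only: comult_mult tensor_mult_def ts_tmap[OF b1] ts_tmap[OF b2])
  then have "ts f (comult (a * b)) = ts f \<dots>" by simp
  also have "\<dots> = ts (\<lambda>a1 a2. ts f (ts (\<lambda>b1 b2. (a1 * b1) \<otimes> (a2 * b2)) (comult b))) (comult a)"
    by (rule ts_hom) (simp_all add: ts_0[OF assms] ts_plus[OF assms])
  also have "\<dots> = ts (\<lambda>a1 a2. ts (\<lambda>b1 b2. ts f ((a1 * b1) \<otimes> (a2 * b2))) (comult b)) (comult a)"
  proof -
    have "ts f (ts (\<lambda>b1 b2. (a1 * b1) \<otimes> (a2 * b2)) (comult b)) =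
      ts (\<lambda>b1 b2. ts f ((a1 * b1) \<otimes> (a2 * b2))) (comult b)" for a1 a2
      by (rule ts_hom) (simp_all add: ts_0[OF assms] ts_plus[OF assms])
    then show ?thesis by simp
  qed
  finally show ?thesis by (simp only: ts_pure[OF assms])
qed

text \<open>Together with \<open>dg_cancel_left\<close>, the antipode identities after applying the involution. Through them \<open>\<dagger>\<close> takes over the role
  of the inverse antipode, so that neither invertibility nor antimultiplicativity of the antipode has to be established.\<close>
lemma dg_cancel_right: "ts (\<lambda>a1 a2. dg a2 * star a1) (comult a) = cnj (counit a) *\<^sub>C 1"
proof -
  have b: "bal (\<lambda>a b. a * antipode b)"
    using clinear_antipode unfolding clinear_iff by (intro balI) (simp_all add: mult_simps)
  have "star (ts (\<lambda>a b. a * antipode b) (comult a)) = star (counit a *\<^sub>C 1)"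
    by (simp only: antipode_right ts_tmap[OF b, symmetric])
  moreover have "star (ts (\<lambda>a b. a * antipode b) (comult a)) = ts (\<lambda>a b. star (a * antipode b)) (comult a)"
    by (rule ts_hom) (simp_all add: star_add)
  ultimately show ?thesis by (simp add: star_mult star_scale dg_def)
qed

lemma dg_cancel_left: "ts (\<lambda>a1 a2. star a2 * dg a1) (comult a) = cnj (counit a) *\<^sub>C 1"
proof -
  have b: "bal (\<lambda>a b. antipode a * b)"
    using clinear_antipode unfolding clinear_iff by (intro balI) (simp_all add: mult_simps)
  have "star (ts (\<lambda>a b. antipode a * b) (comult a)) = star (counit a *\<^sub>C 1)"
    by (simp only: antipode_left ts_tmap[OF b, symmetric])
  moreover have "star (ts (\<lambda>a b. antipode a * b) (comult a)) = ts (\<lambda>a b. star (antipode a * b)) (comult a)"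
    by (rule ts_hom) (simp_all add: star_add)
  ultimately show ?thesis by (simp add: star_mult star_scale dg_def)
qed

end

context cqg_hopf_star_algebra
begin

definition Haar :: "'a \<Rightarrow> complex"
  where "Haar = (SOME \<Phi>. clinear \<Phi> \<and>
    (\<forall>a. tmap (\<lambda>b c. \<Phi> c *\<^sub>C b) (comult a) = \<Phi> a *\<^sub>C 1) \<and>
    (\<forall>a. tmap (\<lambda>b c. \<Phi> b *\<^sub>C c) (comult a) = \<Phi> a *\<^sub>C 1) \<and>
    \<Phi> 1 = 1 \<and> (\<forall>a. \<Phi> (star a * a) \<in> \<real>\<^sub>\<ge>\<^sub>0))"

lemma Haar_props: "clinear Haar"
    "tmap (\<lambda>b c. Haar c *\<^sub>C b) (comult a) = Haar a *\<^sub>C 1"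
    "tmap (\<lambda>b c. Haar b *\<^sub>C c) (comult a) = Haar a *\<^sub>C 1"
    "Haar 1 = 1" "Haar (star a * a) \<in> \<real>\<^sub>\<ge>\<^sub>0"
  using someI_ex[OF haar] unfolding Haar_def[symmetric] by blast+

lemma Haar_add: "Haar (a + b) = Haar a + Haar b"
  and Haar_scale: "Haar (c *\<^sub>C a) = c * Haar a"
  using Haar_props(1) by (simp_all add: clinear_iff)

lemma Haar_zero [simp]: "Haar 0 = 0"
  using Haar_add[of 0 0] by simp

lemma Haar_right: "ts (\<lambda>b c. Haar c *\<^sub>C b) (comult a) = Haar a *\<^sub>C 1"
  using Haar_props(2)[of a] by (simp only: ts_tmap[OF bal_slice[OF Haar_props(1)]])

lemma Haar_left: "ts (\<lambda>b c. Haar b *\<^sub>C c) (comult a) = Haar a *\<^sub>C 1"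
  using Haar_props(3)[of a] by (simp only: ts_tmap[OF bal_ract[OF Haar_props(1)]])

text \<open>The inner product defined by the Haar functional.\<close>
definition hip :: "'a \<Rightarrow> 'a \<Rightarrow> complex" where "hip a b = Haar (star a * b)"

lemma hip_add_right: "hip a (b + c) = hip a b + hip a c"
  and hip_add_left: "hip (a + b) c = hip a c + hip b c"
  and hip_scale_right: "hip a (r *\<^sub>C b) = r * hip a b"
  and hip_scale_left: "hip (r *\<^sub>C a) b = cnj r * hip a b"
  by (simp_all add: hip_def lin_simps Haar_add Haar_scale)

lemmas hip_simps = hip_add_right hip_add_left hip_scale_right hip_scale_left

lemma hip_real: "Im (hip a a) = 0" and hip_nonneg: "Re (hip a a) \<ge> 0"
  using Haar_props(5)[of a] by (auto simp: hip_def complex_nonneg_Reals_iff)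

lemma hip_commute: "hip a b = cnj (hip b a)"
proof -
  have "Im (hip a b) + Im (hip b a) = 0"
    using hip_real[of "a + b"] hip_real[of a] hip_real[of b] by (simp add: hip_simps)
  moreover have "Re (hip a b) - Re (hip b a) = 0"
    using hip_real[of "a + \<i> *\<^sub>C b"] hip_real[of a] hip_real[of b] by (simp add: hip_simps)
  ultimately show ?thesis by (simp add: complex_eq_iff)
qed

text \<open>The Cauchy-Schwarz argument for a form that is only known to be positive semidefinite; \<open>t\<close> is chosen so that a nonzero
  \<open>hip a n\<close> would make the form at \<open>a + t (cnj (hip a n)) n\<close> negative.\<close>
lemma hip_null:
  assumes "hip n n = 0"
  shows "hip a n = 0"
proof (rule ccontr)
  assume ne: "hip a n \<noteq> 0"
  (* with this t the form at a + t cnj (hip a n) n has real part - hip a a - 2 *)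
  define t :: real where "t = - (Re (hip a a) + 1) / (norm (hip a n))\<^sup>2"
  let ?r = "complex_of_real t * cnj (hip a n)"
  have "hip (a + ?r *\<^sub>C n) (a + ?r *\<^sub>C n) = hip a a + ?r * hip a n + cnj ?r * hip n a"
    by (simp add: hip_simps assms)
  also have "hip n a = cnj (hip a n)" by (rule hip_commute)
  also have "hip a a + ?r * hip a n + cnj ?r * cnj (hip a n) = hip a a + complex_of_real (2 * t * (norm (hip a n))\<^sup>2)"
    by (simp only: of_real_mult complex_norm_square of_real_numeral complex_cnj_mult complex_cnj_cnj
        complex_cnj_complex_of_real) (simp add: algebra_simps)
  also have "2 * t * (norm (hip a n))\<^sup>2 = - 2 * (Re (hip a a) + 1)"
    using ne by (simp add: t_def field_simps)
  finally have "Re (hip (a + ?r *\<^sub>C n) (a + ?r *\<^sub>C n)) = - Re (hip a a) - 2" by simp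
  then show False using hip_nonneg[of "a + ?r *\<^sub>C n"] hip_nonneg[of a] by simp
qed

text \<open>Strong left invariance. The scalar \<open>\<Phi>(a\<^sub>(\<^sub>1\<^sub>)\<^sup>* b) 1\<close> on the right-hand side is expanded by invariance into
  \<open>\<Phi>(a\<^sub>(\<^sub>1\<^sub>)\<^sup>* b\<^sub>(\<^sub>1\<^sub>)) a\<^sub>(\<^sub>2\<^sub>)\<^sup>* b\<^sub>(\<^sub>2\<^sub>)\<close>; the factor \<open>a\<^sub>(\<^sub>3\<^sub>)\<^sup>\<dagger> a\<^sub>(\<^sub>2\<^sub>)\<^sup>*\<close> then collapses to the counit.\<close>
lemma strong_invariance:
  "ts (\<lambda>b1 b2. hip a b1 *\<^sub>C b2) (comult b) = ts (\<lambda>a1 a2. hip a1 b *\<^sub>C dg a2) (comult a)"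
proof -
  have 1: "hip p b *\<^sub>C 1 = ts (\<lambda>p1 p2. ts (\<lambda>b1 b2. hip p1 b1 *\<^sub>C (star p2 * b2)) (comult b)) (comult p)" for p
  proof -
    have "hip p b *\<^sub>C 1 = ts (\<lambda>c d. Haar c *\<^sub>C d) (comult (star p * b))"
      by (simp add: Haar_left hip_def)
    also have "\<dots> = ts (\<lambda>p1 p2. ts (\<lambda>b1 b2. Haar (p1 * b1) *\<^sub>C (p2 * b2)) (comult b)) (comult (star p))"
      by (rule sw_mult[OF bal_ract[OF Haar_props(1)]])
    also have "\<dots> = ts (\<lambda>p1 p2. ts (\<lambda>b1 b2. Haar (star p1 * b1) *\<^sub>C (star p2 * b2)) (comult b)) (comult p)"
    proof (rule sw_star, rule balI)
      show "ts (\<lambda>b1 b2. Haar ((c *\<^sub>C v) * b1) *\<^sub>C (w * b2)) (comult b) =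
        ts (\<lambda>b1 b2. Haar (v * b1) *\<^sub>C ((c *\<^sub>C w) * b2)) (comult b)" for c v w
        by (simp add: lin_simps Haar_scale mult.commute)
    qed (simp_all add: lin_simps Haar_add ts_add_fun)
    finally show ?thesis by (simp add: hip_def)
  qed
  have "ts (\<lambda>a1 a2. hip a1 b *\<^sub>C dg a2) (comult a) = ts (\<lambda>a1 a2. dg a2 * (hip a1 b *\<^sub>C 1)) (comult a)"
    by (simp add: lin_simps)
  also have "\<dots> = ts (\<lambda>x r. ts (\<lambda>p q. ts (\<lambda>b1 b2. hip p b1 *\<^sub>C (dg r * star q * b2)) (comult b)) (comult x)) (comult a)"
    by (simp only: 1 ts_mult_left mult_scaleC_right mult.assoc)
  also have "\<dots> = ts (\<lambda>p y. ts (\<lambda>q r. ts (\<lambda>b1 b2. hip p b1 *\<^sub>C (dg r * star q * b2)) (comult b)) (comult y)) (comult a)"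
    by (rule sw_coassoc, rule triI) (simp_all add: lin_simps hip_simps ts_add_fun mult_ac)
  also have "\<dots> = ts (\<lambda>p y. ts (\<lambda>b1 b2. hip p b1 *\<^sub>C (ts (\<lambda>q r. dg r * star q) (comult y) * b2)) (comult b)) (comult a)"
    by (subst ts_swap) (simp only: ts_mult_right ts_scale_fun[symmetric])
  also have "\<dots> = ts (\<lambda>p y. ts (\<lambda>b1 b2. (hip p b1 * cnj (counit y)) *\<^sub>C b2) (comult b)) (comult a)"
    by (simp add: dg_cancel_right lin_simps)
  also have "\<dots> = ts (\<lambda>b1 b2. ts (\<lambda>p y. (hip p b1 * cnj (counit y)) *\<^sub>C b2) (comult a)) (comult b)"
    by (rule ts_swap)
  also have "\<dots> = ts (\<lambda>b1 b2. hip a b1 *\<^sub>C b2) (comult b)"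
  proof -
    have "ts (\<lambda>p y. (hip p b1 * cnj (counit y)) *\<^sub>C b2) (comult a) = hip a b1 *\<^sub>C b2" for b1 b2
    proof -
      have "hip (ts (\<lambda>p y. counit y *\<^sub>C p) (comult a)) b1 = ts (\<lambda>p y. hip (counit y *\<^sub>C p) b1) (comult a)"
        by (rule ts_hom[of "\<lambda>z. hip z b1"]) (simp_all add: hip_simps hip_def[of 0])
      moreover have "ts (\<lambda>p y. counit y *\<^sub>C p) (comult a) = a"
        using lact_counit[of a] by (simp add: lact_def)
      ultimately have "hip a b1 = ts (\<lambda>p y. hip p b1 * cnj (counit y)) (comult a)"
        by (simp add: hip_simps mult.commute)
      then show ?thesis by (simp only: ts_scale_left)
    qed
    then have "(\<lambda>b1 b2. ts (\<lambda>p y. (hip p b1 * cnj (counit y)) *\<^sub>C b2) (comult a)) = (\<lambda>b1 b2. hip a b1 *\<^sub>C b2)"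
      by (intro ext)
    then show ?thesis by (rule arg_cong)
  qed
  finally show ?thesis by (rule HOL.sym)
qed

text \<open>By strong invariance the null space of the Haar form is a right coideal: if \<open>n\<close> is null, then so are
  the coefficients of \<open>\<Delta>(n)\<close> along independent second legs.\<close>
lemma null_comult:
  assumes n: "\<And>a. hip a n = 0" and "comult n = (\<Sum>k\<in>K. g k \<otimes> k)" "finite K" "\<not> module.dependent scaleC K" "k \<in> K"
  shows "hip a (g k) = 0"
proof -
  have b: "bal (\<lambda>b1 b2. hip a b1 *\<^sub>C b2)"
    by (rule balI) (simp_all add: hip_simps scale_simps mult.commute)
  have "ts (\<lambda>b1 b2. hip a b1 *\<^sub>C b2) (comult n) = 0"
    unfolding strong_invariance by (simp add: n)
  then have "(\<Sum>k\<in>K. hip a (g k) *\<^sub>C k) = 0"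
    unfolding assms(2) by (simp only: ts_sum[OF b] ts_pure[OF b])
  from complex_vector.independentD[OF assms(4,3) subset_refl this assms(5)] show ?thesis .
qed

lemma null_counit:
  assumes n: "\<And>a. hip a n = 0"
  shows "counit (star n) = 0"
proof -
  obtain K g where K: "finite K" "\<not> module.dependent scaleC K" "comult n = (\<Sum>k\<in>K. g k \<otimes> k)"
    using tensor_basis_right[of "comult n"] by blast
  have b1: "bal (\<lambda>a1 a2. dg a2 * star a1)" by (rule balI) (simp_all add: lin_simps)
  have b2: "bal (\<lambda>a1 a2. Haar (dg (star a2) * a1))" by (rule balI) (simp_all add: lin_simps Haar_add)
  have "cnj (counit (star n)) *\<^sub>C 1 = ts (\<lambda>a1 a2. dg (star a2) * a1) (comult n)"
    unfolding dg_cancel_right[symmetric] by (simp only: sw_star[OF b1] star_star)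
  then have "Haar (cnj (counit (star n)) *\<^sub>C 1) = Haar (ts (\<lambda>a1 a2. dg (star a2) * a1) (comult n))" by simp
  also have "\<dots> = ts (\<lambda>a1 a2. Haar (dg (star a2) * a1)) (comult n)"
    by (rule ts_clinear[OF Haar_props(1)])
  also have "\<dots> = (\<Sum>k\<in>K. Haar (dg (star k) * g k))"
    unfolding K(3) by (simp only: ts_sum[OF b2] ts_pure[OF b2])
  also have "\<dots> = (\<Sum>k\<in>K. hip (star (dg (star k))) (g k))"
    by (simp add: hip_def star_star)
  also have "\<dots> = 0" using null_comult[OF n K(3,1,2)] by simp
  finally show ?thesis by (simp add: Haar_scale Haar_props(4))
qed

text \<open>Faithfulness of the Haar functional. By \<open>dg_cancel_right\<close> the conjugate of \<open>\<epsilon>(n\<^sup>*)\<close> is \<open>\<Phi>(n\<^sub>(\<^sub>2\<^sub>)\<^sup>*\<^sup>\<dagger> n\<^sub>(\<^sub>1\<^sub>))\<close>, which vanishes because the first legs are null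
  (\<open>null_counit\<close>). Since the coefficients of \<open>\<Delta>(n)\<close> are null as well, applying \<open>\<epsilon>\<close> to the first leg of \<open>\<Delta>(n\<^sup>*)\<close> gives \<open>n\<^sup>* = 0\<close>.\<close>
lemma null_zero:
  assumes n: "\<And>a. hip a n = 0"
  shows "n = 0"
proof -
  obtain K g where K: "finite K" "\<not> module.dependent scaleC K" "comult n = (\<Sum>k\<in>K. g k \<otimes> k)"
    using tensor_basis_right[of "comult n"] by blast
  have b: "bal (\<lambda>b c. counit (star b) *\<^sub>C star c)"
    using clinear_counit unfolding clinear_iff by (intro balI) (simp_all add: lin_simps mult_ac)
  have "star n = ts (\<lambda>b c. counit b *\<^sub>C c) (comult (star n))"
    using ract_counit[of "star n"] by (simp add: ract_def)
  also have "\<dots> = ts (\<lambda>b c. counit (star b) *\<^sub>C star c) (comult n)"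
    by (rule sw_star[OF bal_ract[OF clinear_counit]])
  also have "\<dots> = (\<Sum>k\<in>K. counit (star (g k)) *\<^sub>C star k)"
    unfolding K(3) by (simp only: ts_sum[OF b] ts_pure[OF b])
  also have "\<dots> = 0" using null_counit[OF null_comult[OF n K(3,1,2)]] by simp
  finally show ?thesis by (metis star_star star_zero)
qed

sublocale hip: pos_form hip
proof
  fix a :: 'a assume "a \<noteq> 0"
  then have "hip a a \<noteq> 0" using hip_null[of a] null_zero[of a] by auto
  then show "Re (hip a a) > 0" using hip_nonneg[of a] hip_real[of a] by (simp add: complex_eq_iff)
qed (fact hip_simps hip_commute)+

end

section \<open>Doi-Koppinen data of coideal type\<close>

locale dk =
  fixes X :: "('a::complex_algebra_1, 'c::complex_vector) dk_datum"
  assumes datum: "cqg_doi_koppinen_datum X"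
begin

sublocale A: cqg_hopf_star_algebra "star X" "comult X" "counit X" "antipode X"
  using datum by (simp add: cqg_doi_koppinen_datum_def)

sublocale C: dagger_coalgebra "ccomult X" "ccounit X" "cdag X"
  using datum by (simp add: cqg_doi_koppinen_datum_def module_dagger_coalgebra_def)

lemma clinear_act: "clinear (act X a)" and clinear_act_left: "clinear (\<lambda>a. act X a c)"
  and act_one: "act X 1 c = c" and act_mult: "act X (a * b) c = act X a (act X b c)"
  and ccounit_act: "ccounit X (act X a c) = counit X a * ccounit X c"
  using datum unfolding cqg_doi_koppinen_datum_def module_dagger_coalgebra_def by blast+

lemma clinear_proj: "clinear (proj X)" and surj_proj: "surj (proj X)"
  and proj_dg: "proj X (A.dg a) = cdag X (proj X a)" and proj_mult: "proj X (a * b) = act X a (proj X b)"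
  using datum unfolding cqg_doi_koppinen_datum_def adag_def A.dg_def by blast+

lemma act_simps: "act X a (c + d) = act X a c + act X a d" "act X a (r *\<^sub>C c) = r *\<^sub>C act X a c"
  "act X (a + b) c = act X a c + act X b c" "act X (r *\<^sub>C a) c = r *\<^sub>C act X a c"
  using clinear_act[of a] clinear_act_left[of c] by (simp_all add: clinear_iff)

lemma proj_simps: "proj X (a + b) = proj X a + proj X b" "proj X (r *\<^sub>C a) = r *\<^sub>C proj X a"
  using clinear_proj by (simp_all add: clinear_iff)

lemma cdag_simps: "cdag X (c + d) = cdag X c + cdag X d" "cdag X (r *\<^sub>C c) = cnj r *\<^sub>C cdag X c"
  using C.antilinear_dag by (simp_all add: antilinear_def)

lemma cdag_zero [simp]: "cdag X 0 = 0"
  using cdag_simps(2)[of 0 0] by simp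

lemmas tensor_simps = pure_tensor_add_left pure_tensor_add_right pure_tensor_scaleC_left pure_tensor_scaleC_right

lemmas all_simps = A.lin_simps act_simps proj_simps cdag_simps tensor_simps

lemma comult_proj: "ccomult X (proj X a) = ts (\<lambda>a1 a2. proj X a1 \<otimes> proj X a2) (comult X a)"
proof -
  have b: "bal (\<lambda>a1 a2. proj X a1 \<otimes> proj X a2)" by (rule balI) (simp_all add: all_simps)
  have "\<forall>a. ccomult X (proj X a) = tmap (\<lambda>a1 a2. proj X a1 \<otimes> proj X a2) (comult X a)"
    using datum unfolding cqg_doi_koppinen_datum_def by blast
  then show ?thesis by (simp only: ts_tmap[OF b])
qed

lemma sw_proj:
  assumes "bal f"
  shows "ts f (ccomult X (proj X a)) = ts (\<lambda>a1 a2. f (proj X a1) (proj X a2)) (comult X a)"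
proof -
  have "ts f (ccomult X (proj X a)) = ts (\<lambda>a1 a2. ts f (proj X a1 \<otimes> proj X a2)) (comult X a)"
    unfolding comult_proj by (rule ts_hom) (simp_all add: ts_0[OF assms] ts_plus[OF assms])
  then show ?thesis by (simp only: ts_pure[OF assms])
qed

lemma sw_dag:
  assumes "bal f"
  shows "ts f (ccomult X (cdag X c)) = ts (\<lambda>d e. f (cdag X e) (cdag X d)) (ccomult X c)"
proof -
  have b: "bal (\<lambda>d e. cdag X e \<otimes> cdag X d)" by (rule balI) (simp_all add: all_simps)
  have "ts f (ccomult X (cdag X c)) = ts (\<lambda>d e. ts f (cdag X e \<otimes> cdag X d)) (ccomult X c)"
    unfolding C.comult_dag ts_tmap[OF b] by (rule ts_hom) (simp_all add: ts_0[OF assms] ts_plus[OF assms])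
  then show ?thesis by (simp only: ts_pure[OF assms])
qed

lemma full_dual_iff: "x \<in> full_dual X \<longleftrightarrow> clinear x"
  by (simp add: full_dual_def)

lemma dual_mult_conv: "clinear x \<Longrightarrow> clinear y \<Longrightarrow> dual_mult X x y = C.conv x y"
  by (rule ext) (simp add: dual_mult_def C.conv_def ts_tmap[OF bal_mult])

lemma restricted_dual_eq: "restricted_dual X = C.rdual"
proof -
  have "{dual_mult X y (dual_mult X x z) |y z. y \<in> full_dual X \<and> z \<in> full_dual X} =
    {C.conv y (C.conv x z) |y z. clinear y \<and> clinear z}" (is "?L = ?R") if x: "clinear x" for x
  proof -
    have dm: "dual_mult X y (dual_mult X x z) = C.conv y (C.conv x z)" if "clinear y" "clinear z" for y z
      by (simp only: dual_mult_conv[OF x that(2)] dual_mult_conv[OF that(1) C.clinear_conv[OF x that(2)]])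
    show ?thesis
    proof (intro subset_antisym subsetI)
      fix u assume "u \<in> ?L"
      then obtain y z where u: "u = dual_mult X y (dual_mult X x z)" and yz: "clinear y" "clinear z"
        unfolding full_dual_iff by blast
      show "u \<in> ?R" unfolding u dm[OF yz] using yz by blast
    next
      fix u assume "u \<in> ?R"
      then obtain y z where u: "u = C.conv y (C.conv x z)" and yz: "clinear y" "clinear z" by blast
      show "u \<in> ?L" unfolding u dm[OF yz, symmetric] full_dual_iff using yz by blast
    qed
  qed
  then show ?thesis unfolding restricted_dual_def C.rdual_def full_dual_iff
    by (intro Collect_cong conj_cong) simp_all
qed

subsection \<open>The coideal subalgebra\<close>

lemma bal_proj_tensor: "bal (\<lambda>a1 a2. proj X a1 \<otimes> a2)"
  by (rule balI) (simp_all add: all_simps)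

lemma coinv_iff: "a \<in> coinv X \<longleftrightarrow> ts (\<lambda>a1 a2. proj X a1 \<otimes> a2) (comult X a) = proj X 1 \<otimes> a"
  unfolding coinv_def by (simp add: ts_tmap[OF bal_proj_tensor])

lemma sw_coinv:
  assumes "b \<in> coinv X" "bal f"
  shows "ts (\<lambda>b1 b2. f (proj X b1) b2) (comult X b) = f (proj X 1) b"
proof -
  have "ts f (ts (\<lambda>a1 a2. proj X a1 \<otimes> a2) (comult X b)) = ts (\<lambda>a1 a2. ts f (proj X a1 \<otimes> a2)) (comult X b)"
    by (rule ts_hom) (simp_all add: ts_0[OF assms(2)] ts_plus[OF assms(2)])
  then show ?thesis using assms(1) unfolding coinv_iff by (simp add: ts_pure[OF assms(2)])
qed

lemma csubspace_coinv: "csubspace (coinv X)"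
  unfolding csubspace_iff
proof (intro conjI ballI allI)
  show "0 \<in> coinv X"
    by (simp add: coinv_iff clinear_zero[OF A.clinear_comult] ts_0[OF bal_proj_tensor] tensor_zero_right)
next
  fix x y assume "x \<in> coinv X" "y \<in> coinv X"
  then show "x + y \<in> coinv X" by (simp add: coinv_iff A.sw_add[OF bal_proj_tensor] all_simps)
next
  fix c x assume "x \<in> coinv X"
  then show "c *\<^sub>C x \<in> coinv X"
    by (simp add: coinv_iff A.sw_scale[OF bal_proj_tensor] all_simps ts_scale_fun)
qed

lemma one_coinv: "1 \<in> coinv X"
  unfolding coinv_iff A.comult_one by (rule ts_pure[OF bal_proj_tensor])

lemma mult_coinv:
  assumes "a \<in> coinv X" "b \<in> coinv X"
  shows "a * b \<in> coinv X"
proof -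
  have "ts (\<lambda>p q. proj X p \<otimes> q) (comult X (a * b)) =
    ts (\<lambda>a1 a2. ts (\<lambda>b1 b2. proj X (a1 * b1) \<otimes> (a2 * b2)) (comult X b)) (comult X a)"
    by (rule A.sw_mult[OF bal_proj_tensor])
  also have "\<dots> = ts (\<lambda>a1 a2. ts (\<lambda>b1 b2. act X a1 (proj X b1) \<otimes> (a2 * b2)) (comult X b)) (comult X a)"
    by (simp only: proj_mult)
  also have "\<dots> = ts (\<lambda>a1 a2. act X a1 (proj X 1) \<otimes> (a2 * b)) (comult X a)"
  proof -
    have "ts (\<lambda>b1 b2. act X a1 (proj X b1) \<otimes> (a2 * b2)) (comult X b) = act X a1 (proj X 1) \<otimes> (a2 * b)" for a1 a2
      by (rule sw_coinv[OF assms(2), of "\<lambda>c y. act X a1 c \<otimes> (a2 * y)"], rule balI) (simp_all add: all_simps)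
    then show ?thesis by simp
  qed
  also have "\<dots> = ts (\<lambda>a1 a2. proj X a1 \<otimes> (a2 * b)) (comult X a)"
    by (simp add: proj_mult[symmetric])
  also have "\<dots> = proj X 1 \<otimes> (a * b)"
    by (rule sw_coinv[OF assms(1), of "\<lambda>c y. c \<otimes> (y * b)"], rule balI) (simp_all add: all_simps)
  finally show ?thesis unfolding coinv_iff .
qed

text \<open>Starting from \<open>\<pi>(b\<^sub>(\<^sub>1\<^sub>)) \<otimes> b\<^sub>(\<^sub>2\<^sub>) \<otimes> b\<^sub>(\<^sub>3\<^sub>) = \<pi>(1) \<otimes> b\<^sub>(\<^sub>1\<^sub>) \<otimes> b\<^sub>(\<^sub>2\<^sub>)\<close>, apply \<open>\<dagger>\<close> to the first leg and \<open>*\<close> to the others, and let the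
  second leg act on the first. The right-hand side becomes the expression wanted for \<open>b\<^sup>*\<close>, since \<open>\<pi>(1)\<^sup>\<dagger> = \<pi>(1)\<close>; on the left
  \<open>b\<^sub>(\<^sub>2\<^sub>)\<^sup>* b\<^sub>(\<^sub>1\<^sub>)\<^sup>\<dagger>\<close> collapses to the counit.\<close>
lemma star_coinv:
  assumes "b \<in> coinv X"
  shows "star X b \<in> coinv X"
proof -
  let ?f = "\<lambda>p q r. act X (star X q) (cdag X (proj X p)) \<otimes> star X r"
  let ?T = "ts (\<lambda>p y. ts (\<lambda>q r. ?f p q r) (comult X y)) (comult X b)"
  have c1: "cdag X (proj X 1) = proj X 1" using proj_dg[of 1] by simp
  have "?T = ts (\<lambda>q r. act X (star X q) (cdag X (proj X 1)) \<otimes> star X r) (comult X b)"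
  proof (rule sw_coinv[OF assms, of "\<lambda>c y. ts (\<lambda>q r. act X (star X q) (cdag X c) \<otimes> star X r) (comult X y)"])
    have b: "bal (\<lambda>q r. act X (star X q) (cdag X c) \<otimes> star X r)" for c
      by (rule balI) (simp_all add: all_simps)
    show "bal (\<lambda>c y. ts (\<lambda>q r. act X (star X q) (cdag X c) \<otimes> star X r) (comult X y))"
      by (rule balI) (simp_all add: A.sw_add[OF b] A.sw_scale[OF b] all_simps ts_add_fun)
  qed
  also have "\<dots> = ts (\<lambda>q r. proj X (star X q) \<otimes> star X r) (comult X b)"
    by (simp add: c1 proj_mult[symmetric])
  also have "\<dots> = ts (\<lambda>p q. proj X p \<otimes> q) (comult X (star X b))"
    by (rule A.sw_star[OF bal_proj_tensor, symmetric])
  finally have 1: "?T = ts (\<lambda>p q. proj X p \<otimes> q) (comult X (star X b))" .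
  have "?T = ts (\<lambda>x r. ts (\<lambda>p q. ?f p q r) (comult X x)) (comult X b)"
    by (rule A.sw_coassoc[symmetric], rule triI) (simp_all add: all_simps)
  also have "\<dots> = ts (\<lambda>x r. proj X (ts (\<lambda>p q. star X q * A.dg p) (comult X x)) \<otimes> star X r) (comult X b)"
  proof -
    have "ts (\<lambda>p q. ?f p q r) t = proj X (ts (\<lambda>p q. star X q * A.dg p) t) \<otimes> star X r" for t r
    proof -
      have "proj X (ts (\<lambda>p q. star X q * A.dg p) t) \<otimes> star X r = ts (\<lambda>p q. proj X (star X q * A.dg p) \<otimes> star X r) t"
        by (rule ts_hom[of "\<lambda>z. proj X z \<otimes> star X r"]) (simp_all add: all_simps clinear_zero[OF clinear_proj] tensor_zero_left)
      then show ?thesis by (simp add: proj_mult proj_dg)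
    qed
    then show ?thesis by simp
  qed
  also have "\<dots> = ts (\<lambda>x r. proj X 1 \<otimes> star X (counit X x *\<^sub>C r)) (comult X b)"
    by (simp add: A.dg_cancel_left all_simps)
  also have "\<dots> = proj X 1 \<otimes> star X (ts (\<lambda>x r. counit X x *\<^sub>C r) (comult X b))"
    by (rule ts_hom[symmetric, of "\<lambda>z. proj X 1 \<otimes> star X z"]) (simp_all add: all_simps tensor_zero_right)
  also have "\<dots> = proj X 1 \<otimes> star X b"
    using A.ract_counit[of b] by (simp add: A.ract_def)
  finally show ?thesis unfolding coinv_iff using 1 by simp
qed

text \<open>The left legs of \<open>\<Delta>(b)\<close> are again coinvariant, since coinvariance concerns the other side of \<open>b\<close>.\<close>
lemma lact_coinv:
  assumes "b \<in> coinv X" "clinear \<phi>"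
  shows "A.lact \<phi> b \<in> coinv X"
proof -
  note phi = clinear_add[OF assms(2)] clinear_scale[OF assms(2)]
  let ?f = "\<lambda>p q r. \<phi> r *\<^sub>C (proj X p \<otimes> q)"
  have "ts (\<lambda>p q. proj X p \<otimes> q) (comult X (A.lact \<phi> b)) =
    ts (\<lambda>x r. ts (\<lambda>p q. proj X p \<otimes> q) (comult X (\<phi> r *\<^sub>C x))) (comult X b)"
    unfolding A.lact_def
    by (rule ts_hom[of "\<lambda>z. ts (\<lambda>p q. proj X p \<otimes> q) (comult X z)"])
      (simp_all add: A.sw_add[OF bal_proj_tensor] clinear_zero[OF A.clinear_comult] ts_0[OF bal_proj_tensor])
  also have "\<dots> = ts (\<lambda>x r. ts (\<lambda>p q. ?f p q r) (comult X x)) (comult X b)"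
    by (simp add: A.sw_scale[OF bal_proj_tensor] all_simps ts_scale_fun)
  also have "\<dots> = ts (\<lambda>p y. ts (\<lambda>q r. ?f p q r) (comult X y)) (comult X b)"
    by (rule A.sw_coassoc, rule triI) (simp_all add: all_simps phi mult_ac)
  also have "\<dots> = ts (\<lambda>q r. \<phi> r *\<^sub>C (proj X 1 \<otimes> q)) (comult X b)"
  proof (rule sw_coinv[OF assms(1), of "\<lambda>c y. ts (\<lambda>q r. \<phi> r *\<^sub>C (c \<otimes> q)) (comult X y)"])
    have b: "bal (\<lambda>q r. \<phi> r *\<^sub>C (c \<otimes> q))" for c :: 'c
      by (rule balI) (simp_all add: all_simps phi mult_ac)
    show "bal (\<lambda>(c::'c) y. ts (\<lambda>q r. \<phi> r *\<^sub>C (c \<otimes> q)) (comult X y))"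
      by (rule balI) (simp_all add: A.sw_add[OF b] A.sw_scale[OF b] all_simps ts_add_fun)
  qed
  also have "\<dots> = proj X 1 \<otimes> A.lact \<phi> b"
    unfolding A.lact_def
    by (subst ts_hom[of "\<lambda>z. proj X 1 \<otimes> z"]) (simp_all add: all_simps tensor_zero_right)
  finally show ?thesis unfolding coinv_iff .
qed

lemma comult_coinv:
  assumes "b \<in> coinv X"
  shows "\<exists>bs. set bs \<subseteq> coinv X \<times> UNIV \<and> comult X b = psum (\<otimes>) bs"
proof -
  have "comult X b \<in> tensor_span (coinv X) UNIV"
  proof (rule tensor_span_slices[OF csubspace_coinv csubspace_UNIV])
    fix y :: "'a \<Rightarrow> complex" assume "clinear y"
    then show "slice y (comult X b) \<in> coinv X"
      using lact_coinv[OF assms] by (simp add: A.lact_slice)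
    assume "\<And>w. w \<in> UNIV \<Longrightarrow> y w = 0"
    then show "slice y (comult X b) = 0" by (simp add: slice_def)
  qed
  then show ?thesis unfolding tensor_span_psum[OF csubspace_coinv] .
qed

text \<open>Expand \<open>\<Delta>(b) = \<Sum> h(e) \<otimes> e\<close> along an orthonormal family for the Haar form. Invariance of \<open>\<Phi>\<close> at \<open>b\<^sup>* b\<close> reads
  \<open>\<Phi>(b\<^sup>* b) 1 = \<Sum> h(e)\<^sup>* h(f) \<Phi>(e\<^sup>* f)\<close>, which is the sum of squares, and the counit recovers \<open>b\<close> from the \<open>h(e)\<close>.\<close>
lemma coinv_sum_of_squares:
  assumes "b \<in> coinv X"
  shows "\<exists>E h r. finite E \<and> h ` E \<subseteq> coinv X \<and> b = (\<Sum>e\<in>E. counit X e *\<^sub>C h e) \<and>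
    (\<Sum>e\<in>E. star X (h e) * h e) = r *\<^sub>C 1"
proof -
  obtain bs where bs: "set bs \<subseteq> coinv X \<times> UNIV" "comult X b = psum (\<otimes>) bs"
    using comult_coinv[OF assms] by blast
  obtain E where E: "finite E" "A.hip.orthonormal E" "snd ` set bs \<subseteq> cspan E"
    using A.hip.gram_schmidt[OF finite_imageI[OF finite_set], of snd bs] by blast
  have 1: "set bs \<subseteq> UNIV \<times> cspan E" using E(3) by auto
  have 2: "fst ` set bs \<subseteq> coinv X" using bs(1) by auto
  obtain h where h: "comult X b = (\<Sum>e\<in>E. h e \<otimes> e)" "h ` E \<subseteq> coinv X"
    using tensor_indep_right[OF E(1) 1 csubspace_coinv 2] unfolding bs(2) by blast
  have "b = A.lact (counit X) b" by (simp add: A.lact_counit)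
  also have "\<dots> = (\<Sum>e\<in>E. counit X e *\<^sub>C h e)"
    unfolding A.lact_def h(1) by (simp only: ts_sum[OF bal_slice[OF A.clinear_counit]] ts_pure[OF bal_slice[OF A.clinear_counit]])
  finally have b: "b = (\<Sum>e\<in>E. counit X e *\<^sub>C h e)" .
  have bi: "bal (\<lambda>b1 b2. A.Haar (star X a2 * b2) *\<^sub>C (star X a1 * b1))" for a1 a2
    by (rule balI) (simp_all add: all_simps A.Haar_add A.Haar_scale mult.commute)
  have bo: "bal (\<lambda>a1 a2. ts (\<lambda>b1 b2. A.Haar (star X a2 * b2) *\<^sub>C (star X a1 * b1)) t)" for t
    by (rule balI) (simp_all add: all_simps A.Haar_add A.Haar_scale ts_add_fun mult.commute)
  have bq: "bal (\<lambda>(p::'a) (q::'a). ts (\<lambda>b1 b2. A.Haar (q * b2) *\<^sub>C (p * b1)) t)" for t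
    by (rule balI) (simp_all add: all_simps A.Haar_add A.Haar_scale ts_add_fun mult.commute)
  have "A.Haar (star X b * b) *\<^sub>C 1 = ts (\<lambda>p q. A.Haar q *\<^sub>C p) (comult X (star X b * b))"
    by (rule A.Haar_right[symmetric])
  also have "\<dots> = ts (\<lambda>a1 a2. ts (\<lambda>b1 b2. A.Haar (a2 * b2) *\<^sub>C (a1 * b1)) (comult X b)) (comult X (star X b))"
    by (rule A.sw_mult[OF bal_slice[OF A.Haar_props(1)]])
  also have "\<dots> = ts (\<lambda>a1 a2. ts (\<lambda>b1 b2. A.Haar (star X a2 * b2) *\<^sub>C (star X a1 * b1)) (comult X b)) (comult X b)"
    by (rule A.sw_star[OF bq])
  also have "\<dots> = (\<Sum>e\<in>E. \<Sum>f\<in>E. A.Haar (star X e * f) *\<^sub>C (star X (h e) * h f))"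
  proof -
    have o: "ts G (comult X b) = (\<Sum>e\<in>E. G (h e) e)" if "bal G" for G :: "'a \<Rightarrow> 'a \<Rightarrow> 'a"
      unfolding h(1) by (simp only: ts_sum[OF that] ts_pure[OF that])
    show ?thesis by (rule HOL.trans[OF o[OF bo] sum.cong[OF HOL.refl o[OF bi]]])
  qed
  also have "\<dots> = (\<Sum>e\<in>E. \<Sum>f\<in>E. if e = f then star X (h e) * h f else 0)"
    using E(2) by (intro sum.cong) (auto simp: A.hip.orthonormal_def A.hip_def scaleC_one)
  also have "\<dots> = (\<Sum>e\<in>E. star X (h e) * h e)" using E(1) by simp
  finally show ?thesis using E(1) h(2) b by (intro exI[of _ E] exI[of _ h] exI[of _ "A.Haar (star X b * b)"]) simp
qed

subsection \<open>The *-structure of the dual\<close>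

lemma clinear_dual_star: "clinear x \<Longrightarrow> clinear (dual_star X x)"
  unfolding clinear_iff by (simp add: dual_star_def cdag_simps)

lemma dual_star_star: "dual_star X (dual_star X x) = x"
  by (rule ext) (simp add: dual_star_def C.dag_dag)

lemma dual_star_add: "dual_star X (x + y) = dual_star X x + dual_star X y"
  and dual_star_scale: "dual_star X (r *\<^sub>C x) = cnj r *\<^sub>C dual_star X x"
  by (rule ext, simp add: dual_star_def scaleC_fun_def)+

lemma cdag_lact:
  assumes "clinear y"
  shows "C.lact y (cdag X d) = cdag X (C.ract (dual_star X y) d)"
proof -
  have "C.lact y (cdag X d) = ts (\<lambda>d1 d2. y (cdag X d1) *\<^sub>C cdag X d2) (ccomult X d)"
    unfolding C.lact_def by (rule sw_dag[OF bal_slice[OF assms]])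
  moreover have "cdag X (C.ract (dual_star X y) d) = ts (\<lambda>d1 d2. cdag X (dual_star X y d1 *\<^sub>C d2)) (ccomult X d)"
    unfolding C.ract_def by (rule ts_hom) (simp_all add: cdag_simps)
  ultimately show ?thesis by (simp add: cdag_simps dual_star_def)
qed

lemma cdag_ract:
  assumes "clinear y"
  shows "C.ract y (cdag X d) = cdag X (C.lact (dual_star X y) d)"
proof -
  have "cdag X (C.ract y (cdag X d)) = C.lact (dual_star X y) d"
    using cdag_lact[OF clinear_dual_star[OF assms], of "cdag X d"] by (simp add: C.dag_dag dual_star_star)
  then show ?thesis by (metis C.dag_dag)
qed

lemma dual_star_conv:
  assumes "clinear x" "clinear y"
  shows "dual_star X (C.conv x y) = C.conv (dual_star X y) (dual_star X x)"
proof (rule ext)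
  fix c
  have "dual_star X (C.conv x y) c = cnj (x (C.lact y (cdag X c)))"
    by (simp add: dual_star_def C.conv_lact[OF assms(1)])
  also have "\<dots> = dual_star X x (C.ract (dual_star X y) c)"
    by (simp add: cdag_lact[OF assms(2)] dual_star_def)
  finally show "dual_star X (C.conv x y) c = C.conv (dual_star X y) (dual_star X x) c"
    by (simp add: C.conv_ract[OF clinear_dual_star[OF assms(1)]])
qed

lemma fin_dim_dual_star: "fin_dim V \<Longrightarrow> fin_dim (dual_star X ` V)"
proof -
  assume "fin_dim V"
  then obtain F where F: "finite F" "V \<subseteq> cspan F" by (auto simp: fin_dim_def)
  have "dual_star X v \<in> cspan (dual_star X ` F)" if "v \<in> cspan F" for v
    using that
  proof (induction rule: complex_vector.span_induct_alt)
    case base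
    have "dual_star X 0 = 0" using dual_star_scale[of 0 0] by simp
    then show ?case by (simp only: complex_vector.span_zero)
  next
    case (step c x y)
    then show ?case unfolding dual_star_add dual_star_scale
      by (intro complex_vector.span_add complex_vector.span_scale) (auto intro: complex_vector.span_base)
  qed
  then show ?thesis using F unfolding fin_dim_def by (intro exI[of _ "dual_star X ` F"]) auto
qed

lemma rdual_star:
  assumes "x \<in> C.rdual"
  shows "dual_star X x \<in> C.rdual"
proof -
  obtain V where V: "fin_dim V" "csubspace V" "\<And>y z. clinear y \<Longrightarrow> clinear z \<Longrightarrow> C.conv y (C.conv x z) \<in> V"
    by (rule C.rdualE[OF assms]) iprover
  note x = C.rdual_clinear[OF assms]
  show ?thesis
  proof (rule C.rdualI[OF clinear_dual_star[OF x] fin_dim_dual_star[OF V(1)]])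
    fix y z :: "'c \<Rightarrow> complex" assume yz: "clinear y" "clinear z"
    let ?y = "dual_star X y" and ?z = "dual_star X z"
    have l: "clinear ?y" "clinear ?z" using yz by (simp_all add: clinear_dual_star)
    have "C.conv y (C.conv (dual_star X x) z) = dual_star X (C.conv ?z (C.conv x ?y))"
      using yz l x by (simp add: dual_star_conv C.clinear_conv dual_star_star C.conv_assoc clinear_dual_star)
    then show "C.conv y (C.conv (dual_star X x) z) \<in> dual_star X ` V"
      using V(3)[OF l(2,1)] by simp
  qed
qed

subsection \<open>The action of the dual on the Hopf algebra\<close>

abbreviation aact :: "('c \<Rightarrow> complex) \<Rightarrow> 'a \<Rightarrow> 'a"
  where "aact y \<equiv> A.lact (\<lambda>a. y (proj X a))"

lemma clinear_pull: "clinear y \<Longrightarrow> clinear (\<lambda>a. y (proj X a))"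
  unfolding clinear_iff by (simp add: proj_simps)

lemma proj_aact:
  assumes "clinear y"
  shows "proj X (aact y a) = C.lact y (proj X a)"
  unfolding C.lact_def A.lact_def sw_proj[OF bal_slice[OF assms]]
  by (simp add: ts_clinear[OF clinear_proj] proj_simps)

lemma aact_conv:
  assumes "clinear x" "clinear y"
  shows "aact (C.conv x y) a = aact x (aact y a)"
proof -
  have "(\<lambda>a. C.conv x y (proj X a)) = A.conv (\<lambda>a. x (proj X a)) (\<lambda>a. y (proj X a))"
    unfolding C.conv_def A.conv_def sw_proj[OF bal_mult[OF assms]] ..
  then show ?thesis using A.lact_conv[OF clinear_pull[OF assms(1)] clinear_pull[OF assms(2)]] by simp
qed

text \<open>Strong invariance turns \<open>\<Phi>(a\<^sup>* b\<^sub>(\<^sub>1\<^sub>)) x(\<pi>(b\<^sub>(\<^sub>2\<^sub>)))\<close> into \<open>\<Phi>(a\<^sub>(\<^sub>1\<^sub>)\<^sup>* b) x(\<pi>(a\<^sub>(\<^sub>2\<^sub>)\<^sup>\<dagger>))\<close>, and \<open>\<pi>\<close> preserves \<open>\<dagger>\<close>.\<close>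
lemma aact_adjoint:
  assumes "clinear x"
  shows "A.hip a (aact x b) = A.hip (aact (dual_star X x) a) b"
proof -
  note l = clinear_pull[OF assms]
  have "A.hip a (aact x b) = ts (\<lambda>b1 b2. x (proj X b2) * A.hip a b1) (comult X b)"
    unfolding A.lact_def by (subst ts_hom[of "A.hip a"]) (simp_all add: A.hip_simps)
  also have "\<dots> = x (proj X (ts (\<lambda>b1 b2. A.hip a b1 *\<^sub>C b2) (comult X b)))"
    by (simp add: ts_clinear[OF l] clinear_scale[OF l] mult.commute)
  also have "\<dots> = ts (\<lambda>a1 a2. A.hip a1 b * x (proj X (A.dg a2))) (comult X a)"
    by (simp add: A.strong_invariance ts_clinear[OF l] clinear_scale[OF l])
  also have "\<dots> = ts (\<lambda>a1 a2. A.hip (dual_star X x (proj X a2) *\<^sub>C a1) b) (comult X a)"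
    by (simp add: A.hip_simps dual_star_def proj_dg mult.commute)
  also have "\<dots> = A.hip (aact (dual_star X x) a) b"
    unfolding A.lact_def by (rule ts_hom[symmetric, of "\<lambda>z. A.hip z b"]) (simp_all add: A.hip_simps)
  finally show ?thesis .
qed

lemma ann_star:
  assumes "\<And>d. d \<in> D \<Longrightarrow> cdag X d \<in> D" "y \<in> C.ann D"
  shows "dual_star X y \<in> C.ann D"
  using assms by (simp add: C.ann_def clinear_dual_star) (simp add: dual_star_def)

lemma ann_add: "y \<in> C.ann D \<Longrightarrow> z \<in> C.ann D \<Longrightarrow> y + z \<in> C.ann D"
  and ann_scale: "y \<in> C.ann D \<Longrightarrow> r *\<^sub>C y \<in> C.ann D"
  unfolding C.ann_def by (simp_all add: clinear_iff scaleC_fun_def algebra_simps)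

lemma aact_add_left: "aact (x + y) a = aact x a + aact y a"
  by (simp add: A.lact_def ts_add_fun[symmetric] scaleC_add_left)

lemma aact_scale_left: "aact (r *\<^sub>C x) a = r *\<^sub>C aact x a"
  by (simp add: A.lact_def ts_scale_fun[symmetric] scaleC_scaleC scaleC_fun_def)

lemma clinear_aact: "clinear y \<Longrightarrow> clinear (aact y)"
  by (rule A.clinear_lact[OF clinear_pull])

lemma annD: "y \<in> C.ann D \<Longrightarrow> clinear y"
  by (simp add: C.ann_def)

text \<open>Let \<open>L\<close> be the annihilator of \<open>D\<close>, an ideal of the dual. The orthogonal projection of \<open>a\<close> onto the finite-dimensional space \<open>L \<cdot> a\<close>
  has the form \<open>y \<cdot> a\<close>. For \<open>z \<in> L\<close> the vector \<open>z \<cdot> (a - y \<cdot> a)\<close> lies in \<open>L \<cdot> a\<close>, and its norm squared is the inner product of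
  \<open>a - y \<cdot> a\<close> with another vector of \<open>L \<cdot> a\<close>.\<close>
lemma ann_splitting:
  assumes D: "C.stable D"
  shows "\<exists>y\<in>C.ann D. \<forall>z\<in>C.ann D. aact z (a - aact y a) = 0"
proof -
  let ?K = "(\<lambda>y. aact y a) ` C.ann D"
  have 0: "0 \<in> C.ann D" by (simp add: C.ann_def clinear_iff)
  have "csubspace ?K" unfolding csubspace_iff
  proof (intro conjI ballI allI)
    have "aact 0 a = 0" using aact_scale_left[of 0 0 a] by simp
    then show "0 \<in> ?K" using 0 by (intro image_eqI[of _ _ 0]) simp_all
  next
    fix u v assume "u \<in> ?K" "v \<in> ?K"
    then obtain y z where "y \<in> C.ann D" "z \<in> C.ann D" "u = aact y a" "v = aact z a" by blast
    then show "u + v \<in> ?K" by (intro image_eqI[of _ _ "y + z"]) (simp_all only: aact_add_left ann_add)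
  next
    fix c u assume "u \<in> ?K"
    then obtain y where "y \<in> C.ann D" "u = aact y a" by blast
    then show "c *\<^sub>C u \<in> ?K" by (intro image_eqI[of _ _ "c *\<^sub>C y"]) (simp_all only: aact_scale_left ann_scale)
  qed
  moreover have "?K \<subseteq> {A.lact y a | y. clinear y}"
    using clinear_pull annD by blast
  then have "fin_dim ?K" using fin_dim_subset[OF A.fin_dim_lact] by blast
  ultimately obtain k where k: "k \<in> ?K" "\<And>h. h \<in> ?K \<Longrightarrow> A.hip h (a - k) = 0"
    using A.hip.orthogonal_projection[of ?K a] by blast
  obtain y where y: "y \<in> C.ann D" "k = aact y a" using k(1) by blast
  have "aact z (a - k) = 0" if z: "z \<in> C.ann D" for z
  proof -
    have conv: "aact (C.conv u v) a \<in> ?K" if "clinear u" "v \<in> C.ann D" for u v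
      using C.ann_conv(2)[OF D that(2,1)] by blast
    have conv': "aact u (aact v a) \<in> ?K" if "clinear u" "v \<in> C.ann D" for u v
      using conv[OF that] by (simp only: aact_conv[OF that(1) annD[OF that(2)]])
    (* z(a - ya) is the action on a of the element z - zy of the annihilator *)
    let ?w = "z - C.conv z y"
    have w: "?w \<in> C.ann D"
      using ann_add[OF z ann_scale[OF C.ann_conv(1)[OF D z annD[OF y(1)]], of "-1"]] by (simp only: scaleC_minus1 add_uminus_conv_diff)
    have "aact z (a - k) = aact z a - aact z (aact y a)"
      unfolding y(2) by (rule clinear_diff[OF clinear_aact[OF annD[OF z]]])
    also have "\<dots> = aact z a + aact ((-1) *\<^sub>C C.conv z y) a"
      using aact_scale_left[of "-1" "C.conv z y" a]
      by (simp only: scaleC_minus1 aact_conv[OF annD[OF z] annD[OF y(1)]] add_uminus_conv_diff)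
    also have "\<dots> = aact ?w a" by (simp only: aact_add_left[symmetric] scaleC_minus1 add_uminus_conv_diff)
    finally have e: "aact z (a - k) = aact ?w a" .
    have "A.hip (aact z (a - k)) (aact z (a - k)) = A.hip (aact ?w a) (aact z (a - k))" by (simp only: e)
    also have "\<dots> = A.hip (aact (dual_star X z) (aact ?w a)) (a - k)" by (rule aact_adjoint[OF annD[OF z]])
    also have "\<dots> = 0" by (intro k(2) conv' clinear_dual_star annD[OF z] w)
    finally show ?thesis by (rule A.hip.ip_eq_zero)
  qed
  then show ?thesis using y by blast
qed

text \<open>The complement of \<open>D\<close>: in the cosemisimple case, the sum of the simple subcoalgebras not contained in \<open>D\<close>.\<close>
definition ann_range :: "'c set \<Rightarrow> 'c set"
  where "ann_range D = cspan {C.lact y c | y c. y \<in> C.ann D}"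

lemma ann_range_sum:
  assumes D: "C.stable D"
  shows "\<exists>d\<in>D. c - d \<in> ann_range D"
proof -
  obtain a where a: "c = proj X a" using surj_proj by blast
  obtain y where y: "y \<in> C.ann D" "\<And>z. z \<in> C.ann D \<Longrightarrow> aact z (a - aact y a) = 0"
    using ann_splitting[OF D] by blast
  let ?d = "proj X (a - aact y a)"
  have "?d \<in> D"
  proof (rule C.lact_ann_mem)
    show "csubspace D" using D by (simp add: C.stable_def)
    fix z assume z: "z \<in> C.ann D"
    have "C.lact z ?d = proj X (aact z (a - aact y a))" by (simp only: proj_aact[OF annD[OF z]])
    then show "C.lact z ?d = 0" by (simp only: y(2)[OF z] clinear_zero[OF clinear_proj])
  qed
  moreover have "c - ?d = C.lact y c"
    by (simp add: a clinear_diff[OF clinear_proj] proj_aact[OF annD[OF y(1)]])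
  then have "c - ?d \<in> ann_range D" unfolding ann_range_def
    using y(1) by (auto intro: complex_vector.span_base)
  ultimately show ?thesis by blast
qed

text \<open>Lift \<open>w\<close> to a vector \<open>u\<close> in the span of \<open>L \<cdot> A\<close>, where \<open>L\<close> is the annihilator of \<open>D\<close>, and take \<open>y \<in> L\<close> as in \<open>ann_splitting\<close>. As \<open>D\<close> is
  closed under \<open>\<dagger>\<close>, \<open>L\<close> is closed under \<open>*\<close>, so \<open>u - y \<cdot> u\<close> is orthogonal to \<open>L \<cdot> A\<close>, of whose span it is an element. Hence
  \<open>u = y \<cdot> u\<close>, and \<open>w = y \<cdot> w = 0\<close> because \<open>y\<close> kills \<open>D\<close>.\<close>
lemma ann_range_disjoint:
  assumes D: "C.stable D" and dag: "\<And>d. d \<in> D \<Longrightarrow> cdag X d \<in> D"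
    and w: "w \<in> D" "w \<in> ann_range D"
  shows "w = 0"
proof -
  let ?U = "cspan {aact y a | y a. y \<in> C.ann D}"
  have "\<exists>u\<in>?U. w = proj X u"
    using w(2) unfolding ann_range_def
  proof (induction rule: complex_vector.span_induct_alt)
    case base
    show ?case by (rule bexI[of _ 0]) (simp_all add: clinear_zero[OF clinear_proj] complex_vector.span_zero)
  next
    case (step r x v)
    then obtain u y c where u: "u \<in> ?U" "v = proj X u" and y: "y \<in> C.ann D" "x = C.lact y c" by blast
    obtain a where a: "c = proj X a" using surj_proj by blast
    have "aact y a \<in> ?U" using y(1) by (intro complex_vector.span_base) blast
    then have "r *\<^sub>C aact y a + u \<in> ?U" using u(1) by (intro complex_vector.span_add complex_vector.span_scale)
    moreover have "r *\<^sub>C x + v = proj X (r *\<^sub>C aact y a + u)"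
      by (simp only: proj_simps proj_aact[OF annD[OF y(1)]] u(2) y(2) a)
    ultimately show ?case by blast
  qed
  then obtain u where u: "u \<in> ?U" "w = proj X u" by blast
  obtain y where y: "y \<in> C.ann D" "\<And>z. z \<in> C.ann D \<Longrightarrow> aact z (u - aact y u) = 0"
    using ann_splitting[OF D] by blast
  have orth: "A.hip v (u - aact y u) = 0" if "v \<in> ?U" for v
    using that
  proof (induction rule: complex_vector.span_induct_alt)
    case base show ?case by simp
  next
    case (step r x v)
    then obtain z a where z: "z \<in> C.ann D" "x = aact z a" by blast
    have "A.hip x (u - aact y u) = A.hip a (aact (dual_star X z) (u - aact y u))"
      unfolding z(2) using aact_adjoint[OF clinear_dual_star[OF annD[OF z(1)]]] by (simp only: dual_star_star)
    also have "\<dots> = 0" by (simp only: y(2)[OF ann_star[OF dag z(1)]] A.hip.ip_zero_right)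
    finally show ?case using step(2) by (simp add: A.hip_simps)
  qed
  have "aact y u \<in> ?U" using y(1) by (intro complex_vector.span_base) blast
  then have "u - aact y u \<in> ?U" using u(1) by (intro complex_vector.span_diff)
  then have "u - aact y u = 0" by (intro A.hip.ip_eq_zero orth)
  then have "u = aact y u" by simp
  then have "w = C.lact y w" using proj_aact[OF annD[OF y(1)], of u] u(2) by simp
  then show "w = 0" using C.lact_ann[OF D y(1) w(1)] by simp
qed

lemma ann_range_lact:
  assumes D: "C.stable D" and "v \<in> ann_range D" "clinear z"
  shows "C.lact z v \<in> ann_range D" "C.ract z v \<in> ann_range D"
proof -
  have "C.stable (ann_range D)"
    unfolding ann_range_def
  proof (rule C.cspan_stableI)
    fix u :: "'c \<Rightarrow> complex" and s assume u: "clinear u" and "s \<in> {C.lact y c | y c. y \<in> C.ann D}"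
    then obtain y c where s: "s = C.lact y c" "y \<in> C.ann D" by blast
    have "C.lact u s = C.lact (C.conv u y) c" unfolding s(1) by (rule C.lact_conv[OF u annD[OF s(2)], symmetric])
    moreover have "C.ract u s = C.lact y (C.ract u c)" unfolding s(1) by (rule C.lact_ract[OF u annD[OF s(2)], symmetric])
    ultimately show "C.lact u s \<in> cspan {C.lact y c | y c. y \<in> C.ann D} \<and> C.ract u s \<in> cspan {C.lact y c | y c. y \<in> C.ann D}"
      using C.ann_conv(2)[OF D s(2) u] s(2) by (auto intro!: complex_vector.span_base)
  qed
  then show "C.lact z v \<in> ann_range D" "C.ract z v \<in> ann_range D"
    using assms(2,3) unfolding C.stable_def by blast+
qed

lemma dag_closed_stable:
  assumes "fin_dim V"
  shows "\<exists>D. C.stable D \<and> fin_dim D \<and> V \<subseteq> D \<and> (\<forall>d\<in>D. cdag X d \<in> D)"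
proof -
  obtain E where E: "C.stable E" "fin_dim E" "V \<subseteq> E" using C.fin_dim_stable[OF assms] by blast
  obtain F where F: "finite F" "E \<subseteq> cspan F" using E(2) by (auto simp: fin_dim_def)
  have cd: "cdag X v \<in> cspan (cdag X ` S)" if "v \<in> cspan S" for v S
    using that
    by (induction rule: complex_vector.span_induct_alt)
      (auto simp: cdag_simps complex_vector.span_zero intro!: complex_vector.span_add complex_vector.span_scale intro: complex_vector.span_base)
  have "fin_dim (cdag X ` E)" unfolding fin_dim_def
    using cd F by (intro exI[of _ "cdag X ` F"]) auto
  then have fin: "fin_dim (cspan (E \<union> cdag X ` E))" using E(2) by (intro fin_dim_cspan fin_dim_union)
  have "C.stable (cspan (E \<union> cdag X ` E))"
  proof (rule C.cspan_stableI)
    fix y :: "'c \<Rightarrow> complex" and s assume y: "clinear y" and s: "s \<in> E \<union> cdag X ` E"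
    have "C.lact y s \<in> E \<union> cdag X ` E \<and> C.ract y s \<in> E \<union> cdag X ` E"
    proof (cases "s \<in> E")
      case True then show ?thesis using E(1) y by (simp add: C.stable_def)
    next
      case False
      then obtain d where d: "s = cdag X d" "d \<in> E" using s by blast
      show ?thesis unfolding d(1) cdag_lact[OF y] cdag_ract[OF y]
        using E(1) d(2) clinear_dual_star[OF y] by (simp add: C.stable_def)
    qed
    then show "C.lact y s \<in> cspan (E \<union> cdag X ` E) \<and> C.ract y s \<in> cspan (E \<union> cdag X ` E)"
      by (auto intro: complex_vector.span_base)
  qed
  moreover have "cdag X d \<in> cspan (E \<union> cdag X ` E)" if "d \<in> cspan (E \<union> cdag X ` E)" for d
  proof -
    have "cdag X ` (E \<union> cdag X ` E) = E \<union> cdag X ` E"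
      by (simp add: image_Un image_image C.dag_dag Un_commute)
    then show ?thesis using cd[OF that] by simp
  qed
  moreover have "V \<subseteq> cspan (E \<union> cdag X ` E)" using E(3) by (auto intro: complex_vector.span_base)
  ultimately show ?thesis using fin by blast
qed

text \<open>On the decomposition of the coalgebra into \<open>D\<close> and \<open>ann_range D\<close>, let \<open>e\<close> be the counit on the first and \<open>0\<close> on the second
  summand. Both summands are subbimodules, so the ideal of \<open>e\<close> consists of functionals vanishing on the second one, and
  these are determined by their values on the finite-dimensional \<open>D\<close>.\<close>
lemma local_unit:
  assumes "fin_dim V"
  shows "\<exists>D e. C.stable D \<and> fin_dim D \<and> V \<subseteq> D \<and> e \<in> C.rdual \<and> (\<forall>d\<in>D. e d = ccounit X d)"
proof -
  obtain D where D: "C.stable D" "fin_dim D" "V \<subseteq> D" and dag: "\<And>d. d \<in> D \<Longrightarrow> cdag X d \<in> D"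
    using dag_closed_stable[OF assms] by blast
  have sD: "csubspace D" using D(1) by (simp add: C.stable_def)
  have sR: "csubspace (ann_range D)" by (simp add: ann_range_def)
  (* the projection onto D along ann_range D *)
  define P where "P c = (SOME d. d \<in> D \<and> c - d \<in> ann_range D)" for c
  have P: "P c \<in> D" "c - P c \<in> ann_range D" for c
    using someI_ex[of "\<lambda>d. d \<in> D \<and> c - d \<in> ann_range D"] ann_range_sum[OF D(1), of c] unfolding P_def by blast+
  have PI: "P c = d" if "d \<in> D" "c - d \<in> ann_range D" for c d
  proof -
    have "(c - d) - (c - P c) \<in> ann_range D" by (rule csubspaceD(4)[OF sR that(2) P(2)])
    then have "P c - d \<in> ann_range D" by simp
    then have "P c - d = 0"
      using ann_range_disjoint[OF D(1) dag] csubspaceD(4)[OF sD P(1) that(1)] by blast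
    then show ?thesis by simp
  qed
  have linP: "clinear P" unfolding clinear_iff
  proof (intro conjI allI)
    fix x y show "P (x + y) = P x + P y"
      using csubspaceD(2)[OF sD P(1) P(1)] csubspaceD(2)[OF sR P(2)[of x] P(2)[of y]]
      by (intro PI) (simp_all add: algebra_simps)
    fix c show "P (c *\<^sub>C x) = c *\<^sub>C P x"
      using csubspaceD(3)[OF sD P(1)] csubspaceD(3)[OF sR P(2)[of x], of c]
      by (intro PI) (simp_all add: scale_simps)
  qed
  define e where "e c = ccounit X (P c)" for c
  have Pd: "P d = d" if "d \<in> D" for d using that by (intro PI) (simp_all add: csubspaceD[OF sR])
  have P0: "P c = 0" if "c \<in> ann_range D" for c using that by (intro PI) (simp_all add: csubspaceD[OF sD])
  have line: "clinear e" using linP C.clinear_counit unfolding clinear_iff e_def by simp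
  obtain B where B: "finite B" "B \<subseteq> D" "\<not> module.dependent scaleC B" "D \<subseteq> cspan B"
    by (rule fin_dim_basis[OF D(2)])
  obtain \<psi> :: "'c \<Rightarrow> 'c \<Rightarrow> complex" where \<psi>: "\<And>k. clinear (\<psi> k)" "\<And>k l. l \<in> B \<Longrightarrow> \<psi> k l = (if l = k then 1 else 0)"
    using basis_functionals[OF B(3)] by blast
  have expand: "d = (\<Sum>k\<in>B. \<psi> k d *\<^sub>C k)" if "d \<in> D" for d
  proof -
    have "d \<in> cspan B" using that B(4) by blast
    then obtain r where r: "d = (\<Sum>k\<in>B. r k *\<^sub>C k)" by (rule cspan_finite_sum[OF B(1)])
    have "\<psi> k d = r k" if "k \<in> B" for k
    proof -
      have "\<psi> k d = (\<Sum>l\<in>B. r l * \<psi> k l)"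
        by (simp add: r clinear_sum[OF \<psi>(1)] clinear_scale[OF \<psi>(1)])
      also have "\<dots> = (\<Sum>l\<in>B. if l = k then r l else 0)" by (rule sum.cong) (simp_all add: \<psi>(2))
      finally show ?thesis using B(1) that by simp
    qed
    then show ?thesis using r by simp
  qed
  have "e \<in> C.rdual"
  proof (rule C.rdualI[OF line])
    show "fin_dim (cspan ((\<lambda>k c. \<psi> k (P c)) ` B))" using B(1) by (intro fin_dim_finite_cspan finite_imageI)
    fix y z :: "'c \<Rightarrow> complex" assume yz: "clinear y" "clinear z"
    define f where "f = C.conv y (C.conv e z)"
    have linf: "clinear f" using yz line by (simp add: f_def C.clinear_conv)
    have fe: "f c = e (C.lact z (C.ract y c))" for c
      unfolding f_def C.conv_ract[OF C.clinear_conv[OF line yz(2)]] C.conv_lact[OF line] ..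
    have f0: "f c = 0" if "c \<in> ann_range D" for c
      unfolding fe e_def using ann_range_lact[OF D(1) ann_range_lact(2)[OF D(1) that yz(1)] yz(2)]
      by (simp add: P0 clinear_zero[OF C.clinear_counit])
    have "f c = (\<Sum>k\<in>B. f k *\<^sub>C (\<lambda>c. \<psi> k (P c))) c" for c
    proof -
      have "f c = f (P c) + f (c - P c)" using clinear_add[OF linf, of "P c" "c - P c"] by simp
      also have "\<dots> = f (P c)" by (simp add: f0[OF P(2)])
      also have "\<dots> = f (\<Sum>k\<in>B. \<psi> k (P c) *\<^sub>C k)" using expand[OF P(1)] by simp
      also have "\<dots> = (\<Sum>k\<in>B. f k * \<psi> k (P c))" by (simp add: clinear_sum[OF linf] clinear_scale[OF linf] mult.commute)
      also have "\<dots> = (\<Sum>k\<in>B. f k *\<^sub>C (\<lambda>c. \<psi> k (P c))) c"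
      proof -
        have "(\<Sum>k\<in>S. g k) c = (\<Sum>k\<in>S. g k c)" for S and g :: "'c \<Rightarrow> 'c \<Rightarrow> complex"
          by (induction S rule: infinite_finite_induct) simp_all
        then show ?thesis by (simp add: scaleC_fun_def)
      qed
      finally show ?thesis .
    qed
    then have "f = (\<Sum>k\<in>B. f k *\<^sub>C (\<lambda>c. \<psi> k (P c)))" by (rule ext)
    moreover have "\<dots> \<in> cspan ((\<lambda>k c. \<psi> k (P c)) ` B)"
      by (intro complex_vector.span_sum complex_vector.span_scale complex_vector.span_base imageI)
    ultimately show "C.conv y (C.conv e z) \<in> cspan ((\<lambda>k c. \<psi> k (P c)) ` B)"
      unfolding f_def[symmetric] by simp
  qed
  moreover have "\<forall>d\<in>D. e d = ccounit X d" by (simp add: e_def Pd)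
  ultimately show ?thesis using D by blast
qed

lemma local_unit_lact:
  assumes D: "C.stable D" and "clinear e" "\<And>d. d \<in> D \<Longrightarrow> e d = ccounit X d" "d \<in> D"
  shows "C.lact e d = d"
proof -
  have "e - ccounit X \<in> C.ann D"
    using assms(2,3) C.clinear_counit unfolding C.ann_def by (simp add: clinear_iff algebra_simps)
  from C.lact_ann[OF D this assms(4)] have "C.lact ((e - ccounit X) + ccounit X) d = C.lact (ccounit X) d"
    unfolding C.lact_add by simp
  then show ?thesis by (simp add: C.lact_counit)
qed

lemma local_unit_conv:
  assumes "C.stable D" "clinear e" "\<And>d. d \<in> D \<Longrightarrow> e d = ccounit X d" "d \<in> D" "clinear y"
  shows "C.conv y e d = y d"
  by (simp only: C.conv_lact[OF assms(5)] local_unit_lact[OF assms(1-4)])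

lemma dual_act_clinear: "clinear x \<Longrightarrow> clinear (dual_act X x a)"
  unfolding clinear_iff by (simp add: dual_act_def act_simps)

text \<open>Prepares \<open>e b x = b\<^sub>(\<^sub>0\<^sub>) (e \<lhd> b\<^sub>(\<^sub>1\<^sub>)) x = b x\<close>: the value of \<open>(e \<lhd> a) x\<close> at \<open>c\<close> is \<open>e(a (x \<cdot> c))\<close>, and by \<open>rdual_range\<close> only finitely many
  dimensions of arguments occur, so that \<open>e\<close> may be taken to be a local unit for them.\<close>
lemma local_unit_product:
  assumes "finite S" "snd ` S \<subseteq> C.rdual"
  shows "\<exists>e\<in>C.rdual. \<forall>(a, x)\<in>S. C.conv (dual_act X e a) x = counit X a *\<^sub>C x"
proof -
  have "\<forall>x\<in>C.rdual. \<exists>E. fin_dim E \<and> (\<forall>c. C.lact x c \<in> E)"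
    using C.rdual_range by blast
  then obtain E where E: "\<And>x. x \<in> C.rdual \<Longrightarrow> fin_dim (E x)" "\<And>x c. x \<in> C.rdual \<Longrightarrow> C.lact x c \<in> E x"
    by metis
  have "fin_dim (\<Union>p\<in>S. act X (fst p) ` E (snd p))"
    using assms(2) by (intro fin_dim_UN[OF assms(1)] fin_dim_image[OF clinear_act E(1)]) auto
  from local_unit[OF this] obtain D e where e: "C.stable D" "(\<Union>p\<in>S. act X (fst p) ` E (snd p)) \<subseteq> D" "e \<in> C.rdual"
    "\<And>d. d \<in> D \<Longrightarrow> e d = ccounit X d" by blast
  have "C.conv (dual_act X e a) x c = (counit X a *\<^sub>C x) c" if p: "(a, x) \<in> S" for a x c
  proof -
    have x: "x \<in> C.rdual" using p assms(2) by force
    have "act X a (C.lact x c) \<in> act X (fst (a, x)) ` E (snd (a, x))" using E(2)[OF x] by simp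
    then have "act X a (C.lact x c) \<in> D" using e(2) p by blast
    then have "C.conv (dual_act X e a) x c = ccounit X (act X a (C.lact x c))"
      unfolding C.conv_lact[OF dual_act_clinear[OF C.rdual_clinear[OF e(3)]]] by (simp add: dual_act_def e(4))
    also have "\<dots> = counit X a * C.conv (ccounit X) x c"
      by (simp add: ccounit_act C.conv_lact[OF C.clinear_counit])
    finally show ?thesis
      by (simp add: C.conv_counit_left[OF C.rdual_clinear[OF x]] scaleC_fun_def)
  qed
  then show ?thesis using e(3) by (intro bexI[of _ e]) auto
qed

end

section \<open>Calculations in the double\<close>

lemma tclass_eq_iff: "tclass R s = tclass R t \<longleftrightarrow> star_cong R s t"
proof
  assume "tclass R s = tclass R t"
  then have "t \<in> tclass R s" by (simp add: tclass_def star_cong.refl)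
  then show "star_cong R s t" by (simp add: tclass_def)
next
  assume h: "star_cong R s t"
  have "star_cong R s x \<longleftrightarrow> star_cong R t x" for x
  proof
    assume "star_cong R s x" then show "star_cong R t x" by (rule star_cong.trans[OF star_cong.sym[OF h]])
  next
    assume "star_cong R t x" then show "star_cong R s x" by (rule star_cong.trans[OF h])
  qed
  then show "tclass R s = tclass R t" by (simp add: tclass_def)
qed

lemma tclass_self: "s \<in> tclass R s"
  by (simp add: tclass_def star_cong.refl)

lemma tclass_UN:
  assumes "\<And>s'. star_cong R s s' \<Longrightarrow> f s' = f s"
  shows "(\<Union>s'\<in>tclass R s. f s') = f s"
proof (intro subset_antisym subsetI)
  fix x assume "x \<in> (\<Union>s'\<in>tclass R s. f s')"
  then obtain s' where "star_cong R s s'" "x \<in> f s'" by (auto simp: tclass_def)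
  then show "x \<in> f s" using assms by simp
next
  fix x assume "x \<in> f s"
  then show "x \<in> (\<Union>s'\<in>tclass R s. f s')" using tclass_self[of s R] by (rule UN_I[rotated])
qed

lemma presented_ops:
  "sa_add (presented_star_alg G R) (tclass R s) (tclass R t) = tclass R (TAdd s t)"
  "sa_scale (presented_star_alg G R) c (tclass R s) = tclass R (TScale c s)"
  "sa_mult (presented_star_alg G R) (tclass R s) (tclass R t) = tclass R (TMult s t)"
  "sa_star (presented_star_alg G R) (tclass R s) = tclass R (TStar s)"
proof -
  have 1: "(\<Union>t'\<in>tclass R t. tclass R (TAdd s' t')) = tclass R (TAdd s' t)" for s'
    by (rule tclass_UN) (simp only: tclass_eq_iff star_cong.cong_add[OF star_cong.refl star_cong.sym])
  have "(\<Union>s'\<in>tclass R s. tclass R (TAdd s' t)) = tclass R (TAdd s t)"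
    by (rule tclass_UN) (simp only: tclass_eq_iff star_cong.cong_add[OF star_cong.sym star_cong.refl])
  then show "sa_add (presented_star_alg G R) (tclass R s) (tclass R t) = tclass R (TAdd s t)"
    unfolding presented_star_alg_def star_alg.simps 1 .
  show "sa_scale (presented_star_alg G R) c (tclass R s) = tclass R (TScale c s)"
    unfolding presented_star_alg_def star_alg.simps
    by (subst tclass_UN) (auto simp: tclass_eq_iff intro: star_cong.cong_scale star_cong.sym)
  have 1: "(\<Union>t'\<in>tclass R t. tclass R (TMult s' t')) = tclass R (TMult s' t)" for s'
    by (rule tclass_UN) (simp only: tclass_eq_iff star_cong.cong_mult[OF star_cong.refl star_cong.sym])
  have "(\<Union>s'\<in>tclass R s. tclass R (TMult s' t)) = tclass R (TMult s t)"
    by (rule tclass_UN) (simp only: tclass_eq_iff star_cong.cong_mult[OF star_cong.sym star_cong.refl])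
  then show "sa_mult (presented_star_alg G R) (tclass R s) (tclass R t) = tclass R (TMult s t)"
    unfolding presented_star_alg_def star_alg.simps 1 .
  show "sa_star (presented_star_alg G R) (tclass R s) = tclass R (TStar s)"
    unfolding presented_star_alg_def star_alg.simps
    by (subst tclass_UN) (auto simp: tclass_eq_iff intro: star_cong.cong_star star_cong.sym)
qed

text \<open>The term analogue of \<open>psum\<close>.\<close>
definition tps :: "('x \<Rightarrow> 'y \<Rightarrow> 'g star_term) \<Rightarrow> ('x \<times> 'y) list \<Rightarrow> 'g star_term"
  where "tps f xs = tsum (map (\<lambda>(a, b). f a b) xs)"

lemma tps_simps [simp]: "tps f [] = TZero" "tps f ((a, b) # xs) = TAdd (f a b) (tps f xs)"
  by (simp_all add: tps_def tsum_def)

lemma tps_Cons: "tps f (p # xs) = TAdd (f (fst p) (snd p)) (tps f xs)"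
  by (cases p) simp

context dk
begin

abbreviation I where "I \<equiv> C.rdual"
abbreviation B where "B \<equiv> coinv X"

abbreviation teq :: "('a + ('c \<Rightarrow> complex)) star_term \<Rightarrow> ('a + ('c \<Rightarrow> complex)) star_term \<Rightarrow> bool" (infix "\<simeq>" 50)
  where "s \<simeq> t \<equiv> star_cong (double_rels X) s t"

lemmas teq_refl = star_cong.refl[where R = "double_rels X"]
lemmas teq_sym = star_cong.sym[where R = "double_rels X"]
lemmas teq_trans [trans] = star_cong.trans[where R = "double_rels X"]
lemmas teq_rel = star_cong.rel[where R = "double_rels X"]
lemmas add_cong = star_cong.cong_add[where R = "double_rels X"]
lemmas scale_cong = star_cong.cong_scale[where R = "double_rels X"]
lemmas mult_cong = star_cong.cong_mult[where R = "double_rels X"]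
lemmas star_cong' = star_cong.cong_star[where R = "double_rels X"]
lemmas mult_congL = mult_cong[OF _ teq_refl] and mult_congR = mult_cong[OF teq_refl]
lemmas teq_mult_assoc = star_cong.mult_assoc[where R = "double_rels X"]
lemmas teq_mult_assoc' = teq_sym[OF teq_mult_assoc]

abbreviation bx :: "'a \<Rightarrow> ('c \<Rightarrow> complex) \<Rightarrow> ('a + ('c \<Rightarrow> complex)) star_term"
  where "bx b x \<equiv> TMult (genB b) (genI x)"

text \<open>The terms that represent elements of the double. The calculation takes place on terms modulo the congruence, not on
  their classes.\<close>
definition DT :: "('a + ('c \<Rightarrow> complex)) star_term set"
  where "DT = {t. \<exists>bxs. set bxs \<subseteq> B \<times> I \<and> t \<simeq> tps bx bxs}"

lemma double_carrier: "sa_carrier (double X) = tclass (double_rels X) ` DT"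
proof -
  have "sa_carrier (double X) = {tclass (double_rels X) (tps bx bxs) | bxs. set bxs \<subseteq> B \<times> I}"
    by (simp add: double_def tps_def restricted_dual_eq)
  also have "\<dots> = tclass (double_rels X) ` DT"
  proof (intro subset_antisym subsetI)
    fix u assume "u \<in> {tclass (double_rels X) (tps bx bxs) | bxs. set bxs \<subseteq> B \<times> I}"
    then obtain bxs where "u = tclass (double_rels X) (tps bx bxs)" "set bxs \<subseteq> B \<times> I" by blast
    moreover from this(2) have "tps bx bxs \<in> DT" unfolding DT_def using teq_refl by blast
    ultimately show "u \<in> tclass (double_rels X) ` DT" by blast
  next
    fix u assume "u \<in> tclass (double_rels X) ` DT"
    then obtain t bxs where "u = tclass (double_rels X) t" "set bxs \<subseteq> B \<times> I" "t \<simeq> tps bx bxs"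
      unfolding DT_def by blast
    then show "u \<in> {tclass (double_rels X) (tps bx bxs) | bxs. set bxs \<subseteq> B \<times> I}"
      using tclass_eq_iff[of "double_rels X" t] by blast
  qed
  finally show ?thesis .
qed

lemma double_ops:
  "sa_add (double X) (tclass (double_rels X) s) (tclass (double_rels X) t) = tclass (double_rels X) (TAdd s t)"
  "sa_scale (double X) c (tclass (double_rels X) s) = tclass (double_rels X) (TScale c s)"
  "sa_mult (double X) (tclass (double_rels X) s) (tclass (double_rels X) t) = tclass (double_rels X) (TMult s t)"
  "sa_star (double X) (tclass (double_rels X) s) = tclass (double_rels X) (TStar s)"
  unfolding double_def full_double_def by (simp_all add: presented_ops)

lemma DT_cong: "s \<simeq> t \<Longrightarrow> t \<in> DT \<Longrightarrow> s \<in> DT"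
  unfolding DT_def using teq_trans by blast

lemma DT_zero: "TZero \<in> DT"
  unfolding DT_def by (intro CollectI exI[of _ "[]"]) (simp add: teq_refl)

lemma tps_append: "tps f (xs @ ys) \<simeq> TAdd (tps f xs) (tps f ys)"
proof (induction xs)
  case Nil
  show ?case by simp (rule teq_sym[OF star_cong.add_zero])
next
  case (Cons p xs)
  have "tps f ((p # xs) @ ys) \<simeq> TAdd (f (fst p) (snd p)) (TAdd (tps f xs) (tps f ys))"
    by (simp add: tps_Cons add_cong[OF teq_refl Cons])
  also have "\<dots> \<simeq> TAdd (tps f (p # xs)) (tps f ys)"
    unfolding tps_Cons by (rule teq_sym[OF star_cong.add_assoc])
  finally show ?case .
qed

lemma DT_add:
  assumes "s \<in> DT" "t \<in> DT"
  shows "TAdd s t \<in> DT"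
proof -
  obtain xs ys where xs: "set xs \<subseteq> B \<times> I" "s \<simeq> tps bx xs" and ys: "set ys \<subseteq> B \<times> I" "t \<simeq> tps bx ys"
    using assms unfolding DT_def by blast
  have "TAdd s t \<simeq> tps bx (xs @ ys)"
    by (rule teq_trans[OF add_cong[OF xs(2) ys(2)] teq_sym[OF tps_append]])
  then show ?thesis using xs(1) ys(1) unfolding DT_def by (intro CollectI exI[of _ "xs @ ys"]) auto
qed

lemma DT_bx: "b \<in> B \<Longrightarrow> x \<in> I \<Longrightarrow> bx b x \<in> DT"
  unfolding DT_def
  by (intro CollectI exI[of _ "[(b, x)]"])
    (simp add: teq_sym[OF teq_trans[OF star_cong.add_commute star_cong.add_zero]])

lemma DT_induct [consumes 1, case_names cong zero add prod]:
  assumes "d \<in> DT"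
    and cong: "\<And>s t. s \<simeq> t \<Longrightarrow> t \<in> DT \<Longrightarrow> P t \<Longrightarrow> P s"
    and zero: "P TZero"
    and add: "\<And>s t. s \<in> DT \<Longrightarrow> t \<in> DT \<Longrightarrow> P s \<Longrightarrow> P t \<Longrightarrow> P (TAdd s t)"
    and prod: "\<And>b x. b \<in> B \<Longrightarrow> x \<in> I \<Longrightarrow> P (bx b x)"
  shows "P d"
proof -
  obtain xs where xs: "set xs \<subseteq> B \<times> I" "d \<simeq> tps bx xs" using assms(1) unfolding DT_def by blast
  have "P (tps bx xs) \<and> tps bx xs \<in> DT" using xs(1)
  proof (induction xs)
    case Nil show ?case using zero DT_zero by simp
  next
    case (Cons p xs)
    then have "P (tps bx xs)" "tps bx xs \<in> DT" "fst p \<in> B" "snd p \<in> I" by auto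
    then show ?case unfolding tps_Cons by (intro conjI add DT_add prod DT_bx)
  qed
  then show ?thesis using cong[OF xs(2)] by blast
qed


lemma rel_B:
  "a \<in> B \<Longrightarrow> b \<in> B \<Longrightarrow> genB (a + b) \<simeq> TAdd (genB a) (genB b)"
  "b \<in> B \<Longrightarrow> genB (c *\<^sub>C b) \<simeq> TScale c (genB b)"
  "a \<in> B \<Longrightarrow> b \<in> B \<Longrightarrow> genB (a * b) \<simeq> TMult (genB a) (genB b)"
  "b \<in> B \<Longrightarrow> genB (star X b) \<simeq> TStar (genB b)"
  "genB 1 \<simeq> TOne"
  by (rule teq_rel, rule double_rels.intros, assumption+)+ (rule teq_rel, rule double_rels.intros)

lemma rel_I:
  "clinear x \<Longrightarrow> clinear y \<Longrightarrow> genI (x + y) \<simeq> TAdd (genI x) (genI y)"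
  "clinear x \<Longrightarrow> genI (c *\<^sub>C x) \<simeq> TScale c (genI x)"
  "clinear x \<Longrightarrow> genI (dual_star X x) \<simeq> TStar (genI x)"
  "genI (ccounit X) \<simeq> TOne"
  unfolding full_dual_iff[symmetric]
  by (rule teq_rel, rule double_rels.intros, assumption+)+ (rule teq_rel, rule double_rels.intros)

lemma rel_I_mult: "clinear x \<Longrightarrow> clinear y \<Longrightarrow> genI (C.conv x y) \<simeq> TMult (genI x) (genI y)"
proof -
  assume xy: "clinear x" "clinear y"
  then have "(genI (dual_mult X x y), TMult (genI x) (genI y)) \<in> double_rels X"
    unfolding full_dual_iff[symmetric] by (rule double_rels.intros)
  then show ?thesis unfolding dual_mult_conv[OF xy] by (rule teq_rel)
qed

lemma rel_interchange:
  assumes "b \<in> B" "clinear x" "set bs \<subseteq> B \<times> UNIV" "comult X b = psum (\<otimes>) bs"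
  shows "TMult (genI x) (genB b) \<simeq> tps (\<lambda>b0 b1. bx b0 (dual_act X x b1)) bs"
proof -
  have "comult X b = (\<Sum>(b0, b1)\<leftarrow>bs. b0 \<otimes> b1)" using assms(4) by (simp add: psum_def)
  then have "(TMult (genI x) (genB b), tsum (map (\<lambda>(b0, b1). bx b0 (dual_act X x b1)) bs)) \<in> double_rels X"
    using assms(1-3) unfolding full_dual_iff[symmetric] by (intro double_rels.interchange)
  then show ?thesis unfolding tps_def by (rule teq_rel)
qed

lemma tps_mult_right: "TMult (tps f xs) t \<simeq> tps (\<lambda>a b. TMult (f a b) t) xs"
proof (induction xs)
  case Nil
  have "TMult TZero t \<simeq> TMult (TScale 0 TZero) t" by (intro mult_congL teq_sym[OF star_cong.scale_zero])
  also have "\<dots> \<simeq> TScale 0 (TMult TZero t)" by (rule star_cong.scale_mult)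
  also have "\<dots> \<simeq> TZero" by (rule star_cong.scale_zero)
  finally show ?case by simp
next
  case (Cons p xs)
  then show ?case unfolding tps_Cons
    by (rule teq_trans[OF star_cong.add_mult add_cong[OF teq_refl]])
qed

lemma tps_cong:
  assumes "\<And>a b. (a, b) \<in> set xs \<Longrightarrow> f a b \<simeq> g a b"
  shows "tps f xs \<simeq> tps g xs"
  using assms by (induction xs) (auto simp: tps_Cons intro: teq_refl add_cong)

lemma DT_tps:
  assumes "\<And>a b. (a, b) \<in> set xs \<Longrightarrow> f a b \<in> DT"
  shows "tps f xs \<in> DT"
  using assms by (induction xs) (auto simp: tps_Cons intro: DT_zero DT_add)

text \<open>The terms that multiply the double into itself from the left.\<close>
definition LM :: "('a + ('c \<Rightarrow> complex)) star_term set"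
  where "LM = {s. \<forall>d\<in>DT. TMult s d \<in> DT}"

lemma LM_DT: "s \<in> LM \<Longrightarrow> d \<in> DT \<Longrightarrow> TMult s d \<in> DT"
  by (simp add: LM_def)

lemma mult_TZero: "TMult s TZero \<simeq> TZero"
proof -
  have "TMult s TZero \<simeq> TMult s (TScale 0 TZero)" by (intro mult_congR teq_sym[OF star_cong.scale_zero])
  also have "\<dots> \<simeq> TScale 0 (TMult s TZero)" by (rule star_cong.mult_scale)
  also have "\<dots> \<simeq> TZero" by (rule star_cong.scale_zero)
  finally show ?thesis .
qed

lemma LMI:
  assumes "\<And>b x. b \<in> B \<Longrightarrow> x \<in> I \<Longrightarrow> TMult s (bx b x) \<in> DT"
  shows "s \<in> LM"
  unfolding LM_def
proof (intro CollectI ballI)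
  fix d assume "d \<in> DT"
  then show "TMult s d \<in> DT"
  proof (induction rule: DT_induct)
    case (cong u t) show ?case by (rule DT_cong[OF mult_congR[OF cong(1)] cong(3)])
  next
    case zero
    show ?case by (rule DT_cong[OF mult_TZero DT_zero])
  next
    case (add u t)
    show ?case by (rule DT_cong[OF star_cong.mult_add DT_add[OF add(3,4)]])
  next
    case (prod b x) then show ?case by (rule assms)
  qed
qed

lemma LM_genB: "b \<in> B \<Longrightarrow> genB b \<in> LM"
proof (rule LMI)
  fix b' x assume b: "b \<in> B" "b' \<in> B" "x \<in> I"
  have "TMult (genB b) (bx b' x) \<simeq> bx (b * b') x"
    by (rule teq_trans[OF teq_mult_assoc' mult_congL[OF teq_sym[OF rel_B(3)]]]) fact+
  then show "TMult (genB b) (bx b' x) \<in> DT" by (rule DT_cong[OF _ DT_bx[OF mult_coinv]]) fact+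
qed

text \<open>The interchange relation applied to a product: with \<open>y\<close> arbitrary, the result is again a sum of products \<open>b x\<close>, as \<open>I\<close> is a left ideal.\<close>
lemma interchange_bx:
  assumes "b \<in> B" "clinear y" "x \<in> I" "set bs \<subseteq> B \<times> UNIV" "comult X b = psum (\<otimes>) bs"
  shows "TMult (genI y) (bx b x) \<simeq> tps (\<lambda>b0 b1. bx b0 (C.conv (dual_act X y b1) x)) bs"
proof -
  have "TMult (genI y) (bx b x) \<simeq> TMult (tps (\<lambda>b0 b1. bx b0 (dual_act X y b1)) bs) (genI x)"
    by (rule teq_trans[OF teq_mult_assoc' mult_congL[OF rel_interchange]]) fact+
  also have "\<dots> \<simeq> tps (\<lambda>b0 b1. TMult (bx b0 (dual_act X y b1)) (genI x)) bs"
    by (rule tps_mult_right)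
  also have "\<dots> \<simeq> tps (\<lambda>b0 b1. bx b0 (C.conv (dual_act X y b1) x)) bs"
    by (intro tps_cong teq_trans[OF teq_mult_assoc mult_congR] teq_sym[OF rel_I_mult] dual_act_clinear
        assms(2) C.rdual_clinear[OF assms(3)])
  finally show ?thesis .
qed

lemma LM_genI:
  assumes y: "clinear y"
  shows "genI y \<in> LM"
proof (rule LMI)
  fix b x assume b: "b \<in> B" "x \<in> I"
  obtain bs where bs: "set bs \<subseteq> B \<times> UNIV" "comult X b = psum (\<otimes>) bs" using comult_coinv[OF b(1)] by (elim exE conjE)
  have "tps (\<lambda>b0 b1. bx b0 (C.conv (dual_act X y b1) x)) bs \<in> DT"
  proof (rule DT_tps)
    fix b0 b1 assume "(b0, b1) \<in> set bs"
    then have "b0 \<in> B" using bs(1) by auto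
    then show "bx b0 (C.conv (dual_act X y b1) x) \<in> DT"
      by (rule DT_bx[OF _ C.rdual_mult_left[OF b(2) dual_act_clinear[OF y]]])
  qed
  then show "TMult (genI y) (bx b x) \<in> DT" by (rule DT_cong[OF interchange_bx[OF b(1) y b(2) bs]])
qed

lemma LM_mult: "s \<in> LM \<Longrightarrow> t \<in> LM \<Longrightarrow> TMult s t \<in> LM"
  unfolding LM_def by (intro CollectI ballI, rule DT_cong[OF teq_mult_assoc]) simp

lemma LM_add: "s \<in> LM \<Longrightarrow> t \<in> LM \<Longrightarrow> TAdd s t \<in> LM"
  unfolding LM_def by (intro CollectI ballI, rule DT_cong[OF star_cong.add_mult]) (simp add: DT_add)

lemma LM_cong: "s \<simeq> t \<Longrightarrow> t \<in> LM \<Longrightarrow> s \<in> LM"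
  unfolding LM_def by (intro CollectI ballI, rule DT_cong[OF mult_congL]) (assumption, blast)

lemma LM_zero: "TZero \<in> LM"
proof (unfold LM_def, intro CollectI ballI)
  fix d
  have "TMult TZero d \<simeq> TZero" using tps_mult_right[of undefined "[]" d] by (simp only: tps_simps)
  then show "TMult TZero d \<in> DT" using DT_zero by (rule DT_cong)
qed

lemma DT_subset_LM:
  assumes "d \<in> DT"
  shows "d \<in> LM"
  using assms
proof (induction rule: DT_induct)
  case (cong s t) show ?case by (rule LM_cong[OF cong(1,3)])
next
  case zero show ?case by (rule LM_zero)
next
  case (add s t) show ?case by (rule LM_add[OF add(3,4)])
next
  case (prod b x) then show ?case by (intro LM_mult LM_genB LM_genI C.rdual_clinear)
qed

lemma DT_mult: "s \<in> DT \<Longrightarrow> t \<in> DT \<Longrightarrow> TMult s t \<in> DT"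
  by (rule LM_DT[OF DT_subset_LM])

lemma bx_one: "genI x \<simeq> bx 1 x"
  by (rule teq_sym[OF teq_trans[OF mult_congL[OF rel_B(5)] star_cong.one_mult]])

lemma DT_genI: "x \<in> I \<Longrightarrow> genI x \<in> DT"
  by (rule DT_cong[OF bx_one DT_bx[OF one_coinv]])

lemma tps_scale: "TScale c (tps f xs) \<simeq> tps (\<lambda>a b. TScale c (f a b)) xs"
proof (induction xs)
  case Nil
  have "TScale c TZero \<simeq> TScale c (TScale 0 TZero)" by (intro scale_cong teq_sym[OF star_cong.scale_zero])
  also have "\<dots> \<simeq> TScale (c * 0) TZero" by (rule star_cong.scale_scale)
  also have "\<dots> \<simeq> TZero" by simp (rule star_cong.scale_zero)
  finally show ?case by simp
next
  case (Cons p xs)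
  then show ?case unfolding tps_Cons by (rule teq_trans[OF star_cong.scale_add add_cong[OF teq_refl]])
qed

lemma bx_scale: "b \<in> B \<Longrightarrow> bx (c *\<^sub>C b) x \<simeq> TScale c (bx b x)"
  by (rule teq_trans[OF mult_congL[OF rel_B(2)] star_cong.scale_mult])

lemma DT_scale:
  assumes "d \<in> DT"
  shows "TScale c d \<in> DT"
  using assms
proof (induction rule: DT_induct)
  case (cong s t) show ?case by (rule DT_cong[OF scale_cong[OF cong(1)] cong(3)])
next
  case zero
  have "TScale c TZero \<simeq> TZero" using tps_scale[of c undefined "[]"] by (simp only: tps_simps)
  then show ?case using DT_zero by (rule DT_cong)
next
  case (add s t) show ?case by (rule DT_cong[OF star_cong.scale_add DT_add[OF add(3,4)]])
next
  case (prod b x)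
  then show ?case by (intro DT_cong[OF teq_sym[OF bx_scale] DT_bx] csubspaceD(3)[OF csubspace_coinv])
qed

lemma genB_psum:
  assumes "set bs \<subseteq> B \<times> UNIV"
  shows "TMult (genB (psum (\<lambda>b a. r a *\<^sub>C b) bs)) t \<simeq> tps (\<lambda>b a. TScale (r a) (TMult (genB b) t)) bs"
  using assms
proof (induction bs)
  case Nil
  have "genB (0 *\<^sub>C 1) \<simeq> TScale 0 (genB 1)" by (rule rel_B(2)[OF one_coinv])
  also have "\<dots> \<simeq> TZero" by (rule star_cong.scale_zero)
  finally have 0: "genB 0 \<simeq> TZero" by simp
  have "TMult TZero t \<simeq> TZero" using tps_mult_right[of undefined "[]" t] by (simp only: tps_simps)
  then show ?case using teq_trans[OF mult_congL[OF 0]] by simp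
next
  case (Cons p bs)
  obtain b a where p: "p = (b, a)" by force
  have b: "b \<in> B" and bs: "set bs \<subseteq> B \<times> UNIV" using Cons.prems p by auto
  let ?s = "psum (\<lambda>b a. r a *\<^sub>C b) bs"
  have s: "?s \<in> B" using bs by (intro psum_in[OF csubspace_coinv] csubspaceD(3)[OF csubspace_coinv]) auto
  have rb: "r a *\<^sub>C b \<in> B" by (rule csubspaceD(3)[OF csubspace_coinv b])
  have "TMult (genB (r a *\<^sub>C b + ?s)) t \<simeq> TMult (TAdd (genB (r a *\<^sub>C b)) (genB ?s)) t"
    by (intro mult_congL rel_B(1) rb s)
  also have "\<dots> \<simeq> TAdd (TMult (genB (r a *\<^sub>C b)) t) (TMult (genB ?s) t)" by (rule star_cong.add_mult)
  also have "\<dots> \<simeq> TAdd (TScale (r a) (TMult (genB b) t)) (tps (\<lambda>b a. TScale (r a) (TMult (genB b) t)) bs)"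
    by (intro add_cong Cons.IH[OF bs] teq_trans[OF mult_congL[OF rel_B(2)[OF b]] star_cong.scale_mult])
  finally show ?case by (simp add: p)
qed

lemma left_unit_bx:
  assumes b: "b \<in> B" "x \<in> I" and bs: "set bs \<subseteq> B \<times> UNIV" "comult X b = psum (\<otimes>) bs"
    and e: "clinear e" "\<And>b0 b1. (b0, b1) \<in> set bs \<Longrightarrow> C.conv (dual_act X e b1) x = counit X b1 *\<^sub>C x"
  shows "TMult (genI e) (bx b x) \<simeq> bx b x"
proof -
  have "TMult (genI e) (bx b x) \<simeq> tps (\<lambda>b0 b1. bx b0 (C.conv (dual_act X e b1) x)) bs"
    by (rule interchange_bx[OF b(1) e(1) b(2) bs])
  also have "\<dots> \<simeq> tps (\<lambda>b0 b1. TScale (counit X b1) (bx b0 x)) bs"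
  proof (rule tps_cong)
    fix b0 b1 assume "(b0, b1) \<in> set bs"
    then show "bx b0 (C.conv (dual_act X e b1) x) \<simeq> TScale (counit X b1) (bx b0 x)"
      by (simp add: e(2)) (rule teq_trans[OF mult_congR[OF rel_I(2)[OF C.rdual_clinear[OF b(2)]]] star_cong.mult_scale])
  qed
  also have "\<dots> \<simeq> bx (psum (\<lambda>b0 b1. counit X b1 *\<^sub>C b0) bs) x"
    by (rule teq_sym[OF genB_psum[OF bs(1)]])
  also have "psum (\<lambda>b0 b1. counit X b1 *\<^sub>C b0) bs = b"
    using A.lact_counit[of b] unfolding A.lact_def bs(2) ts_psum[OF bal_slice[OF A.clinear_counit]] .
  finally show ?thesis .
qed

lemma left_unit_list:
  assumes "set bxs \<subseteq> B \<times> I"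
  shows "\<exists>e\<in>I. \<forall>(b, x)\<in>set bxs. TMult (genI e) (bx b x) \<simeq> bx b x"
proof -
  have "\<forall>b\<in>B. \<exists>bs. set bs \<subseteq> B \<times> UNIV \<and> comult X b = psum (\<otimes>) bs"
    by (intro ballI comult_coinv)
  from bchoice[OF this] obtain l where l0: "\<forall>b\<in>B. set (l b) \<subseteq> B \<times> UNIV \<and> comult X b = psum (\<otimes>) (l b)" ..
  have l: "set (l b) \<subseteq> B \<times> UNIV" "comult X b = psum (\<otimes>) (l b)" if "b \<in> B" for b using bspec[OF l0 that] by (rule conjunct1, rule conjunct2)
  let ?S = "\<Union>(b, x)\<in>set bxs. (\<lambda>p. (snd p, x)) ` set (l b)"
  have fin: "finite ?S" by (intro finite_UN_I finite_set) (simp add: case_prod_unfold)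
  have sub: "snd ` ?S \<subseteq> I" using assms by (auto simp: case_prod_unfold)
  obtain e where e: "e \<in> I" "\<forall>(a, x)\<in>?S. C.conv (dual_act X e a) x = counit X a *\<^sub>C x"
    using local_unit_product[OF fin sub] by (elim bexE)
  have "TMult (genI e) (bx b x) \<simeq> bx b x" if p: "(b, x) \<in> set bxs" for b x
  proof -
    have b: "b \<in> B" "x \<in> I" using p assms by auto
    show ?thesis
    proof (rule left_unit_bx[OF b l(1)[OF b(1)] l(2)[OF b(1)] C.rdual_clinear[OF e(1)]])
      fix b0 b1 assume "(b0, b1) \<in> set (l b)"
      then have "(b1, x) \<in> (\<lambda>p. (snd p, x)) ` set (l b)" by (intro image_eqI[of _ _ "(b0, b1)"]) simp_all
      then have "(b1, x) \<in> ?S" by (intro UN_I[OF p]) simp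
      from bspec[OF e(2) this] show "C.conv (dual_act X e b1) x = counit X b1 *\<^sub>C x" by simp
    qed
  qed
  then show ?thesis using e(1) by (intro bexI[of _ e] ballI) (simp_all add: case_prod_unfold)
qed

lemma tps_mult_left: "TMult t (tps f xs) \<simeq> tps (\<lambda>a b. TMult t (f a b)) xs"
proof (induction xs)
  case Nil
  show ?case by simp (rule mult_TZero)
next
  case (Cons p xs)
  then show ?case unfolding tps_Cons by (rule teq_trans[OF star_cong.mult_add add_cong[OF teq_refl]])
qed

lemma left_unit:
  assumes "d \<in> DT"
  shows "\<exists>e\<in>I. TMult (genI e) d \<simeq> d"
proof -
  obtain xs where xs: "set xs \<subseteq> B \<times> I" "d \<simeq> tps bx xs" using assms unfolding DT_def by blast
  obtain e where e: "e \<in> I" "\<And>b x. (b, x) \<in> set xs \<Longrightarrow> TMult (genI e) (bx b x) \<simeq> bx b x"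
    using left_unit_list[OF xs(1)] by (elim bexE) fast
  have "TMult (genI e) d \<simeq> TMult (genI e) (tps bx xs)" by (rule mult_congR[OF xs(2)])
  also have "\<dots> \<simeq> tps (\<lambda>a b. TMult (genI e) (bx a b)) xs" by (rule tps_mult_left)
  also have "\<dots> \<simeq> tps bx xs" by (rule tps_cong[OF e(2)])
  also have "\<dots> \<simeq> d" by (rule teq_sym[OF xs(2)])
  finally show ?thesis using e(1) by blast
qed

text \<open>The product \<open>x\<^sup>* b\<^sup>*\<close> is in the wrong order. But \<open>b x = e b x\<close> gives \<open>(b x)\<^sup>* = x\<^sup>* (b\<^sup>* e\<^sup>*)\<close>, which is a left multiple of
  an element of the double.\<close>
lemma DT_star:
  assumes "d \<in> DT"
  shows "TStar d \<in> DT"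
  using assms
proof (induction rule: DT_induct)
  case (cong s t) show ?case by (rule DT_cong[OF star_cong'[OF cong(1)] cong(3)])
next
  case zero
  have "TStar TZero \<simeq> TStar (TScale 0 TZero)" by (intro star_cong' teq_sym[OF star_cong.scale_zero])
  also have "\<dots> \<simeq> TScale (cnj 0) (TStar TZero)" by (rule star_cong.star_scale)
  also have "\<dots> \<simeq> TZero" by simp (rule star_cong.scale_zero)
  finally show ?case by (rule DT_cong[OF _ DT_zero])
next
  case (add s t) show ?case by (rule DT_cong[OF star_cong.star_add DT_add[OF add(3,4)]])
next
  case (prod b x)
  obtain e where e: "e \<in> I" "TMult (genI e) (bx b x) \<simeq> bx b x"
    using left_unit[OF DT_bx[OF prod]] by (elim bexE)
  have "TStar (bx b x) \<simeq> TStar (TMult (genI e) (bx b x))" by (rule star_cong'[OF teq_sym[OF e(2)]])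
  also have "\<dots> \<simeq> TMult (TStar (bx b x)) (TStar (genI e))" by (rule star_cong.star_mult)
  also have "\<dots> \<simeq> TMult (TMult (TStar (genI x)) (TStar (genB b))) (TStar (genI e))"
    by (rule mult_congL[OF star_cong.star_mult])
  also have "\<dots> \<simeq> TMult (TMult (genI (dual_star X x)) (genB (star X b))) (genI (dual_star X e))"
    by (intro mult_cong teq_sym[OF rel_I(3)] teq_sym[OF rel_B(4)] C.rdual_clinear prod e)
  also have "\<dots> \<simeq> TMult (genI (dual_star X x)) (bx (star X b) (dual_star X e))"
    by (rule teq_mult_assoc)
  finally show ?case
    by (rule DT_cong) (intro LM_DT[OF LM_genI] clinear_dual_star C.rdual_clinear DT_bx star_coinv rdual_star prod e)
qed

lemma common_unit:
  assumes "finite S" "S \<subseteq> I"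
  shows "\<exists>e\<in>I. \<forall>x\<in>S. C.conv e x = x"
proof -
  have "finite ((\<lambda>x. (1::'a, x)) ` S)" "snd ` ((\<lambda>x. (1::'a, x)) ` S) \<subseteq> I" using assms by auto
  from local_unit_product[OF this] obtain e where e: "e \<in> I" "\<forall>x\<in>S. C.conv (dual_act X e 1) x = counit X 1 *\<^sub>C x"
    by auto
  have "dual_act X e 1 = e" by (rule ext) (simp add: dual_act_def act_one)
  then show ?thesis using e by (auto simp: A.counit_one scaleC_one)
qed

end

section \<open>Complex inner product spaces\<close>

lemma cinner_add_left: "cinner (x + y) z = cinner x z + cinner y (z::'v::complex_inner)"
  by (subst (1 2 3) cinner_commute) (simp add: cinner_add_right)

lemma cinner_scaleC_left: "cinner (c *\<^sub>C x) y = cnj c * cinner x (y::'v::complex_inner)"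
  by (subst (1 2) cinner_commute) (simp add: cinner_scaleC_right)

lemma cinner_zero_right [simp]: "cinner x (0::'v::complex_inner) = 0"
  using cinner_scaleC_right[of x 0 0] by simp

lemma cinner_zero_left [simp]: "cinner 0 (x::'v::complex_inner) = 0"
  using cinner_scaleC_left[of 0 0 x] by simp

lemma cinner_diff_left: "cinner (x - y) z = cinner x z - cinner y (z::'v::complex_inner)"
  using cinner_add_left[of "x - y" y z] by simp

lemma cinner_self: "cinner x x = complex_of_real ((norm (x::'v::complex_inner))\<^sup>2)"
proof -
  have "Im (cinner x x) = 0" using cinner_commute[of x x] by (simp add: complex_eq_iff)
  then show ?thesis using inner_eq_Re_cinner[of x x] by (simp add: complex_eq_iff power2_norm_eq_inner)
qed

lemma cinner_eq_zeroD: "cinner x x = 0 \<Longrightarrow> x = (0::'v::complex_inner)"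
  by (simp add: cinner_self)

lemma norm_scaleC: "norm (c *\<^sub>C x) = cmod c * norm (x::'v::complex_inner)"
proof -
  have "complex_of_real ((norm (c *\<^sub>C x))\<^sup>2) = (c * cnj c) * complex_of_real ((norm x)\<^sup>2)"
    unfolding cinner_self[symmetric] by (simp add: cinner_scaleC_left cinner_scaleC_right)
  also have "\<dots> = complex_of_real ((cmod c * norm x)\<^sup>2)"
    by (simp add: complex_norm_square[symmetric] power_mult_distrib)
  finally have "(norm (c *\<^sub>C x))\<^sup>2 = (cmod c * norm x)\<^sup>2" by (simp only: of_real_eq_iff)
  then show ?thesis by (rule power2_eq_imp_eq) simp_all
qed

lemma cinner_bound: "cmod (cinner x y) \<le> norm x * norm (y::'v::complex_inner)"
proof (cases "cinner x y = 0")
  case False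
  let ?r = "cinner x y"
  have "(cmod ?r)\<^sup>2 = Re (cinner x (cnj ?r *\<^sub>C y))"
    by (simp add: cinner_scaleC_right complex_norm_square[symmetric] mult.commute[of "cnj _"] flip: of_real_power)
  also have "\<dots> = inner x (cnj ?r *\<^sub>C y)" by (simp add: inner_eq_Re_cinner)
  also have "\<dots> \<le> norm x * norm (cnj ?r *\<^sub>C y)" by (rule norm_cauchy_schwarz)
  also have "\<dots> = cmod ?r * (norm x * norm y)" by (simp add: norm_scaleC)
  finally have "cmod ?r * cmod ?r \<le> cmod ?r * (norm x * norm y)" by (simp add: power2_eq_square)
  then show ?thesis using False by simp
qed simp

lemma bounded_linear_cinner_right: "bounded_linear (cinner (x::'v::complex_inner))"
  by (rule bounded_linear_intro[of _ "norm x"])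
    (use cinner_bound[of x] in \<open>simp_all add: cinner_add_right scaleR_scaleC cinner_scaleC_right mult.commute scaleR_conv_of_real\<close>)

lemma bounded_linear_cinner_left: "bounded_linear (\<lambda>x. cinner x (y::'v::complex_inner))"
  by (rule bounded_linear_intro[of _ "norm y"])
    (use cinner_bound[of _ y] in \<open>simp_all add: cinner_add_left scaleR_scaleC cinner_scaleC_left scaleR_conv_of_real\<close>)

lemma bounded_linear_scaleC: "bounded_linear (\<lambda>x::'v::complex_inner. c *\<^sub>C x)"
  by (rule bounded_linear_intro[of _ "cmod c"])
    (simp_all add: norm_scaleC scale_simps scaleR_scaleC mult.commute)

lemma bounded_linear_of_clinear:
  fixes F :: "'v::complex_inner \<Rightarrow> 'w::complex_inner"
  assumes "clinear F" "\<And>x. norm (F x) \<le> K * norm x"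
  shows "bounded_linear F"
  by (rule bounded_linear_intro[of _ K])
    (use assms(2) in \<open>simp_all add: clinear_add[OF assms(1)] clinear_scale[OF assms(1)] scaleR_scaleC mult.commute\<close>)

lemma dense_eq:
  fixes f g :: "'h::topological_space \<Rightarrow> 'k::t2_space"
  assumes "closure S = UNIV" "continuous_on UNIV f" "continuous_on UNIV g" "\<And>x. x \<in> S \<Longrightarrow> f x = g x"
  shows "f x = g x"
proof -
  have "closed {x. f x = g x}" by (rule closed_Collect_eq) fact+
  then have "closure S \<subseteq> {x. f x = g x}" using assms(4) by (intro closure_minimal) auto
  then show ?thesis using assms(1) by auto
qed

lemma bl_cont: "bounded_linear f \<Longrightarrow> continuous_on UNIV f"
  by (rule linear_continuous_on)

lemma clinear_onD:
  assumes "clinear_on V f"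
  shows "v \<in> V \<Longrightarrow> w \<in> V \<Longrightarrow> f (v + w) = f v + f w" "v \<in> V \<Longrightarrow> f (c *\<^sub>C v) = c *\<^sub>C f v"
  using assms by (auto simp: clinear_on_def)

lemma clinear_on_zero: "clinear_on V f \<Longrightarrow> 0 \<in> V \<Longrightarrow> f 0 = 0"
  using clinear_onD(2)[of V f 0 0] by simp

lemma clinear_on_diff:
  assumes "clinear_on V f" "csubspace V" "v \<in> V" "w \<in> V"
  shows "f (v - w) = f v - f w"
  using clinear_onD(1)[OF assms(1) csubspaceD(4)[OF assms(2-4)] assms(4)] by simp

lemma clinear_on_psum:
  assumes "clinear_on V f" "csubspace V" "\<And>v w. (v, w) \<in> set xs \<Longrightarrow> h v w \<in> V"
  shows "f (psum h xs) = psum (\<lambda>v w. f (h v w)) xs"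
  using psum_hom_on[where L = f and xs = xs and h = h, OF assms(2,3)] clinear_on_zero[OF assms(1) csubspaceD(1)[OF assms(2)]]
    clinear_onD(1)[OF assms(1)] by blast

lemma completion_norm:
  assumes "completion_map H0 \<iota>" "v \<in> H0"
  shows "norm (\<iota> v) = norm v"
proof -
  have "complex_of_real ((norm (\<iota> v))\<^sup>2) = complex_of_real ((norm v)\<^sup>2)"
    unfolding cinner_self[symmetric] using assms by (simp add: completion_map_def)
  then have "(norm (\<iota> v))\<^sup>2 = (norm v)\<^sup>2" by (simp only: of_real_eq_iff)
  then show ?thesis by (rule power2_eq_imp_eq) simp_all
qed

text \<open>Transport \<open>f\<close> to the image of \<open>\<iota>\<close>, extend it as a uniformly continuous map, and obtain linearity by density.\<close>
lemma bounded_extension_exists: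
  fixes \<iota> :: "'v::complex_inner \<Rightarrow> 'h::{complex_inner, complete_space}"
    and f :: "'v \<Rightarrow> 'k::{complex_inner, complete_space}"
  assumes \<iota>: "completion_map H0 \<iota>" and H0: "csubspace H0" and f: "clinear_on H0 f"
    and K: "\<And>v. v \<in> H0 \<Longrightarrow> norm (f v) \<le> K * norm v"
  shows "\<exists>F. clinear F \<and> bounded_linear F \<and> (\<forall>v\<in>H0. F (\<iota> v) = f v)"
proof -
  have lin: "clinear_on H0 \<iota>" and dense: "closure (\<iota> ` H0) = UNIV" using \<iota> by (simp_all add: completion_map_def)
  note il = clinear_onD[OF lin] and fl = clinear_onD[OF f]
  have dist: "norm (f v - f w) \<le> \<bar>K\<bar> * norm (\<iota> v - \<iota> w)" if "v \<in> H0" "w \<in> H0" for v w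
  proof -
    have d: "v - w \<in> H0" by (rule csubspaceD(4)[OF H0 that])
    have "norm (f v - f w) = norm (f (v - w))" by (simp add: clinear_on_diff[OF f H0 that])
    also have "\<dots> \<le> K * norm (v - w)" by (rule K[OF d])
    also have "\<dots> \<le> \<bar>K\<bar> * norm (v - w)" by (intro mult_right_mono) auto
    also have "norm (v - w) = norm (\<iota> v - \<iota> w)"
      using completion_norm[OF \<iota> d] by (simp add: clinear_on_diff[OF lin H0 that])
    finally show ?thesis .
  qed
  define g where "g x = f (SOME v. v \<in> H0 \<and> \<iota> v = x)" for x
  have g: "g (\<iota> v) = f v" if "v \<in> H0" for v
  proof -
    let ?w = "SOME w. w \<in> H0 \<and> \<iota> w = \<iota> v"
    have "?w \<in> H0 \<and> \<iota> ?w = \<iota> v" by (rule someI[of _ v]) (simp add: that)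
    then show ?thesis using dist[of ?w v] that by (simp add: g_def)
  qed
  have "uniformly_continuous_on (\<iota> ` H0) g"
    unfolding uniformly_continuous_on_def
  proof (intro allI impI)
    fix e :: real assume e: "e > 0"
    show "\<exists>d>0. \<forall>x\<in>\<iota> ` H0. \<forall>x'\<in>\<iota> ` H0. dist x' x < d \<longrightarrow> dist (g x') (g x) < e"
    proof (intro exI[of _ "e / (\<bar>K\<bar> + 1)"] conjI ballI impI)
      show "e / (\<bar>K\<bar> + 1) > 0" using e by simp
      fix x x' assume "x \<in> \<iota> ` H0" "x' \<in> \<iota> ` H0" and d: "dist x' x < e / (\<bar>K\<bar> + 1)"
      then obtain v w where v: "v \<in> H0" "w \<in> H0" "x = \<iota> v" "x' = \<iota> w" by blast
      have "dist (g x') (g x) \<le> \<bar>K\<bar> * dist x' x" using dist[OF v(2,1)] v by (simp add: g dist_norm)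
      also have "\<dots> \<le> (\<bar>K\<bar> + 1) * dist x' x" by (intro mult_right_mono) auto
      also have "\<dots> < (\<bar>K\<bar> + 1) * (e / (\<bar>K\<bar> + 1))" using d by (intro mult_strict_left_mono) auto
      also have "\<dots> = e" by simp
      finally show "dist (g x') (g x) < e" .
    qed
  qed
  then obtain F where F: "uniformly_continuous_on (closure (\<iota> ` H0)) F" "\<And>x. x \<in> \<iota> ` H0 \<Longrightarrow> g x = F x"
    by (rule uniformly_continuous_on_extension_on_closure) iprover
  have cF: "continuous_on UNIV F" using F(1) unfolding dense by (rule uniformly_continuous_imp_continuous)
  have Ff: "F (\<iota> v) = f v" if "v \<in> H0" for v using F(2)[of "\<iota> v"] g[OF that] that by simp
  have cadd: "continuous_on UNIV (\<lambda>x. F (x + y))" for y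
    by (intro continuous_intros continuous_on_compose2[OF cF]) auto
  have caddl: "continuous_on UNIV (\<lambda>y. F (x + y))" for x
    by (intro continuous_intros continuous_on_compose2[OF cF]) auto
  have add1: "F (x + \<iota> w) = F x + F (\<iota> w)" if w: "w \<in> H0" for x w
  proof (rule dense_eq[OF dense cadd])
    show "continuous_on UNIV (\<lambda>x. F x + F (\<iota> w))" by (intro continuous_intros cF)
    fix y assume "y \<in> \<iota> ` H0"
    then obtain v where v: "v \<in> H0" "y = \<iota> v" by blast
    then show "F (y + \<iota> w) = F y + F (\<iota> w)"
      using w Ff[OF csubspaceD(2)[OF H0 v(1) w]] by (simp add: il fl Ff)
  qed
  have add: "F (x + y) = F x + F y" for x y
  proof (rule dense_eq[OF dense caddl])
    show "continuous_on UNIV (\<lambda>y. F x + F y)" by (intro continuous_intros cF)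
  qed (use add1 in auto)
  have scale: "F (c *\<^sub>C x) = c *\<^sub>C F x" for c x
  proof (rule dense_eq[OF dense])
    show "continuous_on UNIV (\<lambda>x. F (c *\<^sub>C x))"
      by (rule continuous_on_compose2[OF cF bl_cont[OF bounded_linear_scaleC]]) simp
    show "continuous_on UNIV (\<lambda>x. c *\<^sub>C F x)"
      by (rule continuous_on_compose2[OF bl_cont[OF bounded_linear_scaleC] cF]) simp
    fix y assume "y \<in> \<iota> ` H0"
    then obtain v where v: "v \<in> H0" "y = \<iota> v" by blast
    then show "F (c *\<^sub>C y) = c *\<^sub>C F y"
      using Ff[OF csubspaceD(3)[OF H0 v(1)], of c] by (simp add: il fl Ff)
  qed
  have clF: "clinear F" by (simp add: clinear_iff add scale)
  have "norm (F x) \<le> \<bar>K\<bar> * norm x" for x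
  proof -
    have "closed {x. norm (F x) \<le> \<bar>K\<bar> * norm x}"
      by (intro closed_Collect_le continuous_intros cF)
    moreover have "\<iota> ` H0 \<subseteq> {x. norm (F x) \<le> \<bar>K\<bar> * norm x}"
    proof clarsimp
      fix v assume v: "v \<in> H0"
      have "norm (f v) \<le> K * norm v" by (rule K[OF v])
      also have "\<dots> \<le> \<bar>K\<bar> * norm v" by (intro mult_right_mono) auto
      finally show "norm (F (\<iota> v)) \<le> \<bar>K\<bar> * norm (\<iota> v)" using v by (simp add: Ff completion_norm[OF \<iota>])
    qed
    ultimately have "closure (\<iota> ` H0) \<subseteq> {x. norm (F x) \<le> \<bar>K\<bar> * norm x}" by (rule closure_minimal[rotated])
    then show ?thesis using dense by auto
  qed
  then have "bounded_linear F" by (rule bounded_linear_of_clinear[OF clF])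
  then show ?thesis using clF Ff by blast
qed

section \<open>Unitary Doi-Koppinen modules\<close>

text \<open>The part of a Doi-Koppinen module needed to evaluate its structural tensor identities by functionals. Each of the lemmas
  \<open>slice_coassoc\<close>, \<open>functional_unitary\<close> and \<open>slice_delta_prod\<close> translates both sides of one axiom into the action \<open>op\<close> of the dual; it is
  read forwards to derive the action from a module, and backwards to verify the axioms from an action.\<close>
locale dk_pre = dk X for X :: "('a::complex_algebra_1, 'c::complex_vector) dk_datum" +
  fixes H0 :: "'v::complex_inner set" and \<pi>0 :: "'a \<Rightarrow> 'v \<Rightarrow> 'v" and \<delta>0 :: "'v \<Rightarrow> ('v, 'c) tensor"
  assumes sub: "csubspace H0" and delta_maps: "\<delta>0 \<in> H0 \<rightarrow>\<^sub>E tensor_span H0 UNIV"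
    and delta_lin: "clinear_on H0 \<delta>0"
    and pi_closed: "b \<in> coinv X \<Longrightarrow> v \<in> H0 \<Longrightarrow> \<pi>0 b v \<in> H0"
    and pi_lin: "b \<in> coinv X \<Longrightarrow> clinear_on H0 (\<pi>0 b)"
    and pi_add: "a \<in> coinv X \<Longrightarrow> b \<in> coinv X \<Longrightarrow> v \<in> H0 \<Longrightarrow> \<pi>0 (a + b) v = \<pi>0 a v + \<pi>0 b v"
    and pi_scale: "b \<in> coinv X \<Longrightarrow> v \<in> H0 \<Longrightarrow> \<pi>0 (c *\<^sub>C b) v = c *\<^sub>C \<pi>0 b v"
begin

lemmas subD = csubspaceD[OF sub]

lemma delta_list:
  assumes "v \<in> H0"
  shows "\<exists>vs. set vs \<subseteq> H0 \<times> UNIV \<and> \<delta>0 v = psum (\<otimes>) vs"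
  using PiE_mem[OF delta_maps assms] unfolding tensor_span_psum[OF sub] .

definition op :: "('c \<Rightarrow> complex) \<Rightarrow> 'v \<Rightarrow> 'v" where "op y v = slice y (\<delta>0 v)"

lemma op_closed: "clinear y \<Longrightarrow> v \<in> H0 \<Longrightarrow> op y v \<in> H0"
  unfolding op_def by (rule slice_in[OF _ sub PiE_mem[OF delta_maps]])

lemma op_lin: "clinear y \<Longrightarrow> clinear_on H0 (op y)"
  by (simp add: clinear_on_def op_def clinear_onD[OF delta_lin] clinear_add[OF clinear_slice]
      clinear_scale[OF clinear_slice])

lemma sweedler_delta:
  assumes "v \<in> H0" "set vs \<subseteq> H0 \<times> UNIV" "\<delta>0 v = psum (\<otimes>) vs" "balanced_on H0 UNIV h"
  shows "sweedler H0 UNIV h (\<delta>0 v) = psum h vs"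
  by (rule sweedler_psum[OF sub csubspace_UNIV assms(4,2,3)])

lemma bal_on: "bal h \<Longrightarrow> balanced_on V W h"
  unfolding balanced_on_def by blast

lemma dual_op_eq:
  assumes "clinear y" "v \<in> H0"
  shows "dual_op H0 \<delta>0 y v = op y v"
proof -
  obtain vs where vs: "set vs \<subseteq> H0 \<times> UNIV" "\<delta>0 v = psum (\<otimes>) vs" using delta_list[OF assms(2)] by (elim exE conjE)
  show ?thesis unfolding dual_op_def sweedler_delta[OF assms(2) vs bal_on[OF bal_slice[OF assms(1)]]]
    by (simp add: op_def vs(2) slice_psum[OF assms(1)])
qed

lemma op_add: "op (x + y) v = op x v + op y v"
  by (simp add: op_def slice_def ts_add_fun[symmetric] scaleC_add_left)

lemma op_scale: "op (c *\<^sub>C x) v = c *\<^sub>C op x v"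
  by (simp add: op_def slice_def ts_scale_fun[symmetric] scaleC_scaleC scaleC_fun_def)

definition coassoc_left :: "'v \<Rightarrow> ('v, ('c, 'c) tensor) tensor"
  where "coassoc_left v = tensor_assoc (sweedler H0 UNIV (\<lambda>w c. \<delta>0 w \<otimes> c) (\<delta>0 v))"

definition coassoc_right :: "'v \<Rightarrow> ('v, ('c, 'c) tensor) tensor"
  where "coassoc_right v = sweedler H0 UNIV (\<lambda>w c. w \<otimes> ccomult X c) (\<delta>0 v)"

lemma slice_coassoc:
  assumes y: "clinear y" and z: "clinear z" and v: "v \<in> H0"
  shows "slice (ts (\<lambda>c d. y c * z d)) (coassoc_left v) = op y (op z v)"
    and "slice (ts (\<lambda>c d. y c * z d)) (coassoc_right v) = op (C.conv y z) v"
proof -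
  obtain vs where vs: "set vs \<subseteq> H0 \<times> UNIV" "\<delta>0 v = psum (\<otimes>) vs" using delta_list[OF v] by (elim exE conjE)
  have vH: "w \<in> H0" if "(w, c) \<in> set vs" for w c using that vs(1) by auto
  have b1: "balanced_on H0 UNIV (\<lambda>w c. \<delta>0 w \<otimes> c)"
    unfolding balanced_on_def using clinear_onD[OF delta_lin] by (simp add: tensor_simps)
  have b2: "balanced_on H0 UNIV (\<lambda>w c. w \<otimes> ccomult X c)"
    by (rule bal_on[OF bal_comp_right[OF C.clinear_comult bal_pure]])
  let ?f = "\<lambda>(a::'v) b c. (y b * z c) *\<^sub>C a"
  have t: "tribalanced ?f"
    by (rule triI) (simp_all add: scale_simps clinear_add[OF y] clinear_add[OF z]
        clinear_scale[OF y] clinear_scale[OF z] distrib_left distrib_right mult_ac)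
  let ?G = "\<lambda>t. ts (\<lambda>a u. ts (?f a) u) t"
  note b = bal_ts_right[OF t]
  have G: "slice (ts (\<lambda>c d. y c * z d)) t = ?G t" for t :: "('v, ('c, 'c) tensor) tensor"
    by (simp only: slice_def ts_scale_left)
  have "?G (tensor_assoc (psum (\<lambda>w c. \<delta>0 w \<otimes> c) vs)) = ?G (psum (\<lambda>w c. tensor_assoc (\<delta>0 w \<otimes> c)) vs)"
    by (rule arg_cong[of _ _ ?G], rule psum_hom) (fact tensor_assoc_hom)+
  also have "\<dots> = psum (\<lambda>w c. ?G (tensor_assoc (\<delta>0 w \<otimes> c))) vs"
    by (rule psum_hom[of ?G]) (simp_all only: ts_0[OF b] ts_plus[OF b])
  also have "\<dots> = psum (\<lambda>w c. z c *\<^sub>C op y w) vs"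
    by (simp only: ts_tensor_assoc_pure[OF t]) (simp add: op_def slice_def ts_scale_fun[symmetric] scaleC_scaleC mult.commute)
  also have "\<dots> = psum (\<lambda>w c. op y (z c *\<^sub>C w)) vs"
    by (rule psum_cong) (simp add: clinear_onD(2)[OF op_lin[OF y]] vH)
  also have "\<dots> = op y (psum (\<lambda>w c. z c *\<^sub>C w) vs)"
    by (rule clinear_on_psum[OF op_lin[OF y] sub, symmetric]) (simp add: subD vH)
  also have "\<dots> = op y (op z v)" by (simp add: op_def[of z] vs(2) slice_psum[OF z])
  finally show "slice (ts (\<lambda>c d. y c * z d)) (coassoc_left v) = op y (op z v)"
    unfolding G coassoc_left_def sweedler_delta[OF v vs b1] .
  have "?G (psum (\<lambda>w c. w \<otimes> ccomult X c) vs) = psum (\<lambda>w c. ?G (w \<otimes> ccomult X c)) vs"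
    by (rule psum_hom[of ?G]) (simp_all only: ts_0[OF b] ts_plus[OF b])
  also have "\<dots> = psum (\<lambda>w c. C.conv y z c *\<^sub>C w) vs"
    by (simp only: ts_pure[OF b] C.conv_def ts_scale_left)
  also have "\<dots> = op (C.conv y z) v"
    by (simp add: op_def vs(2) slice_psum[OF C.clinear_conv[OF y z]])
  finally show "slice (ts (\<lambda>c d. y c * z d)) (coassoc_right v) = op (C.conv y z) v"
    unfolding G coassoc_right_def sweedler_delta[OF v vs b2] .
qed

definition unitary_left :: "'v \<Rightarrow> 'v \<Rightarrow> 'c"
  where "unitary_left v w = sweedler H0 UNIV (\<lambda>w0 w1. cinner v w0 *\<^sub>C w1) (\<delta>0 w)"

definition unitary_right :: "'v \<Rightarrow> 'v \<Rightarrow> 'c"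
  where "unitary_right v w = sweedler H0 UNIV (\<lambda>v0 v1. cinner v0 w *\<^sub>C cdag X v1) (\<delta>0 v)"

lemma functional_unitary:
  assumes y: "clinear y" and v: "v \<in> H0" and w: "w \<in> H0"
  shows "y (unitary_left v w) = cinner v (op y w)" and "y (unitary_right v w) = cinner (op (dual_star X y) v) w"
proof -
  obtain vs where vs: "set vs \<subseteq> H0 \<times> UNIV" "\<delta>0 v = psum (\<otimes>) vs" using delta_list[OF v] by (elim exE conjE)
  obtain ws where ws: "set ws \<subseteq> H0 \<times> UNIV" "\<delta>0 w = psum (\<otimes>) ws" using delta_list[OF w] by (elim exE conjE)
  have b1: "bal (\<lambda>w0 w1. cinner v w0 *\<^sub>C (w1::'c))"
    by (rule balI) (simp_all add: cinner_add_right cinner_scaleC_right scale_simps mult.commute)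
  have b2: "bal (\<lambda>v0 v1. cinner v0 w *\<^sub>C cdag X v1)"
    by (rule balI) (simp_all add: cinner_add_left cinner_scaleC_left scale_simps cdag_simps mult.commute)
  have "cinner v (op y w) = psum (\<lambda>w0 w1. cinner v (y w1 *\<^sub>C w0)) ws"
    unfolding op_def ws(2) slice_psum[OF y] by (rule psum_hom) (simp_all add: cinner_add_right)
  also have "\<dots> = psum (\<lambda>w0 w1. y (cinner v w0 *\<^sub>C w1)) ws"
    by (simp add: cinner_scaleC_right clinear_scale[OF y] mult.commute)
  also have "\<dots> = y (psum (\<lambda>w0 w1. cinner v w0 *\<^sub>C w1) ws)"
    by (rule psum_hom[symmetric, of y]) (simp_all only: clinear_zero[OF y] clinear_add[OF y])
  finally show "y (unitary_left v w) = cinner v (op y w)"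
    unfolding unitary_left_def sweedler_delta[OF w ws bal_on[OF b1]] by (rule HOL.sym)
  have "y (psum (\<lambda>v0 v1. cinner v0 w *\<^sub>C cdag X v1) vs) = psum (\<lambda>v0 v1. y (cinner v0 w *\<^sub>C cdag X v1)) vs"
    by (rule psum_hom[of y]) (simp_all only: clinear_zero[OF y] clinear_add[OF y])
  also have "\<dots> = psum (\<lambda>v0 v1. cinner (dual_star X y v1 *\<^sub>C v0) w) vs"
    by (simp add: cinner_scaleC_left clinear_scale[OF y] dual_star_def mult.commute)
  also have "\<dots> = cinner (op (dual_star X y) v) w"
    unfolding op_def vs(2) slice_psum[OF clinear_dual_star[OF y]]
    by (rule psum_hom[symmetric, of "\<lambda>z. cinner z w"]) (simp_all add: cinner_add_left)
  finally show "y (unitary_right v w) = cinner (op (dual_star X y) v) w"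
    unfolding unitary_right_def sweedler_delta[OF v vs bal_on[OF b2]] .
qed

definition delta_prod :: "'a \<Rightarrow> 'v \<Rightarrow> ('v, 'c) tensor"
  where "delta_prod b v = sweedler (coinv X) UNIV (\<lambda>b0 b1.
         sweedler H0 UNIV (\<lambda>v0 v1. \<pi>0 b0 v0 \<otimes> act X b1 v1) (\<delta>0 v)) (comult X b)"

lemma slice_delta_prod:
  assumes b: "b \<in> B" and v: "v \<in> H0" and y: "clinear y"
    and bs: "set bs \<subseteq> B \<times> UNIV" "comult X b = psum (\<otimes>) bs"
  shows "slice y (delta_prod b v) = psum (\<lambda>b0 b1. \<pi>0 b0 (op (dual_act X y b1) v)) bs"
proof -
  obtain vs where vs: "set vs \<subseteq> H0 \<times> UNIV" "\<delta>0 v = psum (\<otimes>) vs" using delta_list[OF v] by (elim exE conjE)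
  have vH: "w \<in> H0" if "(w, c) \<in> set vs" for w c using that vs(1) by auto
  have bB: "b0 \<in> B" if "(b0, b1) \<in> set bs" for b0 b1 using that bs(1) by auto
  have bi: "balanced_on H0 UNIV (\<lambda>v0 v1. \<pi>0 b0 v0 \<otimes> act X b1 v1)" if "b0 \<in> B" for b0 b1
    unfolding balanced_on_def using clinear_onD[OF pi_lin[OF that]] by (simp add: tensor_simps act_simps)
  have in1: "sweedler H0 UNIV (\<lambda>v0 v1. \<pi>0 b0 v0 \<otimes> act X b1 v1) (\<delta>0 v) = psum (\<lambda>v0 v1. \<pi>0 b0 v0 \<otimes> act X b1 v1) vs"
    if "b0 \<in> B" for b0 b1 by (rule sweedler_delta[OF v vs bi[OF that]])
  have "balanced_on B UNIV (\<lambda>b0 b1. sweedler H0 UNIV (\<lambda>v0 v1. \<pi>0 b0 v0 \<otimes> act X b1 v1) (\<delta>0 v))"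
    unfolding balanced_on_def
  proof (intro conjI ballI allI)
    fix b0 b0' w assume b0: "b0 \<in> B" "b0' \<in> B"
    show "sweedler H0 UNIV (\<lambda>v0 v1. \<pi>0 (b0 + b0') v0 \<otimes> act X w v1) (\<delta>0 v) =
      sweedler H0 UNIV (\<lambda>v0 v1. \<pi>0 b0 v0 \<otimes> act X w v1) (\<delta>0 v) +
      sweedler H0 UNIV (\<lambda>v0 v1. \<pi>0 b0' v0 \<otimes> act X w v1) (\<delta>0 v)"
      unfolding in1[OF b0(1)] in1[OF b0(2)] in1[OF csubspaceD(2)[OF csubspace_coinv b0]] psum_add[symmetric]
      by (rule psum_cong) (simp add: pi_add b0 vH tensor_simps)
  next
    fix b0 w w' assume b0: "b0 \<in> B"
    show "sweedler H0 UNIV (\<lambda>v0 v1. \<pi>0 b0 v0 \<otimes> act X (w + w') v1) (\<delta>0 v) =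
      sweedler H0 UNIV (\<lambda>v0 v1. \<pi>0 b0 v0 \<otimes> act X w v1) (\<delta>0 v) +
      sweedler H0 UNIV (\<lambda>v0 v1. \<pi>0 b0 v0 \<otimes> act X w' v1) (\<delta>0 v)"
      unfolding in1[OF b0] psum_add[symmetric] by (simp add: act_simps tensor_simps)
  next
    fix c b0 w assume b0: "b0 \<in> B"
    show "sweedler H0 UNIV (\<lambda>v0 v1. \<pi>0 (c *\<^sub>C b0) v0 \<otimes> act X w v1) (\<delta>0 v) =
      sweedler H0 UNIV (\<lambda>v0 v1. \<pi>0 b0 v0 \<otimes> act X (c *\<^sub>C w) v1) (\<delta>0 v)"
      unfolding in1[OF b0] in1[OF csubspaceD(3)[OF csubspace_coinv b0]]
      by (rule psum_cong) (simp add: pi_scale b0 vH act_simps tensor_simps)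
  qed
  from sweedler_psum[OF csubspace_coinv csubspace_UNIV this bs]
  have "delta_prod b v = psum (\<lambda>b0 b1. sweedler H0 UNIV (\<lambda>v0 v1. \<pi>0 b0 v0 \<otimes> act X b1 v1) (\<delta>0 v)) bs"
    unfolding delta_prod_def .
  also have "\<dots> = psum (\<lambda>b0 b1. psum (\<lambda>v0 v1. \<pi>0 b0 v0 \<otimes> act X b1 v1) vs) bs"
    by (rule psum_cong) (simp add: in1 bB)
  finally have "slice y (delta_prod b v) = slice y (psum (\<lambda>b0 b1. psum (\<lambda>v0 v1. \<pi>0 b0 v0 \<otimes> act X b1 v1) vs) bs)"
    by (rule arg_cong)
  also have "\<dots> = psum (\<lambda>b0 b1. psum (\<lambda>v0 v1. slice y (\<pi>0 b0 v0 \<otimes> act X b1 v1)) vs) bs"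
  proof -
    note L = clinear_slice[OF y]
    have "slice y (psum h xs) = psum (\<lambda>v w. slice y (h v w)) xs" for h :: "'d \<Rightarrow> 'e \<Rightarrow> ('v, 'c) tensor" and xs
      by (rule psum_hom) (simp_all only: clinear_zero[OF L] clinear_add[OF L])
    note h = this
    have h2: "slice y (psum h xs) = psum (\<lambda>v w. slice y (h v w)) xs" for h :: "'v \<Rightarrow> 'c \<Rightarrow> ('v, 'c) tensor" and xs
      by (rule psum_hom) (simp_all only: clinear_zero[OF L] clinear_add[OF L])
    show ?thesis by (simp only: h h2)
  qed
  also have "\<dots> = psum (\<lambda>b0 b1. psum (\<lambda>v0 v1. \<pi>0 b0 (dual_act X y b1 v1 *\<^sub>C v0)) vs) bs"
    by (intro psum_cong) (simp add: slice_pure[OF y] dual_act_def clinear_onD(2)[OF pi_lin] bB vH)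
  also have "\<dots> = psum (\<lambda>b0 b1. \<pi>0 b0 (psum (\<lambda>v0 v1. dual_act X y b1 v1 *\<^sub>C v0) vs)) bs"
    by (intro psum_cong clinear_on_psum[OF pi_lin sub, symmetric]) (simp_all add: bB vH subD)
  also have "\<dots> = psum (\<lambda>b0 b1. \<pi>0 b0 (op (dual_act X y b1) v)) bs"
    by (simp add: op_def vs(2) slice_psum[OF dual_act_clinear[OF y]])
  finally show ?thesis .
qed

end

locale dk_mod = dk X for X :: "('a::complex_algebra_1, 'c::complex_vector) dk_datum" +
  fixes H0 :: "'v::complex_inner set" and \<pi>0 :: "'a \<Rightarrow> 'v \<Rightarrow> 'v" and \<delta>0 :: "'v \<Rightarrow> ('v, 'c) tensor"
  assumes module: "unitary_dk_module X (H0, \<pi>0, \<delta>0)"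
begin

sublocale dk_pre X H0 \<pi>0 \<delta>0
proof unfold_locales
  show "csubspace H0" "\<delta>0 \<in> H0 \<rightarrow>\<^sub>E tensor_span H0 UNIV" "clinear_on H0 \<delta>0"
    using module unfolding unitary_dk_module_def unitary_comodule_def by blast+
  have rep: "star_rep (coinv_alg X) H0 \<pi>0" using module unfolding unitary_dk_module_def by blast
  note r = rep[unfolded star_rep_def coinv_alg_def star_alg.simps]
  fix a b v c assume b: "b \<in> B"
  show "clinear_on H0 (\<pi>0 b)" using r b by blast
  assume v: "v \<in> H0"
  show "\<pi>0 b v \<in> H0" using r b v by (blast dest: PiE_mem)
  show "\<pi>0 (c *\<^sub>C b) v = c *\<^sub>C \<pi>0 b v" using r b v by blast
  assume "a \<in> B"
  then show "\<pi>0 (a + b) v = \<pi>0 a v + \<pi>0 b v" using r b v by blast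
qed

lemma pi_one: "v \<in> H0 \<Longrightarrow> \<pi>0 1 v = v"
  using module unfolding unitary_dk_module_def by blast

lemma pi_mult: "a \<in> B \<Longrightarrow> b \<in> B \<Longrightarrow> v \<in> H0 \<Longrightarrow> \<pi>0 (a * b) v = \<pi>0 a (\<pi>0 b v)"
  and pi_adj: "b \<in> B \<Longrightarrow> v \<in> H0 \<Longrightarrow> w \<in> H0 \<Longrightarrow> cinner v (\<pi>0 b w) = cinner (\<pi>0 (star X b) v) w"
  using module unfolding unitary_dk_module_def star_rep_def coinv_alg_def star_alg.simps by blast+

lemma op_counit:
  assumes "v \<in> H0"
  shows "op (ccounit X) v = v"
proof -
  have "sweedler H0 UNIV (\<lambda>w c. ccounit X c *\<^sub>C w) (\<delta>0 v) = v"
    using module assms unfolding unitary_dk_module_def unitary_comodule_def by blast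
  then show ?thesis using dual_op_eq[OF C.clinear_counit assms] by (simp add: dual_op_def)
qed

lemma op_conv:
  assumes "clinear y" "clinear z" "v \<in> H0"
  shows "op y (op z v) = op (C.conv y z) v"
proof -
  have "coassoc_left v = coassoc_right v"
    using module assms(3) unfolding unitary_dk_module_def unitary_comodule_def coassoc_left_def coassoc_right_def by blast
  then show ?thesis using slice_coassoc[OF assms] by simp
qed

lemma op_adj:
  assumes "clinear y" "v \<in> H0" "w \<in> H0"
  shows "cinner v (op y w) = cinner (op (dual_star X y) v) w"
proof -
  have "unitary_left v w = unitary_right v w"
    using module assms(2,3) unfolding unitary_dk_module_def unitary_comodule_def unitary_left_def unitary_right_def by blast
  then show ?thesis using functional_unitary[OF assms] by simp
qed

lemma op_pi:
  assumes b: "b \<in> B" and v: "v \<in> H0" and y: "clinear y"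
    and bs: "set bs \<subseteq> B \<times> UNIV" "comult X b = psum (\<otimes>) bs"
  shows "op y (\<pi>0 b v) = psum (\<lambda>b0 b1. \<pi>0 b0 (op (dual_act X y b1) v)) bs"
proof -
  have "\<delta>0 (\<pi>0 b v) = delta_prod b v"
    using module b v unfolding unitary_dk_module_def delta_prod_def by blast
  then show ?thesis using slice_delta_prod[OF assms] by (simp add: op_def)
qed

text \<open>Apply \<open>coinv_sum_of_squares\<close> to a vector: \<open>\<Sum> \<parallel>h(e) v\<parallel>\<^sup>2 = r \<parallel>v\<parallel>\<^sup>2\<close>.\<close>
lemma pi_bounded:
  assumes b: "b \<in> B"
  shows "\<exists>K. \<forall>v\<in>H0. norm (\<pi>0 b v) \<le> K * norm v"
proof -
  obtain E h r where E: "finite E" "h ` E \<subseteq> B" "b = (\<Sum>e\<in>E. counit X e *\<^sub>C h e)"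
    "(\<Sum>e\<in>E. star X (h e) * h e) = r *\<^sub>C 1"
    using coinv_sum_of_squares[OF b] by (elim exE conjE)
  have hB: "h e \<in> B" if "e \<in> E" for e using E(2) that by blast
  have pis: "\<pi>0 (\<Sum>e\<in>S. g e) v = (\<Sum>e\<in>S. \<pi>0 (g e) v) \<and> (\<Sum>e\<in>S. g e) \<in> B"
    if "finite S" "\<And>e. e \<in> S \<Longrightarrow> g e \<in> B" "v \<in> H0" for S :: "'a set" and g v
    using that(1,2)
  proof (induction S rule: finite_induct)
    case empty
    then show ?case using pi_scale[OF one_coinv that(3), of 0] csubspaceD(1)[OF csubspace_coinv] by simp
  next
    case (insert e S)
    then have "\<pi>0 (\<Sum>e\<in>S. g e) v = (\<Sum>e\<in>S. \<pi>0 (g e) v)" "(\<Sum>e\<in>S. g e) \<in> B" "g e \<in> B" by auto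
    then show ?case using insert(1,2) that(3) by (simp add: pi_add csubspaceD[OF csubspace_coinv])
  qed
  have sq: "(\<Sum>e\<in>E. (norm (\<pi>0 (h e) v))\<^sup>2) = Re r * (norm v)\<^sup>2" if v: "v \<in> H0" for v
  proof -
    have "complex_of_real (\<Sum>e\<in>E. (norm (\<pi>0 (h e) v))\<^sup>2) = (\<Sum>e\<in>E. cinner (\<pi>0 (h e) v) (\<pi>0 (h e) v))"
      by (simp add: cinner_self)
    also have "\<dots> = (\<Sum>e\<in>E. cinner v (\<pi>0 (star X (h e) * h e) v))"
    proof (rule sum.cong[OF HOL.refl])
      fix e assume "e \<in> E"
      note h = hB[OF this]
      have "cinner v (\<pi>0 (star X (h e)) (\<pi>0 (h e) v)) = cinner (\<pi>0 (h e) v) (\<pi>0 (h e) v)"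
        using pi_adj[OF star_coinv[OF h] v pi_closed[OF h v]] by (simp add: A.star_star)
      then show "cinner (\<pi>0 (h e) v) (\<pi>0 (h e) v) = cinner v (\<pi>0 (star X (h e) * h e) v)"
        by (simp add: pi_mult[OF star_coinv[OF h] h v])
    qed
    also have "\<dots> = cinner v (\<Sum>e\<in>E. \<pi>0 (star X (h e) * h e) v)"
      using E(1) by (induction E rule: finite_induct) (simp_all add: cinner_add_right)
    also have "\<dots> = cinner v (\<pi>0 (r *\<^sub>C 1) v)"
      using pis[OF E(1) _ v, of "\<lambda>e. star X (h e) * h e"] hB star_coinv mult_coinv by (simp add: E(4))
    also have "\<dots> = r * complex_of_real ((norm v)\<^sup>2)"
      by (simp add: pi_scale[OF one_coinv v] pi_one[OF v] cinner_scaleC_right cinner_self)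
    finally have "Re (complex_of_real (\<Sum>e\<in>E. (norm (\<pi>0 (h e) v))\<^sup>2)) = Re (r * complex_of_real ((norm v)\<^sup>2))" by simp
    then show ?thesis by simp
  qed
  let ?K = "(\<Sum>e\<in>E. cmod (counit X e) * sqrt (Re r))"
  have "norm (\<pi>0 b v) \<le> ?K * norm v" if v: "v \<in> H0" for v
  proof -
    have one: "norm (\<pi>0 (h e) v) \<le> sqrt (Re r) * norm v" if e: "e \<in> E" for e
    proof -
      have "(norm (\<pi>0 (h e) v))\<^sup>2 \<le> Re r * (norm v)\<^sup>2"
        unfolding sq[OF v, symmetric] by (rule member_le_sum[OF e _ E(1)]) simp
      then have "sqrt ((norm (\<pi>0 (h e) v))\<^sup>2) \<le> sqrt (Re r * (norm v)\<^sup>2)" by (rule real_sqrt_le_mono)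
      then show ?thesis by (simp add: real_sqrt_mult)
    qed
    have "\<pi>0 b v = (\<Sum>e\<in>E. \<pi>0 (counit X e *\<^sub>C h e) v)"
      unfolding E(3) using pis[OF E(1) _ v, of "\<lambda>e. counit X e *\<^sub>C h e"] hB csubspaceD(3)[OF csubspace_coinv] by simp
    also have "\<dots> = (\<Sum>e\<in>E. counit X e *\<^sub>C \<pi>0 (h e) v)"
      by (rule sum.cong) (simp_all add: pi_scale hB v)
    also have "norm \<dots> \<le> (\<Sum>e\<in>E. cmod (counit X e) * norm (\<pi>0 (h e) v))"
      by (rule order_trans[OF norm_sum]) (simp add: norm_scaleC)
    also have "\<dots> \<le> (\<Sum>e\<in>E. cmod (counit X e) * (sqrt (Re r) * norm v))"
      by (intro sum_mono mult_left_mono one) simp_all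
    also have "\<dots> = ?K * norm v" by (simp add: sum_distrib_right mult.assoc)
    finally show ?thesis .
  qed
  then show ?thesis by blast
qed

lemma op_span:
  assumes "finite F" "y \<in> cspan F"
  shows "\<exists>r. \<forall>v. op y v = (\<Sum>f\<in>F. r f *\<^sub>C op f v)"
proof -
  obtain r where r: "y = (\<Sum>f\<in>F. r f *\<^sub>C f)" by (rule cspan_finite_sum[OF assms])
  have "op y v = (\<Sum>f\<in>F. r f *\<^sub>C op f v)" for v
  proof -
    have lin: "clinear (\<lambda>y. op y v)" by (simp add: clinear_iff op_add op_scale)
    show ?thesis unfolding r clinear_sum[OF lin] op_scale ..
  qed
  then show ?thesis by blast
qed

text \<open>Let \<open>F\<close> be finite with \<open>f\<^sup>* f\<close> in its span for each \<open>f \<in> F\<close>, and \<open>q(v) = \<Sum> \<parallel>f v\<parallel>\<close>. Then \<open>\<parallel>f v\<parallel>\<^sup>2 \<le> \<parallel>v\<parallel> \<parallel>f\<^sup>* f v\<parallel> \<le> K \<parallel>v\<parallel> q(v)\<close>; taking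
  roots and summing, \<open>q(v)\<^sup>2\<close> is bounded by a multiple of \<open>\<parallel>v\<parallel> q(v)\<close>, hence \<open>q(v)\<close> by a multiple of \<open>\<parallel>v\<parallel>\<close>.\<close>
lemma op_bounded:
  assumes x: "x \<in> I"
  shows "\<exists>K. \<forall>v\<in>H0. norm (op x v) \<le> K * norm v"
proof -
  obtain F where F: "finite F" "\<forall>f\<in>F. clinear f" "x \<in> cspan F" "\<forall>f\<in>F. \<forall>y. clinear y \<longrightarrow> C.conv y f \<in> cspan F"
    using C.rdual_left_ideal[OF x] by (elim exE conjE)
  have Fl: "clinear f" if "f \<in> F" for f using F(2) that by blast
  define q where "q v = (\<Sum>f\<in>F. norm (op f v))" for v
  have q0: "q v \<ge> 0" for v by (simp add: q_def sum_nonneg)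
  have span_q: "\<exists>K\<ge>0. \<forall>v. norm (op y v) \<le> K * q v" if yF: "y \<in> cspan F" for y
  proof -
    obtain r where r: "\<forall>v. op y v = (\<Sum>f\<in>F. r f *\<^sub>C op f v)" using op_span[OF F(1) yF] by (elim exE)
    have "norm (op y v) \<le> (\<Sum>f\<in>F. cmod (r f)) * q v" for v
    proof -
      have "norm (op y v) \<le> (\<Sum>f\<in>F. norm (r f *\<^sub>C op f v))" using r by (simp add: norm_sum)
      also have "\<dots> = (\<Sum>f\<in>F. cmod (r f) * norm (op f v))" by (simp add: norm_scaleC)
      also have "\<dots> \<le> (\<Sum>f\<in>F. cmod (r f) * q v)"
        unfolding q_def by (intro sum_mono mult_left_mono member_le_sum F(1)) simp_all
      finally show ?thesis by (simp add: sum_distrib_right)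
    qed
    then show ?thesis by (intro exI[of _ "\<Sum>f\<in>F. cmod (r f)"]) (simp add: sum_nonneg)
  qed
  have "\<forall>f\<in>F. \<exists>K\<ge>0. \<forall>v. norm (op (C.conv (dual_star X f) f) v) \<le> K * q v"
    using span_q F(4) clinear_dual_star[OF Fl] by blast
  from bchoice[OF this] obtain K where K: "\<And>f. f \<in> F \<Longrightarrow> K f \<ge> 0"
    "\<And>f v. f \<in> F \<Longrightarrow> norm (op (C.conv (dual_star X f) f) v) \<le> K f * q v" by blast
  let ?K = "\<Sum>f\<in>F. K f"
  have K0: "?K \<ge> 0" by (intro sum_nonneg K(1))
  have sq: "(norm (op f v))\<^sup>2 \<le> ?K * q v * norm v" if f: "f \<in> F" and v: "v \<in> H0" for f v
  proof -
    note l = Fl[OF f]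
    have "complex_of_real ((norm (op f v))\<^sup>2) = cinner v (op (dual_star X f) (op f v))"
      using op_adj[OF clinear_dual_star[OF l] v op_closed[OF l v]] by (simp add: dual_star_star cinner_self)
    also have "\<dots> = cinner v (op (C.conv (dual_star X f) f) v)"
      by (simp add: op_conv[OF clinear_dual_star[OF l] l v])
    finally have "(norm (op f v))\<^sup>2 = Re (cinner v (op (C.conv (dual_star X f) f) v))"
      by (metis Re_complex_of_real)
    also have "\<dots> \<le> cmod (cinner v (op (C.conv (dual_star X f) f) v))" by (rule complex_Re_le_cmod)
    also have "\<dots> \<le> norm v * norm (op (C.conv (dual_star X f) f) v)" by (rule cinner_bound)
    also have "\<dots> \<le> norm v * (K f * q v)" by (intro mult_left_mono K(2)[OF f]) simp
    also have "\<dots> \<le> norm v * (?K * q v)"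
      using member_le_sum[OF f, of K] K(1) F(1) q0 by (intro mult_left_mono mult_right_mono) auto
    finally show ?thesis by (simp add: mult_ac)
  qed
  let ?n = "real (card F)"
  have qb: "q v \<le> ?n\<^sup>2 * ?K * norm v" if v: "v \<in> H0" for v
  proof (cases "q v = 0")
    case True then show ?thesis using K0 by simp
  next
    case False
    then have pos: "q v > 0" using q0[of v] by simp
    have "norm (op f v) \<le> sqrt (?K * q v * norm v)" if "f \<in> F" for f
      using sq[OF that v] by (simp add: real_le_rsqrt)
    then have "q v \<le> (\<Sum>f\<in>F. sqrt (?K * q v * norm v))" unfolding q_def by (rule sum_mono)
    then have "q v \<le> ?n * sqrt (?K * q v * norm v)" by simp
    then have "(q v)\<^sup>2 \<le> (?n * sqrt (?K * q v * norm v))\<^sup>2" using q0[of v] by (rule power_mono)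
    also have "\<dots> = ?n\<^sup>2 * (?K * q v * norm v)" using K0 q0[of v] by (simp add: power_mult_distrib)
    finally have "q v * q v \<le> q v * (?n\<^sup>2 * ?K * norm v)" by (simp add: power2_eq_square mult_ac)
    then show ?thesis using pos by simp
  qed
  obtain L where L: "L \<ge> 0" "\<forall>v. norm (op x v) \<le> L * q v" using span_q[OF F(3)] by (elim exE conjE)
  have "norm (op x v) \<le> (L * (?n\<^sup>2 * ?K)) * norm v" if v: "v \<in> H0" for v
  proof -
    have "norm (op x v) \<le> L * q v" using L(2) by blast
    also have "\<dots> \<le> L * (?n\<^sup>2 * ?K * norm v)" by (intro mult_left_mono qb[OF v] L(1))
    finally show ?thesis by (simp add: mult_ac)
  qed
  then show ?thesis by blast
qed

end

section \<open>Representations of the double\<close>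

locale dk_rep = dk X for X :: "('a::complex_algebra_1, 'c::complex_vector) dk_datum" +
  fixes \<pi>D :: "('a + ('c \<Rightarrow> complex)) star_term set \<Rightarrow> 'h \<Rightarrow> 'h::{complex_inner, complete_space}"
  assumes nondeg: "nondeg_star_rep (double X) \<pi>D"
begin

definition \<rho> :: "('a + ('c \<Rightarrow> complex)) star_term \<Rightarrow> 'h \<Rightarrow> 'h"
  where "\<rho> t = \<pi>D (tclass (double_rels X) t)"

lemma carrierI: "t \<in> DT \<Longrightarrow> tclass (double_rels X) t \<in> sa_carrier (double X)"
  by (simp add: double_carrier)

lemma rho_cong: "s \<simeq> t \<Longrightarrow> \<rho> s = \<rho> t"
  by (simp add: \<rho>_def tclass_eq_iff[symmetric])

lemma star_rep_D: "star_rep (double X) UNIV \<pi>D"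
  using nondeg by (simp add: nondeg_star_rep_def)

lemma rho_clinear: "t \<in> DT \<Longrightarrow> clinear (\<rho> t)"
  using star_rep_D carrierI[of t] unfolding star_rep_def clinear_on_def clinear_iff \<rho>_def by blast

lemma rho_bounded: "t \<in> DT \<Longrightarrow> bounded_linear (\<rho> t)"
  using nondeg carrierI[of t] unfolding nondeg_star_rep_def \<rho>_def by blast

lemma rho_add: 
  assumes "s \<in> DT" "t \<in> DT"
  shows "\<rho> (TAdd s t) v = \<rho> s v + \<rho> t v"
  using star_rep_D carrierI[OF assms(1)] carrierI[OF assms(2)]
  unfolding star_rep_def \<rho>_def double_ops(1)[symmetric] by blast

lemma rho_scale: 
  assumes "t \<in> DT"
  shows "\<rho> (TScale c t) v = c *\<^sub>C \<rho> t v"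
  using star_rep_D carrierI[OF assms]
  unfolding star_rep_def \<rho>_def double_ops(2)[symmetric] by blast

lemma rho_mult: 
  assumes "s \<in> DT" "t \<in> DT"
  shows "\<rho> (TMult s t) v = \<rho> s (\<rho> t v)"
  using star_rep_D carrierI[OF assms(1)] carrierI[OF assms(2)]
  unfolding star_rep_def \<rho>_def double_ops(3)[symmetric] by blast

lemma rho_adj: 
  assumes "t \<in> DT"
  shows "cinner v (\<rho> t w) = cinner (\<rho> (TStar t) v) w"
  using star_rep_D carrierI[OF assms]
  unfolding star_rep_def \<rho>_def double_ops(4)[symmetric] by blast

lemma rho_zero: "\<rho> TZero v = 0"
proof -
  have "\<rho> TZero v = \<rho> (TScale 0 TZero) v" by (rule fun_cong[OF rho_cong[OF teq_sym[OF star_cong.scale_zero]]])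
  then show ?thesis by (simp add: rho_scale[OF DT_zero])
qed

lemma rho_dense: "closure (cspan {\<rho> t v | t v. t \<in> DT}) = UNIV"
proof -
  have "{\<pi>D a v | a v. a \<in> sa_carrier (double X)} = {\<rho> t v | t v. t \<in> DT}"
    unfolding double_carrier \<rho>_def by blast
  then show ?thesis using nondeg by (simp add: nondeg_star_rep_def)
qed

text \<open>A representation is additive and the double is spanned by the products \<open>b x\<close>.\<close>
lemma rep_determined:
  assumes "dk_rep X \<pi>'" "\<And>b x v. b \<in> B \<Longrightarrow> x \<in> I \<Longrightarrow> \<pi>D (dprod X b x) v = \<pi>' (dprod X b x) v"
  shows "\<pi>D = \<pi>'"
proof -
  interpret P: dk_rep X \<pi>' by fact
  have "\<rho> t v = P.\<rho> t v" if "t \<in> DT" for t v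
    using that
  proof (induction rule: DT_induct)
    case (cong s t)
    then show ?case using rho_cong[OF cong(1)] P.rho_cong[OF cong(1)] by simp
  next
    case zero show ?case by (simp add: rho_zero P.rho_zero)
  next
    case (add s t) then show ?case by (simp add: rho_add P.rho_add)
  next
    case (prod b x) then show ?case using assms(2)[OF prod] by (simp add: \<rho>_def P.\<rho>_def dprod_def)
  qed
  then have *: "\<pi>D c = \<pi>' c" if "c \<in> sa_carrier (double X)" for c
    using that unfolding double_carrier \<rho>_def P.\<rho>_def by (auto intro: ext)
  show ?thesis
  proof (rule PiE_ext)
    show "\<pi>D \<in> sa_carrier (double X) \<rightarrow>\<^sub>E (UNIV \<rightarrow>\<^sub>E UNIV)" "\<pi>' \<in> sa_carrier (double X) \<rightarrow>\<^sub>E (UNIV \<rightarrow>\<^sub>E UNIV)"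
      using star_rep_D P.star_rep_D by (simp_all add: star_rep_def)
  qed (rule *)
qed

end

section \<open>From modules to representations\<close>

context dk_mod
begin

text \<open>The flag selects the operator or its adjoint, so that the star of a term can be evaluated. Generators that do not belong
  to the algebra act as zero: the congruence also relates terms containing them.\<close>
primrec gv :: "'a + ('c \<Rightarrow> complex) \<Rightarrow> bool \<Rightarrow> 'v \<Rightarrow> 'v" where
  "gv (Inl b) p = (if b \<in> B then \<pi>0 (if p then b else star X b) else (\<lambda>_. 0))"
| "gv (Inr x) p = (if clinear x then op (if p then x else dual_star X x) else (\<lambda>_. 0))"

primrec ev :: "('a + ('c \<Rightarrow> complex)) star_term \<Rightarrow> bool \<Rightarrow> 'v \<Rightarrow> 'v" where
  "ev (TGen g) p = gv g p"
| "ev TZero p = (\<lambda>_. 0)"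
| "ev TOne p = (\<lambda>v. v)"
| "ev (TAdd s t) p = (\<lambda>v. ev s p v + ev t p v)"
| "ev (TScale c s) p = (\<lambda>v. (if p then c else cnj c) *\<^sub>C ev s p v)"
| "ev (TMult s t) p = (\<lambda>v. if p then ev s p (ev t p v) else ev t p (ev s p v))"
| "ev (TStar s) p = ev s (\<not> p)"

lemma gv_closed: "v \<in> H0 \<Longrightarrow> gv g p v \<in> H0"
  by (cases g) (auto simp: pi_closed star_coinv op_closed clinear_dual_star subD)

lemma gv_lin: "clinear_on H0 (gv g p)"
proof (cases g)
  case (Inl b)
  then show ?thesis using pi_lin[of b] pi_lin[of "star X b"] star_coinv by (auto simp: clinear_on_def)
next
  case (Inr x)
  then show ?thesis using op_lin[of x] op_lin[OF clinear_dual_star[of x]] by (auto simp: clinear_on_def)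
qed

lemma gv_adj: "v \<in> H0 \<Longrightarrow> w \<in> H0 \<Longrightarrow> cinner v (gv g p w) = cinner (gv g (\<not> p) v) w"
proof (cases g)
  case (Inl b)
  assume vw: "v \<in> H0" "w \<in> H0"
  show ?thesis
  proof (cases "b \<in> B")
    case True
    then show ?thesis using Inl pi_adj[OF True vw] pi_adj[OF star_coinv[OF True] vw] by (simp add: A.star_star)
  next
    case False then show ?thesis using Inl by simp
  qed
next
  case (Inr x)
  assume vw: "v \<in> H0" "w \<in> H0"
  show ?thesis
  proof (cases "clinear x")
    case True
    then show ?thesis using Inr op_adj[OF True vw] op_adj[OF clinear_dual_star[OF True] vw]
      by (cases p) (simp_all add: dual_star_star)
  next
    case False then show ?thesis using Inr by simp
  qed
qed

lemma ev_closed: "v \<in> H0 \<Longrightarrow> ev t p v \<in> H0"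
  by (induction t arbitrary: p v) (simp_all add: gv_closed subD)

lemma ev_lin: "clinear_on H0 (ev t p)"
proof (induction t arbitrary: p)
  case (TGen g) show ?case by (simp add: gv_lin)
qed (simp_all add: clinear_on_def scale_simps ev_closed mult.commute)

lemma ev_adj: "v \<in> H0 \<Longrightarrow> w \<in> H0 \<Longrightarrow> cinner v (ev t p w) = cinner (ev t (\<not> p) v) w"
proof (induction t arbitrary: p v w)
  case (TGen g) then show ?case by (simp add: gv_adj)
qed (simp_all add: cinner_add_right cinner_add_left cinner_scaleC_right cinner_scaleC_left ev_closed)

lemma ev_adj_eq:
  assumes "\<And>v. v \<in> H0 \<Longrightarrow> ev s p v = ev t p v" "v \<in> H0"
  shows "ev s (\<not> p) v = ev t (\<not> p) v"
proof -
  let ?d = "ev s (\<not> p) v - ev t (\<not> p) v"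
  have d: "?d \<in> H0" by (intro subD ev_closed assms)
  have "cinner ?d ?d = cinner (ev s (\<not> p) v) ?d - cinner (ev t (\<not> p) v) ?d" by (rule cinner_diff_left)
  also have "\<dots> = 0" by (simp add: ev_adj[OF assms(2) d, symmetric] assms(1)[OF d])
  finally have "?d = 0" by (rule cinner_eq_zeroD)
  then show ?thesis by simp
qed

lemma ev_tsum: "ev (tsum us) True v = (\<Sum>t\<leftarrow>us. ev t True v)"
  by (induction us) (simp_all add: tsum_def)

lemma ev_rels:
  assumes "(s, t) \<in> double_rels X" "v \<in> H0"
  shows "ev s True v = ev t True v"
  using assms(1)
proof (cases rule: double_rels.cases)
  case (interchange b x bs)
  have bs: "comult X b = psum (\<otimes>) bs" using interchange(6) by (simp add: psum_def)
  have x: "clinear x" using interchange(4) by (simp add: full_dual_iff)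
  have "ev t True v = psum (\<lambda>b0 b1. ev (bx b0 (dual_act X x b1)) True v) bs"
    unfolding interchange(2) ev_tsum psum_def by (simp add: comp_def case_prod_unfold)
  also have "\<dots> = psum (\<lambda>b0 b1. \<pi>0 b0 (op (dual_act X x b1) v)) bs"
    using interchange(5) by (intro psum_cong) (auto simp: dual_act_clinear x)
  also have "\<dots> = op x (\<pi>0 b v)" by (rule op_pi[OF interchange(3) assms(2) x interchange(5) bs, symmetric])
  finally show ?thesis using interchange(1,3) x by simp
qed (use assms(2) in \<open>simp_all add: full_dual_iff csubspaceD[OF csubspace_coinv] pi_add pi_scale pi_mult mult_coinv
    star_coinv pi_one one_coinv op_add op_scale op_conv dual_mult_conv C.clinear_conv clinear_dual_star op_counit
    C.clinear_counit clinear_plus clinear_scaled\<close>)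

text \<open>For a defining relation it is enough to compare the operators: two elements with the same operator have the same
  adjoint, since the inner product is definite (\<open>ev_adj_eq\<close>).\<close>
lemma ev_cong:
  assumes "s \<simeq> t" "v \<in> H0"
  shows "ev s p v = ev t p v"
  using assms
proof (induction arbitrary: p v rule: star_cong.induct)
  case (rel s t)
  show ?case
  proof (cases p)
    case True then show ?thesis using ev_rels[OF rel] by simp
  next
    case False
    then show ?thesis using ev_adj_eq[of s True t v] ev_rels[OF rel(1)] rel(2) by simp
  qed
qed (simp_all add: ev_closed scale_simps mult.commute clinear_onD[OF ev_lin] add_ac)

lemma ev_DT_bounded:
  assumes "t \<in> DT"
  shows "\<exists>K. \<forall>v\<in>H0. norm (ev t True v) \<le> K * norm v"
  using assms
proof (induction rule: DT_induct)
  case (cong s t) then show ?case using ev_cong[OF cong(1)] by simp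
next
  case zero show ?case by (intro exI[of _ 0]) simp
next
  case (add s t)
  then obtain K L where "\<forall>v\<in>H0. norm (ev s True v) \<le> K * norm v" "\<forall>v\<in>H0. norm (ev t True v) \<le> L * norm v" by blast
  then have "\<forall>v\<in>H0. norm (ev (TAdd s t) True v) \<le> (K + L) * norm v"
    by (auto simp: distrib_right intro!: norm_triangle_mono)
  then show ?case by blast
next
  case (prod b x)
  obtain K where K: "\<forall>v\<in>H0. norm (\<pi>0 b v) \<le> K * norm v" using pi_bounded[OF prod(1)] by blast
  obtain L where L: "\<forall>v\<in>H0. norm (op x v) \<le> L * norm v" using op_bounded[OF prod(2)] by blast
  note x = C.rdual_clinear[OF prod(2)]
  have "norm (ev (bx b x) True v) \<le> (\<bar>K\<bar> * L) * norm v" if v: "v \<in> H0" for v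
  proof -
    have o: "op x v \<in> H0" by (rule op_closed[OF x v])
    have "norm (\<pi>0 b (op x v)) \<le> K * norm (op x v)" using K o by blast
    also have "\<dots> \<le> \<bar>K\<bar> * norm (op x v)" by (intro mult_right_mono) auto
    also have "\<dots> \<le> \<bar>K\<bar> * (L * norm v)" using L v by (intro mult_left_mono) auto
    finally show ?thesis using prod(1) x by (simp add: mult.assoc)
  qed
  then show ?case by blast
qed

text \<open>A local unit for the second legs of the coactions of finitely many vectors.\<close>
lemma op_unit:
  assumes "finite V" "V \<subseteq> H0"
  shows "\<exists>e\<in>I. \<forall>v\<in>V. op e v = v \<and> (\<forall>y. clinear y \<longrightarrow> op (C.conv y e) v = op y v)"
proof -
  have "\<forall>v\<in>V. \<exists>vs. set vs \<subseteq> H0 \<times> UNIV \<and> \<delta>0 v = psum (\<otimes>) vs"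
    using assms(2) by (intro ballI delta_list) blast
  from bchoice[OF this] obtain l where l0: "\<forall>v\<in>V. set (l v) \<subseteq> H0 \<times> UNIV \<and> \<delta>0 v = psum (\<otimes>) (l v)" ..
  let ?S = "\<Union>v\<in>V. snd ` set (l v)"
  have "fin_dim ?S" using assms(1) unfolding fin_dim_def
    by (intro exI[of _ ?S]) (auto intro: complex_vector.span_base)
  from local_unit[OF this] obtain D e where e: "C.stable D" "?S \<subseteq> D" "e \<in> I" "\<And>d. d \<in> D \<Longrightarrow> e d = ccounit X d"
    by blast
  note le = C.rdual_clinear[OF e(3)]
  have main: "op (C.conv y e) v = op y v" if v: "v \<in> V" and y: "clinear y" for v y
  proof -
    have vl: "\<delta>0 v = psum (\<otimes>) (l v)" using l0 v by blast
    have D: "c \<in> D" if "(w, c) \<in> set (l v)" for w c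
    proof -
      have "c \<in> snd ` set (l v)" using that by (intro image_eqI[of _ _ "(w, c)"]) simp_all
      then show ?thesis using e(2) v by blast
    qed
    show ?thesis unfolding op_def vl slice_psum[OF y] slice_psum[OF C.clinear_conv[OF y le]]
      by (rule psum_cong) (simp add: local_unit_conv[OF e(1) le e(4) D y])
  qed
  have "op e v = v" if v: "v \<in> V" for v
    using main[OF v C.clinear_counit] op_counit[of v] v assms(2) by (auto simp: C.conv_counit_left[OF le])
  then show ?thesis using main e(3) by blast
qed

end

locale dk_completed = dk_mod X H0 \<pi>0 \<delta>0
  for X :: "('a::complex_algebra_1, 'c::complex_vector) dk_datum"
    and H0 :: "'v::complex_inner set" and \<pi>0 \<delta>0 +
  fixes \<iota> :: "'v \<Rightarrow> 'h::{complex_inner, complete_space}"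
  assumes completion: "completion_map H0 \<iota>"
begin

lemma iota_lin: "clinear_on H0 \<iota>" and iota_inner: "v \<in> H0 \<Longrightarrow> w \<in> H0 \<Longrightarrow> cinner (\<iota> v) (\<iota> w) = cinner v w"
  and iota_dense: "closure (\<iota> ` H0) = UNIV"
  using completion by (simp_all add: completion_map_def)

lemma extension_exists:
  assumes "clinear_on H0 T" "\<And>v. v \<in> H0 \<Longrightarrow> T v \<in> H0" "\<forall>v\<in>H0. norm (T v) \<le> K * norm v"
  shows "\<exists>F. bounded_extension H0 \<iota> T F"
proof -
  have l: "clinear_on H0 (\<lambda>v. \<iota> (T v))"
    using clinear_onD[OF assms(1)] clinear_onD[OF iota_lin] assms(2) by (simp add: clinear_on_def)
  have "norm (\<iota> (T v)) \<le> K * norm v" if "v \<in> H0" for v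
    using assms that by (simp add: completion_norm[OF completion])
  from bounded_extension_exists[OF completion sub l this] show ?thesis
    unfolding bounded_extension_def by simp
qed

lemma extension_unique:
  assumes "bounded_linear F" "bounded_linear G" "\<And>v. v \<in> H0 \<Longrightarrow> F (\<iota> v) = G (\<iota> v)"
  shows "F = G"
proof (rule ext)
  fix x show "F x = G x"
    by (rule dense_eq[OF iota_dense bl_cont[OF assms(1)] bl_cont[OF assms(2)]]) (use assms(3) in auto)
qed

text \<open>The extensions to the completion of the operators by which terms act; the class of a term determines its operator on \<open>H0\<close>.\<close>
definition rep_of :: "('a + ('c \<Rightarrow> complex)) star_term set \<Rightarrow> 'h \<Rightarrow> 'h"
  where "rep_of = (\<lambda>c\<in>sa_carrier (double X). SOME F. clinear F \<and> bounded_linear F \<and>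
    (\<forall>t\<in>DT. c = tclass (double_rels X) t \<longrightarrow> (\<forall>v\<in>H0. F (\<iota> v) = \<iota> (ev t True v))))"

lemma rep_of:
  assumes t: "t \<in> DT"
  shows "clinear (rep_of (tclass (double_rels X) t))" "bounded_linear (rep_of (tclass (double_rels X) t))"
    "v \<in> H0 \<Longrightarrow> rep_of (tclass (double_rels X) t) (\<iota> v) = \<iota> (ev t True v)"
proof -
  let ?c = "tclass (double_rels X) t"
  define P where "P F \<longleftrightarrow> clinear F \<and> bounded_linear F \<and>
    (\<forall>t\<in>DT. ?c = tclass (double_rels X) t \<longrightarrow> (\<forall>v\<in>H0. F (\<iota> v) = \<iota> (ev t True v)))" for F
  obtain K where "\<forall>v\<in>H0. norm (ev t True v) \<le> K * norm v" using ev_DT_bounded[OF t] ..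
  from extension_exists[OF ev_lin ev_closed this] obtain F where F: "bounded_extension H0 \<iota> (ev t True) F" by blast
  have "P F"
    unfolding P_def
  proof (intro conjI ballI impI)
    show "clinear F" "bounded_linear F" using F by (simp_all add: bounded_extension_def)
    fix t' v assume "?c = tclass (double_rels X) t'" and v: "v \<in> H0"
    then have "t \<simeq> t'" by (simp add: tclass_eq_iff)
    then show "F (\<iota> v) = \<iota> (ev t' True v)" using F v ev_cong by (simp add: bounded_extension_def)
  qed
  then have "P (SOME F. P F)" by (rule someI[of P F])
  moreover have "rep_of ?c = (SOME F. P F)" unfolding rep_of_def P_def using t by (simp add: double_carrier)
  ultimately have P: "P (rep_of ?c)" by (simp only:)
  show "clinear (rep_of ?c)" "bounded_linear (rep_of ?c)" using P unfolding P_def by blast+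
  show "v \<in> H0 \<Longrightarrow> rep_of ?c (\<iota> v) = \<iota> (ev t True v)" using P t unfolding P_def by blast
qed

lemma rep_of_adj:
  assumes t: "t \<in> DT"
  shows "cinner v (rep_of (tclass (double_rels X) t) w) = cinner (rep_of (tclass (double_rels X) (TStar t)) v) w"
proof -
  let ?F = "rep_of (tclass (double_rels X) t)" and ?G = "rep_of (tclass (double_rels X) (TStar t))"
  note F = rep_of[OF t] and G = rep_of[OF DT_star[OF t]]
  have cF: "continuous_on UNIV (\<lambda>w. cinner x (?F w))" for x
    by (rule bl_cont[OF bounded_linear_compose[OF bounded_linear_cinner_right F(2)]])
  have cG: "continuous_on UNIV (\<lambda>v. cinner (?G v) y)" for y
    by (rule bl_cont[OF bounded_linear_compose[OF bounded_linear_cinner_left G(2)]])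
  have 1: "cinner (\<iota> x) (?F w) = cinner (?G (\<iota> x)) w" if x: "x \<in> H0" for x w
  proof (rule dense_eq[OF iota_dense cF bl_cont[OF bounded_linear_cinner_right]])
    fix z assume "z \<in> \<iota> ` H0"
    then obtain y where y: "y \<in> H0" "z = \<iota> y" by blast
    show "cinner (\<iota> x) (?F z) = cinner (?G (\<iota> x)) z"
      using ev_adj[OF x y(1), of t True] ev_closed x y(1)
      by (simp add: y(2) F(3) G(3) iota_inner)
  qed
  show ?thesis
    by (rule dense_eq[OF iota_dense bl_cont[OF bounded_linear_cinner_left] cG]) (use 1 in auto)
qed

text \<open>The algebraic identities hold on the dense image of \<open>\<iota>\<close>; local units show that this image lies in the range of the representation.\<close>
lemma nondeg_rep_of: "nondeg_star_rep (double X) rep_of"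
proof -
  let ?cl = "tclass (double_rels X)"
  have carr: "c \<in> sa_carrier (double X) \<longleftrightarrow> (\<exists>t\<in>DT. c = ?cl t)" for c
    unfolding double_carrier by blast
  have eq: "rep_of (?cl t) w = F w" if "t \<in> DT" "bounded_linear F" "\<And>v. v \<in> H0 \<Longrightarrow> F (\<iota> v) = \<iota> (ev t True v)" for t F w
    using extension_unique[OF rep_of(2)[OF that(1)] that(2)] rep_of(3)[OF that(1)] that(3) by simp
  have "star_rep (double X) UNIV rep_of"
    unfolding star_rep_def
  proof (intro conjI ballI allI)
    show "rep_of \<in> sa_carrier (double X) \<rightarrow>\<^sub>E (UNIV \<rightarrow>\<^sub>E UNIV)" by (simp add: rep_of_def PiE_UNIV_domain)
  next
    fix a assume "a \<in> sa_carrier (double X)"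
    then obtain s where s: "s \<in> DT" "a = ?cl s" unfolding carr by blast
    show "clinear_on UNIV (rep_of a)"
      using rep_of(1)[OF s(1)] unfolding s(2) by (simp add: clinear_on_def clinear_iff)
  next
    fix a b v assume "a \<in> sa_carrier (double X)" "b \<in> sa_carrier (double X)"
    then obtain s t where st: "s \<in> DT" "a = ?cl s" "t \<in> DT" "b = ?cl t" unfolding carr by blast
    show "rep_of (sa_add (double X) a b) v = rep_of a v + rep_of b v"
      unfolding st(2,4) double_ops
      by (rule eq[OF DT_add[OF st(1,3)] bounded_linear_add[OF rep_of(2)[OF st(1)] rep_of(2)[OF st(3)]]])
        (simp add: rep_of(3) st ev_closed clinear_onD[OF iota_lin])
    show "rep_of (sa_mult (double X) a b) v = rep_of a (rep_of b v)"
      unfolding st(2,4) double_ops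
      by (rule eq[OF DT_mult[OF st(1,3)] bounded_linear_compose[OF rep_of(2)[OF st(1)] rep_of(2)[OF st(3)]]])
        (simp add: rep_of(3) st ev_closed)
  next
    fix c a v assume "a \<in> sa_carrier (double X)"
    then obtain s where s: "s \<in> DT" "a = ?cl s" unfolding carr by blast
    show "rep_of (sa_scale (double X) c a) v = c *\<^sub>C rep_of a v"
      unfolding s(2) double_ops
      by (rule eq[OF DT_scale[OF s(1)] bounded_linear_compose[OF bounded_linear_scaleC rep_of(2)[OF s(1)]]])
        (simp add: rep_of(3) s ev_closed clinear_onD[OF iota_lin])
  next
    fix a v w assume "a \<in> sa_carrier (double X)"
    then obtain s where s: "s \<in> DT" "a = ?cl s" unfolding carr by blast
    show "cinner v (rep_of a w) = cinner (rep_of (sa_star (double X) a) v) w"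
      unfolding s(2) double_ops by (rule rep_of_adj[OF s(1)])
  qed
  moreover have "\<forall>a\<in>sa_carrier (double X). bounded_linear (rep_of a)"
  proof
    fix a assume "a \<in> sa_carrier (double X)"
    then obtain s where s: "s \<in> DT" "a = ?cl s" unfolding carr by blast
    show "bounded_linear (rep_of a)" unfolding s(2) by (rule rep_of(2)[OF s(1)])
  qed
  moreover have "closure (cspan {rep_of a v | a v. a \<in> sa_carrier (double X)}) = UNIV"
  proof -
    have "\<iota> v \<in> cspan {rep_of a v | a v. a \<in> sa_carrier (double X)}" if v: "v \<in> H0" for v
    proof -
      obtain e where e: "e \<in> I" "op e v = v" using op_unit[of "{v}"] v by auto
      have "rep_of (?cl (genI e)) (\<iota> v) = \<iota> v"
        using rep_of(3)[OF DT_genI[OF e(1)] v] e(2) C.rdual_clinear[OF e(1)] by simp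
      moreover have "?cl (genI e) \<in> sa_carrier (double X)" using DT_genI[OF e(1)] carr by blast
      ultimately have "\<iota> v \<in> {rep_of a v | a v. a \<in> sa_carrier (double X)}"
        by (intro CollectI exI[of _ "?cl (genI e)"] exI[of _ "\<iota> v"]) simp
      then show ?thesis by (rule complex_vector.span_base)
    qed
    then have "closure (\<iota> ` H0) \<subseteq> closure (cspan {rep_of a v | a v. a \<in> sa_carrier (double X)})"
      by (intro closure_mono) auto
    then show ?thesis unfolding iota_dense by auto
  qed
  ultimately show ?thesis unfolding nondeg_star_rep_def by (intro conjI)
qed

lemma rep_of_formula: "rep_formula X (H0, \<pi>0, \<delta>0) \<iota> rep_of"
  unfolding rep_formula_def prod.case restricted_dual_eq
proof (intro ballI)
  fix b x assume b: "b \<in> B" and x: "x \<in> I"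
  obtain K where K: "\<forall>v\<in>H0. norm (\<pi>0 b v) \<le> K * norm v" using pi_bounded[OF b] ..
  obtain L where L: "\<forall>v\<in>H0. norm (op x v) \<le> L * norm v" using op_bounded[OF x] ..
  note lx = C.rdual_clinear[OF x]
  obtain P where P: "bounded_extension H0 \<iota> (\<pi>0 b) P"
    using extension_exists[OF pi_lin[OF b] pi_closed[OF b] K] ..
  obtain Q where Q: "bounded_extension H0 \<iota> (op x) Q"
    using extension_exists[OF op_lin[OF lx] op_closed[OF lx] L] ..
  note Pd = P[unfolded bounded_extension_def] and Qd = Q[unfolded bounded_extension_def]
  have Q': "bounded_extension H0 \<iota> (dual_op H0 \<delta>0 x) Q"
    using Q by (simp add: bounded_extension_def dual_op_eq[OF lx])
  have "rep_of (dprod X b x) = P \<circ> Q"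
  proof (rule extension_unique)
    show "bounded_linear (rep_of (dprod X b x))" unfolding dprod_def by (rule rep_of(2)[OF DT_bx[OF b x]])
    show "bounded_linear (P \<circ> Q)" using Pd Qd unfolding comp_def
      by (intro bounded_linear_compose[of P Q]) blast+
    fix v assume v: "v \<in> H0"
    have "P (Q (\<iota> v)) = \<iota> (\<pi>0 b (op x v))" using Pd Qd v op_closed[OF lx v] by simp
    then show "rep_of (dprod X b x) (\<iota> v) = (P \<circ> Q) (\<iota> v)"
      unfolding dprod_def rep_of(3)[OF DT_bx[OF b x] v] using b lx by simp
  qed
  then show "\<exists>P Q. bounded_extension H0 \<iota> (\<pi>0 b) P \<and> bounded_extension H0 \<iota> (dual_op H0 \<delta>0 x) Q \<and>
      rep_of (dprod X b x) = P \<circ> Q" using P Q' by blast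
qed

lemma formula_on_core:
  assumes "rep_formula X (H0, \<pi>0, \<delta>0) \<iota> \<pi>D" "b \<in> B" "x \<in> I" "v \<in> H0"
  shows "\<pi>D (dprod X b x) (\<iota> v) = \<iota> (\<pi>0 b (op x v))"
proof -
  note f = assms(1)[unfolded rep_formula_def prod.case restricted_dual_eq]
  obtain P Q where PQ: "bounded_extension H0 \<iota> (\<pi>0 b) P" "bounded_extension H0 \<iota> (dual_op H0 \<delta>0 x) Q"
    "\<pi>D (dprod X b x) = P \<circ> Q"
    using bspec[OF bspec[OF f assms(2)] assms(3)] by (elim exE conjE)
  note lx = C.rdual_clinear[OF assms(3)]
  have "Q (\<iota> v) = \<iota> (op x v)"
    using PQ(2) assms(4) unfolding bounded_extension_def by (simp add: dual_op_eq[OF lx])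
  moreover have "P (\<iota> (op x v)) = \<iota> (\<pi>0 b (op x v))"
    using PQ(1) op_closed[OF lx assms(4)] unfolding bounded_extension_def by simp
  ultimately show ?thesis by (simp add: PQ(3))
qed

lemma rep_unique:
  assumes nd: "nondeg_star_rep (double X) \<pi>D" and rf: "rep_formula X (H0, \<pi>0, \<delta>0) \<iota> \<pi>D"
  shows "\<pi>D = rep_of"
proof -
  have R: "dk_rep X \<pi>D" and S: "dk_rep X rep_of"
    by (unfold_locales, rule nd, unfold_locales, rule nondeg_rep_of)
  show ?thesis
  proof (rule dk_rep.rep_determined[OF R S])
    fix b x v assume b: "b \<in> B" and x: "x \<in> I"
    have "\<pi>D (dprod X b x) = rep_of (dprod X b x)"
    proof (rule extension_unique)
      show "bounded_linear (\<pi>D (dprod X b x))"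
        using dk_rep.rho_bounded[OF R DT_bx[OF b x]] unfolding dk_rep.\<rho>_def[OF R] dprod_def .
      show "bounded_linear (rep_of (dprod X b x))" unfolding dprod_def by (rule rep_of(2)[OF DT_bx[OF b x]])
      fix v assume "v \<in> H0"
      then show "\<pi>D (dprod X b x) (\<iota> v) = rep_of (dprod X b x) (\<iota> v)"
        by (simp only: formula_on_core[OF rf b x] formula_on_core[OF rep_of_formula b x])
    qed
    then show "\<pi>D (dprod X b x) v = rep_of (dprod X b x) v" by simp
  qed
qed

lemma rep_unique':
  "nondeg_star_rep (double X) \<pi>D \<and> rep_formula X (H0, \<pi>0, \<delta>0) \<iota> \<pi>D \<Longrightarrow> \<pi>D = rep_of"
  by (rule rep_unique[OF conjunct1 conjunct2])

lemma rep_of_both: "nondeg_star_rep (double X) rep_of \<and> rep_formula X (H0, \<pi>0, \<delta>0) \<iota> rep_of"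
  by (rule conjI[OF nondeg_rep_of rep_of_formula])

lemma ex1_rep: "\<exists>!\<pi>D. nondeg_star_rep (double X) \<pi>D \<and> rep_formula X (H0, \<pi>0, \<delta>0) \<iota> \<pi>D"
  by (rule ex1I[of "\<lambda>\<pi>D. nondeg_star_rep (double X) \<pi>D \<and> rep_formula X (H0, \<pi>0, \<delta>0) \<iota> \<pi>D", OF rep_of_both rep_unique'])

lemma dk_to_rep_eq: "dk_to_rep X \<iota> (H0, \<pi>0, \<delta>0) = rep_of"
  unfolding dk_to_rep_def
  by (rule the_equality[of "\<lambda>\<pi>D. nondeg_star_rep (double X) \<pi>D \<and> rep_formula X (H0, \<pi>0, \<delta>0) \<iota> \<pi>D", OF rep_of_both rep_unique'])

end

section \<open>From representations to modules\<close>

lemma functionals_eqI: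
  assumes "\<And>f. clinear (f :: 'c::complex_vector \<Rightarrow> complex) \<Longrightarrow> f x = f y"
  shows "x = y"
proof (rule ccontr)
  assume "x \<noteq> y"
  then have "x - y \<notin> {0}" by simp
  then obtain f where f: "clinear f" "f (x - y) = (1::complex)"
    using functional_separates[of "{0}" "x - y"] by auto
  then show False using assms[OF f(1)] by (simp add: clinear_diff[OF f(1)])
qed

lemma clinear_pairing:
  assumes "clinear y" "clinear z"
  shows "clinear (ts (\<lambda>c d. y c * (z d :: complex)))"
  by (rule bal_clinear[OF bal_mult[OF assms]]) (simp add: clinear_scale[OF assms(1)])

text \<open>Product functionals already separate the points of \<open>C \<otimes> C\<close>, so they suffice as slicing functionals.\<close>
lemma tensor_eq_double_slices:
  fixes s t :: "('v::complex_vector, ('c::complex_vector, 'd::complex_vector) tensor) tensor"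
  assumes "\<And>y z. clinear y \<Longrightarrow> clinear z \<Longrightarrow>
    slice (ts (\<lambda>c d. y c * (z d :: complex))) s = slice (ts (\<lambda>c d. y c * z d)) t"
  shows "s = t"
proof -
  obtain K g where K: "finite K" "\<not> module.dependent scaleC K" "s - t = (\<Sum>k\<in>K. k \<otimes> g k)"
    using tensor_basis_left by blast
  have "g k = 0" if k: "k \<in> K" for k
  proof (rule tensor_eq_slices)
    fix z :: "'d \<Rightarrow> complex" assume z: "clinear z"
    show "slice z (g k) = slice z 0"
    proof (rule functionals_eqI)
      fix y :: "'c \<Rightarrow> complex" assume y: "clinear y"
      let ?p = "ts (\<lambda>c d. y c * z d)"
      note p = clinear_pairing[OF y z]
      have "(\<Sum>k\<in>K. ?p (g k) *\<^sub>C k) = slice ?p (s - t)"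
        by (simp only: K(3) clinear_sum[OF clinear_slice[OF p]] slice_pure[OF p])
      also have "\<dots> = 0" by (simp add: clinear_diff[OF clinear_slice[OF p]] assms[OF y z])
      finally have "?p (g k) = 0" using complex_vector.independentD[OF K(2,1) subset_refl _ k, of "\<lambda>k. ?p (g k)"] by blast
      moreover have "y (slice z (g k)) = ?p (g k)"
        unfolding slice_def by (simp add: ts_clinear[OF y] clinear_scale[OF y] mult.commute)
      moreover have "y (slice z 0) = 0" by (simp add: clinear_zero[OF clinear_slice[OF z]] clinear_zero[OF y])
      ultimately show "y (slice z (g k)) = y (slice z 0)" by simp
    qed
  qed
  then have "s - t = 0" using K(3) by (simp add: tensor_zero_right)
  then show ?thesis by simp
qed

context dk
begin

lemma tmult_add: "TMult (TAdd s t) u \<simeq> TAdd (TMult s u) (TMult t u)"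
  by (rule star_cong.add_mult)

lemma LM_scale: "s \<in> LM \<Longrightarrow> TScale c s \<in> LM"
  unfolding LM_def by (intro CollectI ballI, rule DT_cong[OF star_cong.scale_mult]) (simp add: DT_scale)

lemma LM_one: "TOne \<in> LM"
  unfolding LM_def by (intro CollectI ballI, rule DT_cong[OF star_cong.one_mult])

lemma LM_tps:
  assumes "\<And>a b. (a, b) \<in> set xs \<Longrightarrow> f a b \<in> LM"
  shows "tps f xs \<in> LM"
  using assms by (induction xs) (auto simp: tps_Cons intro: LM_zero LM_add)

end

context dk_rep
begin

definition core :: "'h set" where "core = rep_core X \<pi>D"

lemma core_eq: "core = cspan {\<rho> (genI x) h | x h. x \<in> I}"
  by (simp add: core_def rep_core_def \<rho>_def restricted_dual_eq)

lemma csubspace_core: "csubspace core"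
  by (simp add: core_eq)

lemmas coreD = csubspaceD[OF csubspace_core]

lemma rho_core: "x \<in> I \<Longrightarrow> \<rho> (genI x) h \<in> core"
  unfolding core_eq by (rule complex_vector.span_base) blast

lemma unit_rho: "e \<in> I \<Longrightarrow> x \<in> I \<Longrightarrow> C.conv e x = x \<Longrightarrow> \<rho> (genI e) (\<rho> (genI x) h) = \<rho> (genI x) h"
proof -
  assume e: "e \<in> I" and x: "x \<in> I" and c: "C.conv e x = x"
  have "\<rho> (genI e) (\<rho> (genI x) h) = \<rho> (TMult (genI e) (genI x)) h"
    by (rule rho_mult[OF DT_genI[OF e] DT_genI[OF x], symmetric])
  also have "\<dots> = \<rho> (genI (C.conv e x)) h"
    by (rule fun_cong[OF rho_cong[OF teq_sym[OF rel_I_mult[OF C.rdual_clinear[OF e] C.rdual_clinear[OF x]]]]])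
  finally show ?thesis by (simp only: c)
qed

lemma core_finite_support:
  assumes "v \<in> core"
  shows "\<exists>S. finite S \<and> S \<subseteq> I \<and> (\<forall>e\<in>I. (\<forall>x\<in>S. C.conv e x = x) \<longrightarrow> \<rho> (genI e) v = v)"
  using assms unfolding core_eq
proof (induction rule: complex_vector.span_induct_alt)
  case base
  show ?case by (intro exI[of _ "{}"]) (simp add: clinear_zero[OF rho_clinear[OF DT_genI]])
next
  case (step c u v)
  then obtain x h S where x: "u = \<rho> (genI x) h" "x \<in> I" and S: "finite S" "S \<subseteq> I"
    "\<And>e. e \<in> I \<Longrightarrow> (\<forall>x\<in>S. C.conv e x = x) \<Longrightarrow> \<rho> (genI e) v = v" by blast
  have "\<rho> (genI e) (c *\<^sub>C u + v) = c *\<^sub>C u + v" if e: "e \<in> I" "\<forall>y\<in>insert x S. C.conv e y = y" for e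
  proof -
    note l = rho_clinear[OF DT_genI[OF e(1)]]
    have "\<rho> (genI e) u = u" unfolding x(1) using e x(2) by (intro unit_rho) auto
    moreover have "\<rho> (genI e) v = v" using S(3) e by simp
    ultimately show ?thesis by (simp add: clinear_add[OF l] clinear_scale[OF l])
  qed
  then show ?case using S(1,2) x(2) by (intro exI[of _ "insert x S"]) simp
qed

text \<open>Finitely many vectors of \<open>\<pi>(I) \<H>\<close> involve only finitely many elements of \<open>I\<close>, which have a common left unit.\<close>
lemma core_unit:
  assumes "finite V" "V \<subseteq> core"
  shows "\<exists>e\<in>I. \<forall>v\<in>V. \<rho> (genI e) v = v"
proof -
  have "\<forall>v\<in>V. \<exists>S. finite S \<and> S \<subseteq> I \<and> (\<forall>e\<in>I. (\<forall>x\<in>S. C.conv e x = x) \<longrightarrow> \<rho> (genI e) v = v)"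
    using assms(2) by (intro ballI core_finite_support) blast
  from bchoice[OF this] obtain S where
    S: "\<forall>v\<in>V. finite (S v) \<and> S v \<subseteq> I \<and> (\<forall>e\<in>I. (\<forall>x\<in>S v. C.conv e x = x) \<longrightarrow> \<rho> (genI e) v = v)" ..
  have "finite (\<Union>v\<in>V. S v)" "(\<Union>v\<in>V. S v) \<subseteq> I" using S assms(1) by auto
  from common_unit[OF this] obtain e where e: "e \<in> I" "\<forall>x\<in>(\<Union>v\<in>V. S v). C.conv e x = x" by (elim bexE)
  have "\<rho> (genI e) v = v" if "v \<in> V" for v using S e that by blast
  then show ?thesis using e(1) by blast
qed

lemma core_unit1: "v \<in> core \<Longrightarrow> \<exists>e. e \<in> I \<and> \<rho> (genI e) v = v"
  using core_unit[of "{v}"] by auto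

lemma core_unit2: "v \<in> core \<Longrightarrow> w \<in> core \<Longrightarrow> \<exists>e. e \<in> I \<and> \<rho> (genI e) v = v \<and> \<rho> (genI e) w = w"
  using core_unit[of "{v, w}"] by auto

lemma DT_core:
  assumes "d \<in> DT"
  shows "\<rho> d h \<in> core"
proof -
  obtain e where e: "e \<in> I" "TMult (genI e) d \<simeq> d" using left_unit[OF assms] by (elim bexE)
  have "\<rho> (genI e) (\<rho> d h) = \<rho> d h"
    using rho_mult[OF DT_genI[OF e(1)] assms, of h] rho_cong[OF e(2)] by simp
  then show ?thesis using rho_core[OF e(1), of "\<rho> d h"] by (simp only:)
qed

lemma core_dense: "closure core = UNIV"
proof -
  have "{\<rho> t v | t v. t \<in> DT} \<subseteq> core" using DT_core by blast
  from cspan_subset[OF this csubspace_core] have "closure (cspan {\<rho> t v | t v. t \<in> DT}) \<subseteq> closure core"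
    by (rule closure_mono)
  then show ?thesis unfolding rho_dense by auto
qed

lemma core_completion: "completion_map core (id :: 'h \<Rightarrow> 'h)"
  by (simp add: completion_map_def core_dense clinear_on_def)


text \<open>The action of a left multiplier \<open>s\<close> of the double on its core \<open>\<pi>(I) \<H>\<close>. The choice of the unit \<open>e\<close> is immaterial (\<open>sop_eq\<close>): two units of
  \<open>v\<close> are both absorbed by a common unit \<open>f\<close>, so \<open>\<pi>(s e) v = \<pi>(s f) \<pi>(e) v = \<pi>(s f) v\<close>.\<close>
definition sop :: "('a + ('c \<Rightarrow> complex)) star_term \<Rightarrow> 'h \<Rightarrow> 'h"
  where "sop s v = \<rho> (TMult s (genI (SOME e. e \<in> I \<and> \<rho> (genI e) v = v))) v"

lemma sop_absorb:
  assumes s: "s \<in> LM" and f: "f \<in> I" and e: "e \<in> I" "C.conv f e = e" "\<rho> (genI e) v = v"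
  shows "\<rho> (TMult s (genI e)) v = \<rho> (TMult s (genI f)) v"
proof -
  note lf = C.rdual_clinear[OF f] and le = C.rdual_clinear[OF e(1)]
  have "genI e \<simeq> TMult (genI f) (genI e)" using rel_I_mult[OF lf le] by (simp only: e(2))
  then have "TMult s (genI e) \<simeq> TMult (TMult s (genI f)) (genI e)"
    by (rule teq_trans[OF mult_congR teq_mult_assoc'])
  then have "\<rho> (TMult s (genI e)) v = \<rho> (TMult (TMult s (genI f)) (genI e)) v"
    by (rule fun_cong[OF rho_cong])
  also have "\<dots> = \<rho> (TMult s (genI f)) (\<rho> (genI e) v)"
    by (rule rho_mult[OF LM_DT[OF s DT_genI[OF f]] DT_genI[OF e(1)]])
  finally show ?thesis by (simp only: e(3))
qed

lemma sop_eq: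
  assumes s: "s \<in> LM" and v: "v \<in> core" and e: "e \<in> I" "\<rho> (genI e) v = v"
  shows "sop s v = \<rho> (TMult s (genI e)) v"
proof -
  let ?e = "SOME e. e \<in> I \<and> \<rho> (genI e) v = v"
  have e': "?e \<in> I \<and> \<rho> (genI ?e) v = v" by (rule someI_ex[OF core_unit1[OF v]])
  obtain f where f: "f \<in> I" "\<forall>x\<in>{e, ?e}. C.conv f x = x"
    using common_unit[of "{e, ?e}"] e' e(1) by auto
  have "\<rho> (TMult s (genI ?e)) v = \<rho> (TMult s (genI f)) v" using e' f by (intro sop_absorb s) auto
  moreover have "\<rho> (TMult s (genI e)) v = \<rho> (TMult s (genI f)) v" using e f by (intro sop_absorb s) auto
  ultimately show ?thesis unfolding sop_def by simp
qed

lemma sop_core: "s \<in> LM \<Longrightarrow> v \<in> core \<Longrightarrow> sop s v \<in> core"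
  unfolding sop_def using someI_ex[OF core_unit1] by (intro DT_core LM_DT DT_genI) blast+

lemma sop_lin:
  assumes s: "s \<in> LM"
  shows "clinear_on core (sop s)"
  unfolding clinear_on_def
proof (intro conjI ballI allI)
  fix v w assume vw: "v \<in> core" "w \<in> core"
  obtain e where e: "e \<in> I" "\<rho> (genI e) v = v" "\<rho> (genI e) w = w" using core_unit2[OF vw] by blast
  have "\<rho> (genI e) (v + w) = v + w" by (simp add: clinear_add[OF rho_clinear[OF DT_genI[OF e(1)]]] e)
  from sop_eq[OF s coreD(2)[OF vw] e(1) this]
  show "sop s (v + w) = sop s v + sop s w"
    by (simp add: sop_eq[OF s vw(1) e(1,2)] sop_eq[OF s vw(2) e(1,3)]
        clinear_add[OF rho_clinear[OF LM_DT[OF s DT_genI[OF e(1)]]]])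
next
  fix c v assume v: "v \<in> core"
  obtain e where e: "e \<in> I" "\<rho> (genI e) v = v" using core_unit1[OF v] by blast
  have "\<rho> (genI e) (c *\<^sub>C v) = c *\<^sub>C v" by (simp add: clinear_scale[OF rho_clinear[OF DT_genI[OF e(1)]]] e)
  from sop_eq[OF s coreD(3)[OF v] e(1) this]
  show "sop s (c *\<^sub>C v) = c *\<^sub>C sop s v"
    by (simp add: sop_eq[OF s v e] clinear_scale[OF rho_clinear[OF LM_DT[OF s DT_genI[OF e(1)]]]])
qed

lemma sop_cong: "s \<simeq> t \<Longrightarrow> sop s v = sop t v"
  unfolding sop_def by (rule fun_cong[OF rho_cong[OF mult_congL]])

lemma sop_rho:
  assumes s: "s \<in> LM" and d: "d \<in> DT"
  shows "sop s (\<rho> d h) = \<rho> (TMult s d) h"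
proof -
  obtain e where e: "e \<in> I" "TMult (genI e) d \<simeq> d" using left_unit[OF d] by (elim bexE)
  have u: "\<rho> (genI e) (\<rho> d h) = \<rho> d h"
    using rho_mult[OF DT_genI[OF e(1)] d, of h] rho_cong[OF e(2)] by simp
  have "sop s (\<rho> d h) = \<rho> (TMult s (genI e)) (\<rho> d h)" by (rule sop_eq[OF s DT_core[OF d] e(1) u])
  also have "\<dots> = \<rho> (TMult (TMult s (genI e)) d) h"
    by (rule rho_mult[OF LM_DT[OF s DT_genI[OF e(1)]] d, symmetric])
  also have "\<dots> = \<rho> (TMult s d) h"
    by (rule fun_cong[OF rho_cong[OF teq_trans[OF teq_mult_assoc mult_congR[OF e(2)]]]])
  finally show ?thesis .
qed

lemma sop_add:
  assumes "s \<in> LM" "t \<in> LM" "v \<in> core"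
  shows "sop (TAdd s t) v = sop s v + sop t v"
proof -
  obtain e where e: "e \<in> I" "\<rho> (genI e) v = v" using core_unit1[OF assms(3)] by blast
  have "sop (TAdd s t) v = \<rho> (TAdd (TMult s (genI e)) (TMult t (genI e))) v"
    unfolding sop_eq[OF LM_add[OF assms(1,2)] assms(3) e] by (rule fun_cong[OF rho_cong[OF tmult_add]])
  then show ?thesis
    by (simp add: sop_eq[OF assms(1,3) e] sop_eq[OF assms(2,3) e] rho_add LM_DT[OF _ DT_genI[OF e(1)]] assms)
qed

lemma sop_scale:
  assumes "s \<in> LM" "v \<in> core"
  shows "sop (TScale c s) v = c *\<^sub>C sop s v"
proof -
  obtain e where e: "e \<in> I" "\<rho> (genI e) v = v" using core_unit1[OF assms(2)] by blast
  have "sop (TScale c s) v = \<rho> (TScale c (TMult s (genI e))) v"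
    unfolding sop_eq[OF LM_scale[OF assms(1)] assms(2) e] by (rule fun_cong[OF rho_cong[OF star_cong.scale_mult]])
  then show ?thesis
    by (simp add: sop_eq[OF assms e] rho_scale LM_DT[OF assms(1) DT_genI[OF e(1)]])
qed

lemma sop_mult:
  assumes s: "s \<in> LM" and t: "t \<in> LM" and v: "v \<in> core"
  shows "sop (TMult s t) v = sop s (sop t v)"
proof -
  obtain e where e: "e \<in> I" "\<rho> (genI e) v = v" using core_unit1[OF v] by blast
  have "sop (TMult s t) v = \<rho> (TMult s (TMult t (genI e))) v"
    unfolding sop_eq[OF LM_mult[OF s t] v e] by (rule fun_cong[OF rho_cong[OF teq_mult_assoc]])
  also have "\<dots> = sop s (\<rho> (TMult t (genI e)) v)"
    by (rule sop_rho[OF s LM_DT[OF t DT_genI[OF e(1)]], symmetric])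
  finally show ?thesis by (simp only: sop_eq[OF t v e])
qed

lemma sop_one: 
  assumes "v \<in> core"
  shows "sop TOne v = v"
proof -
  obtain e where e: "e \<in> I" "\<rho> (genI e) v = v" using core_unit1[OF assms] by blast
  have "sop TOne v = \<rho> (genI e) v"
    unfolding sop_eq[OF LM_one assms e] by (rule fun_cong[OF rho_cong[OF star_cong.one_mult]])
  then show ?thesis by (simp only: e(2))
qed

lemma sop_tps:
  assumes "\<And>a b. (a, b) \<in> set xs \<Longrightarrow> f a b \<in> LM" "v \<in> core"
  shows "sop (tps f xs) v = psum (\<lambda>a b. sop (f a b) v) xs"
  using assms(1)
proof (induction xs)
  case Nil
  have "sop TZero v = sop (TScale 0 TZero) v" by (rule sop_cong[OF teq_sym[OF star_cong.scale_zero]])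
  then show ?case by (simp add: sop_scale[OF LM_zero assms(2)])
next
  case (Cons p xs)
  then have "f (fst p) (snd p) \<in> LM" "tps f xs \<in> LM" by (auto intro!: LM_tps)
  then show ?case using Cons by (simp add: tps_Cons psum_Cons' sop_add assms(2))
qed

text \<open>With \<open>e\<close> a common unit of \<open>v\<close> and \<open>w\<close>, both sides equal the inner product of \<open>\<pi>(e\<^sup>* s\<^sup>* e) v\<close> with \<open>w\<close>.\<close>
lemma sop_adj:
  assumes s: "s \<in> LM" "TStar s \<in> LM" and vw: "v \<in> core" "w \<in> core"
  shows "cinner v (sop s w) = cinner (sop (TStar s) v) w"
proof -
  obtain e where e: "e \<in> I" "\<rho> (genI e) v = v" "\<rho> (genI e) w = w" using core_unit2[OF vw] by blast
  note De = DT_genI[OF e(1)]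
  have "TMult (TStar (TMult s (genI e))) (genI e) \<simeq> TMult (TStar (genI e)) (TMult (TStar s) (genI e))"
    by (rule teq_trans[OF mult_congL[OF star_cong.star_mult] teq_mult_assoc])
  note eq = fun_cong[OF rho_cong[OF this], of v]
  have "cinner v (sop s w) = cinner (\<rho> (TStar (TMult s (genI e))) v) w"
    unfolding sop_eq[OF s(1) vw(2) e(1,3)] by (rule rho_adj[OF LM_DT[OF s(1) De]])
  also have "\<rho> (TStar (TMult s (genI e))) v = \<rho> (TStar (TMult s (genI e))) (\<rho> (genI e) v)" by (simp only: e(2))
  also have "\<dots> = \<rho> (TMult (TStar (genI e)) (TMult (TStar s) (genI e))) v"
    unfolding eq[symmetric] by (rule rho_mult[OF DT_star[OF LM_DT[OF s(1) De]] De, symmetric])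
  also have "\<dots> = \<rho> (TStar (genI e)) (sop (TStar s) v)"
    unfolding sop_eq[OF s(2) vw(1) e(1,2)] by (rule rho_mult[OF DT_star[OF De] LM_DT[OF s(2) De]])
  also have "cinner (\<rho> (TStar (genI e)) (sop (TStar s) v)) w = cinner (sop (TStar s) v) (\<rho> (genI e) w)"
    by (rule rho_adj[OF De, symmetric])
  finally show ?thesis by (simp only: e(3))
qed

text \<open>The generators acting on the core: \<open>cop\<close> for functionals, \<open>bop\<close> for elements of \<open>B\<close>.\<close>
definition cop :: "('c \<Rightarrow> complex) \<Rightarrow> 'h \<Rightarrow> 'h" where "cop y = sop (genI y)"
definition bop :: "'a \<Rightarrow> 'h \<Rightarrow> 'h" where "bop b = sop (genB b)"

lemma cop_add: "clinear y \<Longrightarrow> clinear z \<Longrightarrow> v \<in> core \<Longrightarrow> cop (y + z) v = cop y v + cop z v"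
  unfolding cop_def using sop_cong[OF rel_I(1)] sop_add[OF LM_genI LM_genI] by simp

lemma cop_scale: "clinear y \<Longrightarrow> v \<in> core \<Longrightarrow> cop (c *\<^sub>C y) v = c *\<^sub>C cop y v"
  unfolding cop_def using sop_cong[OF rel_I(2)] sop_scale[OF LM_genI] by simp

lemma cop_conv: "clinear y \<Longrightarrow> clinear z \<Longrightarrow> v \<in> core \<Longrightarrow> cop y (cop z v) = cop (C.conv y z) v"
  unfolding cop_def using sop_cong[OF rel_I_mult] sop_mult[OF LM_genI LM_genI] by simp

lemma cop_counit: "v \<in> core \<Longrightarrow> cop (ccounit X) v = v"
  unfolding cop_def using sop_cong[OF rel_I(4)] sop_one by simp

lemma cop_adj: "clinear y \<Longrightarrow> v \<in> core \<Longrightarrow> w \<in> core \<Longrightarrow> cinner v (cop y w) = cinner (cop (dual_star X y) v) w"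
  unfolding cop_def sop_cong[OF rel_I(3)]
  using sop_adj[OF LM_genI LM_cong[OF teq_sym[OF rel_I(3)] LM_genI[OF clinear_dual_star]]] by blast

lemma cop_core: "clinear y \<Longrightarrow> v \<in> core \<Longrightarrow> cop y v \<in> core"
  unfolding cop_def by (rule sop_core[OF LM_genI])

lemma cop_lin: "clinear y \<Longrightarrow> clinear_on core (cop y)"
  unfolding cop_def by (rule sop_lin[OF LM_genI])

lemma cop_rho: "x \<in> I \<Longrightarrow> v \<in> core \<Longrightarrow> cop x v = \<rho> (genI x) v"
proof -
  assume x: "x \<in> I" and v: "v \<in> core"
  obtain e where e: "e \<in> I" "\<rho> (genI e) v = v" using core_unit1[OF v] by blast
  have "cop x v = \<rho> (TMult (genI x) (genI e)) v"
    unfolding cop_def by (rule sop_eq[OF LM_genI[OF C.rdual_clinear[OF x]] v e])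
  also have "\<dots> = \<rho> (genI x) v" unfolding rho_mult[OF DT_genI[OF x] DT_genI[OF e(1)]] by (simp only: e(2))
  finally show ?thesis .
qed

lemma bop_core: "b \<in> B \<Longrightarrow> v \<in> core \<Longrightarrow> bop b v \<in> core"
  unfolding bop_def by (rule sop_core[OF LM_genB])

lemma bop_lin: "b \<in> B \<Longrightarrow> clinear_on core (bop b)"
  unfolding bop_def by (rule sop_lin[OF LM_genB])

lemma bop_add: "a \<in> B \<Longrightarrow> b \<in> B \<Longrightarrow> v \<in> core \<Longrightarrow> bop (a + b) v = bop a v + bop b v"
  unfolding bop_def using sop_cong[OF rel_B(1)] sop_add[OF LM_genB LM_genB] by simp

lemma bop_scale: "b \<in> B \<Longrightarrow> v \<in> core \<Longrightarrow> bop (c *\<^sub>C b) v = c *\<^sub>C bop b v"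
  unfolding bop_def using sop_cong[OF rel_B(2)] sop_scale[OF LM_genB] by simp

lemma bop_mult: "a \<in> B \<Longrightarrow> b \<in> B \<Longrightarrow> v \<in> core \<Longrightarrow> bop (a * b) v = bop a (bop b v)"
  unfolding bop_def using sop_cong[OF rel_B(3)] sop_mult[OF LM_genB LM_genB] by simp

lemma bop_one: "v \<in> core \<Longrightarrow> bop 1 v = v"
  unfolding bop_def using sop_cong[OF rel_B(5)] sop_one by simp

lemma bop_adj: "b \<in> B \<Longrightarrow> v \<in> core \<Longrightarrow> w \<in> core \<Longrightarrow> cinner v (bop b w) = cinner (bop (star X b) v) w"
  unfolding bop_def sop_cong[OF rel_B(4)]
  using sop_adj[OF LM_genB LM_cong[OF teq_sym[OF rel_B(4)] LM_genB[OF star_coinv]]] by blast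

lemma cop_bop:
  assumes b: "b \<in> B" and y: "clinear y" and v: "v \<in> core"
    and bs: "set bs \<subseteq> B \<times> UNIV" "comult X b = psum (\<otimes>) bs"
  shows "cop y (bop b v) = psum (\<lambda>b0 b1. bop b0 (cop (dual_act X y b1) v)) bs"
proof -
  have bB: "b0 \<in> B" if "(b0, b1) \<in> set bs" for b0 b1 using that bs(1) by auto
  note ly = dual_act_clinear[OF y]
  have "cop y (bop b v) = sop (TMult (genI y) (genB b)) v"
    unfolding cop_def bop_def by (rule sop_mult[OF LM_genI[OF y] LM_genB[OF b] v, symmetric])
  also have "\<dots> = sop (tps (\<lambda>b0 b1. bx b0 (dual_act X y b1)) bs) v"
    by (rule sop_cong[OF rel_interchange[OF b y bs]])
  also have "\<dots> = psum (\<lambda>b0 b1. sop (bx b0 (dual_act X y b1)) v) bs"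
    by (rule sop_tps[OF LM_mult[OF LM_genB[OF bB] LM_genI[OF ly]] v])
  also have "\<dots> = psum (\<lambda>b0 b1. bop b0 (cop (dual_act X y b1) v)) bs"
    unfolding cop_def bop_def by (rule psum_cong) (rule sop_mult[OF LM_genB[OF bB] LM_genI[OF ly] v])
  finally show ?thesis .
qed

text \<open>If \<open>v = \<pi>(e) v\<close> and \<open>y\<close> kills a subcoalgebra containing \<open>e \<cdot> C\<close>, then \<open>y e = 0\<close>.\<close>
lemma core_support:
  assumes v: "v \<in> core"
  shows "\<exists>D. C.stable D \<and> fin_dim D \<and> (\<forall>y\<in>C.ann D. cop y v = 0)"
proof -
  obtain e where e: "e \<in> I" "\<rho> (genI e) v = v" using core_unit1[OF v] by blast
  note le = C.rdual_clinear[OF e(1)]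
  obtain D where D: "C.stable D" "fin_dim D" "\<forall>c. C.lact e c \<in> D" using C.rdual_range[OF e(1)] by blast
  have "cop y v = 0" if y: "y \<in> C.ann D" for y
  proof -
    note ly = annD[OF y]
    have "C.conv y e = 0" by (rule ext) (use D(3) y in \<open>simp add: C.conv_lact[OF ly] C.ann_def\<close>)
    then have "cop y (cop e v) = cop 0 v" using cop_conv[OF ly le v] by simp
    also have "\<dots> = 0" using cop_scale[OF le v, of 0] by (simp only: complex_vector.scale_zero_left)
    finally show ?thesis using cop_rho[OF e(1) v] e(2) by simp
  qed
  then show ?thesis using D by blast
qed

lemma cop_sum:
  assumes "finite S" "\<And>k. k \<in> S \<Longrightarrow> clinear (f k)" "v \<in> core"
  shows "cop (\<Sum>k\<in>S. f k) v = (\<Sum>k\<in>S. cop (f k) v) \<and> clinear (\<Sum>k\<in>S. f k)"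
  using assms(1,2)
proof (induction S rule: finite_induct)
  case empty
  have "cop 0 v = 0" using cop_scale[OF C.clinear_counit assms(3), of 0] by (simp only: complex_vector.scale_zero_left)
  moreover have "clinear (0 :: 'c \<Rightarrow> complex)" unfolding clinear_iff by simp
  ultimately show ?case by (simp only: sum.empty)
next
  case (insert k S)
  then have "cop (\<Sum>k\<in>S. f k) v = (\<Sum>k\<in>S. cop (f k) v)" "clinear (\<Sum>k\<in>S. f k)" "clinear (f k)" by blast+
  then show ?case unfolding sum.insert[OF insert(1,2)] by (simp only: cop_add[OF _ _ assms(3)] clinear_plus)
qed

text \<open>On a basis \<open>K\<close> of a supporting subcoalgebra with coordinate functionals \<open>\<phi>\<close>, the coaction is \<open>\<Sum> \<phi>\<^sub>k v \<otimes> k\<close>: any functional differs from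
  its expansion in the \<open>\<phi>\<^sub>k\<close> by one that kills the subcoalgebra.\<close>
lemma delta_exists:
  assumes v: "v \<in> core"
  shows "\<exists>t. t \<in> tensor_span core UNIV \<and> (\<forall>y. clinear y \<longrightarrow> slice y t = cop y v)"
proof -
  obtain D where D: "C.stable D" "fin_dim D" "\<forall>y\<in>C.ann D. cop y v = 0" using core_support[OF v] by blast
  obtain K where K: "finite K" "K \<subseteq> D" "\<not> module.dependent scaleC K" "D \<subseteq> cspan K"
    by (rule fin_dim_basis[OF D(2)])
  obtain \<phi> :: "'c \<Rightarrow> 'c \<Rightarrow> complex" where \<phi>: "\<And>k. clinear (\<phi> k)" "\<And>k l. l \<in> K \<Longrightarrow> \<phi> k l = (if l = k then 1 else 0)"
    using basis_functionals[OF K(3)] by blast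
  let ?t = "\<Sum>k\<in>K. cop (\<phi> k) v \<otimes> k"
  have "?t \<in> tensor_span core UNIV"
    unfolding tensor_span_def using cop_core[OF \<phi>(1) v]
    by (intro complex_vector.span_sum complex_vector.span_base) blast
  moreover have "slice y ?t = cop y v" if y: "clinear y" for y
  proof -
    (* the expansion of y in the coordinate functionals of K *)
    let ?f = "\<lambda>k. y k *\<^sub>C \<phi> k"
    have lf: "clinear (?f k)" for k by (rule clinear_scaled[OF \<phi>(1)])
    note cs = cop_sum[OF K(1) lf v]
    have lm: "clinear ((-1) *\<^sub>C (\<Sum>k\<in>K. ?f k))" by (rule clinear_scaled[OF conjunct2[OF cs]])
    have fk: "(\<Sum>k\<in>K. ?f k) l = y l" if l: "l \<in> K" for l
    proof -
      have ev: "(\<Sum>k\<in>S. g k) l = (\<Sum>k\<in>S. g k l)" for S and g :: "'c \<Rightarrow> 'c \<Rightarrow> complex"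
        by (induction S rule: infinite_finite_induct) simp_all
      have "(\<Sum>k\<in>K. ?f k) l = (\<Sum>k\<in>K. if k = l then y k else 0)"
        unfolding ev using l by (intro sum.cong) (auto simp: scaleC_fun_def \<phi>(2))
      then show ?thesis using K(1) l by simp
    qed
    have "y + (-1) *\<^sub>C (\<Sum>k\<in>K. ?f k) \<in> C.ann D"
    proof -
      let ?g = "y + (-1) *\<^sub>C (\<Sum>k\<in>K. ?f k)"
      have lg: "clinear ?g" by (rule clinear_plus[OF y lm])
      have gk: "?g l = 0" if "l \<in> K" for l using fk[OF that] by (simp add: scaleC_fun_def)
      have "?g d = 0" if "d \<in> cspan K" for d
        using that
      proof (induction rule: complex_vector.span_induct_alt)
        case base show ?case by (rule clinear_zero[OF lg])
      next
        case (step c x u)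
        then show ?case by (simp only: clinear_add[OF lg] clinear_scale[OF lg] gk) simp
      qed
      then show ?thesis using lg K(4) unfolding C.ann_def by blast
    qed
    then have "cop (y + (-1) *\<^sub>C (\<Sum>k\<in>K. ?f k)) v = 0" using D(3) by blast
    then have "cop y v + (-1) *\<^sub>C cop (\<Sum>k\<in>K. ?f k) v = 0"
      by (simp only: cop_add[OF y lm v] cop_scale[OF conjunct2[OF cs] v])
    then have "cop y v = cop (\<Sum>k\<in>K. ?f k) v" by (simp add: scaleC_minus1 eq_neg_iff_add_eq_0[symmetric])
    also have "\<dots> = (\<Sum>k\<in>K. cop (?f k) v)" by (rule conjunct1[OF cs])
    also have "\<dots> = (\<Sum>k\<in>K. y k *\<^sub>C cop (\<phi> k) v)" by (rule sum.cong) (simp_all add: cop_scale[OF \<phi>(1) v])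
    also have "\<dots> = slice y ?t" by (simp only: clinear_sum[OF clinear_slice[OF y]] slice_pure[OF y])
    finally show ?thesis by (rule HOL.sym)
  qed
  ultimately show ?thesis by blast
qed

definition cdelta :: "'h \<Rightarrow> ('h, 'c) tensor"
  where "cdelta = (\<lambda>v\<in>core. SOME t. t \<in> tensor_span core UNIV \<and> (\<forall>y. clinear y \<longrightarrow> slice y t = cop y v))"

definition cpi :: "'a \<Rightarrow> 'h \<Rightarrow> 'h"
  where "cpi = (\<lambda>b\<in>B. \<lambda>v\<in>core. bop b v)"

lemma cdelta:
  assumes "v \<in> core"
  shows "cdelta v \<in> tensor_span core UNIV" "clinear y \<Longrightarrow> slice y (cdelta v) = cop y v"
  using someI_ex[OF delta_exists[OF assms]] assms by (simp_all add: cdelta_def)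

lemma cpi: "b \<in> B \<Longrightarrow> v \<in> core \<Longrightarrow> cpi b v = bop b v"
  by (simp add: cpi_def)

sublocale pre: dk_pre X core cpi cdelta
proof unfold_locales
  show "csubspace core" by (rule csubspace_core)
  show "cdelta \<in> core \<rightarrow>\<^sub>E tensor_span core UNIV" using cdelta(1) by (auto simp: cdelta_def)
  show "clinear_on core cdelta"
    unfolding clinear_on_def
  proof (intro conjI ballI allI)
    fix v w assume vw: "v \<in> core" "w \<in> core"
    show "cdelta (v + w) = cdelta v + cdelta w"
    proof (rule tensor_eq_slices)
      fix y :: "'c \<Rightarrow> complex" assume y: "clinear y"
      show "slice y (cdelta (v + w)) = slice y (cdelta v + cdelta w)"
        by (simp add: clinear_add[OF clinear_slice[OF y]] cdelta(2)[OF _ y] vw coreD clinear_onD[OF cop_lin[OF y]])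
    qed
  next
    fix c v assume v: "v \<in> core"
    show "cdelta (c *\<^sub>C v) = c *\<^sub>C cdelta v"
    proof (rule tensor_eq_slices)
      fix y :: "'c \<Rightarrow> complex" assume y: "clinear y"
      show "slice y (cdelta (c *\<^sub>C v)) = slice y (c *\<^sub>C cdelta v)"
        by (simp add: clinear_scale[OF clinear_slice[OF y]] cdelta(2)[OF _ y] v coreD clinear_onD[OF cop_lin[OF y]])
    qed
  qed
  fix a b v c assume b: "b \<in> B"
  show "clinear_on core (cpi b)"
    using clinear_onD[OF bop_lin[OF b]] by (simp add: clinear_on_def cpi b coreD)
  assume v: "v \<in> core"
  show "cpi b v \<in> core" by (simp add: cpi b v bop_core)
  show "cpi (c *\<^sub>C b) v = c *\<^sub>C cpi b v" by (simp add: cpi b v csubspaceD[OF csubspace_coinv] bop_scale)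
  assume "a \<in> B"
  then show "cpi (a + b) v = cpi a v + cpi b v" by (simp add: cpi b v csubspaceD[OF csubspace_coinv] bop_add)
qed

lemma pre_op: "clinear y \<Longrightarrow> v \<in> core \<Longrightarrow> pre.op y v = cop y v"
  by (simp add: pre.op_def cdelta)

text \<open>Each axiom is an equation between tensors or vectors; after slicing it becomes an algebraic identity for \<open>cop\<close> and \<open>bop\<close>.\<close>
lemma core_module: "unitary_dk_module X (core, cpi, cdelta)"
proof -
  have "unitary_comodule X core cdelta"
    unfolding unitary_comodule_def
  proof (intro conjI ballI)
    fix v assume v: "v \<in> core"
    have "pre.coassoc_left v = pre.coassoc_right v"
      by (rule tensor_eq_double_slices)
        (simp add: pre.slice_coassoc v pre_op C.clinear_conv cop_core cop_conv)
    then show "tensor_assoc (sweedler core UNIV (\<lambda>w c. cdelta w \<otimes> c) (cdelta v)) =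
             sweedler core UNIV (\<lambda>w c. w \<otimes> ccomult X c) (cdelta v)"
      unfolding pre.coassoc_left_def pre.coassoc_right_def .
    show "sweedler core UNIV (\<lambda>w c. ccounit X c *\<^sub>C w) (cdelta v) = v"
      using pre.dual_op_eq[OF C.clinear_counit v] by (simp add: dual_op_def pre_op C.clinear_counit v cop_counit)
    fix w assume w: "w \<in> core"
    have "pre.unitary_left v w = pre.unitary_right v w"
      by (rule functionals_eqI)
        (simp add: pre.functional_unitary v w pre_op clinear_dual_star cop_adj)
    then show "sweedler core UNIV (\<lambda>w0 w1. cinner v w0 *\<^sub>C w1) (cdelta w) =
       sweedler core UNIV (\<lambda>v0 v1. cinner v0 w *\<^sub>C cdag X v1) (cdelta v)"
      unfolding pre.unitary_left_def pre.unitary_right_def .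
  qed (rule pre.sub pre.delta_maps pre.delta_lin)+
  moreover have "star_rep (coinv_alg X) core cpi"
    unfolding star_rep_def coinv_alg_def star_alg.simps
  proof (intro conjI ballI allI)
    show "cpi \<in> B \<rightarrow>\<^sub>E core \<rightarrow>\<^sub>E core" by (auto simp: cpi_def bop_core)
    show "clinear_on core (cpi b)" if "b \<in> B" for b by (rule pre.pi_lin[OF that])
    show "cpi (a + b) v = cpi a v + cpi b v" if "a \<in> B" "b \<in> B" "v \<in> core" for a b v by (rule pre.pi_add[OF that])
    show "cpi (c *\<^sub>C b) v = c *\<^sub>C cpi b v" if "b \<in> B" "v \<in> core" for c b v by (rule pre.pi_scale[OF that])
    show "cpi (a * b) v = cpi a (cpi b v)" if "a \<in> B" "b \<in> B" "v \<in> core" for a b v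
      using that by (simp add: cpi mult_coinv bop_core bop_mult)
    show "cinner v (cpi b w) = cinner (cpi (star X b) v) w" if "b \<in> B" "v \<in> core" "w \<in> core" for b v w
      using that by (simp add: cpi star_coinv bop_adj)
  qed
  moreover have "\<forall>v\<in>core. cpi 1 v = v" by (simp add: cpi one_coinv bop_one)
  moreover have "cdelta (cpi b v) = pre.delta_prod b v" if b: "b \<in> B" and v: "v \<in> core" for b v
  proof (rule tensor_eq_slices)
    fix y :: "'c \<Rightarrow> complex" assume y: "clinear y"
    obtain bs where bs: "set bs \<subseteq> B \<times> UNIV" "comult X b = psum (\<otimes>) bs" using comult_coinv[OF b] by (elim exE conjE)
    have bB: "b0 \<in> B" if "(b0, b1) \<in> set bs" for b0 b1 using that bs(1) by auto
    have "slice y (cdelta (cpi b v)) = cop y (bop b v)" by (simp add: cpi b v cdelta(2)[OF bop_core[OF b v] y])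
    also have "\<dots> = psum (\<lambda>b0 b1. bop b0 (cop (dual_act X y b1) v)) bs" by (rule cop_bop[OF b y v bs])
    also have "\<dots> = psum (\<lambda>b0 b1. cpi b0 (pre.op (dual_act X y b1) v)) bs"
      by (rule psum_cong) (simp add: pre_op dual_act_clinear[OF y] v cpi bB cop_core)
    also have "\<dots> = slice y (pre.delta_prod b v)" by (rule pre.slice_delta_prod[OF b v y bs, symmetric])
    finally show "slice y (cdelta (cpi b v)) = slice y (pre.delta_prod b v)" .
  qed
  ultimately show ?thesis unfolding unitary_dk_module_def prod.case pre.delta_prod_def by blast
qed

sublocale dk_completed X core cpi cdelta id
  by (unfold_locales, rule core_module, rule core_completion)

lemma core_formula: "rep_formula X (core, cpi, cdelta) id \<pi>D"
  unfolding rep_formula_def prod.case restricted_dual_eq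
proof (intro ballI)
  fix b x assume b: "b \<in> B" and x: "x \<in> I"
  note lx = C.rdual_clinear[OF x]
  obtain K where K: "\<forall>v\<in>core. norm (cpi b v) \<le> K * norm v" using pi_bounded[OF b] ..
  obtain P where P: "bounded_extension core id (cpi b) P"
    using extension_exists[OF pre.pi_lin[OF b] pre.pi_closed[OF b] K] ..
  have Q: "bounded_extension core id (dual_op core cdelta x) (\<rho> (genI x))"
    unfolding bounded_extension_def
    using rho_clinear[OF DT_genI[OF x]] rho_bounded[OF DT_genI[OF x]]
    by (simp add: pre.dual_op_eq[OF lx] pre_op[OF lx] cop_rho[OF x])
  have "\<pi>D (dprod X b x) = P \<circ> \<rho> (genI x)"
  proof (rule ext)
    fix h
    have "P (\<rho> (genI x) h) = bop b (\<rho> (genI x) h)"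
      using P rho_core[OF x, of h] by (simp add: bounded_extension_def cpi b)
    also have "\<dots> = \<rho> (bx b x) h" unfolding bop_def by (rule sop_rho[OF LM_genB[OF b] DT_genI[OF x]])
    finally show "\<pi>D (dprod X b x) h = (P \<circ> \<rho> (genI x)) h" by (simp add: \<rho>_def dprod_def)
  qed
  then show "\<exists>P Q. bounded_extension core id (cpi b) P \<and> bounded_extension core id (dual_op core cdelta x) Q \<and>
      \<pi>D (dprod X b x) = P \<circ> Q" using P Q by blast
qed

end

section \<open>Uniqueness, local completeness and the correspondence\<close>

context dk_rep
begin

text \<open>The formula prescribes the action of \<open>I\<close>, because \<open>1 \<in> B\<close>, and hence the coaction: on a given vector every functional \<open>y\<close> acts as
  \<open>y e \<in> I\<close>, for a local unit \<open>e\<close>. It also prescribes the action of \<open>B\<close> on \<open>v = \<pi>(e) v\<close>.\<close>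
lemma module_unique:
  assumes m: "unitary_dk_module X (core, \<pi>', \<delta>')" and f: "rep_formula X (core, \<pi>', \<delta>') id \<pi>D"
  shows "\<pi>' = cpi" "\<delta>' = cdelta"
proof -
  interpret N: dk_completed X core \<pi>' \<delta>' id
    by (unfold_locales, rule m, rule core_completion)
  have N: "\<rho> (bx b x) v = \<pi>' b (N.op x v)" if "b \<in> B" "x \<in> I" "v \<in> core" for b x v
    using N.formula_on_core[OF f that] by (simp add: \<rho>_def dprod_def)
  have Nop: "N.op x v = \<rho> (genI x) v" if x: "x \<in> I" and v: "v \<in> core" for x v
    using N[OF one_coinv x v] N.pi_one[OF N.op_closed[OF C.rdual_clinear[OF x] v]] rho_cong[OF bx_one] by simp
  have opy: "N.op y v = cop y v" if y: "clinear y" and v: "v \<in> core" for y v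
  proof -
    obtain e where e: "e \<in> I" "N.op e v = v" "N.op (C.conv y e) v = N.op y v"
      using N.op_unit[of "{v}"] v y by auto
    note le = C.rdual_clinear[OF e(1)]
    have "N.op y v = cop (C.conv y e) v"
      using Nop[OF C.rdual_mult_left[OF e(1) y] v] cop_rho[OF C.rdual_mult_left[OF e(1) y] v] e(3) by simp
    also have "\<dots> = cop y (cop e v)" by (rule cop_conv[OF y le v, symmetric])
    also have "cop e v = v" using cop_rho[OF e(1) v] Nop[OF e(1) v] e(2) by simp
    finally show ?thesis .
  qed
  have pb: "\<pi>' b v = bop b v" if b: "b \<in> B" and v: "v \<in> core" for b v
  proof -
    obtain e where e: "e \<in> I" "\<rho> (genI e) v = v" using core_unit1[OF v] by blast
    have "bop b v = \<rho> (bx b e) v" unfolding bop_def by (rule sop_eq[OF LM_genB[OF b] v e])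
    also have "\<dots> = \<pi>' b (N.op e v)" by (rule N[OF b e(1) v])
    finally show ?thesis by (simp only: Nop[OF e(1) v] e(2))
  qed
  have "star_rep (coinv_alg X) core \<pi>'" using m unfolding unitary_dk_module_def by blast
  then have P: "\<pi>' \<in> B \<rightarrow>\<^sub>E core \<rightarrow>\<^sub>E core" unfolding star_rep_def coinv_alg_def star_alg.simps by blast
  have Q: "cpi \<in> B \<rightarrow>\<^sub>E core \<rightarrow>\<^sub>E core" by (auto simp: cpi_def bop_core)
  show "\<pi>' = cpi"
  proof (rule PiE_ext[OF P Q])
    fix b assume b: "b \<in> B"
    show "\<pi>' b = cpi b"
      by (rule PiE_ext[OF PiE_mem[OF P b] PiE_mem[OF Q b]]) (simp add: pb[OF b] cpi[OF b])
  qed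
  show "\<delta>' = cdelta"
  proof (rule PiE_ext[OF N.delta_maps pre.delta_maps])
    fix v assume v: "v \<in> core"
    show "\<delta>' v = cdelta v"
    proof (rule tensor_eq_slices)
      fix y :: "'c \<Rightarrow> complex" assume y: "clinear y"
      show "slice y (\<delta>' v) = slice y (cdelta v)"
        using opy[OF y v] by (simp add: N.op_def cdelta(2)[OF v y])
    qed
  qed
qed

lemma module_unique':
  "fst M = rep_core X \<pi>D \<and> unitary_dk_module X M \<and> rep_formula X M id \<pi>D \<Longrightarrow> M = (core, cpi, cdelta)"
proof -
  assume M: "fst M = rep_core X \<pi>D \<and> unitary_dk_module X M \<and> rep_formula X M id \<pi>D"
  obtain \<pi>' \<delta>' where m: "M = (core, \<pi>', \<delta>')" using M by (cases M) (simp add: core_def)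
  note M' = M[unfolded m, THEN conjunct2]
  show ?thesis unfolding m by (simp only: module_unique[OF M'[THEN conjunct1] M'[THEN conjunct2]])
qed

lemma core_module_props: "fst (core, cpi, cdelta) = rep_core X \<pi>D \<and> unitary_dk_module X (core, cpi, cdelta) \<and>
    rep_formula X (core, cpi, cdelta) id \<pi>D"
  using core_module core_formula by (simp add: core_def)

lemma ex1_module: "\<exists>!M. fst M = rep_core X \<pi>D \<and> unitary_dk_module X M \<and> rep_formula X M id \<pi>D"
  by (rule ex1I[of "\<lambda>M. fst M = rep_core X \<pi>D \<and> unitary_dk_module X M \<and> rep_formula X M id \<pi>D",
        OF core_module_props module_unique'])

lemma rep_to_dk_eq: "rep_to_dk X \<pi>D = (core, cpi, cdelta)"
  unfolding rep_to_dk_def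
  by (rule the_equality[of "\<lambda>M. fst M = rep_core X \<pi>D \<and> unitary_dk_module X M \<and> rep_formula X M id \<pi>D",
        OF core_module_props module_unique'])

lemma dk_to_rep_core: "dk_to_rep X id (core, cpi, cdelta) = \<pi>D"
  unfolding dk_to_rep_eq by (rule rep_unique[OF nondeg core_formula, symmetric])

text \<open>On \<open>\<H>\<^sub>D\<close> a local unit \<open>e\<close> for \<open>D\<close> acts as the identity. So a limit \<open>l\<close> of vectors of \<open>\<H>\<^sub>D\<close> satisfies \<open>l = \<pi>(e) l\<close> and lies in the core;
  and if \<open>y\<close> kills \<open>D\<close>, then the bounded operator of \<open>y e \<in> I\<close> kills the approximating vectors and therefore \<open>l\<close>.\<close>
lemma core_locally_complete: "locally_complete X (core, cpi, cdelta)"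
  unfolding locally_complete_def prod.case
proof (intro allI impI)
  fix D assume sub: "subcoalgebra X D \<and> fin_dim D"
  note D = sub[THEN conjunct1, unfolded subcoalgebra_def, THEN conjunct1] sub[THEN conjunct2]
  let ?S = "{v \<in> core. cdelta v \<in> tensor_span core D}"
  obtain D' e where e: "D \<subseteq> D'" "e \<in> I" "\<forall>d\<in>D'. e d = ccounit X d"
    using local_unit[OF D(2)] by (elim exE conjE)
  note le = C.rdual_clinear[OF e(2)]
  have fix_e: "\<rho> (genI e) u = u" if u: "u \<in> ?S" for u
  proof -
    have uc: "u \<in> core" and t: "cdelta u \<in> tensor_span core D" using u by auto
    obtain xs where xs: "set xs \<subseteq> core \<times> D" "cdelta u = psum (\<otimes>) xs"
      using t unfolding tensor_span_psum[OF csubspace_core] by blast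
    have "slice e (cdelta u) = slice (ccounit X) (cdelta u)"
      unfolding xs(2) slice_psum[OF le] slice_psum[OF C.clinear_counit]
    proof (rule psum_cong)
      fix v c assume "(v, c) \<in> set xs"
      then have "c \<in> D'" using xs(1) e(1) by auto
      then show "e c *\<^sub>C v = ccounit X c *\<^sub>C v" by (simp only: bspec[OF e(3)])
    qed
    then show ?thesis
      using cdelta(2)[OF uc le] cdelta(2)[OF uc C.clinear_counit] cop_counit[OF uc] cop_rho[OF e(2) uc] by simp
  qed
  have "closed ?S"
    unfolding closed_sequential_limits
  proof (intro allI impI, elim conjE)
    fix s l assume s: "\<forall>n. s n \<in> ?S" and lim: "s \<longlonglongrightarrow> l"
    have sS: "s n \<in> ?S" for n by (rule s[rule_format])
    have sc: "s n \<in> core" for n using sS[of n] by simp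
    have lim_rho: "(\<lambda>n. \<rho> t (s n)) \<longlonglongrightarrow> \<rho> t l" if "t \<in> DT" for t
      by (rule bounded_linear.tendsto[OF rho_bounded[OF that] lim])
    have "(\<lambda>n. \<rho> (genI e) (s n)) \<longlonglongrightarrow> \<rho> (genI e) l" by (rule lim_rho[OF DT_genI[OF e(2)]])
    moreover have "\<rho> (genI e) (s n) = s n" for n by (rule fix_e[OF sS])
    ultimately have "s \<longlonglongrightarrow> \<rho> (genI e) l" by simp
    then have el: "\<rho> (genI e) l = l" using lim by (rule LIMSEQ_unique)
    have lc: "l \<in> core" using rho_core[OF e(2), of l] by (simp only: el)
    have "cdelta l \<in> tensor_span core D"
    proof (rule tensor_span_slices[OF csubspace_core D(1)])
      fix y :: "'c \<Rightarrow> complex" assume y: "clinear y"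
      show "slice y (cdelta l) \<in> core" by (simp add: cdelta(2)[OF lc y] cop_core[OF y lc])
      assume y0: "\<And>w. w \<in> D \<Longrightarrow> y w = 0"
      have ye: "C.conv y e \<in> I" by (rule C.rdual_mult_left[OF e(2) y])
      have cy: "cop y u = \<rho> (genI (C.conv y e)) u" if u: "u \<in> core" "\<rho> (genI e) u = u" for u
        using cop_conv[OF y le u(1)] cop_rho[OF e(2) u(1)] cop_rho[OF ye u(1)] u(2) by simp
      have "\<rho> (genI (C.conv y e)) (s n) = 0" for n
      proof -
        have sn: "cdelta (s n) \<in> tensor_span core D" using sS[of n] by simp
        have "cop y (s n) = slice y (cdelta (s n))" by (rule cdelta(2)[OF sc y, symmetric])
        also have "\<dots> = 0" by (rule slice_ann[OF y csubspace_core sn y0])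
        finally show ?thesis using cy[OF sc fix_e[OF sS]] by simp
      qed
      then have "(\<lambda>n. 0) \<longlonglongrightarrow> \<rho> (genI (C.conv y e)) l"
        using lim_rho[OF DT_genI[OF ye]] by simp
      then have "\<rho> (genI (C.conv y e)) l = 0" by (rule LIMSEQ_unique[OF _ tendsto_const])
      then show "slice y (cdelta l) = 0" by (simp add: cdelta(2)[OF lc y] cy[OF lc el])
    qed
    then show "l \<in> ?S" using lc by simp
  qed
  then show "complete ?S" by (simp only: complete_eq_closed)
qed

lemma core_mem:
  assumes "e \<in> I" "\<rho> (genI e) v = v"
  shows "v \<in> core"
  using rho_core[OF assms(1), of v] by (simp only: assms(2))

end

context dk_completed
begin

lemma rep_of_dk_rep: "dk_rep X rep_of"
  by (unfold_locales) (rule nondeg_rep_of)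

abbreviation "rcore \<equiv> dk_rep.core X rep_of"
abbreviation "rcop \<equiv> dk_rep.cop X rep_of"
abbreviation "rbop \<equiv> dk_rep.bop X rep_of"

lemma rep_of_genI: "x \<in> I \<Longrightarrow> v \<in> H0 \<Longrightarrow> dk_rep.\<rho> X rep_of (genI x) (\<iota> v) = \<iota> (op x v)"
  unfolding dk_rep.\<rho>_def[OF rep_of_dk_rep]
  using rep_of(3)[OF DT_genI] C.rdual_clinear by simp

lemma iota_unit:
  assumes "v \<in> H0"
  shows "\<exists>e\<in>I. op e v = v \<and> (\<forall>y. clinear y \<longrightarrow> op (C.conv y e) v = op y v) \<and> dk_rep.\<rho> X rep_of (genI e) (\<iota> v) = \<iota> v"
proof -
  obtain e where e: "e \<in> I" "op e v = v" "\<forall>y. clinear y \<longrightarrow> op (C.conv y e) v = op y v"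
    using op_unit[of "{v}"] assms by auto
  then show ?thesis using rep_of_genI[OF e(1) assms] by (intro bexI[of _ e]) simp_all
qed

lemma iota_core: "v \<in> H0 \<Longrightarrow> \<iota> v \<in> rcore"
  using iota_unit dk_rep.core_mem[OF rep_of_dk_rep] by blast

lemma rcop_iota:
  assumes y: "clinear y" and v: "v \<in> H0"
  shows "rcop y (\<iota> v) = \<iota> (op y v)"
proof -
  interpret R: dk_rep X rep_of by (rule rep_of_dk_rep)
  obtain e where e: "e \<in> I" "op (C.conv y e) v = op y v" "R.\<rho> (genI e) (\<iota> v) = \<iota> v"
    using iota_unit[OF v] y by blast
  note le = C.rdual_clinear[OF e(1)] and ye = C.rdual_mult_left[OF e(1) y] and c = iota_core[OF v]
  have "R.cop y (\<iota> v) = R.cop y (R.cop e (\<iota> v))" using R.cop_rho[OF e(1) c] e(3) by simp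
  also have "\<dots> = R.\<rho> (genI (C.conv y e)) (\<iota> v)" using R.cop_conv[OF y le c] R.cop_rho[OF ye c] by simp
  also have "\<dots> = \<iota> (op y v)" using rep_of_genI[OF ye v] e(2) by simp
  finally show ?thesis .
qed

lemma rbop_iota:
  assumes b: "b \<in> B" and v: "v \<in> H0"
  shows "rbop b (\<iota> v) = \<iota> (\<pi>0 b v)"
proof -
  interpret R: dk_rep X rep_of by (rule rep_of_dk_rep)
  obtain e where e: "e \<in> I" "op e v = v" "R.\<rho> (genI e) (\<iota> v) = \<iota> v"
    using iota_unit[OF v] by blast
  have "R.bop b (\<iota> v) = R.\<rho> (bx b e) (\<iota> v)"
    unfolding R.bop_def by (rule R.sop_eq[OF LM_genB[OF b] iota_core[OF v] e(1,3)])
  also have "\<dots> = \<iota> (ev (bx b e) True v)" unfolding R.\<rho>_def by (rule rep_of(3)[OF DT_bx[OF b e(1)] v])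
  finally show ?thesis using b C.rdual_clinear[OF e(1)] e(2) by simp
qed

lemma iota_inj: "inj_on \<iota> H0"
proof (rule inj_onI)
  fix v w assume vw: "v \<in> H0" "w \<in> H0" "\<iota> v = \<iota> w"
  have "norm (v - w) = norm (\<iota> (v - w))" using completion_norm[OF completion subD(4)[OF vw(1,2)]] by simp
  also have "\<dots> = 0" by (simp add: clinear_on_diff[OF iota_lin sub vw(1,2)] vw(3))
  finally show "v = w" by simp
qed

lemma iota_dist: "v \<in> H0 \<Longrightarrow> w \<in> H0 \<Longrightarrow> dist (\<iota> v) (\<iota> w) = dist v w"
  using completion_norm[OF completion subD(4)] clinear_on_diff[OF iota_lin sub] by (simp add: dist_norm)

text \<open>The coaction of \<open>x v\<close> is \<open>v\<^sub>(\<^sub>0\<^sub>) \<otimes> x \<cdot> v\<^sub>(\<^sub>1\<^sub>)\<close>.\<close>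
lemma op_range:
  assumes x: "x \<in> I" and D: "csubspace D" "\<And>c. C.lact x c \<in> D" and v: "v \<in> H0"
  shows "\<delta>0 (op x v) \<in> tensor_span H0 D"
proof (rule tensor_span_slices[OF sub D(1)])
  note lx = C.rdual_clinear[OF x]
  fix y :: "'c \<Rightarrow> complex" assume y: "clinear y"
  have s: "slice y (\<delta>0 (op x v)) = op (C.conv y x) v" using op_conv[OF y lx v] by (simp add: op_def[of y])
  show "slice y (\<delta>0 (op x v)) \<in> H0" unfolding s by (rule op_closed[OF C.clinear_conv[OF y lx] v])
  assume y0: "\<And>w. w \<in> D \<Longrightarrow> y w = 0"
  have "C.conv y x = 0" by (rule ext) (simp add: C.conv_lact[OF y] y0 D(2))
  then show "slice y (\<delta>0 (op x v)) = 0" unfolding s using op_scale[of 0 0 v] by (simp only: complex_vector.scale_zero_left)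
qed

text \<open>Let \<open>h\<close> be the limit of \<open>\<iota>(v\<^sub>n)\<close> and \<open>x \<in> I\<close>. All \<open>x v\<^sub>n\<close> lie in the single complete subspace \<open>\<H>\<^sub>D\<close>, where \<open>D\<close> contains \<open>x \<cdot> C\<close>, and form a
  Cauchy sequence because \<open>\<iota>\<close> is isometric. Hence \<open>\<pi>(x) h\<close> is in the image of \<open>\<iota>\<close>.\<close>
lemma iota_image:
  assumes lc: "locally_complete X (H0, \<pi>0, \<delta>0)"
  shows "\<iota> ` H0 = rcore"
proof
  show "\<iota> ` H0 \<subseteq> rcore" using iota_core by blast
  interpret R: dk_rep X rep_of by (rule rep_of_dk_rep)
  have subi: "csubspace (\<iota> ` H0)" unfolding csubspace_iff
  proof (intro conjI ballI allI)
    show "0 \<in> \<iota> ` H0" using clinear_on_zero[OF iota_lin subD(1)] subD(1) by (intro image_eqI[of _ _ 0]) simp_all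
  next
    fix x y assume "x \<in> \<iota> ` H0" "y \<in> \<iota> ` H0"
    then obtain v w where vw: "v \<in> H0" "w \<in> H0" "x = \<iota> v" "y = \<iota> w" by blast
    then show "x + y \<in> \<iota> ` H0" using clinear_onD(1)[OF iota_lin vw(1,2)] subD(2)[OF vw(1,2)]
      by (intro image_eqI[of _ _ "v + w"]) simp_all
  next
    fix c x assume "x \<in> \<iota> ` H0"
    then obtain v where v: "v \<in> H0" "x = \<iota> v" by blast
    then show "c *\<^sub>C x \<in> \<iota> ` H0" using clinear_onD(2)[OF iota_lin v(1)] subD(3)[OF v(1)]
      by (intro image_eqI[of _ _ "c *\<^sub>C v"]) simp_all
  qed
  have "R.\<rho> (genI x) h \<in> \<iota> ` H0" if x: "x \<in> I" for x h
  proof -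
    note lx = C.rdual_clinear[OF x]
    obtain D where D: "C.stable D" "fin_dim D" "\<And>c. C.lact x c \<in> D" using C.rdual_range[OF x] by blast
    have sD: "csubspace D" using D(1) by (simp add: C.stable_def)
    let ?S = "{v \<in> H0. \<delta>0 v \<in> tensor_span H0 D}"
    have "subcoalgebra X D" using D(1) unfolding C.stable_subcoalgebra subcoalgebra_def .
    then have compl: "complete ?S" using lc D(2) unfolding locally_complete_def prod.case by blast
    have "h \<in> closure (\<iota> ` H0)" by (simp add: iota_dense)
    then obtain s where s: "\<And>n. s n \<in> \<iota> ` H0" "s \<longlonglongrightarrow> h" unfolding closure_sequential by blast
    have "\<forall>n. \<exists>v. v \<in> H0 \<and> s n = \<iota> v" using s(1) by blast
    from choice[OF this] obtain v where v: "\<And>n. v n \<in> H0" "\<And>n. s n = \<iota> (v n)" by blast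
    define w where "w n = op x (v n)" for n
    have w: "w n \<in> H0" "w n \<in> ?S" "\<iota> (w n) = R.\<rho> (genI x) (s n)" for n
      using op_closed[OF lx v(1)] op_range[OF x sD D(3) v(1)] rep_of_genI[OF x v(1)] by (simp_all add: w_def v(2))
    have lim: "(\<lambda>n. \<iota> (w n)) \<longlonglongrightarrow> R.\<rho> (genI x) h"
      unfolding w(3) by (rule bounded_linear.tendsto[OF R.rho_bounded[OF DT_genI[OF x]] s(2)])
    have "Cauchy (\<lambda>n. \<iota> (w n))" by (rule LIMSEQ_imp_Cauchy[OF lim])
    then have "Cauchy w" unfolding Cauchy_def by (simp add: iota_dist w(1))
    then obtain l where l: "l \<in> ?S" "w \<longlonglongrightarrow> l" using completeE[OF compl, of w] w(2) by blast
    have "(\<lambda>n. \<iota> (w n)) \<longlonglongrightarrow> \<iota> l"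
      using l unfolding tendsto_iff by (simp add: iota_dist w(1))
    then have "R.\<rho> (genI x) h = \<iota> l" by (rule LIMSEQ_unique[OF lim])
    then show ?thesis using l(1) by blast
  qed
  then have "{R.\<rho> (genI x) h | x h. x \<in> I} \<subseteq> \<iota> ` H0" by blast
  from cspan_subset[OF this subi] show "rcore \<subseteq> \<iota> ` H0" unfolding R.core_eq .
qed

lemma slice_delta_map:
  assumes f: "clinear_on H0 f" and v: "v \<in> H0" and y: "clinear y"
  shows "slice y (sweedler H0 UNIV (\<lambda>w c. f w \<otimes> c) (\<delta>0 v)) = f (op y v)"
proof -
  obtain vs where vs: "set vs \<subseteq> H0 \<times> UNIV" "\<delta>0 v = psum (\<otimes>) vs" using delta_list[OF v] by (elim exE conjE)
  have vH: "w \<in> H0" if "(w, c) \<in> set vs" for w c using that vs(1) by auto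
  have b: "balanced_on H0 UNIV (\<lambda>w c. f w \<otimes> c)"
    unfolding balanced_on_def using clinear_onD[OF f] by (simp add: tensor_simps)
  have "slice y (psum (\<lambda>w c. f w \<otimes> c) vs) = psum (\<lambda>w c. slice y (f w \<otimes> c)) vs"
    by (rule psum_hom) (simp_all only: clinear_zero[OF clinear_slice[OF y]] clinear_add[OF clinear_slice[OF y]])
  also have "\<dots> = psum (\<lambda>w c. f (y c *\<^sub>C w)) vs"
    by (rule psum_cong) (simp add: slice_pure[OF y] clinear_onD(2)[OF f] vH)
  also have "\<dots> = f (psum (\<lambda>w c. y c *\<^sub>C w) vs)"
    by (rule clinear_on_psum[OF f sub, symmetric]) (simp add: subD vH)
  also have "\<dots> = f (op y v)" by (simp add: op_def vs(2) slice_psum[OF y])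
  finally show ?thesis unfolding sweedler_delta[OF v vs b] .
qed

lemma iota_iso:
  assumes lc: "locally_complete X (H0, \<pi>0, \<delta>0)"
  shows "dk_iso X \<iota> (H0, \<pi>0, \<delta>0) (rep_to_dk X rep_of)"
proof -
  interpret R: dk_rep X rep_of by (rule rep_of_dk_rep)
  show ?thesis unfolding R.rep_to_dk_eq dk_iso_def prod.case
  proof (intro conjI ballI)
    show "bij_betw \<iota> H0 R.core" using iota_inj iota_image[OF lc] by (simp add: bij_betw_def)
    show "clinear_on H0 \<iota>" by (rule iota_lin)
    fix v assume v: "v \<in> H0"
    show "cinner (\<iota> v) (\<iota> w) = cinner v w" if "w \<in> H0" for w by (rule iota_inner[OF v that])
    show "\<iota> (\<pi>0 b v) = R.cpi b (\<iota> v)" if "b \<in> B" for b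
      using rbop_iota[OF that v] R.cpi[OF that iota_core[OF v]] by simp
    show "R.cdelta (\<iota> v) = sweedler H0 UNIV (\<lambda>w c. \<iota> w \<otimes> c) (\<delta>0 v)"
    proof (rule tensor_eq_slices)
      fix y :: "'c \<Rightarrow> complex" assume y: "clinear y"
      show "slice y (R.cdelta (\<iota> v)) = slice y (sweedler H0 UNIV (\<lambda>w c. \<iota> w \<otimes> c) (\<delta>0 v))"
        unfolding slice_delta_map[OF iota_lin v y] R.cdelta(2)[OF iota_core[OF v] y] by (rule rcop_iota[OF y v])
    qed
  qed
qed

end

text \<open>On a fixed Hilbert space a locally complete module is the core of its representation, and \<open>module_unique\<close> identifies the structure.\<close>
lemma (in dk) recover_module:
  fixes H0 :: "'h::{complex_inner, complete_space} set"
  assumes m: "unitary_dk_module X (H0, \<pi>0, \<delta>0)" and lc: "locally_complete X (H0, \<pi>0, \<delta>0)"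
    and c: "completion_map H0 (id :: 'h \<Rightarrow> 'h)"
  shows "rep_to_dk X (dk_to_rep X id (H0, \<pi>0, \<delta>0)) = (H0, \<pi>0, \<delta>0)"
proof -
  interpret M: dk_completed X H0 \<pi>0 \<delta>0 id by (unfold_locales, rule m, rule c)
  interpret R: dk_rep X M.rep_of by (rule M.rep_of_dk_rep)
  have "H0 = R.core" using M.iota_image[OF lc] by simp
  then have "fst (H0, \<pi>0, \<delta>0) = rep_core X M.rep_of \<and> unitary_dk_module X (H0, \<pi>0, \<delta>0) \<and>
    rep_formula X (H0, \<pi>0, \<delta>0) id M.rep_of"
    using m M.rep_of_formula by (simp add: R.core_def)
  from R.module_unique'[OF this] show ?thesis
    unfolding M.dk_to_rep_eq R.rep_to_dk_eq by (rule HOL.sym)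
qed

subsection \<open>Isomorphisms\<close>

text \<open>The isomorphism and its inverse extend to the completions, and the extensions intertwine the operators of all terms.\<close>
lemma (in dk) module_iso_imp_rep_iso:
  fixes H0 :: "'v::complex_inner set" and \<iota> :: "'v \<Rightarrow> 'h::{complex_inner, complete_space}"
    and K0 :: "'w::complex_inner set" and \<kappa> :: "'w \<Rightarrow> 'k::{complex_inner, complete_space}"
  assumes m: "unitary_dk_module X (H0, \<pi>0, \<delta>0)" "completion_map H0 \<iota>"
    and n: "unitary_dk_module X (K0, \<rho>0, \<epsilon>0)" "completion_map K0 \<kappa>"
    and U: "dk_iso X U (H0, \<pi>0, \<delta>0) (K0, \<rho>0, \<epsilon>0)"
  shows "\<exists>F. rep_iso (double X) F (dk_to_rep X \<iota> (H0, \<pi>0, \<delta>0)) (dk_to_rep X \<kappa> (K0, \<rho>0, \<epsilon>0))"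
proof -
  interpret M: dk_completed X H0 \<pi>0 \<delta>0 \<iota> by (unfold_locales, rule m, rule m)
  interpret N: dk_completed X K0 \<rho>0 \<epsilon>0 \<kappa> by (unfold_locales, rule n, rule n)
  note U' = U[unfolded dk_iso_def prod.case]
  note bij = U'[THEN conjunct1] and U2 = U'[THEN conjunct2]
  note lin = U2[THEN conjunct1] and U3 = U2[THEN conjunct2]
  note inner = U3[THEN conjunct1, rule_format] and U4 = U3[THEN conjunct2]
  note Upi = U4[THEN conjunct1, rule_format] and Udelta = U4[THEN conjunct2, rule_format]
  have UK: "U v \<in> K0" if "v \<in> H0" for v using bij that by (auto simp: bij_betw_def)
  define V where "V = inv_into H0 U"
  have V: "V w \<in> H0" "U (V w) = w" if "w \<in> K0" for w
    using bij that by (auto simp: V_def bij_betw_def inv_into_into f_inv_into_f)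
  have VU: "V (U v) = v" if "v \<in> H0" for v using bij that by (simp add: V_def bij_betw_def)
  have Ueq: "V w = v" if "v \<in> H0" "U v = w" for v w using VU that by blast
  have Vlin: "clinear_on K0 V"
    unfolding clinear_on_def
  proof (intro conjI ballI allI)
    fix v w assume vw: "v \<in> K0" "w \<in> K0"
    show "V (v + w) = V v + V w"
      using V[OF vw(1)] V[OF vw(2)] by (intro Ueq) (simp_all add: M.subD clinear_onD[OF lin])
  next
    fix c v assume v: "v \<in> K0"
    show "V (c *\<^sub>C v) = c *\<^sub>C V v"
      using V[OF v] by (intro Ueq) (simp_all add: M.subD clinear_onD[OF lin])
  qed
  have cn: "norm x = norm y" if "cinner x x = cinner y y" for x :: "'x::complex_inner" and y :: "'y::complex_inner"
  proof -
    have "(norm x)\<^sup>2 = (norm y)\<^sup>2" using that unfolding cinner_self by (simp only: of_real_eq_iff)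
    then show ?thesis by (rule power2_eq_imp_eq) simp_all
  qed
  have l1: "clinear_on H0 (\<lambda>v. \<kappa> (U v))"
    by (simp add: clinear_on_def clinear_onD[OF lin] clinear_onD[OF N.iota_lin] UK)
  have b1: "norm (\<kappa> (U v)) \<le> 1 * norm v" if "v \<in> H0" for v
    using completion_norm[OF n(2) UK[OF that]] cn[OF inner[OF that that]] by simp
  obtain F where F: "clinear F" "bounded_linear F" "\<And>v. v \<in> H0 \<Longrightarrow> F (\<iota> v) = \<kappa> (U v)"
    using bounded_extension_exists[OF m(2) M.sub l1 b1] by blast
  have l2: "clinear_on K0 (\<lambda>w. \<iota> (V w))"
    by (simp add: clinear_on_def clinear_onD[OF Vlin] clinear_onD[OF M.iota_lin] V)
  have b2: "norm (\<iota> (V w)) \<le> 1 * norm w" if "w \<in> K0" for w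
    using completion_norm[OF m(2) V(1)[OF that]] cn[OF inner[OF V(1)[OF that] V(1)[OF that]]] V(2)[OF that] by simp
  obtain G where G: "clinear G" "bounded_linear G" "\<And>w. w \<in> K0 \<Longrightarrow> G (\<kappa> w) = \<iota> (V w)"
    using bounded_extension_exists[OF n(2) N.sub l2 b2] by blast
  have GF: "G (F x) = x" for x
  proof (rule dense_eq[OF M.iota_dense bl_cont[OF bounded_linear_compose[OF G(2) F(2)]] continuous_on_id])
    fix z assume "z \<in> \<iota> ` H0"
    then obtain v where "v \<in> H0" "z = \<iota> v" by blast
    then show "G (F z) = z" by (simp add: F(3) G(3) UK VU)
  qed
  have FG: "F (G x) = x" for x
  proof (rule dense_eq[OF N.iota_dense bl_cont[OF bounded_linear_compose[OF F(2) G(2)]] continuous_on_id])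
    fix z assume "z \<in> \<kappa> ` K0"
    then obtain v where "v \<in> K0" "z = \<kappa> v" by blast
    then show "F (G z) = z" by (simp add: F(3) G(3) V)
  qed
  have c1: "cinner (F (\<iota> v)) (F y) = cinner (\<iota> v) y" if v: "v \<in> H0" for v y
  proof (rule dense_eq[OF M.iota_dense bl_cont[OF bounded_linear_compose[OF bounded_linear_cinner_right F(2)]]
          bl_cont[OF bounded_linear_cinner_right]])
    fix z assume "z \<in> \<iota> ` H0"
    then obtain w where "w \<in> H0" "z = \<iota> w" by blast
    then show "cinner (F (\<iota> v)) (F z) = cinner (\<iota> v) z"
      using v by (simp add: F(3) N.iota_inner M.iota_inner UK inner)
  qed
  have c2: "cinner (F x) (F y) = cinner x y" for x y
    by (rule dense_eq[OF M.iota_dense bl_cont[OF bounded_linear_compose[OF bounded_linear_cinner_left F(2)]]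
          bl_cont[OF bounded_linear_cinner_left]]) (use c1 in auto)
  have Uop: "U (M.op y v) = N.op y (U v)" if y: "clinear y" and v: "v \<in> H0" for y v
    using M.slice_delta_map[OF lin v y] Udelta[OF v] by (simp add: N.op_def)
  have Uev: "\<forall>v\<in>H0. U (M.ev t True v) = N.ev t True (U v)" if "t \<in> DT" for t
    using that
  proof (induction rule: DT_induct)
    case (cong s t)
    then show ?case using M.ev_cong[OF cong(1)] N.ev_cong[OF cong(1)] UK by simp
  next
    case zero show ?case using clinear_on_zero[OF lin M.subD(1)] by simp
  next
    case (add s t) then show ?case by (simp add: clinear_onD[OF lin] M.ev_closed)
  next
    case (prod b x)
    note lx = C.rdual_clinear[OF prod(2)]
    show ?case using prod(1) lx by (simp add: Upi M.op_closed Uop)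
  qed
  have inter: "F (M.rep_of a x) = N.rep_of a (F x)" if a: "a \<in> sa_carrier (double X)" for a x
  proof -
    obtain t where t: "t \<in> DT" "a = tclass (double_rels X) t" using a unfolding double_carrier by blast
    show ?thesis unfolding t(2)
    proof (rule dense_eq[OF M.iota_dense bl_cont[OF bounded_linear_compose[OF F(2) M.rep_of(2)[OF t(1)]]]
            bl_cont[OF bounded_linear_compose[OF N.rep_of(2)[OF t(1)] F(2)]]])
      fix z assume "z \<in> \<iota> ` H0"
      then obtain v where v: "v \<in> H0" "z = \<iota> v" by blast
      show "F (M.rep_of (tclass (double_rels X) t) z) = N.rep_of (tclass (double_rels X) t) (F z)"
        unfolding v(2) M.rep_of(3)[OF t(1) v(1)] F(3)[OF v(1)] F(3)[OF M.ev_closed[OF v(1)]]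
          N.rep_of(3)[OF t(1) UK[OF v(1)]] bspec[OF Uev[OF t(1)] v(1)] ..
    qed
  qed
  have "bij F" by (rule o_bij[of G]) (simp_all add: fun_eq_iff GF FG)
  then have "rep_iso (double X) F M.rep_of N.rep_of"
    unfolding rep_iso_def by (intro conjI ballI allI F(1) c2 inter)
  then show ?thesis unfolding M.dk_to_rep_eq N.dk_to_rep_eq by (intro exI[of _ F])
qed

text \<open>An intertwining unitary restricts to the cores, which are the images of the two modules by \<open>iota_image\<close>, and there it commutes with
  the action of every left multiplier.\<close>
lemma (in dk) rep_iso_imp_module_iso:
  fixes H0 :: "'v::complex_inner set" and \<iota> :: "'v \<Rightarrow> 'h::{complex_inner, complete_space}"
    and K0 :: "'w::complex_inner set" and \<kappa> :: "'w \<Rightarrow> 'k::{complex_inner, complete_space}"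
  assumes m: "unitary_dk_module X (H0, \<pi>0, \<delta>0)" "completion_map H0 \<iota>" "locally_complete X (H0, \<pi>0, \<delta>0)"
    and n: "unitary_dk_module X (K0, \<rho>0, \<epsilon>0)" "completion_map K0 \<kappa>" "locally_complete X (K0, \<rho>0, \<epsilon>0)"
    and iso: "rep_iso (double X) F (dk_to_rep X \<iota> (H0, \<pi>0, \<delta>0)) (dk_to_rep X \<kappa> (K0, \<rho>0, \<epsilon>0))"
  shows "\<exists>U. dk_iso X U (H0, \<pi>0, \<delta>0) (K0, \<rho>0, \<epsilon>0)"
proof -
  interpret M: dk_completed X H0 \<pi>0 \<delta>0 \<iota> by (unfold_locales, rule m, rule m)
  interpret N: dk_completed X K0 \<rho>0 \<epsilon>0 \<kappa> by (unfold_locales, rule n, rule n)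
  interpret R: dk_rep X M.rep_of by (rule M.rep_of_dk_rep)
  interpret S: dk_rep X N.rep_of by (rule N.rep_of_dk_rep)
  have iso': "rep_iso (double X) F M.rep_of N.rep_of"
    using iso unfolding M.dk_to_rep_eq N.dk_to_rep_eq .
  note i1 = iso'[unfolded rep_iso_def]
  note bijF = i1[THEN conjunct1] and i2 = i1[THEN conjunct2]
  note linF = i2[THEN conjunct1] and i3 = i2[THEN conjunct2]
  note inner = i3[THEN conjunct1, rule_format] and inter = i3[THEN conjunct2, rule_format]
  have Frho: "F (R.\<rho> t h) = S.\<rho> t (F h)" if "t \<in> DT" for t h
    unfolding R.\<rho>_def S.\<rho>_def by (rule inter[OF R.carrierI[OF that]])
  have Fcore: "F h \<in> S.core" if h: "h \<in> R.core" for h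
  proof -
    obtain e where e: "e \<in> I" "R.\<rho> (genI e) h = h" using R.core_unit1[OF h] by blast
    have "S.\<rho> (genI e) (F h) = F h" using Frho[OF DT_genI[OF e(1)], of h] e(2) by simp
    then show ?thesis by (rule S.core_mem[OF e(1)])
  qed
  have Fcore': "h \<in> R.core" if h: "F h \<in> S.core" for h
  proof -
    obtain e where e: "e \<in> I" "S.\<rho> (genI e) (F h) = F h" using S.core_unit1[OF h] by blast
    then have "F (R.\<rho> (genI e) h) = F h" using Frho[OF DT_genI[OF e(1)], of h] by simp
    then have "R.\<rho> (genI e) h = h" using bijF by (simp add: bij_def inj_eq)
    then show ?thesis by (rule R.core_mem[OF e(1)])
  qed
  have Fsop: "F (R.sop s h) = S.sop s (F h)" if s: "s \<in> LM" and h: "h \<in> R.core" for s h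
  proof -
    obtain e where e: "e \<in> I" "R.\<rho> (genI e) h = h" using R.core_unit1[OF h] by blast
    have e': "S.\<rho> (genI e) (F h) = F h" using Frho[OF DT_genI[OF e(1)], of h] e(2) by simp
    show ?thesis unfolding R.sop_eq[OF s h e] S.sop_eq[OF s Fcore[OF h] e(1) e']
      by (rule Frho[OF LM_DT[OF s DT_genI[OF e(1)]]])
  qed
  define U where "U v = inv_into K0 \<kappa> (F (\<iota> v))" for v
  have img: "\<iota> ` H0 = R.core" "\<kappa> ` K0 = S.core" by (rule M.iota_image[OF m(3)], rule N.iota_image[OF n(3)])
  have FK: "F (\<iota> v) \<in> \<kappa> ` K0" if "v \<in> H0" for v unfolding img(2) by (rule Fcore[OF M.iota_core[OF that]])
  have U: "U v \<in> K0" "\<kappa> (U v) = F (\<iota> v)" if "v \<in> H0" for v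
    unfolding U_def by (rule inv_into_into[OF FK[OF that]], rule f_inv_into_f[OF FK[OF that]])
  have Ueq: "U v = w" if "v \<in> H0" "w \<in> K0" "\<kappa> w = F (\<iota> v)" for v w
    by (rule inj_onD[OF N.iota_inj _ U(1)[OF that(1)] that(2)]) (simp only: U(2)[OF that(1)] that(3))
  have Ulin: "clinear_on H0 U"
    unfolding clinear_on_def
  proof (intro conjI ballI allI)
    fix v w assume vw: "v \<in> H0" "w \<in> H0"
    show "U (v + w) = U v + U w"
      by (rule Ueq) (simp_all add: vw M.subD N.subD U clinear_onD[OF N.iota_lin] clinear_onD[OF M.iota_lin] clinear_add[OF linF])
  next
    fix c v assume v: "v \<in> H0"
    show "U (c *\<^sub>C v) = c *\<^sub>C U v"
      by (rule Ueq) (simp_all add: v M.subD N.subD U clinear_onD[OF N.iota_lin] clinear_onD[OF M.iota_lin] clinear_scale[OF linF])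
  qed
  have "bij_betw U H0 K0"
    unfolding bij_betw_def
  proof
    show "inj_on U H0"
    proof (rule inj_onI)
      fix v w assume vw: "v \<in> H0" "w \<in> H0" "U v = U w"
      then have "F (\<iota> v) = F (\<iota> w)" using U(2)[OF vw(1)] U(2)[OF vw(2)] by simp
      then have "\<iota> v = \<iota> w" using bijF by (simp add: bij_def inj_eq)
      then show "v = w" by (rule inj_onD[OF M.iota_inj _ vw(1,2)])
    qed
    show "U ` H0 = K0"
    proof (intro subset_antisym subsetI)
      show "w \<in> K0" if "w \<in> U ` H0" for w using that U(1) by blast
      fix w assume w: "w \<in> K0"
      have "\<kappa> w \<in> range F" using bij_is_surj[OF bijF] by simp
      then obtain h where h: "F h = \<kappa> w" by (elim rangeE) simp
      have "h \<in> R.core" by (rule Fcore') (simp add: h N.iota_core[OF w])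
      then obtain v where v: "v \<in> H0" "h = \<iota> v" using img(1) by blast
      have "U v = w" by (rule Ueq[OF v(1) w]) (simp add: h v(2)[symmetric])
      then show "w \<in> U ` H0" using v(1) by blast
    qed
  qed
  moreover have "cinner (U v) (U w) = cinner v w" if "v \<in> H0" "w \<in> H0" for v w
    using N.iota_inner[OF U(1)[OF that(1)] U(1)[OF that(2)]] U(2)[OF that(1)] U(2)[OF that(2)]
      inner[of "\<iota> v" "\<iota> w"] M.iota_inner[OF that] by simp
  moreover have "U (\<pi>0 b v) = \<rho>0 b (U v)" if b: "b \<in> B" and v: "v \<in> H0" for b v
  proof (rule Ueq[OF M.pi_closed[OF b v] N.pi_closed[OF b U(1)[OF v]]])
    have "\<kappa> (\<rho>0 b (U v)) = S.bop b (F (\<iota> v))" using N.rbop_iota[OF b U(1)[OF v]] U(2)[OF v] by simp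
    also have "\<dots> = F (R.bop b (\<iota> v))"
      unfolding R.bop_def S.bop_def by (rule Fsop[OF LM_genB[OF b] M.iota_core[OF v], symmetric])
    also have "\<dots> = F (\<iota> (\<pi>0 b v))" by (simp only: M.rbop_iota[OF b v])
    finally show "\<kappa> (\<rho>0 b (U v)) = F (\<iota> (\<pi>0 b v))" .
  qed
  moreover have "\<epsilon>0 (U v) = sweedler H0 UNIV (\<lambda>w c. U w \<otimes> c) (\<delta>0 v)" if v: "v \<in> H0" for v
  proof (rule tensor_eq_slices)
    fix y :: "'c \<Rightarrow> complex" assume y: "clinear y"
    have "U (M.op y v) = N.op y (U v)"
    proof (rule Ueq[OF M.op_closed[OF y v] N.op_closed[OF y U(1)[OF v]]])
      have "\<kappa> (N.op y (U v)) = S.cop y (F (\<iota> v))" using N.rcop_iota[OF y U(1)[OF v]] U(2)[OF v] by simp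
      also have "\<dots> = F (R.cop y (\<iota> v))"
        unfolding R.cop_def S.cop_def by (rule Fsop[OF LM_genI[OF y] M.iota_core[OF v], symmetric])
      also have "\<dots> = F (\<iota> (M.op y v))" by (simp only: M.rcop_iota[OF y v])
      finally show "\<kappa> (N.op y (U v)) = F (\<iota> (M.op y v))" .
    qed
    then show "slice y (\<epsilon>0 (U v)) = slice y (sweedler H0 UNIV (\<lambda>w c. U w \<otimes> c) (\<delta>0 v))"
      unfolding M.slice_delta_map[OF Ulin v y] by (simp only: N.op_def)
  qed
  ultimately have "dk_iso X U (H0, \<pi>0, \<delta>0) (K0, \<rho>0, \<epsilon>0)"
    unfolding dk_iso_def prod.case using Ulin by blast
  then show ?thesis by blast
qed

lemma (in dk) completed_moduleI:
  "unitary_dk_module X (H0, \<pi>0, \<delta>0) \<Longrightarrow> completion_map H0 \<iota> \<Longrightarrow> dk_completed X H0 \<pi>0 \<delta>0 \<iota>"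
  by (simp add: dk_completed_def dk_completed_axioms_def dk_mod_def dk_mod_axioms_def dk_axioms)

lemma (in dk) repI: "nondeg_star_rep (double X) \<pi>D \<Longrightarrow> dk_rep X \<pi>D"
  by (simp add: dk_rep_def dk_rep_axioms_def dk_axioms)

lemma (in dk) bij_modules_reps:
  "bij_betw (dk_to_rep X id)
    {M :: ('a, 'c, 'h::{complex_inner, complete_space}) dk_module. unitary_dk_module X M \<and> locally_complete X M \<and>
       completion_map (fst M) (id :: 'h \<Rightarrow> 'h)}
    {\<pi>D. nondeg_star_rep (double X) \<pi>D}"
proof (rule bij_betw_byWitness[where f' = "rep_to_dk X"])
  show "\<forall>M\<in>{M :: ('a, 'c, 'h) dk_module. unitary_dk_module X M \<and> locally_complete X M \<and> completion_map (fst M) (id :: 'h \<Rightarrow> 'h)}.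
      rep_to_dk X (dk_to_rep X id M) = M"
    using recover_module by auto
  show "\<forall>\<pi>D\<in>{\<pi>D. nondeg_star_rep (double X) \<pi>D}. dk_to_rep X id (rep_to_dk X \<pi>D) = (\<pi>D :: _ \<Rightarrow> 'h \<Rightarrow> 'h)"
    by (simp add: dk_rep.rep_to_dk_eq[OF repI] dk_rep.dk_to_rep_core[OF repI])
  show "dk_to_rep X id ` {M :: ('a, 'c, 'h) dk_module. unitary_dk_module X M \<and> locally_complete X M \<and> completion_map (fst M) (id :: 'h \<Rightarrow> 'h)}
      \<subseteq> {\<pi>D. nondeg_star_rep (double X) \<pi>D}"
    by (auto simp: dk_completed.dk_to_rep_eq[OF completed_moduleI] dk_completed.nondeg_rep_of[OF completed_moduleI])
  show "rep_to_dk X ` {\<pi>D. nondeg_star_rep (double X) \<pi>D}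
      \<subseteq> {M :: ('a, 'c, 'h) dk_module. unitary_dk_module X M \<and> locally_complete X M \<and> completion_map (fst M) (id :: 'h \<Rightarrow> 'h)}"
    by (auto simp: dk_rep.rep_to_dk_eq[OF repI] dk_rep.core_module[OF repI] dk_rep.core_locally_complete[OF repI]
        dk_rep.core_completion[OF repI])
qed

theorem theorem3p3:
  fixes X :: "('a::complex_algebra_1, 'c::complex_vector) dk_datum"
  assumes "cqg_doi_koppinen_datum X"
  shows
    \<comment> \<open>from modules to representations\<close>
    "(\<forall>(M :: ('a, 'c, 'v::complex_inner) dk_module) (\<iota> :: 'v \<Rightarrow> 'h::{complex_inner, complete_space}).
        unitary_dk_module X M \<and> completion_map (fst M) \<iota> \<longrightarrow>
        (\<exists>!\<pi>D. nondeg_star_rep (double X) \<pi>D \<and> rep_formula X M \<iota> \<pi>D))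
     \<comment> \<open>from representations to modules\<close>
     \<and> (\<forall>\<pi>D :: _ \<Rightarrow> 'h \<Rightarrow> 'h. nondeg_star_rep (double X) \<pi>D \<longrightarrow>
        completion_map (rep_core X \<pi>D) (id :: 'h \<Rightarrow> 'h) \<and>
        (\<exists>!M. fst M = rep_core X \<pi>D \<and> unitary_dk_module X M \<and> rep_formula X M id \<pi>D))
     \<comment> \<open>the correspondence, on a fixed Hilbert space\<close>
     \<and> bij_betw (dk_to_rep X id)
          {M :: ('a, 'c, 'h) dk_module. unitary_dk_module X M \<and> locally_complete X M \<and>
             completion_map (fst M) (id :: 'h \<Rightarrow> 'h)}
          {\<pi>D. nondeg_star_rep (double X) \<pi>D}
     \<and> (\<forall>\<pi>D :: _ \<Rightarrow> 'h \<Rightarrow> 'h. nondeg_star_rep (double X) \<pi>D \<longrightarrow>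
          locally_complete X (rep_to_dk X \<pi>D) \<and> dk_to_rep X id (rep_to_dk X \<pi>D) = \<pi>D)
     \<comment> \<open>the correspondence, for arbitrary completions and up to unitary isomorphism\<close>
     \<and> (\<forall>(M :: ('a, 'c, 'v) dk_module) (\<iota> :: 'v \<Rightarrow> 'h).
          unitary_dk_module X M \<and> locally_complete X M \<and> completion_map (fst M) \<iota> \<longrightarrow>
          dk_iso X \<iota> M (rep_to_dk X (dk_to_rep X \<iota> M)))
     \<and> (\<forall>(M :: ('a, 'c, 'v) dk_module) (\<iota> :: 'v \<Rightarrow> 'h)
          (N :: ('a, 'c, 'w::complex_inner) dk_module) (\<kappa> :: 'w \<Rightarrow> 'k::{complex_inner, complete_space}).
          unitary_dk_module X M \<and> locally_complete X M \<and> completion_map (fst M) \<iota> \<and>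
          unitary_dk_module X N \<and> locally_complete X N \<and> completion_map (fst N) \<kappa> \<longrightarrow>
          ((\<exists>U. dk_iso X U M N) \<longleftrightarrow>
           (\<exists>U. rep_iso (double X) U (dk_to_rep X \<iota> M) (dk_to_rep X \<kappa> N))))"
proof -
  interpret dk X by unfold_locales fact
  note compI = completed_moduleI
  show ?thesis
  proof (intro conjI allI impI)
    fix M :: "('a, 'c, 'v) dk_module" and \<iota> :: "'v \<Rightarrow> 'h"
    assume M: "unitary_dk_module X M \<and> completion_map (fst M) \<iota>"
    obtain H0 \<pi>0 \<delta>0 where m: "M = (H0, \<pi>0, \<delta>0)" by (rule prod_cases3)
    have "unitary_dk_module X (H0, \<pi>0, \<delta>0)" "completion_map H0 \<iota>" using M by (simp_all add: m)
    then show "\<exists>!\<pi>D. nondeg_star_rep (double X) \<pi>D \<and> rep_formula X M \<iota> \<pi>D"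
      unfolding m by (rule dk_completed.ex1_rep[OF compI])
  next
    fix \<pi>D :: "('a + ('c \<Rightarrow> complex)) star_term set \<Rightarrow> 'h \<Rightarrow> 'h"
    assume nd: "nondeg_star_rep (double X) \<pi>D"
    note R = repI[OF nd]
    show "completion_map (rep_core X \<pi>D) (id :: 'h \<Rightarrow> 'h)"
      using dk_rep.core_completion[OF R] unfolding dk_rep.core_def[OF R] .
    show "\<exists>!M. fst M = rep_core X \<pi>D \<and> unitary_dk_module X M \<and> rep_formula X M id \<pi>D"
      by (rule dk_rep.ex1_module[OF R])
    show "locally_complete X (rep_to_dk X \<pi>D)"
      unfolding dk_rep.rep_to_dk_eq[OF R] by (rule dk_rep.core_locally_complete[OF R])
    show "dk_to_rep X id (rep_to_dk X \<pi>D) = \<pi>D"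
      unfolding dk_rep.rep_to_dk_eq[OF R] by (rule dk_rep.dk_to_rep_core[OF R])
  next
    show "bij_betw (dk_to_rep X id)
          {M :: ('a, 'c, 'h) dk_module. unitary_dk_module X M \<and> locally_complete X M \<and>
             completion_map (fst M) (id :: 'h \<Rightarrow> 'h)}
          {\<pi>D. nondeg_star_rep (double X) \<pi>D}"
      by (rule bij_modules_reps)
  next
    fix M :: "('a, 'c, 'v) dk_module" and \<iota> :: "'v \<Rightarrow> 'h"
    assume M: "unitary_dk_module X M \<and> locally_complete X M \<and> completion_map (fst M) \<iota>"
    obtain H0 \<pi>0 \<delta>0 where m: "M = (H0, \<pi>0, \<delta>0)" by (rule prod_cases3)
    have 1: "unitary_dk_module X (H0, \<pi>0, \<delta>0)" and 2: "completion_map H0 \<iota>"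
      and 3: "locally_complete X (H0, \<pi>0, \<delta>0)" using M by (simp_all add: m)
    note D = compI[OF 1 2]
    show "dk_iso X \<iota> M (rep_to_dk X (dk_to_rep X \<iota> M))"
      unfolding m dk_completed.dk_to_rep_eq[OF D] by (rule dk_completed.iota_iso[OF D 3])
  next
    fix M :: "('a, 'c, 'v) dk_module" and \<iota> :: "'v \<Rightarrow> 'h"
      and N :: "('a, 'c, 'w) dk_module" and \<kappa> :: "'w \<Rightarrow> 'k"
    assume MN: "unitary_dk_module X M \<and> locally_complete X M \<and> completion_map (fst M) \<iota> \<and>
          unitary_dk_module X N \<and> locally_complete X N \<and> completion_map (fst N) \<kappa>"
    obtain H0 \<pi>0 \<delta>0 where m: "M = (H0, \<pi>0, \<delta>0)" by (rule prod_cases3)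
    obtain K0 \<rho>0 \<epsilon>0 where n: "N = (K0, \<rho>0, \<epsilon>0)" by (rule prod_cases3)
    have 1: "unitary_dk_module X (H0, \<pi>0, \<delta>0)" "completion_map H0 \<iota>" "locally_complete X (H0, \<pi>0, \<delta>0)"
      and 2: "unitary_dk_module X (K0, \<rho>0, \<epsilon>0)" "completion_map K0 \<kappa>" "locally_complete X (K0, \<rho>0, \<epsilon>0)"
      using MN by (simp_all add: m n)
    show "(\<exists>U. dk_iso X U M N) \<longleftrightarrow>
           (\<exists>U. rep_iso (double X) U (dk_to_rep X \<iota> M) (dk_to_rep X \<kappa> N))"
    proof
      assume "\<exists>U. dk_iso X U M N"
      then obtain U where "dk_iso X U (H0, \<pi>0, \<delta>0) (K0, \<rho>0, \<epsilon>0)" unfolding m n ..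
      then show "\<exists>U. rep_iso (double X) U (dk_to_rep X \<iota> M) (dk_to_rep X \<kappa> N)"
        unfolding m n by (rule module_iso_imp_rep_iso[OF 1(1,2) 2(1,2)])
    next
      assume "\<exists>U. rep_iso (double X) U (dk_to_rep X \<iota> M) (dk_to_rep X \<kappa> N)"
      then obtain U where "rep_iso (double X) U (dk_to_rep X \<iota> (H0, \<pi>0, \<delta>0)) (dk_to_rep X \<kappa> (K0, \<rho>0, \<epsilon>0))"
        unfolding m n ..
      then show "\<exists>U. dk_iso X U M N"
        unfolding m n by (rule rep_iso_imp_module_iso[OF 1 2])
    qed
  qed
qed

end
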